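(* Let $n\ge 2$, let $D\subset\mathbb{R}^n$ be a domain, let $Q:D\to(0,\infty]$ be a Lebesgue measurable function, let $b\in D$, and let $f:D\setminus\{b\}\to\mathbb{R}^n$ be an open discrete ring $Q$-mapping at the point $b$. Fix $\varepsilon_0>0$ with $\varepsilon_0<\mathrm{dist}(b,\partial D)$. Suppose that $$\int_{0}^{\varepsilon_0}\frac{dt}{t\,q_b^{1/(n-1)}(t)}=\infty$$ and that $q_b(t)<\infty$ for almost all $t\in(0,\varepsilon_0)$. (1) If for some $p$ with $0<p<\left(\frac14\right)^{1/(n-1)}$ and some constant $C>0$ $$|f(x)|\le C\cdot\exp\left\{p\int_{|x-b|}^{\varepsilon_0}\frac{dt}{t\,q_b^{1/(n-1)}(t)}\right\}\qquad\text{for all } x\in B(b,\varepsilon_0)\setminus\{b\},$$ then $f$ has a limit (finite or infinite) at the point $b$. (2) If, instead of the bound in (1), the stronger assumption $$\lim_{x\to b}|f(x)|\cdot\exp\left\{-p\int_{|x-b|}^{\varepsilon_0}\frac{dt}{t\,q_b^{1/(n-1)}(t)}\right\}=0$$ holds for some $p$ with $0<p<\left(\frac14\right)^{1/(n-1)}$, then $b$ is a removable singular point of $f$ (in particular it is not a pole).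
   Context: Notation: $m$ is Lebesgue measure in $\mathbb{R}^n$; $B(x_0,r)=\{x:|x-x_0|<r\}$; $S(x_0,r)=\{x:|x-x_0|=r\}$; $\omega_{n-1}$ is the area of the unit sphere in $\mathbb{R}^n$; $\mathrm{dist}$ is Euclidean distance; $\overline{\mathbb{R}^n}=\mathbb{R}^n\cup\{\infty\}$. All mappings are assumed continuous. A mapping is discrete if the preimage of every point consists of isolated points, and open if it maps open sets to open sets. Modulus: for a family $\Gamma$ of curves in $\mathbb{R}^n$, a Borel function $\rho:\mathbb{R}^n\to[0,\infty]$ is admissible, $\rho\in\mathrm{adm}\,\Gamma$, if $\int_\gamma\rho(x)\,|dx|\ge1$ for every (locally rectifiable) $\gamma\in\Gamma$; the modulus is $M(\Gamma)=\inf_{\rho\in\mathrm{adm}\,\Gamma}\int_{\mathbb{R}^n}\rho^n(x)\,dm(x)$. $\Gamma(E,F,A)$ is the family of all curves $\gamma:[s_1,s_2]\to\mathbb{R}^n$ with $\gamma(s_1)\in E$, $\gamma(s_2)\in F$ and $\gamma(t)\in A$ for $t\in(s_1,s_2)$. For a mapping $f$, $f(\Gamma)=\{f\circ\gamma:\gamma\in\Gamma\}$. Ring $Q$-mapping: let $x_0\in D$, $r_0=\mathrm{dist}(x_0,\partial D)$, and let $Q:D\to[0,\infty]$ be Lebesgue measurable. A mapping $f:D\setminus\{x_0\}\to\overline{\mathbb{R}^n}$ is a ring $Q$-mapping at $x_0$ if $$M\big(f(\Gamma(S(x_0,r_1),S(x_0,r_2),A))\big)\le\int_A Q(x)\,\eta^n(|x-x_0|)\,dm(x)$$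 for every ring $A=\{x\in\mathbb{R}^n:r_1<|x-x_0|<r_2\}$ with $0<r_1<r_2<r_0$ and every measurable $\eta:(r_1,r_2)\to[0,\infty]$ with $\int_{r_1}^{r_2}\eta(r)\,dr\ge1$. Spherical mean: $q_{x_0}(r)=\frac{1}{\omega_{n-1}r^{n-1}}\int_{S(x_0,r)}Q(x)\,dS$, where $dS$ is the surface area element. The isolated boundary point $b$ of $D\setminus\{b\}$ is called removable for $f$ if a finite limit $\lim_{x\to b}f(x)$ exists, and a pole if $f(x)\to\infty$ as $x\to b$. *)

theory Defs
  imports "HOL-Analysis.Analysis"
begin

definition ennreal_powr :: "ennreal \<Rightarrow> real \<Rightarrow> ennreal" where
  "ennreal_powr x p = (if x = \<infinity> then \<infinity> else ennreal (enn2real x powr p))"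

definition exp_ereal :: "ereal \<Rightarrow> ereal" where
  "exp_ereal x = (case x of ereal r \<Rightarrow> ereal (exp r) | PInfty \<Rightarrow> \<infinity> | MInfty \<Rightarrow> 0)"

text \<open>Distance to the boundary. It is \<open>\<infinity>\<close> if the boundary is empty, that is, for the
  whole space; \<^const>\<open>infdist\<close> and \<^const>\<open>setdist\<close> would be \<open>0\<close> in that case.\<close>

definition boundary_dist :: "'a::metric_space \<Rightarrow> 'a set \<Rightarrow> ereal" where
  "boundary_dist x D = (INF y\<in>frontier D. ereal (dist x y))"

text \<open>The triple \<open>(a, b, \<gamma>)\<close> stands for the curve \<open>\<gamma> : [a, b] \<rightarrow> 'a\<close>; values of \<open>\<gamma>\<close> outside
  \<open>[a, b]\<close> never matter.\<close>

type_synonym 'a curve = "real \<times> real \<times> (real \<Rightarrow> 'a)"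

definition curve_length :: "'a::metric_space curve \<Rightarrow> ennreal" where
  "curve_length = (\<lambda>(a, b, \<gamma>).
     SUP (k, t) \<in> {(k :: nat, t :: nat \<Rightarrow> real). mono_on {..k} t \<and> t 0 = a \<and> t k = b}.
       \<Sum>i<k. ennreal (dist (\<gamma> (t i)) (\<gamma> (t (Suc i)))))"

text \<open>A continuous curve on a compact interval is locally rectifiable iff it is rectifiable.\<close>

definition rectifiable :: "'a::metric_space curve \<Rightarrow> bool" where
  "rectifiable c \<longleftrightarrow> curve_length c < \<infinity>"

text \<open>Integral of \<open>\<rho>\<close> along a rectifiable curve with respect to arc length: the function
  \<open>\<gamma> \<circ> inv_into {a..b} s\<close> is the arc length parametrization of the curve. It does not depend on
  the choice made by \<^const>\<open>inv_into\<close>, as \<open>\<gamma>\<close> is constant wherever \<open>s\<close> is.\<close>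

definition curve_integral :: "('a::metric_space \<Rightarrow> ennreal) \<Rightarrow> 'a curve \<Rightarrow> ennreal" where
  "curve_integral \<rho> = (\<lambda>(a, b, \<gamma>).
     let s = (\<lambda>t. enn2real (curve_length (a, t, \<gamma>)))
     in \<integral>\<^sup>+u\<in>{0..s b}. \<rho> (\<gamma> (inv_into {a..b} s u)) \<partial>lborel)"

definition adm :: "'a::euclidean_space curve set \<Rightarrow> ('a \<Rightarrow> ennreal) set" where
  "adm \<Gamma> = {\<rho> \<in> borel_measurable borel. \<forall>c\<in>\<Gamma>. rectifiable c \<longrightarrow> curve_integral \<rho> c \<ge> 1}"

definition modulus :: "'a::euclidean_space curve set \<Rightarrow> ennreal" where
  "modulus \<Gamma> = (INF \<rho>\<in>adm \<Gamma>. \<integral>\<^sup>+x. \<rho> x ^ DIM('a) \<partial>lborel)"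

definition joining_curves ::
  "'a::euclidean_space set \<Rightarrow> 'a set \<Rightarrow> 'a set \<Rightarrow> 'a curve set" where
  "joining_curves E F A = {(a, b, \<gamma>). a < b \<and> continuous_on {a..b} \<gamma> \<and>
     \<gamma> a \<in> E \<and> \<gamma> b \<in> F \<and> (\<forall>t\<in>{a<..<b}. \<gamma> t \<in> A)}"

definition image_curves :: "('a \<Rightarrow> 'b) \<Rightarrow> 'a curve set \<Rightarrow> 'b curve set" where
  "image_curves f \<Gamma> = (\<lambda>(a, b, \<gamma>). (a, b, f \<circ> \<gamma>)) ` \<Gamma>"

definition open_mapping_on :: "'a::topological_space set \<Rightarrow> ('a \<Rightarrow> 'b::topological_space) \<Rightarrow> bool"
  where "open_mapping_on S f \<longleftrightarrow> (\<forall>U. open U \<and> U \<subseteq> S \<longrightarrow> open (f ` U))"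

definition discrete_mapping_on :: "'a::topological_space set \<Rightarrow> ('a \<Rightarrow> 'b) \<Rightarrow> bool"
  where "discrete_mapping_on S f \<longleftrightarrow> (\<forall>y. discrete {x \<in> S. f x = y})"

definition spherical_ring :: "'a::metric_space \<Rightarrow> real \<Rightarrow> real \<Rightarrow> 'a set" where
  "spherical_ring x0 r1 r2 = {x. r1 < dist x x0 \<and> dist x x0 < r2}"

text \<open>Only finite-valued mappings are considered. The curves in question lie in
  \<open>D - {x0}\<close> including their end points, so values of \<open>f\<close> and \<open>Q\<close> outside this set
  do not matter.\<close>

definition ring_Q_mapping ::
  "'a::euclidean_space set \<Rightarrow> ('a \<Rightarrow> ennreal) \<Rightarrow> 'a \<Rightarrow> ('a \<Rightarrow> 'a) \<Rightarrow> bool" where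
  "ring_Q_mapping D Q x0 f \<longleftrightarrow>
     continuous_on (D - {x0}) f \<and>
     (\<forall>r1 r2 \<eta>. 0 < r1 \<and> r1 < r2 \<and> ereal r2 < boundary_dist x0 D \<and>
        \<eta> \<in> borel_measurable (lebesgue_on {r1<..<r2}) \<and>
        (\<integral>\<^sup>+r\<in>{r1<..<r2}. \<eta> r \<partial>lebesgue) \<ge> 1 \<longrightarrow>
        modulus (image_curves f (joining_curves (sphere x0 r1) (sphere x0 r2)
            (spherical_ring x0 r1 r2)))
          \<le> (\<integral>\<^sup>+x\<in>spherical_ring x0 r1 r2. Q x * \<eta> (dist x x0) ^ DIM('a) \<partial>lebesgue))"

text \<open>Surface area on \<open>sphere c r\<close>, as a (completed) Borel measure on the whole space that is
  concentrated on the sphere: the area of \<open>E\<close> is \<open>n / r\<close> times the volume of the cone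
  over \<open>E\<close> with vertex \<open>c\<close>. This is the surface measure of integration in polar coordinates.\<close>

definition sphere_measure :: "'a::euclidean_space \<Rightarrow> real \<Rightarrow> 'a measure" where
  "sphere_measure c r = completion (scale_measure (ennreal (real DIM('a) / r))
     (distr (restrict_space lborel (ball c r - {c})) borel
        (\<lambda>x. c + (r / dist x c) *\<^sub>R (x - c))))"

lemma emeasure_sphere_measure:
  fixes c :: "'a::euclidean_space"
  assumes E: "E \<in> sets borel"
  shows "emeasure (sphere_measure c r) E = ennreal (real DIM('a) / r) *
    emeasure lborel {x \<in> ball c r - {c}. c + (r / dist x c) *\<^sub>R (x - c) \<in> E}"
proof -
  let ?g = "\<lambda>x::'a. c + (r / dist x c) *\<^sub>R (x - c)"
  let ?B = "ball c r - {c}"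
  have "?g \<in> borel_measurable borel"
    by measurable
  then have g: "?g \<in> measurable (restrict_space lborel ?B) borel"
    by (intro measurable_restrict_space1) simp
  have "emeasure (sphere_measure c r) E = ennreal (real DIM('a) / r) *
      emeasure (distr (restrict_space lborel ?B) borel ?g) E"
    unfolding sphere_measure_def using E by (subst emeasure_completion) auto
  also have "emeasure (distr (restrict_space lborel ?B) borel ?g) E =
      emeasure (restrict_space lborel ?B) (?g -` E \<inter> ?B)"
    using emeasure_distr[OF g E] by (simp add: space_restrict_space)
  also have "\<dots> = emeasure lborel (?g -` E \<inter> ?B)"
    by (intro emeasure_restrict_space) auto
  also have "?g -` E \<inter> ?B = {x \<in> ?B. ?g x \<in> E}"
    by auto
  finally show ?thesis .
qed

lemma emeasure_sphere_measure_sphere: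
  fixes c :: "'a::euclidean_space"
  assumes r: "r > 0"
  shows "emeasure (sphere_measure c r) (sphere c r) =
    ennreal (real DIM('a) * unit_ball_vol (real DIM('a)) * r ^ (DIM('a) - 1))"
proof -
  have "c + (r / dist x c) *\<^sub>R (x - c) \<in> sphere c r" if "x \<noteq> c" for x
    using that r by (simp add: dist_norm)
  then have eq: "{x \<in> ball c r - {c}. c + (r / dist x c) *\<^sub>R (x - c) \<in> sphere c r} = ball c r - {c}"
    by blast
  have "emeasure lborel (ball c r - {c}) = emeasure lborel (ball c r)"
    by (intro emeasure_Diff_null_set) auto
  also have "\<dots> = ennreal (unit_ball_vol (real DIM('a)) * r ^ DIM('a))"
    using r by (intro emeasure_ball) auto
  finally have "emeasure (sphere_measure c r) (sphere c r) =
      ennreal (real DIM('a) / r * (unit_ball_vol (real DIM('a)) * r ^ DIM('a)))"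
    using r by (subst emeasure_sphere_measure, simp, simp only: eq, subst ennreal_mult) auto
  also have "r ^ DIM('a) = r * r ^ (DIM('a) - 1)"
    by (metis DIM_positive power_minus_mult mult.commute)
  finally show ?thesis
    using r by (simp add: mult_ac)
qed

definition spherical_mean :: "('a::euclidean_space \<Rightarrow> ennreal) \<Rightarrow> 'a \<Rightarrow> real \<Rightarrow> ennreal" where
  "spherical_mean Q x0 r =
     (\<integral>\<^sup>+x\<in>sphere x0 r. Q x \<partial>sphere_measure x0 r) /
     (emeasure (sphere_measure (0::'a) 1) (sphere 0 1) * ennreal (r ^ (DIM('a) - 1)))"

definition radial_integral :: "('a::euclidean_space \<Rightarrow> ennreal) \<Rightarrow> 'a \<Rightarrow> real \<Rightarrow> real \<Rightarrow> ennreal" where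
  "radial_integral Q x0 r1 r2 = (\<integral>\<^sup>+t\<in>{r1<..<r2}.
     1 / (ennreal t * ennreal_powr (spherical_mean Q x0 t) (1 / real (DIM('a) - 1))) \<partial>lebesgue)"

definition removable_at :: "('a::topological_space \<Rightarrow> 'b::topological_space) \<Rightarrow> 'a \<Rightarrow> bool" where
  "removable_at f b \<longleftrightarrow> (\<exists>l. (f \<longlongrightarrow> l) (at b))"

definition pole_at :: "('a::topological_space \<Rightarrow> 'b::real_normed_vector) \<Rightarrow> 'a \<Rightarrow> bool" where
  "pole_at f b \<longleftrightarrow> filterlim f at_infinity (at b)"

end

theory Submission
  imports Defs "HOL-Complex_Analysis.Great_Picard"
begin

text \<open>Let \<open>\<Gamma>(r,s)\<close> be the family of the images under \<open>f\<close> of the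
  curves that join the spheres of radii \<open>r < s\<close> about \<open>b\<close> inside the
  ring between them, let \<open>I(r,s)\<close> be the integral of
  \<open>1 / (t q(t)^(1/(n-1)))\<close> over \<open>(r,s)\<close>, where \<open>q\<close> is the
  spherical mean of \<open>Q\<close>, and let \<open>\<omega>\<close> be the area of the unit
  sphere.

  The proof balances two facts. In polar coordinates the test function
  \<open>1 / (I(r,s) t q(t)^(1/(n-1)))\<close> shows that the modulus of
  \<open>\<Gamma>(r,s)\<close> is at most \<open>\<omega> / I(r,s)^(n-1)\<close>, and
  \<open>0\<close> if \<open>I(r,s)\<close> is infinite (\<open>modulus_ring_bounds\<close>). On
  the other hand, a segment that starts at \<open>f x\<close> lifts to a path that starts at
  \<open>x\<close> and runs until it leaves a given ring (\<open>ring_lift\<close>), because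
  \<open>f\<close> is open and discrete; if the lift crosses the ring from \<open>r\<close> to
  \<open>s\<close>, then every density that is admissible for \<open>\<Gamma>(r,s)\<close> has
  integral at least \<open>1\<close> along the segment (\<open>segment_crossing\<close>). An
  admissible density of small energy has integral less than \<open>1\<close> along most segments,
  so the lifts of most segments do not cross. This is used three times.

  Firstly, \<open>I(r,s)\<close> is finite for \<open>r > 0\<close>
  (\<open>radial_integral_finite\<close>). Otherwise rings arbitrarily close to some sphere have
  modulus zero, and the lifts of the edges of a suitably placed fine cubical grid do not cross
  that sphere. The preimage of the edges then splits into an inner and an outer closed part, and
  there is a compact set \<open>F\<close> that separates \<open>b\<close> from infinity and whose
  image avoids all edges. Such a set is at most \<open>(n-2)\<close>-dimensional in the sense
  needed here: the radial projection of \<open>F\<close> to the sphere is homotopic to a constant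
  (\<open>grid_avoiding_map_nullhomotopic\<close>), which contradicts Borsuk's separation theorem.
  It follows that \<open>I(r,s)\<close> tends to infinity as \<open>r\<close> tends to
  \<open>0\<close>, for each \<open>s\<close>.

  Secondly, the growth bound with \<open>p < 1\<close> forces \<open>f\<close> to omit a set of
  positive measure outside a large ball (\<open>omitted_set_not_null\<close>). If almost all of a
  sphere of radius \<open>S\<close> about \<open>0\<close> is covered, then the radial segments
  from radius \<open>S\<close> up to a bound \<open>T\<close> for the norm of \<open>f\<close>
  have lifts that cross a ring near \<open>b\<close>. By Hoelder's inequality this bounds the
  modulus of the ring from below by nearly \<open>\<omega> / ln(T / S)^(n-1)\<close>; since
  \<open>ln T\<close> is about \<open>p I\<close>, this contradicts the upper bound
  \<open>\<omega> / I^(n-1)\<close>. In particular \<open>f\<close> does not tend to infinity at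
  \<open>b\<close>, for then it would cover a neighbourhood of infinity (\<open>not_pole\<close>).

  Thirdly, if \<open>f\<close> has neither a finite nor an infinite limit, there are arbitrarily
  small spheres whose images meet a fixed ball and have diameter at least a fixed
  \<open>\<delta>\<close> (\<open>spread_spheres\<close>). Such an image is a continuum, and a
  density of small energy admits two segments with integrals less than \<open>1\<close> that lead
  from the continuum to a point of the omitted set (\<open>short_segments_from_continuum\<close>).
  If the sphere is small and the density is admissible for four suitable rings, then the lifts of
  the two segments remain in a punctured ball about \<open>b\<close>, so the omitted point is a
  value of \<open>f\<close>, a contradiction (\<open>limit_or_pole\<close>).\<close>

section \<open>Lifting paths through open discrete maps\<close>

lemma dist_triangle_4:
  fixes a b c d :: "'a::metric_space"
  shows "dist a d \<le> dist a b + dist b c + dist c d"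
  using dist_triangle[of a d b] dist_triangle[of b d c] by linarith

text \<open>Otherwise there are chains with ever finer steps and with images shrinking to a point, whose
  ends stay apart. By compactness their points accumulate only at a finite fibre, and a chain
  whose steps are finer than the distances within that fibre stays near a single point of it.\<close>

lemma small_chains:
  fixes f :: "'a::metric_space \<Rightarrow> 'b::metric_space"
  assumes K: "compact K" and cont: "continuous_on K f"
    and fin: "\<And>y. finite {x\<in>K. f x = y}" and e: "\<epsilon> > 0"
  shows "\<exists>\<delta>>0. \<forall>x (k::nat) y. (\<forall>i\<le>k. x i \<in> K \<and> dist (f (x i)) y < \<delta>) \<and>
     (\<forall>i<k. dist (x i) (x (Suc i)) < \<delta>) \<longrightarrow> dist (x 0) (x k) < \<epsilon>"
proof (rule ccontr)
  assume neg: "\<not> ?thesis"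
  have "\<exists>x (k::nat) y. (\<forall>i\<le>k. x i \<in> K \<and> dist (f (x i)) y < inverse (real (Suc j))) \<and>
     (\<forall>i<k. dist (x i) (x (Suc i)) < inverse (real (Suc j))) \<and> \<not> dist (x 0) (x k) < \<epsilon>" for j
  proof -
    have "inverse (real (Suc j)) > 0" by simp
    then show ?thesis using neg by blast
  qed
  then obtain x k y where
     X: "\<And>j i. i \<le> k j \<Longrightarrow> x j i \<in> K \<and> dist (f (x j i)) (y j) < inverse (real (Suc j))"
     and step: "\<And>j i. i < k j \<Longrightarrow> dist (x j i) (x j (Suc i)) < inverse (real (Suc j))"
     and far: "\<And>j. \<not> dist (x j 0) (x j (k j :: nat)) < \<epsilon>"
    by metis
  have "\<forall>j. x j 0 \<in> K" using X by blast
  then obtain z r where z: "z \<in> K" "strict_mono (r::nat\<Rightarrow>nat)" "((\<lambda>j. x j 0) \<circ> r) \<longlonglongrightarrow> z"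
    using K[unfolded compact_def] by (metis (no_types, lifting))
  define P where "P = {p\<in>K. f p = f z}"
  have finP: "finite P" unfolding P_def by (rule fin)
  obtain \<eta>0 where \<eta>0: "\<eta>0 > 0" "\<And>p q. p \<in> P \<Longrightarrow> q \<in> P \<Longrightarrow> p \<noteq> q \<Longrightarrow> \<eta>0 \<le> dist p q"
  proof -
    have "\<forall>p\<in>P. \<exists>d>0. \<forall>q\<in>P. q \<noteq> p \<longrightarrow> d \<le> dist p q"
      using finite_set_avoid[OF finP] by blast
    then obtain d where d: "\<And>p. p \<in> P \<Longrightarrow> d p > 0" "\<And>p q. p\<in>P \<Longrightarrow> q \<in> P \<Longrightarrow> q \<noteq> p \<Longrightarrow> d p \<le> dist p q"
      by metis
    define m where "m = Min (insert 1 (d ` P))"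
    have "m > 0" unfolding m_def using finP d by (subst Min_gr_iff) auto
    moreover have "m \<le> dist p q" if "p\<in>P" "q\<in>P" "p \<noteq> q" for p q
    proof -
      have "m \<le> d p" unfolding m_def using finP that by (intro Min_le) auto
      then show ?thesis using d(2)[of p q] that by auto
    qed
    ultimately show ?thesis using that by blast
  qed
  define \<eta> where "\<eta> = min (\<eta>0/3) (\<epsilon>/2)"
  have \<eta>: "\<eta> > 0" "3*\<eta> \<le> \<eta>0" "2*\<eta> \<le> \<epsilon>" using \<eta>0 e by (auto simp: \<eta>_def min_def)
  obtain \<theta> where \<theta>: "\<theta> > 0" "\<And>v. v \<in> K \<Longrightarrow> dist (f v) (f z) < \<theta> \<Longrightarrow> \<exists>p\<in>P. dist v p < \<eta>"
  proof -
    define C where "C = K - (\<Union>p\<in>P. ball p \<eta>)"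
    have "compact C" unfolding C_def using K by (intro compact_diff) auto
    then have cf: "compact (f ` C)" using cont C_def by (intro compact_continuous_image) (auto intro: continuous_on_subset)
    have "f z \<notin> f ` C" using \<eta>(1) by (force simp: C_def P_def)
    moreover have "open (- (f ` C))" using compact_imp_closed[OF cf] by blast
    ultimately obtain \<theta> where "\<theta> > 0" "\<forall>v. dist v (f z) < \<theta> \<longrightarrow> v \<in> - (f`C)"
      unfolding open_dist by blast
    then show ?thesis
      by (intro that[of \<theta>]) (fastforce simp: C_def dist_commute)+
  qed
  have lim0: "(\<lambda>j. inverse (real (Suc (r j)))) \<longlonglongrightarrow> 0"
    using LIMSEQ_subseq_LIMSEQ[OF LIMSEQ_inverse_real_of_nat z(2)] by (simp add: o_def)
  have limf: "(\<lambda>j. f (x (r j) 0)) \<longlonglongrightarrow> f z"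
    using cont z(1,3) X unfolding continuous_on_sequentially by (auto simp: o_def)
  have "\<forall>\<^sub>F j in sequentially. inverse (real (Suc (r j))) < min \<eta> (\<theta>/3)"
    by (intro order_tendstoD(2)[OF lim0]) (use \<eta>(1) \<theta>(1) in auto)
  moreover have "\<forall>\<^sub>F j in sequentially. dist (f (x (r j) 0)) (f z) < \<theta>/3"
    by (intro tendstoD[OF limf]) (use \<theta>(1) in auto)
  ultimately have "\<forall>\<^sub>F j in sequentially. inverse (real (Suc (r j))) < min \<eta> (\<theta>/3) \<and> dist (f (x (r j) 0)) (f z) < \<theta>/3"
    by eventually_elim simp
  then obtain j where j: "inverse (real (Suc (r j))) < min \<eta> (\<theta>/3)" "dist (f (x (r j) 0)) (f z) < \<theta>/3"
    by (auto simp: eventually_sequentially)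
  let ?j = "r j"
  have near: "\<exists>p\<in>P. dist (x ?j i) p < \<eta>" if "i \<le> k ?j" for i
  proof -
    have "dist (f (x ?j i)) (f z) \<le> dist (f (x ?j i)) (y ?j) + dist (f (x ?j 0)) (y ?j) + dist (f (x ?j 0)) (f z)"
      using dist_triangle_4[of "f (x ?j i)" "f z" "y ?j" "f (x ?j 0)"] by (simp add: dist_commute)
    also have "\<dots> < \<theta>" using X[OF that] X[of 0 ?j] j by linarith
    finally show ?thesis using \<theta>(2) X[OF that] by blast
  qed
  obtain p where p: "p \<in> P" "dist (x ?j 0) p < \<eta>" using near by blast
  have "i \<le> k ?j \<longrightarrow> dist (x ?j i) p < \<eta>" for i
  proof (induction i)
    case (Suc i)
    show ?case
    proof
      assume i: "Suc i \<le> k ?j"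
      obtain q where q: "q \<in> P" "dist (x ?j (Suc i)) q < \<eta>" using near[OF i] by blast
      have "dist p q \<le> dist (x ?j i) p + dist (x ?j i) (x ?j (Suc i)) + dist (x ?j (Suc i)) q"
        using dist_triangle_4[of p q "x ?j i" "x ?j (Suc i)"] by (simp add: dist_commute)
      also have "\<dots> < 3*\<eta>" using Suc i q step[of i ?j] j by linarith
      finally have "p = q" using \<eta>0(2)[OF p(1) q(1)] \<eta> by linarith
      then show "dist (x ?j (Suc i)) p < \<eta>" using q by simp
    qed
  qed (use p in auto)
  then have "dist (x ?j 0) p < \<eta>" "dist (x ?j (k ?j)) p < \<eta>" by auto
  then have "dist (x ?j 0) (x ?j (k ?j)) < 2*\<eta>"
    using dist_triangle2[of "x ?j 0" "x ?j (k ?j)" p] by linarith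
  then show False using far[of ?j] \<eta> by linarith
qed

text \<open>If the images of balls around a convergent sequence of centres miss points close to the images
  of the centres, then the image of a smaller ball around the limit, which is open, has to contain
  these points.\<close>

lemma uniformly_open:
  fixes f :: "'a::metric_space \<Rightarrow> 'b::metric_space"
  assumes K: "compact K" and cont: "continuous_on K f" and U: "U \<subseteq> K"
    and op: "open_mapping_on U f" and e: "\<epsilon> > 0"
  shows "\<exists>\<delta>>0. \<forall>x y. x \<in> K \<and> ball x \<epsilon> \<subseteq> U \<and> dist (f x) y < \<delta> \<longrightarrow> y \<in> f ` ball x \<epsilon>"
proof (rule ccontr)
  assume neg: "\<not> ?thesis"
  have "\<exists>x y. x \<in> K \<and> ball x \<epsilon> \<subseteq> U \<and> dist (f x) y < inverse (real (Suc j)) \<and> y \<notin> f ` ball x \<epsilon>" for j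
  proof -
    have "inverse (real (Suc j)) > 0" by simp
    then show ?thesis using neg by blast
  qed
  then obtain x y where X: "\<And>j. x j \<in> K" "\<And>j. ball (x j) \<epsilon> \<subseteq> U"
    and d: "\<And>j. dist (f (x j)) (y j) < inverse (real (Suc j))" and out: "\<And>j. y j \<notin> f ` ball (x j) \<epsilon>"
    by metis
  obtain z r where z: "z \<in> K" "strict_mono (r::nat\<Rightarrow>nat)" "(x \<circ> r) \<longlonglongrightarrow> z"
    using K[unfolded compact_def] X(1) by (metis (no_types, lifting))
  have ev: "\<forall>\<^sub>F j in sequentially. dist (x (r j)) z < \<epsilon>/2"
    using z(3) half_gt_zero[OF e] unfolding tendsto_iff o_def by blast
  have sub: "ball z (\<epsilon>/2) \<subseteq> ball (x (r j)) \<epsilon>" if "dist (x (r j)) z < \<epsilon>/2" for j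
  proof
    fix v assume "v \<in> ball z (\<epsilon>/2)"
    then show "v \<in> ball (x (r j)) \<epsilon>" using that dist_triangle_half_l[of "x (r j)" z \<epsilon> v] by (auto simp: dist_commute)
  qed
  then have bU: "ball z (\<epsilon>/2) \<subseteq> U" using ev X(2) by (fastforce simp: eventually_sequentially)
  have "open (f ` ball z (\<epsilon>/2))" using op bU unfolding open_mapping_on_def by blast
  then obtain \<theta> where \<theta>: "\<theta> > 0" "\<And>v. dist v (f z) < \<theta> \<Longrightarrow> v \<in> f ` ball z (\<epsilon>/2)"
    using e unfolding open_dist by fastforce
  have limf: "(\<lambda>j. f (x (r j))) \<longlonglongrightarrow> f z"
    using cont z(1,3) X unfolding continuous_on_sequentially by (auto simp: o_def)
  have lim0: "(\<lambda>j. inverse (real (Suc (r j)))) \<longlonglongrightarrow> 0"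
    using LIMSEQ_subseq_LIMSEQ[OF LIMSEQ_inverse_real_of_nat z(2)] by (simp add: o_def)
  have "\<forall>\<^sub>F j in sequentially. inverse (real (Suc (r j))) < \<theta>/2"
    by (intro order_tendstoD(2)[OF lim0]) (use \<theta>(1) in auto)
  moreover have "\<forall>\<^sub>F j in sequentially. dist (f (x (r j))) (f z) < \<theta>/2"
    by (intro tendstoD[OF limf]) (use \<theta>(1) in auto)
  ultimately have "\<forall>\<^sub>F j in sequentially. False" using ev
  proof eventually_elim
    case (elim j)
    have "dist (y (r j)) (f z) < \<theta>"
      using d[of "r j"] elim dist_triangle_half_r[of "f (x (r j))" "y (r j)" \<theta> "f z"] by linarith
    then have "y (r j) \<in> f ` ball z (\<epsilon>/2)" using \<theta> by blast
    then show False using out[of "r j"] sub[OF elim(3)] by blast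
  qed
  then show False by simp
qed

text \<open>A finely subdivided path is lifted point by point; the lift stops early only when it comes
  within \<open>\<epsilon>\<close> of the complement of \<open>U\<close>.\<close>

lemma discrete_lift:
  fixes f :: "'a::metric_space \<Rightarrow> 'b::metric_space" and p :: "nat \<Rightarrow> 'b"
  assumes U: "U \<subseteq> K"
    and op: "\<And>x y. x \<in> K \<Longrightarrow> ball x \<epsilon> \<subseteq> U \<Longrightarrow> dist (f x) y < \<delta> \<Longrightarrow> y \<in> f ` ball x \<epsilon>"
    and x0: "x0 \<in> U" "f x0 = p 0"
    and p: "\<And>i. i < N \<Longrightarrow> dist (p i) (p (Suc i)) < \<delta>"
  shows "\<exists>k\<le>N. \<exists>s. s 0 = x0 \<and> (\<forall>i\<le>k. s i \<in> U \<and> f (s i) = p i) \<and>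
    (\<forall>i<k. dist (s i) (s (Suc i)) < \<epsilon>) \<and> (k = N \<or> \<not> ball (s k) \<epsilon> \<subseteq> U)"
  using p
proof (induction N)
  case 0
  then show ?case using x0 by (intro exI[of _ 0] conjI exI[of _ "\<lambda>_. x0"]) auto
next
  case (Suc N)
  then obtain k s where ks: "k \<le> N" "s 0 = x0" "\<forall>i\<le>k. s i \<in> U \<and> f (s i) = p i"
    "\<forall>i<k. dist (s i) (s (Suc i)) < \<epsilon>" "k = N \<or> \<not> ball (s k) \<epsilon> \<subseteq> U" by (metis less_Suc_eq)
  show ?case
  proof (cases "ball (s k) \<epsilon> \<subseteq> U")
    case True
    then have k: "k = N" using ks by blast
    have "dist (f (s k)) (p (Suc k)) < \<delta>" using Suc.prems[of k] ks k by auto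
    then have "p (Suc k) \<in> f ` ball (s k) \<epsilon>"
      by (intro op[OF _ True]) (use ks(3) U in auto)
    then obtain x where x: "x \<in> ball (s k) \<epsilon>" "f x = p (Suc k)" by auto
    let ?s = "s(Suc k := x)"
    have "?s i \<in> U \<and> f (?s i) = p i" if "i \<le> Suc k" for i
      using that ks x True by (cases "i = Suc k") auto
    moreover have "dist (?s i) (?s (Suc i)) < \<epsilon>" if "i < Suc k" for i
      using that ks x by (cases "i = k") auto
    moreover have "?s 0 = x0" using ks by simp
    ultimately show ?thesis using k by (intro exI[of _ "Suc k"] conjI exI[of _ ?s]) auto
  next
    case False
    then show ?thesis using ks by (intro exI[of _ k] conjI exI[of _ s]) auto
  qed
qed

text \<open>Lifts through a branched map are not unique, so they are obtained by compactness instead of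
  continuation: lifts of ever finer subdivisions are equicontinuous up to the scale of subdivision
  by \<open>small_chains\<close>, and a subsequence that converges at all rational times converges
  to a continuous lift. The lift is followed until it first leaves \<open>U\<close>.\<close>

lemma lift_path:
  fixes f :: "'a::euclidean_space \<Rightarrow> 'b::metric_space" and \<sigma> :: "real \<Rightarrow> 'b"
  assumes K: "compact K" and cont: "continuous_on K f"
    and fin: "\<And>y. finite {x\<in>K. f x = y}" and U: "open U" "U \<subseteq> K"
    and op: "open_mapping_on U f" and \<sigma>: "continuous_on {0..1} \<sigma>"
    and x0: "x0 \<in> U" "f x0 = \<sigma> 0"
  shows "\<exists>c\<in>{0..1}. \<exists>\<gamma>. continuous_on {0..c} \<gamma> \<and> \<gamma> 0 = x0 \<and>
    (\<forall>t\<in>{0..c}. \<gamma> t \<in> K \<and> f (\<gamma> t) = \<sigma> t) \<and> (\<forall>t\<in>{0..<c}. \<gamma> t \<in> U) \<and> (\<gamma> c \<in> U \<longrightarrow> c = 1)"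
proof -
  have uc: "\<exists>d>0. \<forall>t\<in>{0..1}. \<forall>t'\<in>{0..1}. \<bar>t - t'\<bar> < d \<longrightarrow> dist (\<sigma> t) (\<sigma> t') < e" if "e > 0" for e
    using compact_uniformly_continuous[OF \<sigma>] that unfolding uniformly_continuous_on_def
    by (simp add: dist_real_def) (metis abs_minus_commute dist_commute)
  define ep where "ep = (\<lambda>m::nat. inverse (real (Suc m)))"
  have ep: "ep m > 0" for m by (simp add: ep_def)
  \<comment> \<open>\<open>s\<close> lifts the first \<open>k\<close> of \<open>N\<close> subdivision points with
    steps shorter than \<open>ep m\<close>.\<close>
  define R where "R = (\<lambda>m N k s. N \<ge> Suc m \<and> k \<le> N \<and> s 0 = x0 \<and>
      (\<forall>i\<le>k. s i \<in> U \<and> f (s i) = \<sigma> (real i / real N)) \<and>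
      (\<forall>i<k. dist (s i) (s (Suc i)) < ep m) \<and> (k = N \<or> \<not> ball (s k) (ep m) \<subseteq> U) \<and>
      (\<forall>t\<in>{0..1}. \<forall>t'\<in>{0..1}. \<bar>t - t'\<bar> \<le> 1 / real N \<longrightarrow> dist (\<sigma> t) (\<sigma> t') < ep m))"
  have "\<exists>N k s. R m N k s" for m
  proof -
    obtain \<delta> where \<delta>: "\<delta> > 0" "\<And>x y. x \<in> K \<Longrightarrow> ball x (ep m) \<subseteq> U \<Longrightarrow> dist (f x) y < \<delta> \<Longrightarrow> y \<in> f ` ball x (ep m)"
      using uniformly_open[OF K cont U(2) op ep] by metis
    obtain d where d: "d > 0" "\<forall>t\<in>{0..1}. \<forall>t'\<in>{0..1}. \<bar>t - t'\<bar> < d \<longrightarrow> dist (\<sigma> t) (\<sigma> t') < min \<delta> (ep m)"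
      using uc[of "min \<delta> (ep m)"] \<delta> ep by auto
    obtain N0 where N0: "inverse (real (Suc N0)) < d" using reals_Archimedean[OF d(1)] by blast
    define N where "N = Suc (max m N0)"
    have "1 / real N \<le> inverse (real (Suc N0))" by (simp add: N_def field_simps)
    then have N: "N \<ge> Suc m" "1 / real N < d" using N0 by (auto simp: N_def)
    then have Npos: "real N > 0" by simp
    have st: "dist (\<sigma> (real i / real N)) (\<sigma> (real (Suc i) / real N)) < \<delta>" if "i < N" for i
    proof -
      have "\<bar>real i / real N - real (Suc i) / real N\<bar> = 1 / real N"
        using Npos by (simp add: field_simps)
      then show ?thesis using d(2) N that Npos by (auto simp del: of_nat_Suc)
    qed
    have "f x0 = \<sigma> (real 0 / real N)" using x0 by simp
    have "\<exists>k\<le>N. \<exists>s. s 0 = x0 \<and> (\<forall>i\<le>k. s i \<in> U \<and> f (s i) = \<sigma> (real i / real N)) \<and>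
      (\<forall>i<k. dist (s i) (s (Suc i)) < ep m) \<and> (k = N \<or> \<not> ball (s k) (ep m) \<subseteq> U)"
    proof (rule discrete_lift[where p = "\<lambda>i. \<sigma> (real i / real N)", OF U(2)])
      show "y \<in> f ` ball x (ep m)" if "x \<in> K" "ball x (ep m) \<subseteq> U" "dist (f x) y < \<delta>" for x y
        using \<delta>(2) that by blast
    qed (fact x0(1), fact, fact st)
    then obtain k s where ks: "k\<le>N" "s 0 = x0" "\<forall>i\<le>k. s i \<in> U \<and> f (s i) = \<sigma> (real i / real N)"
      "\<forall>i<k. dist (s i) (s (Suc i)) < ep m" "k = N \<or> \<not> ball (s k) (ep m) \<subseteq> U" by blast
    have "\<forall>t\<in>{0..1}. \<forall>t'\<in>{0..1}. \<bar>t - t'\<bar> \<le> 1 / real N \<longrightarrow> dist (\<sigma> t) (\<sigma> t') < ep m"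
      using d(2) N by force
    then have "R m N k s" unfolding R_def using ks N by blast
    then show ?thesis by blast
  qed
  then obtain N k s where R: "\<And>m. R m (N m) (k m) (s m)" by metis
  then have N: "\<And>m. N m \<ge> Suc m" and kN: "\<And>m. k m \<le> N m" and s0: "\<And>m. s m 0 = x0"
    and sU: "\<And>m i. i \<le> k m \<Longrightarrow> s m i \<in> U" and sf: "\<And>m i. i \<le> k m \<Longrightarrow> f (s m i) = \<sigma> (real i / real (N m))"
    and sstep: "\<And>m i. i < k m \<Longrightarrow> dist (s m i) (s m (Suc i)) < ep m"
    and stop: "\<And>m. k m = N m \<or> \<not> ball (s m (k m)) (ep m) \<subseteq> U"
    and mesh: "\<And>m t t'. t \<in> {0..1} \<Longrightarrow> t' \<in> {0..1} \<Longrightarrow> \<bar>t - t'\<bar> \<le> 1 / real (N m) \<Longrightarrow> dist (\<sigma> t) (\<sigma> t') < ep m"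
    unfolding R_def by blast+
  have Npos: "real (N m) > 0" for m using N[of m] by simp
  have Nep: "1 / real (N m) \<le> ep m" for m
    using N[of m] unfolding ep_def by (simp add: field_simps)
  have ep_small: "\<exists>M. \<forall>m\<ge>M. ep m < e" if "e > 0" for e
  proof -
    have "(\<lambda>m. ep m) \<longlonglongrightarrow> 0" unfolding ep_def by (rule LIMSEQ_inverse_real_of_nat)
    then show ?thesis using that by (metis (no_types, lifting) order_tendstoD(2) eventually_sequentially)
  qed
  define ix where "ix = (\<lambda>m t. min (nat \<lfloor>t * real (N m)\<rfloor>) (k m))"
  define g where "g = (\<lambda>m t. s m (ix m t))"
  define c where "c = (\<lambda>m. real (k m) / real (N m))"
  have ixk: "ix m t \<le> k m" for m t by (simp add: ix_def)
  have gU: "g m t \<in> U" for m t unfolding g_def by (rule sU[OF ixk])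
  have g0: "g m 0 = x0" for m by (simp add: g_def ix_def s0)
  have c01: "c m \<in> {0..1}" for m using kN[of m] Npos[of m] by (simp add: c_def)
  have gc: "g m (c m) = s m (k m)" for m using Npos[of m] by (simp add: g_def ix_def c_def)
  have gf: "dist (f (g m t)) (\<sigma> t) < ep m" if "0 \<le> t" "t \<le> c m" for m t
  proof -
    have "t * real (N m) \<le> real (k m)" using that Npos[of m] by (simp add: c_def field_simps)
    then have "\<lfloor>t * real (N m)\<rfloor> \<le> int (k m)" by linarith
    then have ix: "real (ix m t) = of_int \<lfloor>t * real (N m)\<rfloor>" using that by (auto simp: ix_def min_def)
    have "\<bar>real (ix m t) - t * real (N m)\<bar> \<le> 1" unfolding ix by linarith
    moreover have "real (ix m t) / real (N m) - t = (real (ix m t) - t * real (N m)) / real (N m)"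
      using Npos[of m] by (simp add: diff_divide_distrib)
    ultimately have "\<bar>real (ix m t) / real (N m) - t\<bar> \<le> 1 / real (N m)"
      using Npos[of m] by (simp only: abs_divide) (simp add: divide_right_mono)
    moreover have "real (ix m t) / real (N m) \<in> {0..1}" using ixk[of m t] kN[of m] Npos[of m] by simp
    moreover have "t \<in> {0..1}" using that c01[of m] by auto
    ultimately have "dist (\<sigma> (real (ix m t) / real (N m))) (\<sigma> t) < ep m" using mesh by blast
    then show ?thesis using sf[OF ixk] by (simp add: g_def)
  qed
  \<comment> \<open>Equicontinuity at scales above the mesh: the points between two nearby times form a chain with
    a small image.\<close>
  have equi1: "\<exists>\<delta>>0. \<exists>M. \<forall>m\<ge>M. \<forall>t t'. 0 \<le> t \<and> t \<le> t' \<and> t' \<le> 1 \<and> t' - t < \<delta> \<longrightarrow> dist (g m t) (g m t') < e" if e: "e > 0" for e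
  proof -
    obtain \<delta>0 where \<delta>0: "\<delta>0 > 0" "\<And>x (k::nat) y. (\<forall>i\<le>k. x i \<in> K \<and> dist (f (x i)) y < \<delta>0) \<Longrightarrow>
     (\<forall>i<k. dist (x i) (x (Suc i)) < \<delta>0) \<Longrightarrow> dist (x 0) (x k) < e"
      using small_chains[OF K cont fin e] by blast
    obtain d where d: "d > 0" "\<forall>t\<in>{0..1}. \<forall>t'\<in>{0..1}. \<bar>t - t'\<bar> < d \<longrightarrow> dist (\<sigma> t) (\<sigma> t') < \<delta>0"
      using uc[OF \<delta>0(1)] by auto
    obtain M where M: "\<And>m. m \<ge> M \<Longrightarrow> ep m < min \<delta>0 (d/2)" using ep_small[of "min \<delta>0 (d/2)"] \<delta>0 d by auto
    have "dist (g m t) (g m t') < e" if m: "m \<ge> M" and t: "0 \<le> t" "t \<le> t'" "t' \<le> 1" "t' - t < d/2" for m t t'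
    proof -
      have "t * real (N m) \<le> t' * real (N m)" using t Npos[of m] by (simp add: mult_right_mono)
      then have "nat \<lfloor>t * real (N m)\<rfloor> \<le> nat \<lfloor>t' * real (N m)\<rfloor>" by (intro nat_mono floor_mono)
      then have le: "ix m t \<le> ix m t'" by (auto simp: ix_def min_def)
      have "real (ix m t') - real (ix m t) \<le> of_int \<lfloor>t' * real (N m)\<rfloor> - of_int \<lfloor>t * real (N m)\<rfloor>"
      proof -
        have "0 \<le> t * real (N m)" "0 \<le> t' * real (N m)" using t Npos[of m] by auto
        then have "0 \<le> \<lfloor>t * real (N m)\<rfloor>" "\<lfloor>t * real (N m)\<rfloor> \<le> \<lfloor>t' * real (N m)\<rfloor>"
          using \<open>t * real (N m) \<le> t' * real (N m)\<close> by (auto intro: floor_mono)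
        moreover have "real (min (nat b) k) - real (min (nat a) k) \<le> of_int b - of_int a"
          if "0 \<le> a" "a \<le> b" for a b :: int and k :: nat
          using that by (auto simp: min_def)
        ultimately show ?thesis unfolding ix_def by blast
      qed
      also have "\<dots> \<le> (t' - t) * real (N m) + 1" unfolding left_diff_distrib by linarith
      finally have "(real (ix m t') - real (ix m t)) / real (N m) \<le> ((t' - t) * real (N m) + 1) / real (N m)"
        using Npos[of m] by (intro divide_right_mono) auto
      also have "\<dots> = (t' - t) + 1 / real (N m)" using Npos[of m] by (simp add: field_simps)
      also have "\<dots> < d" using Nep[of m] M[OF m] t by auto
      finally have dd: "(real (ix m t') - real (ix m t)) / real (N m) < d" .
      have "dist (s m (ix m t + 0)) (s m (ix m t + (ix m t' - ix m t))) < e"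
      proof (rule \<delta>0(2)[of "ix m t' - ix m t" "\<lambda>j. s m (ix m t + j)" "\<sigma> (real (ix m t) / real (N m))"])
        show "\<forall>i\<le>ix m t' - ix m t. s m (ix m t + i) \<in> K \<and> dist (f (s m (ix m t + i))) (\<sigma> (real (ix m t) / real (N m))) < \<delta>0"
        proof (intro allI impI conjI)
          fix i assume i: "i \<le> ix m t' - ix m t"
          then have ik: "ix m t + i \<le> k m" using ixk[of m t'] le by linarith
          show "s m (ix m t + i) \<in> K" using sU[OF ik] U by blast
          have "\<bar>real (ix m t + i) / real (N m) - real (ix m t) / real (N m)\<bar> = real i / real (N m)"
            using Npos[of m] by (simp add: field_simps)
          also have "\<dots> \<le> (real (ix m t') - real (ix m t)) / real (N m)"
            using i le Npos[of m] by (intro divide_right_mono) auto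
          finally have "\<bar>real (ix m t + i) / real (N m) - real (ix m t) / real (N m)\<bar> < d" using dd by simp
          moreover have "real (ix m t + i) / real (N m) \<in> {0..1}" "real (ix m t) / real (N m) \<in> {0..1}"
            using ik kN[of m] Npos[of m] by auto
          ultimately show "dist (f (s m (ix m t + i))) (\<sigma> (real (ix m t) / real (N m))) < \<delta>0"
            using d(2) sf[OF ik] by auto
        qed
        show "\<forall>i<ix m t' - ix m t. dist (s m (ix m t + i)) (s m (ix m t + Suc i)) < \<delta>0"
        proof (intro allI impI)
          fix i assume "i < ix m t' - ix m t"
          then have "ix m t + i < k m" using ixk[of m t'] by linarith
          from sstep[OF this] show "dist (s m (ix m t + i)) (s m (ix m t + Suc i)) < \<delta>0"
            using M[OF m] by simp
        qed
      qed
      then show ?thesis using le by (simp add: g_def)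
    qed
    then show ?thesis using d(1) by (intro exI[of _ "d/2"]) auto
  qed
  have equi: "\<exists>\<delta>>0. \<exists>M. \<forall>m\<ge>M. \<forall>t\<in>{0..1}. \<forall>t'\<in>{0..1}. \<bar>t' - t\<bar> < \<delta> \<longrightarrow> dist (g m t) (g m t') < e" if e: "e > 0" for e
  proof -
    obtain \<delta> M where \<delta>: "\<delta> > 0" "\<forall>m\<ge>M. \<forall>t t'. 0 \<le> t \<and> t \<le> t' \<and> t' \<le> 1 \<and> t' - t < \<delta> \<longrightarrow> dist (g m t) (g m t') < e"
      using equi1[OF e] by blast
    have "dist (g m t) (g m t') < e" if "m \<ge> M" "t\<in>{0..1}" "t'\<in>{0..1}" "\<bar>t' - t\<bar> < \<delta>" for m t t'
      using \<delta>(2)[rule_format, of m t t'] \<delta>(2)[rule_format, of m t' t] that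
      by (cases "t \<le> t'") (auto simp: dist_commute)
    then show ?thesis using \<delta>(1) by blast
  qed
  obtain cl r1 where cl: "cl \<in> {0..1}" "strict_mono (r1::nat\<Rightarrow>nat)" "(c \<circ> r1) \<longlonglongrightarrow> cl"
    using compact_Icc[of 0 "1::real", unfolded compact_def] c01 by (metis (no_types, lifting))
  obtain B where B: "\<And>x. x \<in> K \<Longrightarrow> norm x \<le> B" using compact_imp_bounded[OF K] by (auto simp: bounded_iff)
  obtain r2 where r2: "strict_mono (r2::nat\<Rightarrow>nat)" "\<And>q. q \<in> \<rat> \<inter> {0..1} \<Longrightarrow> \<exists>l. (\<lambda>n. g (r1 (r2 n)) q) \<longlonglongrightarrow> l"
  proof (rule function_convergent_subsequence[of "\<rat> \<inter> {0..1::real}" "\<lambda>n. g (r1 n)" B])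
    show "countable (\<rat> \<inter> {0..1::real})" using countable_rat by (rule countable_subset[rotated]) auto
    show "norm (g (r1 n) x) \<le> B" for n x using gU U B by blast
  qed blast
  define r where "r = r1 \<circ> r2"
  have r: "strict_mono r" unfolding r_def using cl(2) r2(1) by (rule strict_mono_o)
  have rge: "r n \<ge> n" for n by (rule seq_suble[OF r])
  have cr: "(\<lambda>n. c (r n)) \<longlonglongrightarrow> cl" using LIMSEQ_subseq_LIMSEQ[OF cl(3) r2(1)] by (simp add: o_def r_def)
  have conv: "\<exists>l. (\<lambda>n. g (r n) t) \<longlonglongrightarrow> l" if t: "t \<in> {0..1}" for t
  proof -
    have "Cauchy (\<lambda>n. g (r n) t)"
    proof (rule metric_CauchyI)
      fix e :: real assume e: "e > 0"
      obtain \<delta> M where \<delta>: "\<delta> > 0" "\<forall>m\<ge>M. \<forall>t\<in>{0..1}. \<forall>t'\<in>{0..1}. \<bar>t' - t\<bar> < \<delta> \<longrightarrow> dist (g m t) (g m t') < e/3"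
        using equi[of "e/3"] e by auto
      obtain q where q: "q \<in> \<rat> \<inter> {0..1}" "\<bar>q - t\<bar> < \<delta>"
      proof (cases "t < 1")
        case True
        then obtain q where "q \<in> \<rat>" "t < q" "q < min 1 (t + \<delta>)" using Rats_dense_in_real[of t "min 1 (t+\<delta>)"] \<delta> by auto
        then show ?thesis using t by (intro that[of q]) auto
      next
        case False
        then show ?thesis using t \<delta> by (intro that[of 1]) auto
      qed
      have "Cauchy (\<lambda>n. g (r n) q)" using r2(2)[OF q(1)] by (auto simp: r_def intro: LIMSEQ_imp_Cauchy)
      then obtain M' where M': "\<And>m n. m \<ge> M' \<Longrightarrow> n \<ge> M' \<Longrightarrow> dist (g (r m) q) (g (r n) q) < e/3"
        using metric_CauchyD[of _ "e/3"] e by fastforce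
      have "dist (g (r m) t) (g (r n) t) < e" if "m \<ge> max M M'" "n \<ge> max M M'" for m n
      proof -
        have "dist (g (r m) t) (g (r m) q) < e/3" "dist (g (r n) t) (g (r n) q) < e/3"
          using \<delta>(2) q t that rge[of m] rge[of n] by auto
        moreover have "dist (g (r m) q) (g (r n) q) < e/3" using M' that by simp
        moreover have "dist (g (r m) t) (g (r n) t) \<le> dist (g (r m) t) (g (r m) q) + dist (g (r m) q) (g (r n) q) + dist (g (r n) t) (g (r n) q)"
          using dist_triangle_4[of "g (r m) t" "g (r n) t" "g (r m) q" "g (r n) q"] by (simp add: dist_commute)
        ultimately show ?thesis by linarith
      qed
      then show "\<exists>M. \<forall>m\<ge>M. \<forall>n\<ge>M. dist (g (r m) t) (g (r n) t) < e" by blast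
    qed
    then show ?thesis by (simp add: Cauchy_convergent_iff convergent_def)
  qed
  then obtain G where G: "\<And>t. t \<in> {0..1} \<Longrightarrow> (\<lambda>n. g (r n) t) \<longlonglongrightarrow> G t" by metis
  have GK: "G t \<in> K" if "t \<in> {0..1}" for t
    using closed_sequentially[OF compact_imp_closed[OF K] _ G[OF that]] gU U by blast
  have Gequi: "\<exists>\<delta>>0. \<forall>t\<in>{0..1}. \<forall>t'\<in>{0..1}. \<bar>t' - t\<bar> < \<delta> \<longrightarrow> dist (G t) (G t') \<le> e" if e: "e > 0" for e
  proof -
    obtain \<delta> M where \<delta>: "\<delta> > 0" "\<forall>m\<ge>M. \<forall>t\<in>{0..1}. \<forall>t'\<in>{0..1}. \<bar>t' - t\<bar> < \<delta> \<longrightarrow> dist (g m t) (g m t') < e"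
      using equi[OF e] by blast
    have "dist (G t) (G t') \<le> e" if "t\<in>{0..1}" "t'\<in>{0..1}" "\<bar>t' - t\<bar> < \<delta>" for t t'
    proof (rule tendsto_upperbound[OF tendsto_dist[OF G[OF that(1)] G[OF that(2)]]])
      show "\<forall>\<^sub>F n in sequentially. dist (g (r n) t) (g (r n) t') \<le> e"
        unfolding eventually_sequentially using \<delta>(2) that rge by (meson less_imp_le order_trans)
    qed simp
    then show ?thesis using \<delta>(1) by blast
  qed
  have Gcont: "continuous_on {0..1} G"
    unfolding continuous_on_iff
  proof (intro ballI allI impI)
    fix t e :: real assume t: "t \<in> {0..1}" and e: "0 < e"
    obtain \<delta> where "\<delta>>0" "\<forall>t\<in>{0..1}. \<forall>t'\<in>{0..1}. \<bar>t' - t\<bar> < \<delta> \<longrightarrow> dist (G t) (G t') \<le> e/2"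
      using Gequi[of "e/2"] e by auto
    then have "\<forall>t'\<in>{0..1}. dist t' t < \<delta> \<longrightarrow> dist (G t') (G t) \<le> e/2" using t
      by (auto simp: dist_real_def abs_minus_commute)
    then show "\<exists>d>0. \<forall>x'\<in>{0..1}. dist x' t < d \<longrightarrow> dist (G x') (G t) < e"
      using \<open>\<delta> > 0\<close> e by (intro exI[of _ \<delta>]) fastforce
  qed
  have Gc: "(\<lambda>n. g (r n) (c (r n))) \<longlonglongrightarrow> G cl"
    unfolding lim_sequentially
  proof (intro allI impI)
    fix e :: real assume e: "e > 0"
    obtain \<delta> M where \<delta>: "\<delta> > 0" "\<forall>m\<ge>M. \<forall>t\<in>{0..1}. \<forall>t'\<in>{0..1}. \<bar>t' - t\<bar> < \<delta> \<longrightarrow> dist (g m t) (g m t') < e/2"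
      using equi[of "e/2"] e by auto
    obtain M1 where M1: "\<And>n. n \<ge> M1 \<Longrightarrow> dist (c (r n)) cl < \<delta>" using cr \<delta>(1) unfolding lim_sequentially by blast
    obtain M2 where M2: "\<And>n. n \<ge> M2 \<Longrightarrow> dist (g (r n) cl) (G cl) < e/2"
      using G[OF cl(1)] e unfolding lim_sequentially by (meson half_gt_zero)
    have "dist (g (r n) (c (r n))) (G cl) < e" if n: "n \<ge> max M (max M1 M2)" for n
    proof -
      have "dist (g (r n) cl) (g (r n) (c (r n))) < e/2"
        using \<delta>(2) M1[of n] n rge[of n] cl(1) c01 by (auto simp: dist_real_def)
      then show ?thesis using M2[of n] n dist_triangle_half_r[of "g (r n) cl" "g (r n) (c (r n))" e "G cl"] by auto
    qed
    then show "\<exists>no. \<forall>n\<ge>no. dist (g (r n) (c (r n))) (G cl) < e" by blast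
  qed
  have G0: "G 0 = x0" using G[of 0] g0 by (simp add: LIMSEQ_const_iff)
  have epr: "(\<lambda>n. ep (r n)) \<longlonglongrightarrow> 0"
    using LIMSEQ_subseq_LIMSEQ[OF LIMSEQ_inverse_real_of_nat r] by (simp add: o_def ep_def)
  have Gf1: "f (G t) = \<sigma> t" if t: "0 \<le> t" "t < cl" for t
  proof -
    have t01: "t \<in> {0..1}" using t cl by auto
    have l1: "(\<lambda>n. f (g (r n) t)) \<longlonglongrightarrow> f (G t)"
      by (rule continuous_on_tendsto_compose[OF cont G[OF t01] GK[OF t01]]) (use gU U in \<open>auto intro!: always_eventually\<close>)
    have "\<forall>\<^sub>F n in sequentially. t < c (r n)" using order_tendstoD(1)[OF cr t(2)] .
    then have "\<forall>\<^sub>F n in sequentially. dist (f (g (r n) t)) (\<sigma> t) \<le> ep (r n)"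
      by eventually_elim (use gf t in \<open>simp add: less_imp_le\<close>)
    then have "(\<lambda>n. dist (f (g (r n) t)) (\<sigma> t)) \<longlonglongrightarrow> 0"
      by (intro tendsto_sandwich[OF _ _ tendsto_const epr]) auto
    then have "(\<lambda>n. f (g (r n) t)) \<longlonglongrightarrow> \<sigma> t" using tendsto_dist_iff by blast
    then show ?thesis using l1 LIMSEQ_unique by blast
  qed
  have Gf: "f (G t) = \<sigma> t" if t: "0 \<le> t" "t \<le> cl" for t
  proof (cases "t < cl \<or> cl = 0")
    case True
    then show ?thesis using Gf1 t G0 x0 by auto
  next
    case False
    then have tc: "t = cl" "cl > 0" using t by auto
    have c1: "continuous_on {0..cl} (f \<circ> G)"
      by (intro continuous_on_compose continuous_on_subset[OF Gcont] continuous_on_subset[OF cont]) (use cl GK in auto)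
    have c2: "continuous_on {0..cl} \<sigma>" using cl by (intro continuous_on_subset[OF \<sigma>]) auto
    define u where "u = (\<lambda>n::nat. cl * (1 - inverse (real (Suc n))))"
    have "u \<longlonglongrightarrow> cl * (1 - 0)"
      unfolding u_def by (intro tendsto_intros LIMSEQ_inverse_real_of_nat)
    then have u: "u \<longlonglongrightarrow> cl" by simp
    have u2: "0 \<le> u n \<and> u n < cl" for n
      unfolding u_def using tc(2) by (simp add: field_simps)
    then have u3: "\<forall>\<^sub>F n in sequentially. u n \<in> {0..cl}" by (auto simp: less_imp_le)
    have clm: "cl \<in> {0..cl}" using tc by simp
    have "(\<lambda>n. (f \<circ> G) (u n)) \<longlonglongrightarrow> (f \<circ> G) cl"
      by (rule continuous_on_tendsto_compose[OF c1 u clm u3])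
    moreover have "(\<lambda>n. \<sigma> (u n)) \<longlonglongrightarrow> \<sigma> cl"
      by (rule continuous_on_tendsto_compose[OF c2 u clm u3])
    moreover have "(f \<circ> G) (u n) = \<sigma> (u n)" for n using u2 Gf1 by simp
    ultimately have "(f \<circ> G) cl = \<sigma> cl" by (metis (no_types, lifting) LIMSEQ_unique ext)
    then show ?thesis using tc by simp
  qed
  show ?thesis
  proof (cases "\<forall>t\<in>{0..cl}. G t \<in> U")
    case True
    have "cl = 1"
    proof (rule ccontr)
      assume "cl \<noteq> 1"
      then have "cl < 1" using cl by auto
      have "G cl \<in> U" using True cl by auto
      then obtain e where e: "e > 0" "ball (G cl) e \<subseteq> U" using U(1) by (meson openE)
      have "\<forall>\<^sub>F n in sequentially. c (r n) < 1" using order_tendstoD(2)[OF cr \<open>cl < 1\<close>] .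
      moreover have "\<forall>\<^sub>F n in sequentially. dist (g (r n) (c (r n))) (G cl) < e/2"
        using Gc half_gt_zero[OF e(1)] unfolding tendsto_iff by blast
      moreover have "\<forall>\<^sub>F n in sequentially. ep (r n) < e/2" using order_tendstoD(2)[OF epr half_gt_zero[OF e(1)]] .
      ultimately have "\<forall>\<^sub>F n in sequentially. False"
      proof eventually_elim
        case (elim n)
        have "k (r n) \<noteq> N (r n)" using elim(1) Npos[of "r n"] by (auto simp: c_def)
        then have nb: "\<not> ball (g (r n) (c (r n))) (ep (r n)) \<subseteq> U" using stop[of "r n"] gc by simp
        have "ball (g (r n) (c (r n))) (ep (r n)) \<subseteq> ball (G cl) e"
        proof
          fix v assume "v \<in> ball (g (r n) (c (r n))) (ep (r n))"
          then show "v \<in> ball (G cl) e"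
            using elim dist_triangle_half_r[of "g (r n) (c (r n))" "G cl" e v] by auto
        qed
        then show False using nb e by blast
      qed
      then show False by simp
    qed
    then show ?thesis
      using Gcont G0 GK Gf True by (intro bexI[of _ 1] exI[of _ G]) auto
  next
    case False
    \<comment> \<open>The limit may leave \<open>U\<close> before the time \<open>cl\<close>; it is cut off at the
      first such time.\<close>
    define T where "T = {t\<in>{0..cl}. G t \<in> - U}"
    have "closed T" unfolding T_def
      using continuous_closed_preimage[OF continuous_on_subset[OF Gcont], of "{0..cl}" "- U"] U cl
      by (auto simp: vimage_def Int_def)
    then have "compact ({0..cl} \<inter> T)" by (intro compact_Int_closed) auto
    moreover have "{0..cl} \<inter> T = T" by (auto simp: T_def)
    ultimately have cT: "compact T" by simp
    have "T \<noteq> {}" using False by (auto simp: T_def)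
    from compact_attains_inf[OF cT this]
    obtain c' where c': "c' \<in> T" "\<forall>t\<in>T. c' \<le> t" by (elim bexE)
    have "c' \<in> {0..1}" "c' \<le> cl" "G c' \<notin> U" using c' cl by (auto simp: T_def)
    moreover have "G t \<in> U" if "t \<in> {0..<c'}" for t
      using c'(2) that \<open>c' \<le> cl\<close> by (auto simp: T_def)
    ultimately show ?thesis using G0 GK Gf
      by (intro bexI[of _ c'] exI[of _ G]) (auto intro!: continuous_on_subset[OF Gcont])
  qed
qed

section \<open>Line integrals along lifted segments\<close>

lemma curve_length_segment:
  fixes u v :: "'a::euclidean_space"
  assumes "a \<le> t" and line: "\<And>x. x \<in> {a..t} \<Longrightarrow> \<gamma> x = u + x *\<^sub>R v"
  shows "curve_length (a, t, \<gamma>) = ennreal ((t - a) * norm v)"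
proof -
  define S where "S = {(k :: nat, \<tau> :: nat \<Rightarrow> real). mono_on {..k} \<tau> \<and> \<tau> 0 = a \<and> \<tau> k = t}"
  have val: "(\<Sum>i<k. ennreal (dist (\<gamma> (\<tau> i)) (\<gamma> (\<tau> (Suc i))))) = ennreal ((t - a) * norm v)"
    if "(k, \<tau>) \<in> S" for k \<tau>
  proof -
    have m: "mono_on {..k} \<tau>" and e: "\<tau> 0 = a" "\<tau> k = t" using that by (auto simp: S_def)
    have in_at: "\<tau> i \<in> {a..t}" if "i \<le> k" for i
      using mono_onD[OF m, of 0 i] mono_onD[OF m, of i k] that e by auto
    have st: "dist (\<gamma> (\<tau> i)) (\<gamma> (\<tau> (Suc i))) = (\<tau> (Suc i) - \<tau> i) * norm v" if "i < k" for i
    proof -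
      have "\<tau> i \<le> \<tau> (Suc i)" using mono_onD[OF m, of i "Suc i"] that by auto
      moreover have "\<gamma> (\<tau> i) - \<gamma> (\<tau> (Suc i)) = (\<tau> i - \<tau> (Suc i)) *\<^sub>R v"
        using line in_at[of i] in_at[of "Suc i"] that by (simp add: algebra_simps)
      ultimately show ?thesis by (simp add: dist_norm)
    qed
    have "(\<Sum>i<k. ennreal (dist (\<gamma> (\<tau> i)) (\<gamma> (\<tau> (Suc i))))) = (\<Sum>i<k. ennreal ((\<tau> (Suc i) - \<tau> i) * norm v))"
      using st by (intro sum.cong) auto
    also have "\<dots> = ennreal (\<Sum>i<k. (\<tau> (Suc i) - \<tau> i) * norm v)"
      using st by (intro sum_ennreal) (metis lessThan_iff zero_le_dist)
    also have "(\<Sum>i<k. (\<tau> (Suc i) - \<tau> i) * norm v) = (t - a) * norm v"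
      by (simp add: sum_distrib_right[symmetric] sum_lessThan_telescope e)
    finally show ?thesis .
  qed
  have "(1, \<lambda>i. if i = 0 then a else t) \<in> S"
    using assms(1) by (auto simp: S_def mono_on_def)
  then have "S \<noteq> {}" by blast
  have "curve_length (a, t, \<gamma>) = (SUP (k, \<tau>)\<in>S. \<Sum>i<k. ennreal (dist (\<gamma> (\<tau> i)) (\<gamma> (\<tau> (Suc i)))))"
    by (simp add: curve_length_def S_def)
  also have "\<dots> = (SUP x\<in>S. ennreal ((t - a) * norm v))"
    using val by (intro SUP_cong) auto
  also have "\<dots> = ennreal ((t - a) * norm v)" using \<open>S \<noteq> {}\<close> by simp
  finally show ?thesis .
qed

text \<open>Arc length is proportional to the parameter, so the arc-length parametrization in the definition
  amounts to a linear substitution.\<close>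

lemma curve_integral_segment:
  fixes u v :: "'a::euclidean_space"
  assumes ab: "a < b" and line: "\<And>x. x \<in> {a..b} \<Longrightarrow> \<gamma> x = u + x *\<^sub>R v"
    and [measurable]: "\<rho> \<in> borel_measurable borel"
  shows "curve_integral \<rho> (a, b, \<gamma>) = ennreal (norm v) * (\<integral>\<^sup>+t\<in>{a..b}. \<rho> (u + t *\<^sub>R v) \<partial>lborel)"
proof -
  define s where "s = (\<lambda>t. enn2real (curve_length (a, t, \<gamma>)))"
  have s: "s t = (t - a) * norm v" if "t \<in> {a..b}" for t
    unfolding s_def using that line by (subst curve_length_segment[of a t \<gamma> u v]) auto
  have eq: "curve_integral \<rho> (a, b, \<gamma>) = (\<integral>\<^sup>+w\<in>{0..s b}. \<rho> (\<gamma> (inv_into {a..b} s w)) \<partial>lborel)"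
    by (simp add: curve_integral_def s_def Let_def)
  show ?thesis
  proof (cases "v = 0")
    case True
    then have "s b = 0" using s[of b] ab by simp
    then have "(\<integral>\<^sup>+w\<in>{0..s b}. \<rho> (\<gamma> (inv_into {a..b} s w)) \<partial>lborel) =
      (\<integral>\<^sup>+w. \<rho> (\<gamma> (inv_into {a..b} s 0)) * indicator {0::real} w \<partial>lborel)"
      by (intro nn_integral_cong) (auto simp: indicator_def)
    also have "\<dots> = 0" by (simp add: nn_integral_cmult_indicator)
    finally show ?thesis using eq True by simp
  next
    case False
    then have nv: "norm v > 0" by simp
    have inj: "inj_on s {a..b}" using s nv by (auto simp: inj_on_def)
    have inv: "inv_into {a..b} s w = a + w / norm v" if "w \<in> {0..s b}" for w
    proof (rule inv_into_f_eq[OF inj])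
      show m: "a + w / norm v \<in> {a..b}" using that s[of b] ab nv by (auto simp: field_simps)
      show "s (a + w / norm v) = w" unfolding s[OF m] using nv by simp
    qed
    have "curve_integral \<rho> (a, b, \<gamma>) = (\<integral>\<^sup>+w. \<rho> (u + (a + w / norm v) *\<^sub>R v) * indicator {0..s b} w \<partial>lborel)"
      unfolding eq
    proof (intro nn_integral_cong)
      fix w
      have "a + w / norm v \<in> {a..b}" if "w \<in> {0..s b}"
        using that s[of b] ab nv by (auto simp: field_simps)
      then show "\<rho> (\<gamma> (inv_into {a..b} s w)) * indicator {0..s b} w = \<rho> (u + (a + w / norm v) *\<^sub>R v) * indicator {0..s b} w"
        using inv line by (auto simp: indicator_def)
    qed
    also have "\<dots> = ennreal \<bar>norm v\<bar> * (\<integral>\<^sup>+t. \<rho> (u + (a + (- a * norm v + norm v * t) / norm v) *\<^sub>R v) *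
        indicator {0..s b} (- a * norm v + norm v * t) \<partial>lborel)"
      using nv by (intro nn_integral_real_affine) auto
    also have "(\<integral>\<^sup>+t. \<rho> (u + (a + (- a * norm v + norm v * t) / norm v) *\<^sub>R v) *
        indicator {0..s b} (- a * norm v + norm v * t) \<partial>lborel) = (\<integral>\<^sup>+t\<in>{a..b}. \<rho> (u + t *\<^sub>R v) \<partial>lborel)"
    proof (intro nn_integral_cong)
      fix t
      have e1: "a + (- a * norm v + norm v * t) / norm v = t" using nv by (simp add: field_simps)
      have "- a * norm v + norm v * t = (t - a) * norm v" by (simp add: algebra_simps)
      moreover have "(t - a) * norm v \<le> (b - a) * norm v \<longleftrightarrow> t \<le> b" "0 \<le> (t - a) * norm v \<longleftrightarrow> a \<le> t"
        using nv by (auto simp: zero_le_mult_iff)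
      moreover have "s b = (b - a) * norm v" using s[of b] ab by simp
      ultimately have "indicator {0..s b} (- a * norm v + norm v * t) = (indicator {a..b} t :: ennreal)"
        by (simp add: indicator_def)
      then show "\<rho> (u + (a + (- a * norm v + norm v * t) / norm v) *\<^sub>R v) *
        indicator {0..s b} (- a * norm v + norm v * t) = \<rho> (u + t *\<^sub>R v) * indicator {a..b} t"
        unfolding e1 by simp
    qed
    finally show ?thesis by simp
  qed
qed

text \<open>The line integral over the segment from \<open>u\<close> to \<open>u + v\<close>: the second
  argument is a direction, not an end point.\<close>

definition segment_integral :: "('a::euclidean_space \<Rightarrow> ennreal) \<Rightarrow> 'a \<Rightarrow> 'a \<Rightarrow> ennreal" where
  "segment_integral \<rho> u v = ennreal (norm v) * (\<integral>\<^sup>+t\<in>{0..1}. \<rho> (u + t *\<^sub>R v) \<partial>lborel)"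

text \<open>\<open>t2\<close> is the first time at level \<open>s\<close>, and \<open>t1\<close> the last
  time before \<open>t2\<close> at level \<open>r\<close>.\<close>

lemma crossing_interval:
  fixes h :: "real \<Rightarrow> real"
  assumes h: "continuous_on {0..c} h" and "0 \<le> c" "h 0 \<le> r" "r < s" "s \<le> h c"
  shows "\<exists>t1 t2. 0 \<le> t1 \<and> t1 < t2 \<and> t2 \<le> c \<and> h t1 = r \<and> h t2 = s \<and> (\<forall>t\<in>{t1<..<t2}. r < h t \<and> h t < s)"
proof -
  have comp: "compact {t \<in> {0..d}. h t \<in> C}" if "closed C" "d \<le> c" for C d
  proof -
    have "closed ({0..d} \<inter> h -` C)"
      using that by (intro continuous_closed_preimage continuous_on_subset[OF h]) auto
    then have "compact ({0..d} \<inter> ({0..d} \<inter> h -` C))" by (intro compact_Int_closed) auto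
    moreover have "{0..d} \<inter> ({0..d} \<inter> h -` C) = {t \<in> {0..d}. h t \<in> C}" by auto
    ultimately show ?thesis by simp
  qed
  have "compact {t \<in> {0..c}. h t \<in> {s..}}" by (rule comp) auto
  moreover have "{t \<in> {0..c}. h t \<in> {s..}} \<noteq> {}" using assms by (auto intro!: exI[of _ c])
  ultimately obtain t2 where t2: "t2 \<in> {t \<in> {0..c}. h t \<in> {s..}}" "\<forall>t\<in>{t \<in> {0..c}. h t \<in> {s..}}. t2 \<le> t"
    using compact_attains_inf by (metis (no_types, lifting))
  have "\<exists>x. 0 \<le> x \<and> x \<le> t2 \<and> h x = s"
    using t2 assms by (intro IVT' continuous_on_subset[OF h]) auto
  then obtain x where x: "0 \<le> x" "x \<le> t2" "h x = s" by blast
  then have "x = t2" using t2 by (intro antisym) auto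
  then have ht2: "h t2 = s" using x by simp
  have "compact {t \<in> {0..t2}. h t \<in> {..r}}" using t2 by (intro comp) auto
  moreover have "{t \<in> {0..t2}. h t \<in> {..r}} \<noteq> {}" using assms t2 by (auto intro!: exI[of _ 0])
  ultimately obtain t1 where t1: "t1 \<in> {t \<in> {0..t2}. h t \<in> {..r}}" "\<forall>t\<in>{t \<in> {0..t2}. h t \<in> {..r}}. t \<le> t1"
    using compact_attains_sup by (metis (no_types, lifting))
  have "\<exists>y. t1 \<le> y \<and> y \<le> t2 \<and> h y = r"
    using t1 t2 assms ht2 by (intro IVT' continuous_on_subset[OF h]) auto
  then obtain y where y: "t1 \<le> y" "y \<le> t2" "h y = r" by blast
  then have "y = t1" using t1 by (intro antisym) auto
  then have ht1: "h t1 = r" using y by simp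
  have "t1 \<noteq> t2" using ht1 ht2 assms by auto
  moreover have "r < h t \<and> h t < s" if "t \<in> {t1<..<t2}" for t
  proof
    have "t \<in> {0..t2}" "t \<in> {0..c}" using t1(1) t2(1) that by auto
    show "r < h t"
    proof (rule ccontr)
      assume "\<not> r < h t"
      then have "t \<le> t1" using t1(2) \<open>t \<in> {0..t2}\<close> by simp
      then show False using that by simp
    qed
    show "h t < s"
    proof (rule ccontr)
      assume "\<not> h t < s"
      then have "t2 \<le> t" using t2(2) \<open>t \<in> {0..c}\<close> by simp
      then show False using that by simp
    qed
  qed
  ultimately show ?thesis using t1 t2 ht1 ht2 by (intro exI[of _ t1] exI[of _ t2]) auto
qed

text \<open>The part of \<open>\<gamma>\<close> inside the ring belongs to the joining curves, and its image
  is a part of the segment.\<close>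

lemma segment_crossing_outward:
  fixes f :: "'a::euclidean_space \<Rightarrow> 'a"
  assumes adm: "\<rho> \<in> adm (image_curves f (joining_curves (sphere b r) (sphere b s) (spherical_ring b r s)))"
    and rs: "r < s" and c: "0 \<le> c" and \<gamma>: "continuous_on {0..c} \<gamma>"
    and f: "\<And>t. t \<in> {0..c} \<Longrightarrow> f (\<gamma> t) = u + t *\<^sub>R v"
    and ends: "dist (\<gamma> 0) b \<le> r" "s \<le> dist (\<gamma> c) b"
  shows "1 \<le> ennreal (norm v) * (\<integral>\<^sup>+t\<in>{0..c}. \<rho> (u + t *\<^sub>R v) \<partial>lborel)"
proof -
  have "continuous_on {0..c} (\<lambda>t. dist (\<gamma> t) b)" by (intro continuous_intros \<gamma>)
  from crossing_interval[OF this c ends(1) rs ends(2)]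
  obtain t1 t2 where t: "0 \<le> t1" "t1 < t2" "t2 \<le> c" "dist (\<gamma> t1) b = r" "dist (\<gamma> t2) b = s"
     "\<forall>t\<in>{t1<..<t2}. r < dist (\<gamma> t) b \<and> dist (\<gamma> t) b < s" by blast
  have "(t1, t2, \<gamma>) \<in> joining_curves (sphere b r) (sphere b s) (spherical_ring b r s)"
    using t by (auto simp: joining_curves_def spherical_ring_def dist_commute intro!: continuous_on_subset[OF \<gamma>])
  then have m: "(t1, t2, f \<circ> \<gamma>) \<in> image_curves f (joining_curves (sphere b r) (sphere b s) (spherical_ring b r s))"
    unfolding image_curves_def by (force intro: image_eqI[rotated])
  have line: "(f \<circ> \<gamma>) x = u + x *\<^sub>R v" if "x \<in> {t1..t2}" for x using f that t by auto
  have "rectifiable (t1, t2, f \<circ> \<gamma>)"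
    unfolding rectifiable_def using curve_length_segment[of t1 t2 "f \<circ> \<gamma>" u v] line t by simp
  then have "1 \<le> curve_integral \<rho> (t1, t2, f \<circ> \<gamma>)" using adm m unfolding adm_def by blast
  also have "\<dots> = ennreal (norm v) * (\<integral>\<^sup>+t\<in>{t1..t2}. \<rho> (u + t *\<^sub>R v) \<partial>lborel)"
    using adm line t by (intro curve_integral_segment) (auto simp: adm_def)
  also have "\<dots> \<le> ennreal (norm v) * (\<integral>\<^sup>+t\<in>{0..c}. \<rho> (u + t *\<^sub>R v) \<partial>lborel)"
    using t by (intro mult_left_mono nn_integral_mono) (auto simp: indicator_def)
  finally show ?thesis .
qed

text \<open>An inward crossing becomes an outward one when the segment is reversed.\<close>

lemma segment_crossing:
  fixes f :: "'a::euclidean_space \<Rightarrow> 'a"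
  assumes adm: "\<rho> \<in> adm (image_curves f (joining_curves (sphere b r) (sphere b s) (spherical_ring b r s)))"
    and rs: "r < s" and c: "0 \<le> c" "c \<le> 1" and \<gamma>: "continuous_on {0..c} \<gamma>"
    and f: "\<And>t. t \<in> {0..c} \<Longrightarrow> f (\<gamma> t) = u + t *\<^sub>R v"
    and ends: "dist (\<gamma> 0) b \<le> r \<and> s \<le> dist (\<gamma> c) b \<or> dist (\<gamma> c) b \<le> r \<and> s \<le> dist (\<gamma> 0) b"
  shows "1 \<le> segment_integral \<rho> u v"
proof -
  have [measurable]: "\<rho> \<in> borel_measurable borel" using adm by (simp add: adm_def)
  have "1 \<le> ennreal (norm v) * (\<integral>\<^sup>+t\<in>{0..c}. \<rho> (u + t *\<^sub>R v) \<partial>lborel)"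
    using ends
  proof
    assume "dist (\<gamma> 0) b \<le> r \<and> s \<le> dist (\<gamma> c) b"
    then show ?thesis by (intro segment_crossing_outward[OF adm rs c(1) \<gamma> f]) auto
  next
    assume e: "dist (\<gamma> c) b \<le> r \<and> s \<le> dist (\<gamma> 0) b"
    have "1 \<le> ennreal (norm (- v)) * (\<integral>\<^sup>+t\<in>{0..c}. \<rho> ((u + c *\<^sub>R v) + t *\<^sub>R (- v)) \<partial>lborel)"
    proof (rule segment_crossing_outward[OF adm rs c(1), of "\<lambda>t. \<gamma> (c - t)"])
      show "continuous_on {0..c} (\<lambda>t. \<gamma> (c - t))"
        by (rule continuous_on_compose2[OF \<gamma>]) (auto intro!: continuous_intros)
      show "f (\<gamma> (c - t)) = u + c *\<^sub>R v + t *\<^sub>R - v" if "t \<in> {0..c}" for t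
        using f[of "c - t"] that by (simp add: algebra_simps)
    qed (use e in auto)
    also have "(\<integral>\<^sup>+t\<in>{0..c}. \<rho> ((u + c *\<^sub>R v) + t *\<^sub>R (- v)) \<partial>lborel) =
       ennreal \<bar>-1\<bar> * (\<integral>\<^sup>+t. \<rho> ((u + c *\<^sub>R v) + (c + (-1) * t) *\<^sub>R (- v)) * indicator {0..c} (c + (-1) * t) \<partial>lborel)"
      by (intro nn_integral_real_affine) auto
    also have "(\<integral>\<^sup>+t. \<rho> ((u + c *\<^sub>R v) + (c + (-1) * t) *\<^sub>R (- v)) * indicator {0..c} (c + (-1) * t) \<partial>lborel) =
       (\<integral>\<^sup>+t\<in>{0..c}. \<rho> (u + t *\<^sub>R v) \<partial>lborel)"
      by (intro nn_integral_cong) (auto simp: indicator_def algebra_simps)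
    finally show ?thesis by simp
  qed
  also have "\<dots> \<le> segment_integral \<rho> u v"
    unfolding segment_integral_def using c by (intro mult_left_mono nn_integral_mono) (auto simp: indicator_def)
  finally show ?thesis .
qed

text \<open>An infinite part of a fibre in a compact set would accumulate at a point of the fibre, which
  then is not isolated.\<close>

lemma finite_fibre:
  fixes f :: "'a::euclidean_space \<Rightarrow> 'b::metric_space"
  assumes "discrete_mapping_on S f" "continuous_on S f" "compact K" "K \<subseteq> S"
  shows "finite {x\<in>K. f x = y}"
proof -
  let ?F = "{x\<in>K. f x = y}"
  have "closed (K \<inter> f -` {y})"
    using assms by (intro continuous_closed_preimage continuous_on_subset[OF assms(2)] compact_imp_closed) auto
  then have "compact (K \<inter> (K \<inter> f -` {y}))" using assms by (intro compact_Int_closed)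
  moreover have "K \<inter> (K \<inter> f -` {y}) = ?F" by auto
  ultimately have comp: "compact ?F" by simp
  have disc: "discrete {x\<in>S. f x = y}" using assms(1) by (simp add: discrete_mapping_on_def)
  show ?thesis
  proof (rule ccontr)
    assume "infinite ?F"
    then obtain z where z: "z \<in> ?F" "z islimpt ?F"
      using comp unfolding compact_eq_Bolzano_Weierstrass by blast
    then have "z islimpt {x\<in>S. f x = y}" using assms(4) by (auto elim: islimpt_subset)
    moreover have "z \<in> {x\<in>S. f x = y}" using z assms by auto
    ultimately show False using disc unfolding discrete_def isolated_in_islimpt_iff by blast
  qed
qed

lemma ring_lift:
  fixes f :: "'a::euclidean_space \<Rightarrow> 'a"
  assumes S: "{x. r \<le> dist x b \<and> dist x b \<le> s} \<subseteq> S"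
    and f: "continuous_on S f" "open_mapping_on S f" "discrete_mapping_on S f"
    and x: "r < dist x b" "dist x b < s"
  obtains c \<gamma> where "0 \<le> c" "c \<le> 1" "continuous_on {0..c} \<gamma>" "\<gamma> 0 = x"
    "\<And>t. t \<in> {0..c} \<Longrightarrow> f (\<gamma> t) = f x + t *\<^sub>R v"
    "\<And>t. t \<in> {0..c} \<Longrightarrow> r \<le> dist (\<gamma> t) b \<and> dist (\<gamma> t) b \<le> s"
    "c = 1 \<and> r < dist (\<gamma> c) b \<and> dist (\<gamma> c) b < s \<or> dist (\<gamma> c) b = r \<or> dist (\<gamma> c) b = s"
proof -
  let ?K = "{x. r \<le> dist x b \<and> dist x b \<le> s}"
  let ?U = "{x. r < dist x b \<and> dist x b < s}"
  have "closed ?K" by (intro closed_Collect_conj closed_Collect_le continuous_intros)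
  moreover have "bounded ?K" by (rule bounded_subset[OF bounded_cball[of b s]]) (auto simp: dist_commute)
  ultimately have K: "compact ?K" by (simp add: compact_eq_bounded_closed)
  have U: "open ?U" by (intro open_Collect_conj open_Collect_less continuous_intros)
  have "?U \<subseteq> S" using S by force
  then have op: "open_mapping_on ?U f" using f(2) unfolding open_mapping_on_def by (meson order_trans)
  have "\<exists>c\<in>{0..1}. \<exists>\<gamma>. continuous_on {0..c} \<gamma> \<and> \<gamma> 0 = x \<and>
    (\<forall>t\<in>{0..c}. \<gamma> t \<in> ?K \<and> f (\<gamma> t) = f x + t *\<^sub>R v) \<and> (\<forall>t\<in>{0..<c}. \<gamma> t \<in> ?U) \<and> (\<gamma> c \<in> ?U \<longrightarrow> c = 1)"
    by (rule lift_path[OF K continuous_on_subset[OF f(1) S] finite_fibre[OF f(3) f(1) K S] U _ op])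
       (use x in \<open>auto intro!: continuous_intros\<close>)
  then obtain c \<gamma> where c: "c\<in>{0..1}" "continuous_on {0..c} \<gamma>" "\<gamma> 0 = x"
    "\<And>t. t\<in>{0..c} \<Longrightarrow> \<gamma> t \<in> ?K \<and> f (\<gamma> t) = f x + t *\<^sub>R v" "\<gamma> c \<in> ?U \<longrightarrow> c = 1" by blast
  have cc: "c \<in> {0..c}" using c(1) by simp
  show ?thesis
  proof (rule that[of c \<gamma>])
    show "0 \<le> c" "c \<le> 1" using c(1) by auto
    show "f (\<gamma> t) = f x + t *\<^sub>R v" "r \<le> dist (\<gamma> t) b \<and> dist (\<gamma> t) b \<le> s" if "t \<in> {0..c}" for t
      using c(4)[OF that] by auto
    show "c = 1 \<and> r < dist (\<gamma> c) b \<and> dist (\<gamma> c) b < s \<or> dist (\<gamma> c) b = r \<or> dist (\<gamma> c) b = s"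
      using c(4)[OF cc] c(5) by auto
  qed (fact c(2), fact c(3))
qed

section \<open>Polar coordinates\<close>

lemma nn_integral_affine:
  fixes g :: "'a::euclidean_space \<Rightarrow> ennreal"
  assumes [measurable]: "g \<in> borel_measurable borel" and c: "c \<noteq> 0"
  shows "(\<integral>\<^sup>+x. g x \<partial>lborel) = ennreal (\<bar>c\<bar> ^ DIM('a)) * (\<integral>\<^sup>+u. g (t + c *\<^sub>R u) \<partial>lborel)"
  by (subst lborel_affine[OF c, of t])
     (simp add: nn_integral_density nn_integral_distr nn_integral_cmult)

lemma nn_integral_inverse_power_tail:
  fixes a :: real
  assumes a: "a > 0" and n: "n > 0"
  shows "(\<integral>\<^sup>+t\<in>{a..}. ennreal (1 / t ^ Suc n) \<partial>lborel) = ennreal (1 / (real n * a ^ n))"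
proof -
  have "(\<integral>\<^sup>+t. ennreal (1 / t ^ Suc n) * indicator {a..} t \<partial>lborel) = 0 - (- (1 / (real n * a ^ n)))"
  proof (rule nn_integral_FTC_atLeast)
    show "DERIV (\<lambda>x. - (1 / (real n * x ^ n))) x :> 1 / x ^ Suc n" if "a \<le> x" for x
    proof -
      have x: "x > 0" using that a by simp
      have "DERIV (\<lambda>x. - (1 / (real n * x ^ n))) x :> real n * (real n * x ^ (n - 1)) / (real n * x ^ n)^2"
        using x n by (auto intro!: derivative_eq_intros simp: power2_eq_square)
      moreover have "real n * (real n * x ^ (n - 1)) / (real n * x ^ n)^2 = 1 / x ^ Suc n"
      proof -
        have "x ^ n = x * x ^ (n-1)" using n by (metis power_minus_mult mult.commute)
        then show ?thesis using x n by (simp add: power2_eq_square divide_simps)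
      qed
      ultimately show ?thesis by simp
    qed
    have "filterlim (\<lambda>x::real. real n * x ^ n) at_infinity at_top"
    proof (rule filterlim_at_top_imp_at_infinity)
      show "filterlim (\<lambda>x::real. real n * x ^ n) at_top at_top"
        by (intro filterlim_tendsto_pos_mult_at_top[OF tendsto_const] filterlim_pow_at_top filterlim_ident) (use n in auto)
    qed
    then have "((\<lambda>x. 1 / (real n * x ^ n)) \<longlongrightarrow> 0) at_top"
      by (intro tendsto_divide_0[OF tendsto_const])
    then show "((\<lambda>x. - (1 / (real n * x ^ n))) \<longlongrightarrow> 0) at_top"
      using tendsto_minus by fastforce
  qed (use a in auto)
  then show ?thesis by simp
qed

text \<open>Polar coordinates without surface measure: directions are represented by the points of the unit
  ball, of which only \<open>u / norm u\<close> matters. The constant \<open>1/n\<close> equals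
  the integral of \<open>\<bar>x - c\<bar>^n / s^(n+1)\<close> over
  \<open>s > \<bar>x - c\<bar>\<close>; inserting it in the integral of \<open>g\<close>,
  exchanging the order and scaling the ball of radius \<open>s\<close> to the unit ball gives the
  formula.\<close>

lemma nn_integral_polar:
  fixes g :: "'a::euclidean_space \<Rightarrow> ennreal"
  assumes [measurable]: "g \<in> borel_measurable borel"
  shows "(\<integral>\<^sup>+x. g x \<partial>lborel) = of_nat DIM('a) *
    (\<integral>\<^sup>+u\<in>ball 0 1. (\<integral>\<^sup>+s\<in>{0<..}. g (c + (s / norm u) *\<^sub>R u) * ennreal (s ^ (DIM('a) - 1)) \<partial>lborel) \<partial>lborel)"
proof -
  let ?n = "DIM('a)"
  have n: "?n > 0" by simp
  define B :: "'a set" where "B = ball 0 1"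
  have [measurable]: "B \<in> sets borel" by (simp add: B_def)
  have "(\<integral>\<^sup>+u\<in>B. (\<integral>\<^sup>+s\<in>{0<..}. g (c + (s / norm u) *\<^sub>R u) * ennreal (s ^ (?n - 1)) \<partial>lborel) \<partial>lborel)
    = (\<integral>\<^sup>+u\<in>B. (\<integral>\<^sup>+s\<in>{0<..}. g (c + s *\<^sub>R u) * ennreal (norm u ^ ?n * s ^ (?n - 1)) \<partial>lborel) \<partial>lborel)"
  proof (rule nn_integral_cong_AE)
    have "AE u in lborel. u \<noteq> (0::'a)" by (rule AE_lborel_singleton)
    then show "AE u in lborel. (\<integral>\<^sup>+s\<in>{0<..}. g (c + (s / norm u) *\<^sub>R u) * ennreal (s ^ (?n - 1)) \<partial>lborel) * indicator B u =
      (\<integral>\<^sup>+s\<in>{0<..}. g (c + s *\<^sub>R u) * ennreal (norm u ^ ?n * s ^ (?n - 1)) \<partial>lborel) * indicator B u"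
    proof eventually_elim
      case (elim u)
      then have nu: "norm u > 0" by simp
      have "(\<integral>\<^sup>+s\<in>{0<..}. g (c + (s / norm u) *\<^sub>R u) * ennreal (s ^ (?n - 1)) \<partial>lborel) =
        ennreal \<bar>norm u\<bar> * (\<integral>\<^sup>+s. g (c + ((0 + norm u * s) / norm u) *\<^sub>R u) * ennreal ((0 + norm u * s) ^ (?n - 1)) * indicator {0<..} (0 + norm u * s) \<partial>lborel)"
        using nu by (intro nn_integral_real_affine) auto
      also have "\<dots> = (\<integral>\<^sup>+s. ennreal (norm u) * (g (c + ((0 + norm u * s) / norm u) *\<^sub>R u) * ennreal ((0 + norm u * s) ^ (?n - 1)) * indicator {0<..} (0 + norm u * s)) \<partial>lborel)"
        by (subst nn_integral_cmult) auto
      also have "\<dots> = (\<integral>\<^sup>+s\<in>{0<..}. g (c + s *\<^sub>R u) * ennreal (norm u ^ ?n * s ^ (?n - 1)) \<partial>lborel)"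
      proof (intro nn_integral_cong)
        fix s :: real
        have p: "norm u ^ ?n = norm u * norm u ^ (?n - 1)" by (metis n power_minus_mult mult.commute)
        show "ennreal (norm u) * (g (c + ((0 + norm u * s) / norm u) *\<^sub>R u) * ennreal ((0 + norm u * s) ^ (?n - 1)) * indicator {0<..} (0 + norm u * s)) =
          g (c + s *\<^sub>R u) * ennreal (norm u ^ ?n * s ^ (?n - 1)) * indicator {0<..} s"
          unfolding p using nu
          by (cases "s > 0") (auto simp: indicator_def power_mult_distrib ennreal_mult mult_ac zero_less_mult_iff)
      qed
      finally show ?case by simp
    qed
  qed
  also have "\<dots> = (\<integral>\<^sup>+u. (\<integral>\<^sup>+s. g (c + s *\<^sub>R u) * ennreal (norm u ^ ?n * s ^ (?n - 1)) * indicator {0<..} s * indicator B u \<partial>lborel) \<partial>lborel)"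
    by (intro nn_integral_cong nn_integral_multc[symmetric]) auto
  also have "\<dots> = (\<integral>\<^sup>+s. (\<integral>\<^sup>+u. g (c + s *\<^sub>R u) * ennreal (norm u ^ ?n * s ^ (?n - 1)) * indicator {0<..} s * indicator B u \<partial>lborel) \<partial>lborel)"
    by (rule lborel_pair.Fubini'[symmetric]) measurable
  also have "\<dots> = (\<integral>\<^sup>+s. (\<integral>\<^sup>+x. g x * ennreal (norm (x - c) ^ ?n * (1 / s ^ Suc ?n)) * indicator {0<..} s * indicator (ball c s) x \<partial>lborel) \<partial>lborel)"
  proof (rule nn_integral_cong)
    fix s :: real
    show "(\<integral>\<^sup>+u. g (c + s *\<^sub>R u) * ennreal (norm u ^ ?n * s ^ (?n - 1)) * indicator {0<..} s * indicator B u \<partial>lborel) =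
      (\<integral>\<^sup>+x. g x * ennreal (norm (x - c) ^ ?n * (1 / s ^ Suc ?n)) * indicator {0<..} s * indicator (ball c s) x \<partial>lborel)"
    proof (cases "s > 0")
      case True
      have [measurable]: "ball c s \<in> sets borel" by simp
      have "(\<integral>\<^sup>+x. g x * ennreal (norm (x - c) ^ ?n * (1 / s ^ Suc ?n)) * indicator {0<..} s * indicator (ball c s) x \<partial>lborel) =
        ennreal (\<bar>s\<bar> ^ ?n) * (\<integral>\<^sup>+u. g (c + s *\<^sub>R u) * ennreal (norm (c + s *\<^sub>R u - c) ^ ?n * (1 / s ^ Suc ?n)) * indicator {0<..} s * indicator (ball c s) (c + s *\<^sub>R u) \<partial>lborel)"
        using True by (intro nn_integral_affine) auto
      also have "\<dots> = (\<integral>\<^sup>+u. ennreal (\<bar>s\<bar> ^ ?n) * (g (c + s *\<^sub>R u) * ennreal (norm (c + s *\<^sub>R u - c) ^ ?n * (1 / s ^ Suc ?n)) * indicator {0<..} s * indicator (ball c s) (c + s *\<^sub>R u)) \<partial>lborel)"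
        by (subst nn_integral_cmult) auto
      also have "\<dots> = (\<integral>\<^sup>+u. g (c + s *\<^sub>R u) * ennreal (norm u ^ ?n * s ^ (?n - 1)) * indicator {0<..} s * indicator B u \<partial>lborel)"
      proof (intro nn_integral_cong)
        fix u :: 'a
        have b: "(indicator (ball c s) (c + s *\<^sub>R u) :: ennreal) = indicator B u"
          using True by (auto simp: indicator_def B_def dist_norm)
        have p: "s ^ ?n = s * s ^ (?n - 1)" by (metis n power_minus_mult mult.commute)
        have "s ^ ?n * (norm (c + s *\<^sub>R u - c) ^ ?n * (1 / s ^ Suc ?n)) = norm u ^ ?n * s ^ (?n - 1)"
          using True p by (simp add: power_mult_distrib field_simps)
        then have e: "ennreal (\<bar>s\<bar> ^ ?n) * ennreal (norm (c + s *\<^sub>R u - c) ^ ?n * (1 / s ^ Suc ?n)) = ennreal (norm u ^ ?n * s ^ (?n - 1))"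
          using True by (subst ennreal_mult[symmetric]) auto
        show "ennreal (\<bar>s\<bar> ^ ?n) * (g (c + s *\<^sub>R u) * ennreal (norm (c + s *\<^sub>R u - c) ^ ?n * (1 / s ^ Suc ?n)) * indicator {0<..} s * indicator (ball c s) (c + s *\<^sub>R u)) =
          g (c + s *\<^sub>R u) * ennreal (norm u ^ ?n * s ^ (?n - 1)) * indicator {0<..} s * indicator B u"
          unfolding e[symmetric] b by (simp only: mult_ac)
      qed
      finally show ?thesis by (rule sym)
    next
      case False
      then have "indicator {0<..} s = (0::ennreal)" by simp
      then show ?thesis by (simp only: mult_zero_right mult_zero_left nn_integral_const)
    qed
  qed
  also have "\<dots> = (\<integral>\<^sup>+x. (\<integral>\<^sup>+s. g x * ennreal (norm (x - c) ^ ?n * (1 / s ^ Suc ?n)) * indicator {0<..} s * indicator (ball c s) x \<partial>lborel) \<partial>lborel)"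
    by (rule lborel_pair.Fubini') (simp add: ball_def dist_norm indicator_def[abs_def] split_beta')
  also have "\<dots> = (\<integral>\<^sup>+x. g x * ennreal (1 / real ?n) \<partial>lborel)"
  proof (rule nn_integral_cong_AE)
    have "AE x in lborel. x \<noteq> c" by (rule AE_lborel_singleton)
    then show "AE x in lborel. (\<integral>\<^sup>+s. g x * ennreal (norm (x - c) ^ ?n * (1 / s ^ Suc ?n)) * indicator {0<..} s * indicator (ball c s) x \<partial>lborel) = g x * ennreal (1 / real ?n)"
    proof eventually_elim
      case (elim x)
      define a where "a = norm (x - c)"
      have a: "a > 0" using elim by (simp add: a_def)
      have "(\<integral>\<^sup>+s. g x * ennreal (norm (x - c) ^ ?n * (1 / s ^ Suc ?n)) * indicator {0<..} s * indicator (ball c s) x \<partial>lborel) =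
        (\<integral>\<^sup>+s. (g x * ennreal (a ^ ?n)) * (ennreal (1 / s ^ Suc ?n) * indicator {a..} s) \<partial>lborel)"
      proof (rule nn_integral_cong_AE)
        have "AE s in lborel. s \<noteq> a" by (rule AE_lborel_singleton)
        then show "AE s in lborel. g x * ennreal (norm (x - c) ^ ?n * (1 / s ^ Suc ?n)) * indicator {0<..} s * indicator (ball c s) x =
          (g x * ennreal (a ^ ?n)) * (ennreal (1 / s ^ Suc ?n) * indicator {a..} s)"
        proof eventually_elim
          case (elim s)
          show ?case
          proof (cases "s > a")
            case True
            then have "x \<in> ball c s" by (simp add: a_def dist_norm norm_minus_commute)
            moreover have "s > 0" using True a by linarith
            moreover have "ennreal (norm (x - c) ^ ?n * (1 / s ^ Suc ?n)) = ennreal (a ^ ?n) * ennreal (1 / s ^ Suc ?n)"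
              unfolding a_def using \<open>s > 0\<close> by (intro ennreal_mult) auto
            ultimately show ?thesis using True by (simp add: mult_ac del: power_Suc)
          next
            case False
            then have "x \<notin> ball c s" "s \<notin> {a..}" using elim by (auto simp: a_def dist_norm norm_minus_commute)
            then show ?thesis by simp
          qed
        qed
      qed
      also have "\<dots> = g x * ennreal (a ^ ?n) * ennreal (1 / (real ?n * a ^ ?n))"
        by (subst nn_integral_cmult) (use nn_integral_inverse_power_tail[OF a n] in auto)
      also have "ennreal (a ^ ?n) * ennreal (1 / (real ?n * a ^ ?n)) = ennreal (1 / real ?n)"
        using a by (subst ennreal_mult[symmetric]) auto
      then have "g x * ennreal (a ^ ?n) * ennreal (1 / (real ?n * a ^ ?n)) = g x * ennreal (1 / real ?n)"
        by (simp only: mult.assoc)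
      finally show ?case .
    qed
  qed
  also have "\<dots> = (\<integral>\<^sup>+x. g x \<partial>lborel) * ennreal (1 / real ?n)" by (rule nn_integral_multc) auto
  finally have "of_nat ?n * (\<integral>\<^sup>+u\<in>B. (\<integral>\<^sup>+s\<in>{0<..}. g (c + (s / norm u) *\<^sub>R u) * ennreal (s ^ (?n - 1)) \<partial>lborel) \<partial>lborel) =
    (\<integral>\<^sup>+x. g x \<partial>lborel) * (ennreal (1 / real ?n) * of_nat ?n)" by (simp only: mult_ac)
  also have "ennreal (1 / real ?n) * of_nat ?n = 1"
    by (simp add: ennreal_of_nat_eq_real_of_nat ennreal_mult[symmetric])
  finally show ?thesis by (simp add: B_def)
qed

lemma nn_integral_polar_swapped:
  fixes g :: "'a::euclidean_space \<Rightarrow> ennreal"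
  assumes [measurable]: "g \<in> borel_measurable borel"
  shows "(\<integral>\<^sup>+x. g x \<partial>lborel) = of_nat DIM('a) *
    (\<integral>\<^sup>+s\<in>{0<..}. ennreal (s ^ (DIM('a) - 1)) * (\<integral>\<^sup>+u\<in>ball 0 1. g (c + (s / norm u) *\<^sub>R u) \<partial>lborel) \<partial>lborel)"
proof -
  define B :: "'a set" where "B = ball 0 1"
  have [measurable]: "B \<in> sets borel" by (simp add: B_def)
  have "(\<integral>\<^sup>+u\<in>B. (\<integral>\<^sup>+s\<in>{0<..}. g (c + (s / norm u) *\<^sub>R u) * ennreal (s ^ (DIM('a) - 1)) \<partial>lborel) \<partial>lborel) =
    (\<integral>\<^sup>+u. (\<integral>\<^sup>+s. g (c + (s / norm u) *\<^sub>R u) * ennreal (s ^ (DIM('a) - 1)) * indicator {0<..} s * indicator B u \<partial>lborel) \<partial>lborel)"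
    by (rule nn_integral_cong, rule nn_integral_multc[symmetric]) measurable
  also have "\<dots> = (\<integral>\<^sup>+s. (\<integral>\<^sup>+u. g (c + (s / norm u) *\<^sub>R u) * ennreal (s ^ (DIM('a) - 1)) * indicator {0<..} s * indicator B u \<partial>lborel) \<partial>lborel)"
    by (rule lborel_pair.Fubini'[symmetric]) measurable
  also have "\<dots> = (\<integral>\<^sup>+s\<in>{0<..}. ennreal (s ^ (DIM('a) - 1)) * (\<integral>\<^sup>+u\<in>B. g (c + (s / norm u) *\<^sub>R u) \<partial>lborel) \<partial>lborel)"
  proof (rule nn_integral_cong)
    fix s :: real
    have "(\<integral>\<^sup>+u. g (c + (s / norm u) *\<^sub>R u) * ennreal (s ^ (DIM('a) - 1)) * indicator {0<..} s * indicator B u \<partial>lborel) =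
      (\<integral>\<^sup>+u. (ennreal (s ^ (DIM('a) - 1)) * indicator {0<..} s) * (g (c + (s / norm u) *\<^sub>R u) * indicator B u) \<partial>lborel)"
      by (rule nn_integral_cong) (simp only: mult_ac)
    also have "\<dots> = (ennreal (s ^ (DIM('a) - 1)) * indicator {0<..} s) * (\<integral>\<^sup>+u\<in>B. g (c + (s / norm u) *\<^sub>R u) \<partial>lborel)"
      by (rule nn_integral_cmult) measurable
    finally show "(\<integral>\<^sup>+u. g (c + (s / norm u) *\<^sub>R u) * ennreal (s ^ (DIM('a) - 1)) * indicator {0<..} s * indicator B u \<partial>lborel) =
      ennreal (s ^ (DIM('a) - 1)) * (\<integral>\<^sup>+u\<in>B. g (c + (s / norm u) *\<^sub>R u) \<partial>lborel) * indicator {0<..} s"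
      by (simp only: mult_ac)
  qed
  finally show ?thesis by (simp add: nn_integral_polar[of g c] B_def)
qed

text \<open>Up to the factor \<open>n * r^(n-1)\<close> this is the surface integral over the sphere of
  radius \<open>r\<close>, since the direction of a uniformly distributed point of the ball is
  uniformly distributed on the sphere.\<close>

definition direction_integral :: "('a::euclidean_space \<Rightarrow> ennreal) \<Rightarrow> 'a \<Rightarrow> real \<Rightarrow> ennreal" where
  "direction_integral g c r = (\<integral>\<^sup>+u\<in>ball 0 1. g (c + (r / norm u) *\<^sub>R u) \<partial>lborel)"

lemma direction_integral_measurable[measurable]:
  fixes g :: "'a::euclidean_space \<Rightarrow> ennreal"
  assumes [measurable]: "g \<in> borel_measurable borel"
  shows "direction_integral g c \<in> borel_measurable borel"
proof -
  define B :: "'a set" where "B = ball 0 1"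
  have [measurable]: "B \<in> sets borel" by (simp add: B_def)
  have "(\<lambda>r. \<integral>\<^sup>+u\<in>B. g (c + (r / norm u) *\<^sub>R u) \<partial>lborel) \<in> borel_measurable borel" by measurable
  then show ?thesis unfolding direction_integral_def[abs_def] B_def .
qed

lemma nn_integral_sphere_measure:
  fixes g :: "'a::euclidean_space \<Rightarrow> ennreal"
  assumes [measurable]: "g \<in> borel_measurable borel" and r: "r > 0"
  shows "(\<integral>\<^sup>+x\<in>sphere b r. g x \<partial>sphere_measure b r) =
    ennreal (real DIM('a) * r ^ (DIM('a) - 1)) * direction_integral g b r"
proof -
  let ?n = "DIM('a)"
  let ?h = "\<lambda>x::'a. b + (r / dist x b) *\<^sub>R (x - b)"
  let ?B = "ball b r - {b}"
  have h: "?h \<in> borel_measurable borel" by measurable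
  then have hr: "?h \<in> measurable (restrict_space lborel ?B) borel"
    by (intro measurable_restrict_space1) simp
  have [measurable]: "sphere b r \<in> sets borel" "ball b r \<in> sets borel" "ball 0 1 \<in> sets (borel :: 'a measure)" by auto
  have "(\<integral>\<^sup>+x\<in>sphere b r. g x \<partial>sphere_measure b r) =
    ennreal (real ?n / r) * (\<integral>\<^sup>+x\<in>sphere b r. g x \<partial>distr (restrict_space lborel ?B) borel ?h)"
    unfolding sphere_measure_def nn_integral_completion by (rule nn_integral_scale_measure) measurable
  also have "(\<integral>\<^sup>+x\<in>sphere b r. g x \<partial>distr (restrict_space lborel ?B) borel ?h) =
    (\<integral>\<^sup>+x. g (?h x) * indicator (sphere b r) (?h x) \<partial>restrict_space lborel ?B)"
    by (rule nn_integral_distr[OF hr]) measurable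
  also have "\<dots> = (\<integral>\<^sup>+x\<in>?B. g (?h x) * indicator (sphere b r) (?h x) \<partial>lborel)"
    by (rule nn_integral_restrict_space) simp
  also have "\<dots> = (\<integral>\<^sup>+x\<in>ball b r. g (?h x) \<partial>lborel)"
  proof (rule nn_integral_cong_AE)
    have "AE x in lborel. x \<noteq> b" by (rule AE_lborel_singleton)
    then show "AE x in lborel. g (?h x) * indicator (sphere b r) (?h x) * indicator ?B x = g (?h x) * indicator (ball b r) x"
    proof eventually_elim
      case (elim x)
      then have "?h x \<in> sphere b r" using r by (simp add: dist_norm)
      then have "(indicator (sphere b r) (?h x) :: ennreal) = 1" by simp
      moreover have "(indicator ?B x :: ennreal) = indicator (ball b r) x" using elim by (simp add: indicator_def)
      ultimately show ?case by simp
    qed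
  qed
  also have "\<dots> = ennreal (\<bar>r\<bar> ^ ?n) * (\<integral>\<^sup>+u. g (?h (b + r *\<^sub>R u)) * indicator (ball b r) (b + r *\<^sub>R u) \<partial>lborel)"
    using r by (intro nn_integral_affine) auto
  also have "(\<integral>\<^sup>+u. g (?h (b + r *\<^sub>R u)) * indicator (ball b r) (b + r *\<^sub>R u) \<partial>lborel) = direction_integral g b r"
    unfolding direction_integral_def
  proof (rule nn_integral_cong)
    fix u :: 'a
    have i1: "(indicator (ball b r) (b + r *\<^sub>R u) :: ennreal) = indicator (ball 0 1) u"
      using r by (simp add: indicator_def dist_norm)
    have i2: "?h (b + r *\<^sub>R u) = b + (r / norm u) *\<^sub>R u" using r by (simp add: dist_norm)
    show "g (?h (b + r *\<^sub>R u)) * indicator (ball b r) (b + r *\<^sub>R u) = g (b + (r / norm u) *\<^sub>R u) * indicator (ball 0 1) u"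
      unfolding i1 i2 ..
  qed
  also have "ennreal (real ?n / r) * (ennreal (\<bar>r\<bar> ^ ?n) * direction_integral g b r) =
    ennreal (real ?n * r ^ (?n - 1)) * direction_integral g b r"
  proof -
    have "r ^ ?n = r * r ^ (?n - 1)" by (metis DIM_positive power_minus_mult mult.commute)
    then have "real ?n / r * \<bar>r\<bar> ^ ?n = real ?n * r ^ (?n - 1)" using r by simp
    then show ?thesis using r by (simp add: mult.assoc[symmetric] ennreal_mult[symmetric])
  qed
  finally show ?thesis .
qed

lemma borel_sphere_measure: "sets borel \<subseteq> sets (sphere_measure b r)"
  unfolding sphere_measure_def by (rule subsetI, rule sets_completionI_sets) simp

text \<open>Polar coordinates for the indicator of \<open>N\<close>: almost every sphere meets a null set in
  a set of surface measure zero.\<close>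

lemma null_set_direction_integral:
  fixes N :: "'a::euclidean_space set"
  assumes N: "N \<in> null_sets lborel"
  shows "AE r in lborel. 0 < r \<longrightarrow> direction_integral (indicator N) b r = 0"
proof -
  have [measurable]: "N \<in> sets borel" using N by auto
  have [measurable]: "direction_integral (indicator N) b \<in> borel_measurable borel" by measurable
  have "0 = (\<integral>\<^sup>+x. indicator N x \<partial>lborel)" using N by auto
  also have "\<dots> = of_nat DIM('a) * (\<integral>\<^sup>+s\<in>{0<..}. ennreal (s ^ (DIM('a) - 1)) * direction_integral (indicator N) b s \<partial>lborel)"
    unfolding direction_integral_def by (rule nn_integral_polar_swapped) measurable
  finally have "(\<integral>\<^sup>+s\<in>{0<..}. ennreal (s ^ (DIM('a) - 1)) * direction_integral (indicator N) b s \<partial>lborel) = 0"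
    by (simp add: mult_eq_0_iff)
  then have "AE s in lborel. ennreal (s ^ (DIM('a) - 1)) * direction_integral (indicator N) b s * indicator {0<..} s = 0"
    by (subst (asm) nn_integral_0_iff_AE) auto
  then show ?thesis
    by eventually_elim (auto simp: indicator_def)
qed

text \<open>A merely Lebesgue measurable \<open>Q\<close> is replaced by a Borel function that agrees with
  it on the sphere up to surface measure zero.\<close>

lemma spherical_mean_eq:
  fixes Q Q' :: "'a::euclidean_space \<Rightarrow> ennreal"
  assumes [measurable]: "Q' \<in> borel_measurable borel" and r: "r > 0"
    and N: "N \<in> sets borel" "direction_integral (indicator N) b r = 0"
    and eq: "\<And>x. x \<in> sphere b r \<Longrightarrow> x \<notin> N \<Longrightarrow> Q x = Q' x"
  shows "spherical_mean Q b r = direction_integral Q' b r / ennreal (unit_ball_vol (real DIM('a)))"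
proof -
  let ?n = "DIM('a)"
  define \<Omega> where "\<Omega> = unit_ball_vol (real ?n)"
  have \<Omega>: "\<Omega> > 0" unfolding \<Omega>_def by simp
  note N(1)[measurable]
  have "(\<integral>\<^sup>+x\<in>sphere b r. indicator N x \<partial>sphere_measure b r) = 0"
    by (subst nn_integral_sphere_measure[OF _ r]) (auto simp: N(2))
  moreover have "(\<lambda>x. indicator N x * indicator (sphere b r) x :: ennreal) \<in> borel_measurable (sphere_measure b r)"
    by (intro borel_measurable_times_ennreal borel_measurable_indicator subsetD[OF borel_sphere_measure]) (use N in auto)
  ultimately have "AE x in sphere_measure b r. indicator N x * indicator (sphere b r) x = (0::ennreal)"
    using nn_integral_0_iff_AE by blast
  then have "AE x in sphere_measure b r. Q x * indicator (sphere b r) x = Q' x * indicator (sphere b r) x"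
    by eventually_elim (use eq in \<open>auto simp: indicator_def split: if_splits\<close>)
  then have "(\<integral>\<^sup>+x\<in>sphere b r. Q x \<partial>sphere_measure b r) = (\<integral>\<^sup>+x\<in>sphere b r. Q' x \<partial>sphere_measure b r)"
    by (rule nn_integral_cong_AE)
  also have "\<dots> = ennreal (real ?n * r ^ (?n - 1)) * direction_integral Q' b r"
    by (rule nn_integral_sphere_measure[OF _ r]) measurable
  finally have num: "(\<integral>\<^sup>+x\<in>sphere b r. Q x \<partial>sphere_measure b r) = ennreal (real ?n * r ^ (?n - 1)) * direction_integral Q' b r" .
  have "emeasure (sphere_measure (0::'a) 1) (sphere 0 1) * ennreal (r ^ (?n - 1)) = ennreal (real ?n * r ^ (?n - 1)) * ennreal \<Omega>"
    using r \<Omega> by (simp add: emeasure_sphere_measure_sphere \<Omega>_def[symmetric] ennreal_mult[symmetric] mult_ac)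
  then have "spherical_mean Q b r = (ennreal (real ?n * r ^ (?n - 1)) * direction_integral Q' b r) / (ennreal (real ?n * r ^ (?n - 1)) * ennreal \<Omega>)"
    unfolding spherical_mean_def num by simp
  also have "\<dots> = direction_integral Q' b r / ennreal \<Omega>"
  proof -
    define k where "k = real ?n * r ^ (?n - 1)"
    have k: "k > 0" using r by (simp add: k_def)
    have "ennreal k * inverse (ennreal (k * \<Omega>)) = inverse (ennreal \<Omega>)"
      using k \<Omega> by (simp add: inverse_ennreal ennreal_mult[symmetric])
    then show ?thesis unfolding k_def[symmetric] divide_ennreal_def
      using k \<Omega> by (metis (no_types, lifting) ennreal_mult less_imp_le mult.assoc mult.commute)
  qed
  finally show ?thesis by (simp add: \<Omega>_def)
qed

section \<open>Upper bounds for the modulus of a ring\<close>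

abbreviation ring_image_family :: "('a::euclidean_space \<Rightarrow> 'a) \<Rightarrow> 'a \<Rightarrow> real \<Rightarrow> real \<Rightarrow> 'a curve set" where
  "ring_image_family f b r s \<equiv>
     image_curves f (joining_curves (sphere b r) (sphere b s) (spherical_ring b r s))"

lemma borel_version:
  fixes Q :: "'a::euclidean_space \<Rightarrow> ennreal"
  assumes D: "open D" and Q: "Q \<in> borel_measurable (lebesgue_on D)" and pos: "\<And>x. x \<in> D \<Longrightarrow> Q x > 0"
  obtains Q' N where "Q' \<in> borel_measurable borel" "N \<in> null_sets lborel"
    "\<And>x. x \<in> D \<Longrightarrow> x \<notin> N \<Longrightarrow> Q x = Q' x" "\<And>x. x \<in> D \<Longrightarrow> x \<notin> N \<Longrightarrow> Q' x > 0"
proof -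
  have "(\<lambda>x. if x \<in> D then Q x else 0) \<in> borel_measurable lebesgue"
    using Q D by (subst measurable_restrict_space_iff[symmetric]) (auto intro: lmeasurable_open)
  from completion_ex_borel_measurable[OF this]
  obtain Q' where Q': "Q' \<in> borel_measurable lborel" "AE x in lborel. (if x \<in> D then Q x else 0) = Q' x" by blast
  obtain N where N: "{x \<in> space lborel. \<not> (if x \<in> D then Q x else 0) = Q' x} \<subseteq> N" "emeasure lborel N = 0" "N \<in> sets lborel"
    using AE_E[OF Q'(2)] by blast
  have e: "Q x = Q' x" if "x \<in> D" "x \<notin> N" for x
  proof (rule ccontr)
    assume "Q x \<noteq> Q' x"
    then have "x \<in> {x \<in> space lborel. \<not> (if x \<in> D then Q x else 0) = Q' x}" using that by simp
    then show False using N(1) that by blast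
  qed
  have "Q' x > 0" if "x \<in> D" "x \<notin> N" for x using e[OF that] pos[OF that(1)] by simp
  moreover have "N \<in> null_sets lborel" using N(2,3) by blast
  moreover have "Q' \<in> borel_measurable borel" using Q'(1) by simp
  ultimately show ?thesis using e that by blast
qed

text \<open>The integrand of the radial integral, for a spherical mean \<open>q\<close>.\<close>

definition radial_density :: "nat \<Rightarrow> (real \<Rightarrow> ennreal) \<Rightarrow> real \<Rightarrow> ennreal" where
  "radial_density n q t = 1 / (ennreal t * ennreal_powr (q t) (1 / real (n - 1)))"

lemma radial_density_measurable[measurable]:
  assumes [measurable]: "q \<in> borel_measurable borel"
  shows "radial_density n q \<in> borel_measurable borel"
proof -
  have "(\<lambda>x. ennreal_powr x (1 / real (n - 1))) \<in> borel_measurable borel"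
    unfolding ennreal_powr_def by measurable
  then have [measurable]: "(\<lambda>t. ennreal_powr (q t) (1 / real (n - 1))) \<in> borel_measurable borel"
    using assms by (rule measurable_compose[rotated])
  show ?thesis unfolding radial_density_def[abs_def] by measurable
qed

text \<open>The exponent \<open>1 / (n - 1)\<close> is chosen for this identity: the weighted
  \<open>n\<close>-th power in the energy is the density itself.\<close>

lemma radial_density_power:
  assumes n: "n \<ge> 2" and s: "s > 0" and q: "0 < q s" "q s < top"
  shows "ennreal (s ^ (n - 1)) * (q s * radial_density n q s ^ n) = radial_density n q s"
    and "radial_density n q s < top"
proof -
  obtain x where x: "q s = ennreal x" "x > 0" using q by (cases "q s") auto
  define y where "y = x powr (1 / real (n - 1))"
  have y: "y > 0" using x by (simp add: y_def)
  have yn: "y ^ (n - 1) = x"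
  proof -
    have "y ^ (n - 1) = y powr real (n - 1)" using y by (intro powr_realpow[symmetric])
    also have "\<dots> = x powr (1 / real (n - 1) * real (n - 1))" unfolding y_def by (rule powr_powr)
    also have "\<dots> = x" using n x by simp
    finally show ?thesis .
  qed
  have d: "radial_density n q s = ennreal (1 / (s * y))"
    using x y s by (simp add: radial_density_def ennreal_powr_def y_def ennreal_mult[symmetric] divide_ennreal flip: ennreal_1)
  show "radial_density n q s < top" by (simp add: d)
  have "s ^ (n - 1) * (x * (1 / (s * y)) ^ n) = 1 / (s * y)"
  proof -
    have "(s * y) ^ n = (s * y) * (s ^ (n - 1) * y ^ (n - 1))"
      using n by (metis power_minus_mult mult.commute power_mult_distrib zero_less_numeral less_le_trans)
    then show ?thesis using s y x yn by (simp add: power_one_over field_simps)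
  qed
  then show "ennreal (s ^ (n - 1)) * (q s * radial_density n q s ^ n) = radial_density n q s"
    using s x y unfolding d x(1) by (simp add: ennreal_mult[symmetric] ennreal_power)
qed

lemma ring_nn_integral_radial:
  fixes Q' :: "'a::euclidean_space \<Rightarrow> ennreal"
  assumes [measurable]: "Q' \<in> borel_measurable borel" "\<eta> \<in> borel_measurable borel" and r: "0 < r1"
  shows "(\<integral>\<^sup>+x\<in>spherical_ring b r1 r2. Q' x * \<eta> (dist x b) ^ DIM('a) \<partial>lborel) =
    of_nat DIM('a) * (\<integral>\<^sup>+s\<in>{r1<..<r2}. ennreal (s ^ (DIM('a) - 1)) * (direction_integral Q' b s * \<eta> s ^ DIM('a)) \<partial>lborel)"
proof -
  let ?n = "DIM('a)"
  have [measurable]: "spherical_ring b r1 r2 \<in> sets borel" unfolding spherical_ring_def by measurable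
  have [measurable]: "ball (0::'a) 1 \<in> sets borel" by simp
  have "(\<integral>\<^sup>+x\<in>spherical_ring b r1 r2. Q' x * \<eta> (dist x b) ^ ?n \<partial>lborel) = of_nat ?n *
    (\<integral>\<^sup>+s\<in>{0<..}. ennreal (s ^ (?n - 1)) * (\<integral>\<^sup>+u\<in>ball 0 1. Q' (b + (s / norm u) *\<^sub>R u) * \<eta> (dist (b + (s / norm u) *\<^sub>R u) b) ^ ?n *
       indicator (spherical_ring b r1 r2) (b + (s / norm u) *\<^sub>R u) \<partial>lborel) \<partial>lborel)"
    by (rule nn_integral_polar_swapped) measurable
  also have "(\<integral>\<^sup>+s\<in>{0<..}. ennreal (s ^ (?n - 1)) * (\<integral>\<^sup>+u\<in>ball 0 1. Q' (b + (s / norm u) *\<^sub>R u) * \<eta> (dist (b + (s / norm u) *\<^sub>R u) b) ^ ?n *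
       indicator (spherical_ring b r1 r2) (b + (s / norm u) *\<^sub>R u) \<partial>lborel) \<partial>lborel) =
    (\<integral>\<^sup>+s\<in>{r1<..<r2}. ennreal (s ^ (?n - 1)) * (direction_integral Q' b s * \<eta> s ^ ?n) \<partial>lborel)"
  proof (rule nn_integral_cong)
    fix s :: real
    show "ennreal (s ^ (?n - 1)) * (\<integral>\<^sup>+u\<in>ball 0 1. Q' (b + (s / norm u) *\<^sub>R u) * \<eta> (dist (b + (s / norm u) *\<^sub>R u) b) ^ ?n *
       indicator (spherical_ring b r1 r2) (b + (s / norm u) *\<^sub>R u) \<partial>lborel) * indicator {0<..} s =
      ennreal (s ^ (?n - 1)) * (direction_integral Q' b s * \<eta> s ^ ?n) * indicator {r1<..<r2} s"
    proof (cases "s > 0")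
      case True
      have "(\<integral>\<^sup>+u\<in>ball 0 1. Q' (b + (s / norm u) *\<^sub>R u) * \<eta> (dist (b + (s / norm u) *\<^sub>R u) b) ^ ?n *
         indicator (spherical_ring b r1 r2) (b + (s / norm u) *\<^sub>R u) \<partial>lborel) =
        (\<integral>\<^sup>+u. (\<eta> s ^ ?n * indicator {r1<..<r2} s) * (Q' (b + (s / norm u) *\<^sub>R u) * indicator (ball 0 1) u) \<partial>lborel)"
      proof (rule nn_integral_cong_AE)
        have "AE u in lborel. u \<noteq> (0::'a)" by (rule AE_lborel_singleton)
        then show "AE u in lborel. Q' (b + (s / norm u) *\<^sub>R u) * \<eta> (dist (b + (s / norm u) *\<^sub>R u) b) ^ ?n *
           indicator (spherical_ring b r1 r2) (b + (s / norm u) *\<^sub>R u) * indicator (ball 0 1) u =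
          (\<eta> s ^ ?n * indicator {r1<..<r2} s) * (Q' (b + (s / norm u) *\<^sub>R u) * indicator (ball 0 1) u)"
        proof eventually_elim
          case (elim u)
          have d: "dist (b + (s / norm u) *\<^sub>R u) b = s" using elim True by (simp add: dist_norm)
          have i: "(indicator (spherical_ring b r1 r2) (b + (s / norm u) *\<^sub>R u) :: ennreal) = indicator {r1<..<r2} s"
            unfolding indicator_def spherical_ring_def mem_Collect_eq d by simp
          show ?case unfolding d i by (simp only: mult_ac)
        qed
      qed
      also have "\<dots> = (\<eta> s ^ ?n * indicator {r1<..<r2} s) * direction_integral Q' b s"
        unfolding direction_integral_def by (rule nn_integral_cmult) measurable
      finally show ?thesis using True by (simp add: mult_ac)
    next
      case False
      then show ?thesis using r by simp
    qed
  qed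
  finally show ?thesis .
qed

lemma direction_integral_pos:
  fixes Q' :: "'a::euclidean_space \<Rightarrow> ennreal"
  assumes [measurable]: "Q' \<in> borel_measurable borel" "N \<in> sets borel"
    and N: "direction_integral (indicator N) b r = 0" and r: "r > 0"
    and pos: "\<And>x. dist x b = r \<Longrightarrow> x \<notin> N \<Longrightarrow> Q' x > 0"
  shows "direction_integral Q' b r > 0"
proof (rule ccontr)
  assume "\<not> ?thesis"
  then have z: "direction_integral Q' b r = 0" by (simp add: zero_less_iff_neq_zero)
  have [measurable]: "ball (0::'a) 1 \<in> sets borel" by simp
  have "AE u in lborel. Q' (b + (r / norm u) *\<^sub>R u) * indicator (ball 0 1) u = 0"
    using z unfolding direction_integral_def by (subst (asm) nn_integral_0_iff_AE) auto
  moreover have "AE u in lborel. indicator N (b + (r / norm u) *\<^sub>R u) * indicator (ball 0 1) u = (0::ennreal)"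
    using N unfolding direction_integral_def by (subst (asm) nn_integral_0_iff_AE) auto
  moreover have "AE u in lborel. u \<noteq> (0::'a)" by (rule AE_lborel_singleton)
  ultimately have "AE u in lborel. u \<notin> ball (0::'a) 1"
  proof eventually_elim
    case (elim u)
    show ?case
    proof
      assume u: "u \<in> ball 0 1"
      then have "b + (r / norm u) *\<^sub>R u \<notin> N" "Q' (b + (r / norm u) *\<^sub>R u) = 0"
        using elim by (auto simp: indicator_def split: if_splits)
      moreover have "dist (b + (r / norm u) *\<^sub>R u) b = r" using elim r by (simp add: dist_norm)
      ultimately show False using pos[of "b + (r / norm u) *\<^sub>R u"] by simp
    qed
  qed
  then have "emeasure lborel (ball (0::'a) 1) = 0"
    by (subst (asm) AE_iff_measurable[of "ball 0 1"]) auto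
  moreover have "emeasure lborel (ball (0::'a) 1) = ennreal (unit_ball_vol (real DIM('a)) * 1 ^ DIM('a))"
    by (rule emeasure_ball) simp
  moreover have "unit_ball_vol (real DIM('a)) > 0" by simp
  ultimately show False by (simp add: ennreal_eq_0_iff)
qed

text \<open>The test function is the radial density on \<open>E\<close>, divided by its integral
  \<open>j\<close>. By \<open>radial_density_power\<close> its energy is
  \<open>\<omega> * j / j^n\<close>. The set \<open>E\<close> cuts the density down to where its
  integral is finite.\<close>

lemma modulus_le_of_density_piece:
  fixes f :: "'a::euclidean_space \<Rightarrow> 'a"
  assumes ring: "ring_Q_mapping D Q b f" and r: "0 < r1" "r1 < r2" "ereal r2 < boundary_dist b D"
    and Q': "Q' \<in> borel_measurable borel" and N: "N \<in> null_sets lborel"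
    and eq: "\<And>x. x \<in> spherical_ring b r1 r2 \<Longrightarrow> x \<notin> N \<Longrightarrow> Q x = Q' x"
    and n: "DIM('a) \<ge> 2"
  defines "q \<equiv> \<lambda>t. direction_integral Q' b t / ennreal (unit_ball_vol (real DIM('a)))"
  assumes E: "E \<in> sets borel" "E \<subseteq> {r1<..<r2}" and qE: "AE t in lborel. t \<in> E \<longrightarrow> 0 < q t \<and> q t < top"
    and J: "(\<integral>\<^sup>+t\<in>E. radial_density DIM('a) q t \<partial>lborel) = ennreal j" "j > 0"
  shows "modulus (ring_image_family f b r1 r2) \<le> ennreal (real DIM('a) * unit_ball_vol (real DIM('a)) / j ^ (DIM('a) - 1))"
proof -
  let ?n = "DIM('a)"
  define \<Omega> where "\<Omega> = unit_ball_vol (real ?n)"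
  have \<Omega>: "\<Omega> > 0" unfolding \<Omega>_def by simp
  note Q'[measurable] E(1)[measurable]
  have q[measurable]: "q \<in> borel_measurable borel" unfolding q_def by measurable
  define \<psi> where "\<psi> = radial_density ?n q"
  have [measurable]: "\<psi> \<in> borel_measurable borel" unfolding \<psi>_def by measurable
  define \<eta> where "\<eta> = (\<lambda>t. ennreal (1 / j) * (\<psi> t * indicator E t))"
  have \<eta>[measurable]: "\<eta> \<in> borel_measurable borel" unfolding \<eta>_def by measurable
  have J': "(\<integral>\<^sup>+t. \<psi> t * indicator E t \<partial>lborel) = ennreal j" using J(1) by (simp add: \<psi>_def)
  have "(\<integral>\<^sup>+t\<in>{r1<..<r2}. \<eta> t \<partial>lebesgue) = (\<integral>\<^sup>+t\<in>{r1<..<r2}. \<eta> t \<partial>lborel)" by (rule nn_integral_completion)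
  also have "\<dots> = (\<integral>\<^sup>+t. ennreal (1 / j) * (\<psi> t * indicator E t) \<partial>lborel)"
    using E(2) by (intro nn_integral_cong) (auto simp: \<eta>_def indicator_def)
  also have "\<dots> = ennreal (1 / j) * (\<integral>\<^sup>+t. \<psi> t * indicator E t \<partial>lborel)"
    by (rule nn_integral_cmult) measurable
  also have "\<dots> = 1" unfolding J' using J(2) by (simp add: ennreal_mult[symmetric])
  finally have one: "(\<integral>\<^sup>+t\<in>{r1<..<r2}. \<eta> t \<partial>lebesgue) \<ge> 1" by simp
  have "\<eta> \<in> borel_measurable lebesgue" using \<eta> by (intro measurable_completion) simp
  then have \<eta>l: "\<eta> \<in> borel_measurable (lebesgue_on {r1<..<r2})" by (rule measurable_restrict_space1)
  have "modulus (ring_image_family f b r1 r2) \<le> (\<integral>\<^sup>+x\<in>spherical_ring b r1 r2. Q x * \<eta> (dist x b) ^ ?n \<partial>lebesgue)"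
    using ring r one \<eta>l unfolding ring_Q_mapping_def by blast
  also have "\<dots> = (\<integral>\<^sup>+x\<in>spherical_ring b r1 r2. Q x * \<eta> (dist x b) ^ ?n \<partial>lborel)" by (rule nn_integral_completion)
  also have "\<dots> = (\<integral>\<^sup>+x\<in>spherical_ring b r1 r2. Q' x * \<eta> (dist x b) ^ ?n \<partial>lborel)"
  proof (rule nn_integral_cong_AE)
    have "AE x in lborel. x \<notin> N" using N by (rule AE_not_in)
    then show "AE x in lborel. Q x * \<eta> (dist x b) ^ ?n * indicator (spherical_ring b r1 r2) x =
       Q' x * \<eta> (dist x b) ^ ?n * indicator (spherical_ring b r1 r2) x"
      by eventually_elim (auto simp: indicator_def eq)
  qed
  also have "\<dots> = of_nat ?n * (\<integral>\<^sup>+s\<in>{r1<..<r2}. ennreal (s ^ (?n - 1)) * (direction_integral Q' b s * \<eta> s ^ ?n) \<partial>lborel)"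
    by (rule ring_nn_integral_radial[OF Q' \<eta> r(1)])
  also have "(\<integral>\<^sup>+s\<in>{r1<..<r2}. ennreal (s ^ (?n - 1)) * (direction_integral Q' b s * \<eta> s ^ ?n) \<partial>lborel) =
    (\<integral>\<^sup>+s. ennreal (\<Omega> / j ^ ?n) * (\<psi> s * indicator E s) \<partial>lborel)"
  proof (rule nn_integral_cong_AE)
    show "AE s in lborel. ennreal (s ^ (?n - 1)) * (direction_integral Q' b s * \<eta> s ^ ?n) * indicator {r1<..<r2} s =
      ennreal (\<Omega> / j ^ ?n) * (\<psi> s * indicator E s)"
      using qE
    proof eventually_elim
      case (elim s)
      show ?case
      proof (cases "s \<in> E")
        case False
        then have "\<eta> s = 0" by (simp add: \<eta>_def)
        then show ?thesis using False by (simp add: zero_power)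
      next
        case True
        then have s: "s \<in> {r1<..<r2}" "s > 0" using E(2) r by auto
        have dq: "direction_integral Q' b s = ennreal \<Omega> * q s"
          using \<Omega> unfolding q_def \<Omega>_def[symmetric]
          by (simp add: ennreal_times_divide mult.commute[of "ennreal \<Omega>"] mult_divide_eq_ennreal)
        have "ennreal (1 / j) ^ ?n = ennreal (1 / j ^ ?n)" using J(2) by (simp add: ennreal_power power_one_over)
        then have en: "\<eta> s ^ ?n = ennreal (1 / j ^ ?n) * \<psi> s ^ ?n"
          using True by (simp add: \<eta>_def power_mult_distrib)
        have "ennreal (s ^ (?n - 1)) * (direction_integral Q' b s * \<eta> s ^ ?n) =
          (ennreal \<Omega> * ennreal (1 / j ^ ?n)) * (ennreal (s ^ (?n - 1)) * (q s * \<psi> s ^ ?n))"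
          unfolding dq en by (simp only: mult_ac)
        also have "ennreal (s ^ (?n - 1)) * (q s * \<psi> s ^ ?n) = \<psi> s"
          unfolding \<psi>_def using elim True s by (intro radial_density_power n) auto
        also have "ennreal \<Omega> * ennreal (1 / j ^ ?n) = ennreal (\<Omega> / j ^ ?n)"
          using \<Omega> J(2) by (subst ennreal_mult[symmetric]) auto
        finally show ?thesis using True s by simp
      qed
    qed
  qed
  also have "\<dots> = ennreal (\<Omega> / j ^ ?n) * ennreal j"
    unfolding J'[symmetric] by (rule nn_integral_cmult) measurable
  also have "of_nat ?n * (ennreal (\<Omega> / j ^ ?n) * ennreal j) = ennreal (real ?n * \<Omega> / j ^ (?n - 1))"
  proof -
    have "j ^ ?n = j * j ^ (?n - 1)" by (metis DIM_positive power_minus_mult mult.commute)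
    then have "real ?n * (\<Omega> / j ^ ?n * j) = real ?n * \<Omega> / j ^ (?n - 1)" using J(2) by simp
    then show ?thesis using \<Omega> J(2) by (simp add: ennreal_of_nat_eq_real_of_nat ennreal_mult[symmetric])
  qed
  finally show ?thesis by (simp add: \<Omega>_def)
qed

lemma AE_spherical_mean:
  fixes Q :: "'a::euclidean_space \<Rightarrow> ennreal"
  assumes D: "open D" and Q: "Q \<in> borel_measurable (lebesgue_on D)" and pos: "\<And>x. x \<in> D \<Longrightarrow> Q x > 0"
    and ball: "cball b R \<subseteq> D"
  obtains Q' N where "Q' \<in> borel_measurable borel" "N \<in> null_sets lborel"
    "\<And>x. x \<in> D \<Longrightarrow> x \<notin> N \<Longrightarrow> Q x = Q' x"
    "AE t in lborel. 0 < t \<and> t < R \<longrightarrow> spherical_mean Q b t = direction_integral Q' b t / ennreal (unit_ball_vol (real DIM('a)))"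
    "AE t in lborel. 0 < t \<and> t < R \<longrightarrow> 0 < direction_integral Q' b t / ennreal (unit_ball_vol (real DIM('a)))"
proof -
  obtain Q' N where Q': "Q' \<in> borel_measurable borel" and N: "N \<in> null_sets lborel"
    and eq: "\<And>x. x \<in> D \<Longrightarrow> x \<notin> N \<Longrightarrow> Q x = Q' x" and pos': "\<And>x. x \<in> D \<Longrightarrow> x \<notin> N \<Longrightarrow> Q' x > 0"
    using borel_version[OF D Q pos] by metis
  have Nb: "N \<in> sets borel" using N by auto
  have sub: "x \<in> D" if "dist x b = t" "t < R" for x t
    using that ball by (auto simp: dist_commute subset_iff)
  have ae: "AE t in lborel. 0 < t \<longrightarrow> direction_integral (indicator N) b t = 0"
    by (rule null_set_direction_integral[OF N])
  have "AE t in lborel. 0 < t \<and> t < R \<longrightarrow> spherical_mean Q b t = direction_integral Q' b t / ennreal (unit_ball_vol (real DIM('a)))"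
    using ae
  proof eventually_elim
    case (elim t)
    show ?case
    proof
      assume t: "0 < t \<and> t < R"
      show "spherical_mean Q b t = direction_integral Q' b t / ennreal (unit_ball_vol (real DIM('a)))"
      proof (rule spherical_mean_eq[OF Q' _ Nb])
        show "Q x = Q' x" if "x \<in> sphere b t" "x \<notin> N" for x
          using eq[OF sub[of x t]] that t by (simp add: dist_commute)
      qed (use t elim in auto)
    qed
  qed
  moreover have "AE t in lborel. 0 < t \<and> t < R \<longrightarrow> 0 < direction_integral Q' b t / ennreal (unit_ball_vol (real DIM('a)))"
    using ae
  proof eventually_elim
    case (elim t)
    show ?case
    proof
      assume t: "0 < t \<and> t < R"
      have "0 < direction_integral Q' b t"
      proof (rule direction_integral_pos[OF Q' Nb])
        show "Q' x > 0" if "dist x b = t" "x \<notin> N" for x using pos'[OF sub[OF that(1)] that(2)] t by blast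
      qed (use t elim in auto)
      then show "0 < direction_integral Q' b t / ennreal (unit_ball_vol (real DIM('a)))"
        by (simp add: ennreal_zero_less_divide)
    qed
  qed
  ultimately show ?thesis using Q' N eq by (intro that[of Q' N])
qed

text \<open>If the radial integral is infinite, then the sets where the density is at most \<open>m\<close>
  give pieces with finite and arbitrarily large integrals.\<close>

lemma modulus_ring_bounds:
  fixes f :: "'a::euclidean_space \<Rightarrow> 'a"
  assumes n: "DIM('a) \<ge> 2" and ring: "ring_Q_mapping D Q b f"
    and D: "open D" and Q: "Q \<in> borel_measurable (lebesgue_on D)" and pos: "\<And>x. x \<in> D \<Longrightarrow> Q x > 0"
    and ball: "cball b R \<subseteq> D" and R: "ereal R < boundary_dist b D"
    and fin: "AE t in lebesgue. t \<in> {0<..<R} \<longrightarrow> spherical_mean Q b t < \<infinity>"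
    and r: "0 < r1" "r1 < r2" "r2 \<le> R"
  shows "\<And>j. j > 0 \<Longrightarrow> radial_integral Q b r1 r2 = ennreal j \<Longrightarrow>
      modulus (ring_image_family f b r1 r2) \<le> ennreal (real DIM('a) * unit_ball_vol (real DIM('a)) / j ^ (DIM('a) - 1))"
    and "radial_integral Q b r1 r2 = top \<Longrightarrow> modulus (ring_image_family f b r1 r2) = 0"
proof -
  let ?n = "DIM('a)"
  define \<omega> where "\<omega> = real ?n * unit_ball_vol (real ?n)"
  have \<omega>: "\<omega> > 0" by (simp add: \<omega>_def)
  obtain Q' N where Q': "Q' \<in> borel_measurable borel" and N: "N \<in> null_sets lborel"
    and eq: "\<And>x. x \<in> D \<Longrightarrow> x \<notin> N \<Longrightarrow> Q x = Q' x"
    and mean: "AE t in lborel. 0 < t \<and> t < R \<longrightarrow> spherical_mean Q b t = direction_integral Q' b t / ennreal (unit_ball_vol (real ?n))"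
    and mpos: "AE t in lborel. 0 < t \<and> t < R \<longrightarrow> 0 < direction_integral Q' b t / ennreal (unit_ball_vol (real ?n))"
    by (rule AE_spherical_mean[OF D Q pos ball], assumption, rule that, assumption+)
  define q where "q = (\<lambda>t. direction_integral Q' b t / ennreal (unit_ball_vol (real ?n)))"
  have [measurable]: "q \<in> borel_measurable borel" unfolding q_def using Q' by measurable
  define \<psi> where "\<psi> = radial_density ?n q"
  have [measurable]: "\<psi> \<in> borel_measurable borel" unfolding \<psi>_def by measurable
  have fin': "AE t in lborel. t \<in> {0<..<R} \<longrightarrow> spherical_mean Q b t < \<infinity>"
    using fin by (simp add: AE_completion_iff)
  have q0: "AE t in lborel. t \<in> {r1<..<r2} \<longrightarrow> 0 < q t \<and> q t < top"
    using mean mpos fin'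
  proof eventually_elim
    case (elim t)
    show ?case
    proof
      assume "t \<in> {r1<..<r2}"
      then have "0 < t" "t < R" using r by auto
      then show "0 < q t \<and> q t < top" using elim by (auto simp: q_def)
    qed
  qed
  have rad: "radial_integral Q b r1 r2 = (\<integral>\<^sup>+t\<in>{r1<..<r2}. \<psi> t \<partial>lborel)"
    unfolding radial_integral_def nn_integral_completion
  proof (rule nn_integral_cong_AE)
    show "AE t in lborel. 1 / (ennreal t * ennreal_powr (spherical_mean Q b t) (1 / real (?n - 1))) * indicator {r1<..<r2} t
      = \<psi> t * indicator {r1<..<r2} t"
      using mean
    proof eventually_elim
      case (elim t)
      show ?case
      proof (cases "t \<in> {r1<..<r2}")
        case True
        then have "spherical_mean Q b t = q t" using elim r by (simp add: q_def)
        then show ?thesis by (simp add: \<psi>_def radial_density_def)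
      qed simp
    qed
  qed
  have R2: "ereal r2 < boundary_dist b D" using r(3) R by (metis ereal_less_eq(3) le_less_trans)
  have eq': "Q x = Q' x" if "x \<in> spherical_ring b r1 r2" "x \<notin> N" for x
  proof -
    have "x \<in> cball b R" using that(1) r by (simp add: spherical_ring_def dist_commute)
    then show ?thesis using eq ball that(2) by blast
  qed
  have piece: "modulus (ring_image_family f b r1 r2) \<le> ennreal (\<omega> / j ^ (?n - 1))"
    if E: "E \<in> sets borel" "E \<subseteq> {r1<..<r2}" and J: "(\<integral>\<^sup>+t\<in>E. \<psi> t \<partial>lborel) = ennreal j" "j > 0" for E j
    unfolding \<omega>_def
  proof (rule modulus_le_of_density_piece[OF ring r(1,2) R2 Q' N _ n E])
    show "Q x = Q' x" if "x \<in> spherical_ring b r1 r2" "x \<notin> N" for x using eq' that .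
    show "AE t in lborel. t \<in> E \<longrightarrow> 0 < direction_integral Q' b t / ennreal (unit_ball_vol (real ?n)) \<and>
       direction_integral Q' b t / ennreal (unit_ball_vol (real ?n)) < top"
      using q0 by eventually_elim (use E(2) in \<open>auto simp: q_def\<close>)
    show "(\<integral>\<^sup>+t\<in>E. radial_density ?n (\<lambda>t. direction_integral Q' b t / ennreal (unit_ball_vol (real ?n))) t \<partial>lborel) = ennreal j"
      using J(1) by (simp add: \<psi>_def q_def)
  qed (fact J(2))
  show "modulus (ring_image_family f b r1 r2) \<le> ennreal (real ?n * unit_ball_vol (real ?n) / j ^ (?n - 1))"
    if "j > 0" "radial_integral Q b r1 r2 = ennreal j" for j
    using piece[of "{r1<..<r2}" j] that by (simp add: rad \<omega>_def)
  show "modulus (ring_image_family f b r1 r2) = 0" if inf: "radial_integral Q b r1 r2 = top"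
  proof -
    define E where "E = (\<lambda>m::nat. {t\<in>{r1<..<r2}. \<psi> t \<le> of_nat m})"
    have [measurable]: "E m \<in> sets borel" for m unfolding E_def by measurable
    have inc: "incseq (\<lambda>m t. \<psi> t * indicator (E m) t)"
    proof (rule incseq_SucI, rule le_funI)
      fix m t
      have "E m \<subseteq> E (Suc m)" unfolding E_def by (auto intro: order_trans)
      then show "\<psi> t * indicator (E m) t \<le> \<psi> t * indicator (E (Suc m)) t"
        by (auto simp: indicator_def)
    qed
    have "(\<integral>\<^sup>+t\<in>{r1<..<r2}. \<psi> t \<partial>lborel) = (\<integral>\<^sup>+t. (SUP m. \<psi> t * indicator (E m) t) \<partial>lborel)"
    proof (rule nn_integral_cong_AE)
      show "AE t in lborel. \<psi> t * indicator {r1<..<r2} t = (SUP m. \<psi> t * indicator (E m) t)"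
        using q0
      proof eventually_elim
        case (elim t)
        show ?case
        proof (cases "t \<in> {r1<..<r2}")
          case False
          then have "t \<notin> E m" for m by (auto simp: E_def)
          then show ?thesis using False by simp
        next
          case True
          then have "\<psi> t < top" unfolding \<psi>_def using elim r by (intro radial_density_power n) auto
          then obtain m where m: "\<psi> t \<le> of_nat m" by (metis ennreal_Ex_less_of_nat less_imp_le)
          show ?thesis
          proof (rule antisym)
            have "\<psi> t * indicator {r1<..<r2} t = \<psi> t * indicator (E m) t" using True m by (simp add: E_def)
            also have "\<dots> \<le> (SUP m. \<psi> t * indicator (E m) t)" by (rule SUP_upper) simp
            finally show "\<psi> t * indicator {r1<..<r2} t \<le> (SUP m. \<psi> t * indicator (E m) t)" .
            show "(SUP m. \<psi> t * indicator (E m) t) \<le> \<psi> t * indicator {r1<..<r2} t"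
              by (rule SUP_least) (auto simp: E_def indicator_def)
          qed
        qed
      qed
    qed
    also have "\<dots> = (SUP m. \<integral>\<^sup>+t\<in>E m. \<psi> t \<partial>lborel)"
      by (rule nn_integral_monotone_convergence_SUP[OF inc]) measurable
    finally have sup: "(SUP m. \<integral>\<^sup>+t\<in>E m. \<psi> t \<partial>lborel) = top" using inf rad by simp
    have small: "modulus (ring_image_family f b r1 r2) \<le> ennreal (\<omega> / T)" if T: "T \<ge> 1" for T
    proof -
      have "ennreal T < (SUP m. \<integral>\<^sup>+t\<in>E m. \<psi> t \<partial>lborel)" unfolding sup by simp
      then obtain m where m: "ennreal T < (\<integral>\<^sup>+t\<in>E m. \<psi> t \<partial>lborel)" by (auto simp: less_SUP_iff)
      have "(\<integral>\<^sup>+t\<in>E m. \<psi> t \<partial>lborel) \<le> (\<integral>\<^sup>+t. of_nat m * indicator {r1<..<r2} t \<partial>lborel)"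
        by (rule nn_integral_mono) (auto simp: E_def indicator_def)
      also have "\<dots> = of_nat m * ennreal (r2 - r1)" using r by (simp add: nn_integral_cmult_indicator)
      also have "\<dots> < top" by (simp add: ennreal_mult_less_top of_nat_less_top)
      finally obtain j where j: "j \<ge> 0" "(\<integral>\<^sup>+t\<in>E m. \<psi> t \<partial>lborel) = ennreal j"
        by (cases "\<integral>\<^sup>+t\<in>E m. \<psi> t \<partial>lborel") auto
      have Tj: "T < j" using m j T by (simp add: ennreal_less_iff)
      have "modulus (ring_image_family f b r1 r2) \<le> ennreal (\<omega> / j ^ (?n - 1))"
        using Tj T by (intro piece[of "E m"] j(2)) (auto simp: E_def)
      also have "\<dots> \<le> ennreal (\<omega> / T)"
      proof (rule ennreal_leI)
        have "T \<le> j ^ 1" using Tj by simp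
        also have "\<dots> \<le> j ^ (?n - 1)" using Tj T n by (intro power_increasing) auto
        finally show "\<omega> / j ^ (?n - 1) \<le> \<omega> / T" using \<omega> T by (intro divide_left_mono) auto
      qed
      finally show ?thesis .
    qed
    show ?thesis
    proof (rule ccontr)
      assume "modulus (ring_image_family f b r1 r2) \<noteq> 0"
      moreover have "modulus (ring_image_family f b r1 r2) < top" using small[of 1] by (auto simp: le_less_trans)
      ultimately obtain x where x: "modulus (ring_image_family f b r1 r2) = ennreal x" "x > 0"
        by (cases "modulus (ring_image_family f b r1 r2)") auto
      define T where "T = max 1 (2 * \<omega> / x)"
      have "ennreal x \<le> ennreal (\<omega> / T)" using small[of T] x by (simp add: T_def)
      then have "x \<le> \<omega> / T" using \<omega> by (simp add: T_def ennreal_le_iff)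
      moreover have "\<omega> / T \<le> x / 2"
      proof -
        have "2 * \<omega> / x \<le> T" "T > 0" by (auto simp: T_def)
        then show ?thesis using x(2) by (simp add: field_simps)
      qed
      ultimately show False using x(2) by simp
    qed
  qed
qed

section \<open>Short segments from a continuum to a set of positive measure\<close>

text \<open>Either \<open>\<rho> \<le> \<epsilon>\<close> or
  \<open>\<rho> \<le> \<rho>^n / \<epsilon>^(n-1)\<close>. The free parameter makes this as good
  as Hoelder's inequality below.\<close>

lemma young_split:
  fixes \<rho> :: ennreal
  assumes e: "\<epsilon> > 0" and n: "n > 0"
  shows "\<rho> \<le> ennreal \<epsilon> + ennreal (1 / \<epsilon> ^ (n - 1)) * \<rho> ^ n"
proof (cases \<rho>)
  case (real r)
  show ?thesis
  proof (cases "r \<le> \<epsilon>")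
    case True
    then have "\<rho> \<le> ennreal \<epsilon>" using real by (simp add: ennreal_leI)
    then show ?thesis by (rule order_trans) simp
  next
    case False
    have "r ^ n = r * r ^ (n - 1)" using n by (metis power_minus_mult mult.commute)
    moreover have "\<epsilon> ^ (n - 1) \<le> r ^ (n - 1)" using False e by (intro power_mono) auto
    ultimately have "r \<le> 1 / \<epsilon> ^ (n - 1) * r ^ n"
      using e False by (simp add: divide_simps mult_left_mono)
    then have "\<rho> \<le> ennreal (1 / \<epsilon> ^ (n - 1) * r ^ n)" using real by (simp add: ennreal_leI)
    also have "\<dots> = ennreal (1 / \<epsilon> ^ (n - 1)) * \<rho> ^ n"
      by (subst ennreal_mult) (use real e in \<open>auto simp: ennreal_power\<close>)
    finally show ?thesis by (rule order_trans) simp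
  qed
next
  case top
  then show ?thesis using e n by (simp add: ennreal_top_mult ennreal_mult_top power_eq_top_ennreal)
qed

lemma nn_integral_young:
  fixes \<rho> :: "'a::euclidean_space \<Rightarrow> ennreal"
  assumes [measurable]: "\<rho> \<in> borel_measurable borel" "S \<in> sets borel" and e: "\<epsilon> > 0"
  shows "(\<integral>\<^sup>+x\<in>S. \<rho> x \<partial>lborel) \<le> ennreal \<epsilon> * emeasure lborel S +
     ennreal (1 / \<epsilon> ^ (DIM('a) - 1)) * (\<integral>\<^sup>+x\<in>S. \<rho> x ^ DIM('a) \<partial>lborel)"
proof -
  have "(\<integral>\<^sup>+x\<in>S. \<rho> x \<partial>lborel) \<le> (\<integral>\<^sup>+x. (ennreal \<epsilon> * indicator S x +
      ennreal (1 / \<epsilon> ^ (DIM('a) - 1)) * (\<rho> x ^ DIM('a) * indicator S x)) \<partial>lborel)"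
    using young_split[OF e DIM_positive] by (intro nn_integral_mono) (auto simp: indicator_def)
  also have "\<dots> = ennreal \<epsilon> * emeasure lborel S +
     ennreal (1 / \<epsilon> ^ (DIM('a) - 1)) * (\<integral>\<^sup>+x\<in>S. \<rho> x ^ DIM('a) \<partial>lborel)"
    by (subst nn_integral_add) (auto simp: nn_integral_cmult)
  finally show ?thesis .
qed

lemma segment_integral_measurable[measurable]:
  fixes \<rho> :: "'a::euclidean_space \<Rightarrow> ennreal"
  assumes [measurable]: "\<rho> \<in> borel_measurable borel" "g \<in> borel_measurable M" "h \<in> borel_measurable M"
  shows "(\<lambda>w. segment_integral \<rho> (g w) (h w)) \<in> borel_measurable M"
  unfolding segment_integral_def by measurable

lemma powr_integral_unit:
  assumes "n > 0"
  shows "(\<integral>\<^sup>+t\<in>{0..1}. ennreal (t powr (- ((real n - 1) / real n))) \<partial>lborel) = ennreal (real n)"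
proof -
  define a where "a = - ((real n - 1) / real n)"
  have a: "a > -1" "a + 1 = 1 / real n" using assms by (auto simp: a_def field_simps)
  have "((\<lambda>x. x powr a) has_integral (1 powr (a+1) / (a+1))) {0..1}"
    using a by (intro has_integral_powr_from_0) auto
  then have "(\<integral>\<^sup>+t\<in>{0..1}. ennreal (t powr a) \<partial>lborel) = ennreal (1 powr (a+1) / (a+1))"
    by (intro nn_integral_has_integral_lebesgue') auto
  also have "1 powr (a+1) / (a+1) = real n" using a assms by simp
  finally show ?thesis by (simp add: a_def)
qed

text \<open>After an exchange of integrals, the points at parameter \<open>t\<close> contribute
  \<open>t^(-n)\<close> times the integral of \<open>\<rho>\<close> over the ball of radius
  \<open>t * d\<close>. By the linear bound on the energy of these balls, this is of order
  \<open>t^(-(n-1)/n)\<close>, which is integrable on the unit interval.\<close>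

lemma mean_segment_integral:
  fixes \<rho> :: "'a::euclidean_space \<Rightarrow> ennreal"
  assumes [measurable]: "\<rho> \<in> borel_measurable borel" and d: "d > 0" and a: "a > 0" and c: "c \<ge> 0"
    and small: "\<And>r. 0 < r \<Longrightarrow> r \<le> d \<Longrightarrow> (\<integral>\<^sup>+x\<in>ball y r. \<rho> x ^ DIM('a) \<partial>lborel) \<le> ennreal (c * r)"
  shows "(\<integral>\<^sup>+w\<in>ball y d. segment_integral \<rho> y (w - y) \<partial>lborel) \<le>
    ennreal (d * real DIM('a) * (a * unit_ball_vol DIM('a) * d ^ DIM('a) + c * d / a ^ (DIM('a) - 1)))"
proof -
  let ?n = "DIM('a)"
  define \<Omega> where "\<Omega> = unit_ball_vol (real ?n)"
  define \<beta> where "\<beta> = (real ?n - 1) / real ?n"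
  define Kc where "Kc = a * \<Omega> * d ^ ?n + c * d / a ^ (?n - 1)"
  have n: "?n > 0" by simp
  have \<Omega>: "\<Omega> > 0" unfolding \<Omega>_def by simp
  have Kc: "Kc \<ge> 0" using a c d \<Omega> by (simp add: Kc_def)
  have [measurable]: "ball y d \<in> sets borel" "ball 0 d \<in> sets (borel :: 'a measure)" by auto
  have "(\<integral>\<^sup>+w\<in>ball y d. segment_integral \<rho> y (w - y) \<partial>lborel) \<le>
    (\<integral>\<^sup>+w. ennreal d * (\<integral>\<^sup>+t. \<rho> (y + t *\<^sub>R (w - y)) * indicator {0..1} t * indicator (ball y d) w \<partial>lborel) \<partial>lborel)"
  proof (rule nn_integral_mono)
    fix w :: 'a
    show "segment_integral \<rho> y (w - y) * indicator (ball y d) w \<le>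
      ennreal d * (\<integral>\<^sup>+t. \<rho> (y + t *\<^sub>R (w - y)) * indicator {0..1} t * indicator (ball y d) w \<partial>lborel)"
    proof (cases "w \<in> ball y d")
      case True
      then have "norm (w - y) \<le> d" by (simp add: dist_norm norm_minus_commute)
      then show ?thesis using True
        by (auto simp: segment_integral_def intro!: mult_right_mono ennreal_leI)
    qed simp
  qed
  also have "\<dots> = ennreal d * (\<integral>\<^sup>+w. (\<integral>\<^sup>+t. \<rho> (y + t *\<^sub>R (w - y)) * indicator {0..1} t * indicator (ball y d) w \<partial>lborel) \<partial>lborel)"
    by (rule nn_integral_cmult) measurable
  finally have start: "(\<integral>\<^sup>+w\<in>ball y d. segment_integral \<rho> y (w - y) \<partial>lborel) \<le> ennreal d *
     (\<integral>\<^sup>+w. (\<integral>\<^sup>+t. \<rho> (y + t *\<^sub>R (w - y)) * indicator {0..1} t * indicator (ball y d) w \<partial>lborel) \<partial>lborel)" .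
  have "(\<integral>\<^sup>+w. (\<integral>\<^sup>+t. \<rho> (y + t *\<^sub>R (w - y)) * indicator {0..1::real} t * indicator (ball y d) w \<partial>lborel) \<partial>lborel) =
    (\<integral>\<^sup>+t. (\<integral>\<^sup>+w. \<rho> (y + t *\<^sub>R (w - y)) * indicator {0..1} t * indicator (ball y d) w \<partial>lborel) \<partial>lborel)"
    by (rule lborel_pair.Fubini'[symmetric]) measurable
  also have "\<dots> \<le> (\<integral>\<^sup>+t. ennreal Kc * (ennreal (t powr (- \<beta>)) * indicator {0..1} t) \<partial>lborel)"
  proof (rule nn_integral_mono_AE)
    have "AE t in lborel. t \<noteq> (0::real)" by (rule AE_lborel_singleton)
    then show "AE t in lborel. (\<integral>\<^sup>+w. \<rho> (y + t *\<^sub>R (w - y)) * indicator {0..1} t * indicator (ball y d) w \<partial>lborel) \<le>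
       ennreal Kc * (ennreal (t powr (- \<beta>)) * indicator {0..1} t)"
    proof eventually_elim
      case (elim t)
      show ?case
      proof (cases "t \<in> {0..1}")
        case False
        then show ?thesis by simp
      next
        case True
        then have t: "0 < t" "t \<le> 1" using elim by auto
        \<comment> \<open>With this exponent both terms of the split are of order \<open>t^(-(n-1)/n)\<close>
          after division by \<open>t^n\<close>.\<close>
        define e where "e = a * t powr (- \<beta>)"
        have e: "e > 0" using a t by (simp add: e_def)
        have [measurable]: "ball y (t * d) \<in> sets borel" by simp
        have td: "0 < t * d" "t * d \<le> d" using t d by (auto simp: mult_left_le_one_le)
        have b1: "(\<integral>\<^sup>+x\<in>ball y (t * d). \<rho> x \<partial>lborel) \<le> ennreal (e * (\<Omega> * (t * d) ^ ?n) + 1 / e ^ (?n - 1) * (c * (t * d)))"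
        proof -
          have "(\<integral>\<^sup>+x\<in>ball y (t * d). \<rho> x \<partial>lborel) \<le> ennreal e * emeasure lborel (ball y (t * d)) +
            ennreal (1 / e ^ (?n - 1)) * (\<integral>\<^sup>+x\<in>ball y (t * d). \<rho> x ^ ?n \<partial>lborel)"
            by (rule nn_integral_young) (use e in auto)
          also have "\<dots> \<le> ennreal e * ennreal (\<Omega> * (t * d) ^ ?n) + ennreal (1 / e ^ (?n - 1)) * ennreal (c * (t * d))"
            using td small[OF td] by (intro add_mono mult_left_mono) (auto simp: emeasure_ball \<Omega>_def)
          also have "\<dots> = ennreal (e * (\<Omega> * (t * d) ^ ?n) + 1 / e ^ (?n - 1) * (c * (t * d)))"
          proof -
            have nn: "0 \<le> e" "0 \<le> \<Omega> * (t * d) ^ ?n" "0 \<le> 1 / e ^ (?n - 1)" "0 \<le> c * (t * d)"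
              using e \<Omega> td c by auto
            show ?thesis
              using nn by (simp only: ennreal_mult[symmetric] ennreal_plus[symmetric] mult_nonneg_nonneg)
          qed
          finally show ?thesis .
        qed
        have id: "1 / t ^ ?n * (e * (\<Omega> * (t * d) ^ ?n) + 1 / e ^ (?n - 1) * (c * (t * d))) = t powr (- \<beta>) * Kc"
        proof -
          have en: "e ^ (?n - 1) = a ^ (?n - 1) * t powr (- \<beta> * real (?n - 1))"
          proof -
            have "(t powr - \<beta>) ^ (?n - 1) = (t powr - \<beta>) powr real (?n - 1)"
              using t by (intro powr_realpow[symmetric]) simp
            also have "\<dots> = t powr (- \<beta> * real (?n - 1))" by (rule powr_powr)
            finally show ?thesis unfolding e_def power_mult_distrib by (rule arg_cong)
          qed
          have "t powr (- real ?n) * t powr 1 / t powr (- \<beta> * real (?n - 1)) = t powr (- real ?n + 1 - (- \<beta> * real (?n - 1)))"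
            by (simp only: powr_diff powr_add)
          also have "- real ?n + 1 - (- \<beta> * real (?n - 1)) = - \<beta>"
            using n by (simp add: \<beta>_def of_nat_diff field_simps)
          finally have e2: "1 / t ^ ?n * (t / t powr (- \<beta> * real (?n - 1))) = t powr (- \<beta>)"
            using t by (simp add: powr_minus powr_realpow divide_simps)
          have "1 / t ^ ?n * (e * (\<Omega> * (t * d) ^ ?n) + 1 / e ^ (?n - 1) * (c * (t * d))) =
            a * t powr (- \<beta>) * \<Omega> * d ^ ?n + (1 / t ^ ?n * (t / t powr (- \<beta> * real (?n - 1)))) * (c * d / a ^ (?n - 1))"
            unfolding en using t a by (simp add: e_def power_mult_distrib field_simps)
          also have "\<dots> = t powr (- \<beta>) * Kc" unfolding e2 by (simp add: Kc_def algebra_simps)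
          finally show ?thesis .
        qed
        have sc: "(\<integral>\<^sup>+x\<in>ball y (t * d). \<rho> x \<partial>lborel) =
          ennreal (t ^ ?n) * (\<integral>\<^sup>+w. \<rho> (y + t *\<^sub>R (w - y)) * indicator (ball y d) w \<partial>lborel)"
        proof -
          have "(\<integral>\<^sup>+x\<in>ball y (t * d). \<rho> x \<partial>lborel) =
            ennreal (\<bar>t\<bar> ^ ?n) * (\<integral>\<^sup>+w. \<rho> ((y - t *\<^sub>R y) + t *\<^sub>R w) * indicator (ball y (t * d)) ((y - t *\<^sub>R y) + t *\<^sub>R w) \<partial>lborel)"
            using t by (intro nn_integral_affine) auto
          also have "(\<integral>\<^sup>+w. \<rho> ((y - t *\<^sub>R y) + t *\<^sub>R w) * indicator (ball y (t * d)) ((y - t *\<^sub>R y) + t *\<^sub>R w) \<partial>lborel) =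
            (\<integral>\<^sup>+w. \<rho> (y + t *\<^sub>R (w - y)) * indicator (ball y d) w \<partial>lborel)"
          proof (rule nn_integral_cong)
            fix w :: 'a
            have e1: "(y - t *\<^sub>R y) + t *\<^sub>R w = y + t *\<^sub>R (w - y)" by (simp add: algebra_simps)
            have e2: "dist y (y + t *\<^sub>R (w - y)) = t * dist y w"
              using t by (simp add: dist_norm norm_minus_commute)
            show "\<rho> ((y - t *\<^sub>R y) + t *\<^sub>R w) * indicator (ball y (t * d)) ((y - t *\<^sub>R y) + t *\<^sub>R w) =
              \<rho> (y + t *\<^sub>R (w - y)) * indicator (ball y d) w"
              unfolding e1 indicator_def mem_ball e2 using t by simp
          qed
          finally show ?thesis using t by simp
        qed
        have "(\<integral>\<^sup>+w. \<rho> (y + t *\<^sub>R (w - y)) * indicator {0..1} t * indicator (ball y d) w \<partial>lborel) =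
          ennreal (1 / t ^ ?n) * (ennreal (t ^ ?n) * (\<integral>\<^sup>+w. \<rho> (y + t *\<^sub>R (w - y)) * indicator (ball y d) w \<partial>lborel))"
          using t by (simp add: mult.assoc[symmetric] ennreal_mult[symmetric])
        also have "\<dots> \<le> ennreal (1 / t ^ ?n) * ennreal (e * (\<Omega> * (t * d) ^ ?n) + 1 / e ^ (?n - 1) * (c * (t * d)))"
          unfolding sc[symmetric] by (intro mult_left_mono b1) auto
        also have "\<dots> = ennreal (1 / t ^ ?n * (e * (\<Omega> * (t * d) ^ ?n) + 1 / e ^ (?n - 1) * (c * (t * d))))"
          using t e \<Omega> c d by (intro ennreal_mult[symmetric]) auto
        also have "\<dots> = ennreal Kc * (ennreal (t powr (- \<beta>)) * indicator {0..1} t)"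
          unfolding id using t Kc by (simp add: ennreal_mult mult.commute)
        finally show ?thesis .
      qed
    qed
  qed
  also have "\<dots> = ennreal Kc * (\<integral>\<^sup>+t\<in>{0..1}. ennreal (t powr (- \<beta>)) \<partial>lborel)"
    by (rule nn_integral_cmult) measurable
  also have "\<dots> = ennreal Kc * ennreal (real ?n)"
    unfolding \<beta>_def by (simp only: powr_integral_unit[OF n])
  finally have "ennreal d * (\<integral>\<^sup>+w. (\<integral>\<^sup>+t. \<rho> (y + t *\<^sub>R (w - y)) * indicator {0..1::real} t * indicator (ball y d) w \<partial>lborel) \<partial>lborel)
    \<le> ennreal d * (ennreal Kc * ennreal (real ?n))" by (rule mult_left_mono) simp
  also have "\<dots> = ennreal (d * real ?n * Kc)"
    using d Kc by (simp add: ennreal_mult[symmetric] mult_ac)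
  finally show ?thesis using start unfolding Kc_def \<Omega>_def by (rule order_trans[rotated])
qed

text \<open>If every centre has a ball of too large mass, Vitali's covering lemma selects disjoint ones
  whose fivefold enlargements cover \<open>K\<close> near \<open>p\<close>. The distances of the
  points of \<open>K\<close> from \<open>p\<close> fill the interval from \<open>0\<close> to
  \<open>\<delta>\<close>, so the radii add up to at least \<open>\<delta> / 10\<close>, and the
  masses to at least \<open>c * \<delta> / 10\<close>.\<close>

lemma exists_good_centre:
  fixes \<mu> :: "'a::euclidean_space measure"
  assumes \<mu>: "sets \<mu> = sets borel" and K: "compact K" "connected K" "p \<in> K" "q \<in> K" "\<delta> \<le> dist p q"
    and \<delta>: "\<delta> > 0" and c: "c > 0" and small: "emeasure \<mu> UNIV < ennreal (c * \<delta> / 10)"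
  shows "\<exists>y\<in>K \<inter> cball p \<delta>. \<forall>r. 0 < r \<and> r \<le> d \<longrightarrow> emeasure \<mu> (ball y r) \<le> ennreal (c * r)"
proof (rule ccontr)
  assume neg: "\<not> ?thesis"
  define P where "P = K \<inter> cball p \<delta>"
  have P: "compact P" unfolding P_def by (intro compact_Int K(1) compact_cball)
  have "\<forall>y\<in>P. \<exists>r. 0 < r \<and> r \<le> d \<and> emeasure \<mu> (ball y r) > ennreal (c * r)"
    using neg unfolding P_def by (meson not_le)
  then obtain r where r: "\<And>y. y \<in> P \<Longrightarrow> 0 < r y" "\<And>y. y \<in> P \<Longrightarrow> r y \<le> d"
    "\<And>y. y \<in> P \<Longrightarrow> emeasure \<mu> (ball y (r y)) > ennreal (c * r y)" by metis
  have "P \<subseteq> (\<Union>y\<in>P. ball y (r y))" using r(1) by force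
  then obtain D where D: "D \<subseteq> P" "finite D" "P \<subseteq> (\<Union>y\<in>D. ball y (r y))"
    using compactE_image[OF P, of P "\<lambda>y. ball y (r y)"] by (metis open_ball)
  obtain C where C: "C \<subseteq> D" "pairwise (\<lambda>i j. disjnt (ball i (r i)) (ball j (r j))) C"
     "P \<subseteq> (\<Union>i\<in>C. ball i (5 * r i))"
    by (rule Vitali_covering_lemma_balls[where S=P and K=D and a="\<lambda>y. y" and r=r and B=d]) (use D r in auto)
  have fC: "finite C" using C(1) D(2) finite_subset by blast
  have rC: "i \<in> C \<Longrightarrow> 0 < r i" for i using C(1) D(1) r(1) by blast
  have "{0..\<delta>} \<subseteq> (\<Union>i\<in>C. {dist p i - 5 * r i .. dist p i + 5 * r i})"
  proof
    fix t assume t: "t \<in> {0..\<delta>}"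
    have "connected (dist p ` K)" by (intro connected_continuous_image K continuous_intros)
    moreover have "0 \<in> dist p ` K" using K(3) by force
    moreover have "dist p q \<in> dist p ` K" using K by blast
    ultimately have "t \<in> dist p ` K"
      using connected_contains_Icc[of "dist p ` K" 0 "dist p q"] t K(5) by auto
    then obtain x where x: "x \<in> K" "dist p x = t" by blast
    then have "x \<in> P" using t by (simp add: P_def)
    then obtain i where i: "i \<in> C" "dist i x < 5 * r i" using C(3) by auto
    then have "\<bar>dist p i - t\<bar> \<le> 5 * r i"
      using x dist_triangle[of p x i] dist_triangle[of p i x] by (simp add: dist_commute)
    then show "t \<in> (\<Union>i\<in>C. {dist p i - 5 * r i .. dist p i + 5 * r i})" using i by (auto intro!: bexI[of _ i] simp: abs_le_iff)
  qed
  then have "emeasure lborel {0..\<delta>} \<le> emeasure lborel (\<Union>i\<in>C. {dist p i - 5 * r i .. dist p i + 5 * r i})"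
    by (rule emeasure_mono) (use fC in auto)
  also have "\<dots> \<le> (\<Sum>i\<in>C. emeasure lborel {dist p i - 5 * r i .. dist p i + 5 * r i})"
    by (rule emeasure_subadditive_finite) (use fC in auto)
  also have "\<dots> = (\<Sum>i\<in>C. ennreal (10 * r i))"
    using rC by (intro sum.cong refl) (simp add: less_imp_le)
  also have "\<dots> = ennreal (\<Sum>i\<in>C. 10 * r i)" using rC by (intro sum_ennreal) (simp add: less_imp_le)
  finally have "\<delta> \<le> (\<Sum>i\<in>C. 10 * r i)"
    using \<delta> rC by (simp add: ennreal_le_iff sum_nonneg less_imp_le)
  then have "c * \<delta> / 10 \<le> (\<Sum>i\<in>C. c * r i)"
    using c by (simp add: sum_distrib_left[symmetric])
  then have "ennreal (c * \<delta> / 10) \<le> ennreal (\<Sum>i\<in>C. c * r i)" by (rule ennreal_leI)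
  also have "\<dots> = (\<Sum>i\<in>C. ennreal (c * r i))" using rC c by (intro sum_ennreal[symmetric]) (simp add: less_imp_le)
  also have "\<dots> \<le> (\<Sum>i\<in>C. emeasure \<mu> (ball i (r i)))"
    using r(3) C(1) D(1) by (intro sum_mono) (meson less_imp_le subset_iff)
  also have "\<dots> = emeasure \<mu> (\<Union>i\<in>C. ball i (r i))"
  proof (rule sum_emeasure)
    show "disjoint_family_on (\<lambda>i. ball i (r i)) C"
      using C(2) by (auto simp: disjoint_family_on_def pairwise_def disjnt_def)
    show "(\<lambda>i. ball i (r i)) ` C \<subseteq> sets \<mu>" unfolding \<mu> by auto
  qed (fact fC)
  also have "\<dots> \<le> emeasure \<mu> UNIV" by (rule emeasure_mono) (unfold \<mu>, auto)
  finally show False using small by simp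
qed

text \<open>The contraction by \<open>s\<close> towards \<open>q\<close> maps the convex set into itself and
  reduces volumes by at most \<open>2^n\<close>.\<close>

lemma mean_over_convex:
  fixes \<rho> :: "'a::euclidean_space \<Rightarrow> ennreal"
  assumes [measurable]: "\<rho> \<in> borel_measurable borel" and B: "convex B" "B \<in> sets borel" "q \<in> B"
    and s: "1/2 \<le> s" "s \<le> 1"
  shows "(\<integral>\<^sup>+z\<in>B. \<rho> ((1 - s) *\<^sub>R q + s *\<^sub>R z) \<partial>lborel) \<le> ennreal (2 ^ DIM('a)) * (\<integral>\<^sup>+x\<in>B. \<rho> x \<partial>lborel)"
proof -
  let ?n = "DIM('a)"
  note B(2)[measurable]
  have "(\<integral>\<^sup>+x\<in>B. \<rho> x \<partial>lborel) = ennreal (\<bar>s\<bar> ^ ?n) *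
     (\<integral>\<^sup>+z. \<rho> ((1 - s) *\<^sub>R q + s *\<^sub>R z) * indicator B ((1 - s) *\<^sub>R q + s *\<^sub>R z) \<partial>lborel)"
    using s by (intro nn_integral_affine) auto
  moreover have "(\<integral>\<^sup>+z\<in>B. \<rho> ((1 - s) *\<^sub>R q + s *\<^sub>R z) \<partial>lborel) \<le>
     (\<integral>\<^sup>+z. \<rho> ((1 - s) *\<^sub>R q + s *\<^sub>R z) * indicator B ((1 - s) *\<^sub>R q + s *\<^sub>R z) \<partial>lborel)"
  proof (rule nn_integral_mono)
    fix z
    have "(1 - s) *\<^sub>R q + s *\<^sub>R z \<in> B" if "z \<in> B"
      using B(1,3) that s by (intro convexD) auto
    then show "\<rho> ((1 - s) *\<^sub>R q + s *\<^sub>R z) * indicator B z \<le>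
      \<rho> ((1 - s) *\<^sub>R q + s *\<^sub>R z) * indicator B ((1 - s) *\<^sub>R q + s *\<^sub>R z)"
      by (auto simp: indicator_def)
  qed
  ultimately have "ennreal (s ^ ?n) * (\<integral>\<^sup>+z\<in>B. \<rho> ((1 - s) *\<^sub>R q + s *\<^sub>R z) \<partial>lborel) \<le> (\<integral>\<^sup>+x\<in>B. \<rho> x \<partial>lborel)"
    using s by (simp add: mult_left_mono)
  then have "ennreal (2 ^ ?n) * (ennreal (s ^ ?n) * (\<integral>\<^sup>+z\<in>B. \<rho> ((1 - s) *\<^sub>R q + s *\<^sub>R z) \<partial>lborel))
     \<le> ennreal (2 ^ ?n) * (\<integral>\<^sup>+x\<in>B. \<rho> x \<partial>lborel)" by (rule mult_left_mono) simp
  moreover have "1 \<le> ennreal (2 ^ ?n) * ennreal (s ^ ?n)"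
  proof -
    have "1 \<le> (2 * s) ^ ?n" using s by (intro one_le_power) auto
    then have "ennreal 1 \<le> ennreal (2 ^ ?n * s ^ ?n)" by (intro ennreal_leI) (simp add: power_mult_distrib)
    then show ?thesis using s by (simp add: ennreal_mult)
  qed
  then have "1 * (\<integral>\<^sup>+z\<in>B. \<rho> ((1 - s) *\<^sub>R q + s *\<^sub>R z) \<partial>lborel) \<le>
    ennreal (2 ^ ?n) * ennreal (s ^ ?n) * (\<integral>\<^sup>+z\<in>B. \<rho> ((1 - s) *\<^sub>R q + s *\<^sub>R z) \<partial>lborel)"
    by (rule mult_right_mono) simp
  ultimately show ?thesis by (simp add: mult.assoc)
qed

text \<open>At each parameter of the segment one of its ends has weight at least \<open>1/2\<close>;
  \<open>mean_over_convex\<close> is applied to the integral over that end.\<close>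

lemma mean_segment_pairs:
  fixes \<rho> :: "'a::euclidean_space \<Rightarrow> ennreal"
  assumes [measurable]: "\<rho> \<in> borel_measurable borel" and T: "T > 0"
  defines "B \<equiv> ball (0::'a) T"
  shows "(\<integral>\<^sup>+w\<in>B. (\<integral>\<^sup>+z\<in>B. segment_integral \<rho> w (z - w) \<partial>lborel) \<partial>lborel) \<le>
    ennreal (2 * T) * (ennreal (2 ^ DIM('a)) * (\<integral>\<^sup>+x\<in>B. \<rho> x \<partial>lborel) * emeasure lborel B)"
proof -
  have [measurable]: "B \<in> sets borel" by (simp add: B_def)
  have conv: "convex B" by (simp add: B_def)
  define A where "A = ennreal (2 ^ DIM('a)) * (\<integral>\<^sup>+x\<in>B. \<rho> x \<partial>lborel)"
  define F where "F = (\<lambda>w z t. \<rho> (w + t *\<^sub>R (z - w)) * indicator {0..1::real} t * indicator B z * indicator B w)"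
  have Ft: "(\<integral>\<^sup>+w. (\<integral>\<^sup>+z. F w z t \<partial>lborel) \<partial>lborel) \<le> A * emeasure lborel B * indicator {0..1} t" for t
  proof (cases "t \<in> {0..1}")
    case False
    then show ?thesis by (simp add: F_def)
  next
    case t: True
    show ?thesis
    proof (cases "1/2 \<le> t")
      case True
      have "(\<integral>\<^sup>+w. (\<integral>\<^sup>+z. F w z t \<partial>lborel) \<partial>lborel) \<le> (\<integral>\<^sup>+w. A * indicator B w \<partial>lborel)"
      proof (rule nn_integral_mono)
        fix w
        show "(\<integral>\<^sup>+z. F w z t \<partial>lborel) \<le> A * indicator B w"
        proof (cases "w \<in> B")
          case w: True
          have "(\<integral>\<^sup>+z. F w z t \<partial>lborel) = (\<integral>\<^sup>+z\<in>B. \<rho> ((1 - t) *\<^sub>R w + t *\<^sub>R z) \<partial>lborel)"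
            using t w by (intro nn_integral_cong) (auto simp: F_def algebra_simps)
          also have "\<dots> \<le> A" unfolding A_def using True t w conv by (intro mean_over_convex) auto
          finally show ?thesis using w by simp
        qed (simp add: F_def)
      qed
      then show ?thesis using t by (simp add: nn_integral_cmult_indicator)
    next
      case False
      have "(\<integral>\<^sup>+w. (\<integral>\<^sup>+z. F w z t \<partial>lborel) \<partial>lborel) = (\<integral>\<^sup>+z. (\<integral>\<^sup>+w. F w z t \<partial>lborel) \<partial>lborel)"
        by (rule lborel_pair.Fubini'[symmetric]) (unfold F_def, measurable)
      also have "\<dots> \<le> (\<integral>\<^sup>+z. A * indicator B z \<partial>lborel)"
      proof (rule nn_integral_mono)
        fix z
        show "(\<integral>\<^sup>+w. F w z t \<partial>lborel) \<le> A * indicator B z"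
        proof (cases "z \<in> B")
          case z: True
          have "(\<integral>\<^sup>+w. F w z t \<partial>lborel) = (\<integral>\<^sup>+w\<in>B. \<rho> ((1 - (1 - t)) *\<^sub>R z + (1 - t) *\<^sub>R w) \<partial>lborel)"
            using t z by (intro nn_integral_cong) (auto simp: F_def algebra_simps)
          also have "\<dots> \<le> A" unfolding A_def using False t z conv by (intro mean_over_convex) auto
          finally show ?thesis using z by simp
        qed (simp add: F_def)
      qed
      finally show ?thesis using t by (simp add: nn_integral_cmult_indicator)
    qed
  qed
  have "(\<integral>\<^sup>+w\<in>B. (\<integral>\<^sup>+z\<in>B. segment_integral \<rho> w (z - w) \<partial>lborel) \<partial>lborel) \<le>
    (\<integral>\<^sup>+w. (\<integral>\<^sup>+z. ennreal (2 * T) * (\<integral>\<^sup>+t. F w z t \<partial>lborel) \<partial>lborel) \<partial>lborel)"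
  proof (rule nn_integral_mono)
    fix w
    show "(\<integral>\<^sup>+z\<in>B. segment_integral \<rho> w (z - w) \<partial>lborel) * indicator B w \<le>
      (\<integral>\<^sup>+z. ennreal (2 * T) * (\<integral>\<^sup>+t. F w z t \<partial>lborel) \<partial>lborel)"
    proof (cases "w \<in> B")
      case w: True
      have "(\<integral>\<^sup>+z\<in>B. segment_integral \<rho> w (z - w) \<partial>lborel) \<le> (\<integral>\<^sup>+z. ennreal (2 * T) * (\<integral>\<^sup>+t. F w z t \<partial>lborel) \<partial>lborel)"
      proof (rule nn_integral_mono)
        fix z
        show "segment_integral \<rho> w (z - w) * indicator B z \<le> ennreal (2 * T) * (\<integral>\<^sup>+t. F w z t \<partial>lborel)"
        proof (cases "z \<in> B")
          case z: True
          have "norm (z - w) \<le> 2 * T" using w z norm_triangle_ineq4[of z w] by (simp add: B_def)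
          then show ?thesis using w z
            by (auto simp: F_def segment_integral_def intro!: mult_right_mono ennreal_leI)
        qed simp
      qed
      then show ?thesis using w by simp
    qed simp
  qed
  also have "\<dots> = ennreal (2 * T) * (\<integral>\<^sup>+w. (\<integral>\<^sup>+z. (\<integral>\<^sup>+t. F w z t \<partial>lborel) \<partial>lborel) \<partial>lborel)"
  proof -
    have "(\<integral>\<^sup>+w. (\<integral>\<^sup>+z. ennreal (2 * T) * (\<integral>\<^sup>+t. F w z t \<partial>lborel) \<partial>lborel) \<partial>lborel) =
      (\<integral>\<^sup>+w. ennreal (2 * T) * (\<integral>\<^sup>+z. (\<integral>\<^sup>+t. F w z t \<partial>lborel) \<partial>lborel) \<partial>lborel)"
      by (intro nn_integral_cong, rule nn_integral_cmult) (unfold F_def, measurable)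
    also have "\<dots> = ennreal (2 * T) * (\<integral>\<^sup>+w. (\<integral>\<^sup>+z. (\<integral>\<^sup>+t. F w z t \<partial>lborel) \<partial>lborel) \<partial>lborel)"
      by (rule nn_integral_cmult) (unfold F_def, measurable)
    finally show ?thesis .
  qed
  also have "(\<integral>\<^sup>+w. (\<integral>\<^sup>+z. (\<integral>\<^sup>+t. F w z t \<partial>lborel) \<partial>lborel) \<partial>lborel) = (\<integral>\<^sup>+t. (\<integral>\<^sup>+w. (\<integral>\<^sup>+z. F w z t \<partial>lborel) \<partial>lborel) \<partial>lborel)"
  proof -
    have "(\<integral>\<^sup>+w. (\<integral>\<^sup>+z. (\<integral>\<^sup>+t. F w z t \<partial>lborel) \<partial>lborel) \<partial>lborel) = (\<integral>\<^sup>+w. (\<integral>\<^sup>+t. (\<integral>\<^sup>+z. F w z t \<partial>lborel) \<partial>lborel) \<partial>lborel)"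
      by (intro nn_integral_cong, rule lborel_pair.Fubini'[symmetric]) (unfold F_def, measurable)
    also have "\<dots> = (\<integral>\<^sup>+t. (\<integral>\<^sup>+w. (\<integral>\<^sup>+z. F w z t \<partial>lborel) \<partial>lborel) \<partial>lborel)"
      by (rule lborel_pair.Fubini'[symmetric]) (unfold F_def, measurable)
    finally show ?thesis .
  qed
  also have "ennreal (2 * T) * \<dots> \<le> ennreal (2 * T) * (A * emeasure lborel B)"
  proof (rule mult_left_mono)
    have "(\<integral>\<^sup>+t. (\<integral>\<^sup>+w. (\<integral>\<^sup>+z. F w z t \<partial>lborel) \<partial>lborel) \<partial>lborel) \<le>
       (\<integral>\<^sup>+t. A * emeasure lborel B * indicator {0..1::real} t \<partial>lborel)"
      by (rule nn_integral_mono) (rule Ft)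
    also have "\<dots> = A * emeasure lborel B" by (simp add: nn_integral_cmult_indicator)
    finally show "(\<integral>\<^sup>+t. (\<integral>\<^sup>+w. (\<integral>\<^sup>+z. F w z t \<partial>lborel) \<partial>lborel) \<partial>lborel) \<le> A * emeasure lborel B" .
  qed simp
  finally show ?thesis by (simp add: A_def)
qed

text \<open>A weak Loewner property. Let \<open>\<beta>\<close> be the volume of the ball of radius
  \<open>T\<close> and \<open>\<zeta>\<close> that of \<open>Z\<close>. For a centre
  \<open>y\<close> of \<open>K\<close> with linearly decaying energy, the mean value estimate
  leaves at least \<open>3/4 * \<beta>\<close> of good intermediate points \<open>w\<close>. If
  none of them could be continued to \<open>Z\<close>, the integral over all pairs of points would
  be at least \<open>3/4 * \<beta> * \<zeta>\<close>, whereas small energy makes it at most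
  \<open>\<beta> * \<zeta> / 4\<close>.\<close>

lemma short_segments_from_continuum:
  fixes Z :: "'a::euclidean_space set"
  assumes T: "T > 0" and \<delta>: "\<delta> > 0" and Z: "Z \<in> sets borel" "Z \<subseteq> ball 0 T" "emeasure lborel Z > 0"
  shows "\<exists>\<epsilon>>0. \<forall>\<rho> K p q. \<rho> \<in> borel_measurable borel \<and> (\<integral>\<^sup>+x. \<rho> x ^ DIM('a) \<partial>lborel) < ennreal \<epsilon> \<and>
     compact K \<and> connected K \<and> p \<in> K \<and> q \<in> K \<and> \<delta> \<le> dist p q \<and> cball p \<delta> \<subseteq> ball 0 T \<longrightarrow>
     (\<exists>y\<in>K. \<exists>w. \<exists>z\<in>Z. segment_integral \<rho> y (w - y) < 1 \<and> segment_integral \<rho> w (z - w) < 1)"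
proof -
  let ?n = "DIM('a)"
  define B where "B = ball (0::'a) T"
  define \<Omega> where "\<Omega> = unit_ball_vol (real ?n)"
  define \<beta> where "\<beta> = \<Omega> * T ^ ?n"
  have n: "real ?n > 0" by simp
  have \<Omega>: "\<Omega> > 0" unfolding \<Omega>_def by simp
  have \<beta>: "\<beta> > 0" using \<Omega> T by (simp add: \<beta>_def)
  have B[measurable]: "B \<in> sets borel" by (simp add: B_def)
  note Z(1)[measurable]
  have eB: "emeasure lborel B = ennreal \<beta>"
    using T unfolding B_def \<beta>_def \<Omega>_def by (intro emeasure_ball) simp
  have ZB: "Z \<subseteq> B" using Z(2) by (simp add: B_def)
  have "emeasure lborel Z \<le> ennreal \<beta>" using emeasure_mono[OF ZB, of lborel] eB by simp
  then have "emeasure lborel Z < top" by (rule le_less_trans) simp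
  then obtain \<zeta> where \<zeta>: "\<zeta> \<ge> 0" "emeasure lborel Z = ennreal \<zeta>" by (cases "emeasure lborel Z") auto
  have \<zeta>0: "\<zeta> > 0" using \<zeta> Z(3) by (cases "\<zeta> = 0") auto
  define d where "d = 2 * T"
  have d: "d > 0" using T by (simp add: d_def)
  \<comment> \<open>\<open>a\<close> and \<open>c\<close> are such that the mean over the intermediate points is
    \<open>\<beta> / 4\<close>.\<close>
  define a where "a = \<beta> / (8 * d * real ?n * \<Omega> * d ^ ?n)"
  have a: "a > 0" using \<beta> d n \<Omega> by (simp add: a_def)
  define c where "c = \<beta> * a ^ (?n - 1) / (8 * d * real ?n * d)"
  have c: "c > 0" using \<beta> d n a by (simp add: c_def)
  have mean: "d * real ?n * (a * \<Omega> * d ^ ?n + c * d / a ^ (?n - 1)) = \<beta> / 4"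
  proof -
    have "d * real ?n * (a * \<Omega> * d ^ ?n) = \<beta> / 8" using d n \<Omega> by (simp add: a_def)
    moreover have "d * real ?n * (c * d / a ^ (?n - 1)) = \<beta> / 8" using d n a by (simp add: c_def)
    ultimately have "d * real ?n * (a * \<Omega> * d ^ ?n + c * d / a ^ (?n - 1)) = \<beta> / 8 + \<beta> / 8"
      unfolding distrib_left by (simp only:)
    then show ?thesis by simp
  qed
  \<comment> \<open>\<open>e1\<close> and \<open>e2\<close> are such that the mean over pairs is at most
    \<open>\<beta> * \<zeta> / 4\<close>.\<close>
  define e1 where "e1 = \<zeta> / (16 * T * 2 ^ ?n * \<beta>)"
  have e1: "e1 > 0" using \<zeta>0 T \<beta> by (simp add: e1_def)
  define e2 where "e2 = \<zeta> * e1 ^ (?n - 1) / (16 * T * 2 ^ ?n)"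
  have e2: "e2 > 0" using \<zeta>0 T e1 by (simp add: e2_def)
  have pairs: "2 * T * (2 ^ ?n * (e1 * \<beta> + 1 / e1 ^ (?n - 1) * e2) * \<beta>) = \<beta> * \<zeta> / 4"
  proof -
    have "2 * T * (2 ^ ?n * (e1 * \<beta>) * \<beta>) = \<beta> * \<zeta> / 8" using T \<beta> by (simp add: e1_def)
    moreover have "2 * T * (2 ^ ?n * (1 / e1 ^ (?n - 1) * e2) * \<beta>) = \<beta> * \<zeta> / 8" using T e1 by (simp add: e2_def)
    ultimately have "2 * T * (2 ^ ?n * (e1 * \<beta> + 1 / e1 ^ (?n - 1) * e2) * \<beta>) = \<beta> * \<zeta> / 8 + \<beta> * \<zeta> / 8"
      unfolding distrib_left distrib_right by (simp only:)
    then show ?thesis by simp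
  qed
  define \<epsilon> where "\<epsilon> = min (c * \<delta> / 10) e2"
  have "\<epsilon> > 0" using c \<delta> e2 by (simp add: \<epsilon>_def)
  moreover have "\<exists>y\<in>K. \<exists>w. \<exists>z\<in>Z. segment_integral \<rho> y (w - y) < 1 \<and> segment_integral \<rho> w (z - w) < 1"
    if \<rho>[measurable]: "\<rho> \<in> borel_measurable borel" and small: "(\<integral>\<^sup>+x. \<rho> x ^ ?n \<partial>lborel) < ennreal \<epsilon>"
      and K: "compact K" "connected K" "p \<in> K" "q \<in> K" "\<delta> \<le> dist p q" and pT: "cball p \<delta> \<subseteq> ball 0 T" for \<rho> K p q
  proof (rule ccontr)
    assume neg: "\<not> ?thesis"
    define \<mu> where "\<mu> = density lborel (\<lambda>x. \<rho> x ^ ?n)"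
    have s\<mu>: "sets \<mu> = sets borel" by (simp add: \<mu>_def)
    have e\<mu>: "emeasure \<mu> X = (\<integral>\<^sup>+x\<in>X. \<rho> x ^ ?n \<partial>lborel)" if "X \<in> sets borel" for X
      unfolding \<mu>_def using that by (intro emeasure_density) auto
    have "emeasure \<mu> UNIV = (\<integral>\<^sup>+x. \<rho> x ^ ?n \<partial>lborel)" using e\<mu>[of UNIV] by simp
    also have "\<dots> < ennreal (c * \<delta> / 10)"
      using small by (rule less_le_trans) (simp add: \<epsilon>_def ennreal_leI)
    finally have "emeasure \<mu> UNIV < ennreal (c * \<delta> / 10)" .
    from exists_good_centre[OF s\<mu> K \<delta> c this, of d]
    obtain y where y: "y \<in> K" "y \<in> cball p \<delta>"
       "\<And>r. 0 < r \<Longrightarrow> r \<le> d \<Longrightarrow> emeasure \<mu> (ball y r) \<le> ennreal (c * r)" by blast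
    have "(\<integral>\<^sup>+w\<in>ball y d. segment_integral \<rho> y (w - y) \<partial>lborel) \<le>
      ennreal (d * real ?n * (a * unit_ball_vol ?n * d ^ ?n + c * d / a ^ (?n - 1)))"
      using c y(3) e\<mu> by (intro mean_segment_integral d a) auto
    then have m1: "(\<integral>\<^sup>+w\<in>ball y d. segment_integral \<rho> y (w - y) \<partial>lborel) \<le> ennreal (\<beta> / 4)"
      using mean unfolding \<Omega>_def by (simp only:)
    have yB: "y \<in> B" using y pT by (auto simp: B_def)
    have Bd: "B \<subseteq> ball y d"
    proof
      fix w assume "w \<in> B"
      then show "w \<in> ball y d"
        using yB norm_triangle_ineq4[of y w] by (simp add: B_def d_def dist_norm)
    qed
    define G where "G = {w \<in> B. segment_integral \<rho> y (w - y) < 1}"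
    define H where "H = {w \<in> B. 1 \<le> segment_integral \<rho> y (w - y)}"
    have [measurable]: "G \<in> sets borel" "H \<in> sets borel"
      unfolding G_def H_def by measurable
    have "emeasure lborel H = (\<integral>\<^sup>+w. indicator H w \<partial>lborel)" by simp
    also have "\<dots> \<le> (\<integral>\<^sup>+w\<in>ball y d. segment_integral \<rho> y (w - y) \<partial>lborel)"
      using Bd by (intro nn_integral_mono) (auto simp: indicator_def H_def)
    also note m1
    finally have H: "emeasure lborel H \<le> ennreal (\<beta> / 4)" .
    have "G \<subseteq> B" by (auto simp: G_def)
    then have "emeasure lborel G \<le> ennreal \<beta>" using emeasure_mono[of G B lborel] eB by simp
    then have "emeasure lborel G < top" by (rule le_less_trans) simp
    then obtain g where g: "g \<ge> 0" "emeasure lborel G = ennreal g" by (cases "emeasure lborel G") auto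
    have "B = G \<union> H" by (auto simp: G_def H_def)
    then have "ennreal \<beta> \<le> emeasure lborel G + emeasure lborel H"
      using emeasure_subadditive[of G lborel H] eB by simp
    also have "\<dots> \<le> ennreal g + ennreal (\<beta> / 4)" unfolding g(2) by (rule add_left_mono) (rule H)
    also have "\<dots> = ennreal (g + \<beta> / 4)" using g \<beta> by (intro ennreal_plus[symmetric]) auto
    finally have "\<beta> \<le> g + \<beta> / 4" using g \<beta> by (subst (asm) ennreal_le_iff) auto
    then have g34: "g \<ge> 3 / 4 * \<beta>" by simp
    have far: "1 \<le> segment_integral \<rho> w (z - w)" if "w \<in> G" "z \<in> Z" for w z
    proof -
      have "\<not> (segment_integral \<rho> y (w - y) < 1 \<and> segment_integral \<rho> w (z - w) < 1)"
        using neg that(2) y(1) by blast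
      moreover have "segment_integral \<rho> y (w - y) < 1" using that(1) by (simp add: G_def)
      ultimately have "\<not> segment_integral \<rho> w (z - w) < 1" by blast
      then show ?thesis by (simp only: not_less)
    qed
    have "ennreal (\<zeta> * g) = (\<integral>\<^sup>+w. ennreal \<zeta> * indicator G w \<partial>lborel)"
      using \<zeta> g by (simp add: nn_integral_cmult_indicator ennreal_mult)
    also have "\<dots> \<le> (\<integral>\<^sup>+w\<in>B. (\<integral>\<^sup>+z\<in>B. segment_integral \<rho> w (z - w) \<partial>lborel) \<partial>lborel)"
    proof (rule nn_integral_mono)
      fix w
      show "ennreal \<zeta> * indicator G w \<le> (\<integral>\<^sup>+z\<in>B. segment_integral \<rho> w (z - w) \<partial>lborel) * indicator B w"
      proof (cases "w \<in> G")
        case True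
        have "ennreal \<zeta> = (\<integral>\<^sup>+z. indicator Z z \<partial>lborel)" using \<zeta>(2) by simp
        also have "\<dots> \<le> (\<integral>\<^sup>+z\<in>B. segment_integral \<rho> w (z - w) \<partial>lborel)"
          using far[OF True] ZB by (intro nn_integral_mono) (auto simp: indicator_def)
        finally show ?thesis using True \<open>G \<subseteq> B\<close> by auto
      qed simp
    qed
    also have "\<dots> \<le> ennreal (2 * T) * (ennreal (2 ^ ?n) * (\<integral>\<^sup>+x\<in>B. \<rho> x \<partial>lborel) * emeasure lborel B)"
      unfolding B_def by (rule mean_segment_pairs[OF \<rho> T])
    also have "\<dots> \<le> ennreal (2 * T) * (ennreal (2 ^ ?n) * ennreal (e1 * \<beta> + 1 / e1 ^ (?n - 1) * e2) * ennreal \<beta>)"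
    proof -
      have "(\<integral>\<^sup>+x\<in>B. \<rho> x \<partial>lborel) \<le> ennreal e1 * emeasure lborel B + ennreal (1 / e1 ^ (?n - 1)) * (\<integral>\<^sup>+x\<in>B. \<rho> x ^ ?n \<partial>lborel)"
        by (rule nn_integral_young[OF \<rho> B e1])
      also have "\<dots> \<le> ennreal e1 * ennreal \<beta> + ennreal (1 / e1 ^ (?n - 1)) * ennreal e2"
      proof -
        have "(\<integral>\<^sup>+x\<in>B. \<rho> x ^ ?n \<partial>lborel) \<le> (\<integral>\<^sup>+x. \<rho> x ^ ?n \<partial>lborel)"
          by (intro nn_integral_mono) (auto simp: indicator_def)
        also have "\<dots> \<le> ennreal \<epsilon>" using small by (rule less_imp_le)
        also have "\<dots> \<le> ennreal e2" by (rule ennreal_leI) (simp add: \<epsilon>_def)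
        finally show ?thesis unfolding eB by (intro add_left_mono mult_left_mono) auto
      qed
      also have "\<dots> = ennreal (e1 * \<beta> + 1 / e1 ^ (?n - 1) * e2)"
        using e1 e2 \<beta> by (simp add: ennreal_mult[symmetric] ennreal_plus[symmetric] del: ennreal_plus)
      finally show ?thesis unfolding eB by (intro mult_left_mono mult_right_mono) auto
    qed
    also have "\<dots> = ennreal (2 * T * (2 ^ ?n * (e1 * \<beta> + 1 / e1 ^ (?n - 1) * e2) * \<beta>))"
    proof -
      have "0 \<le> e1 * \<beta> + 1 / e1 ^ (?n - 1) * e2" using e1 e2 \<beta> by simp
      then show ?thesis using T \<beta> by (simp only: ennreal_mult[symmetric] mult_nonneg_nonneg zero_le_power zero_le_numeral less_imp_le)
    qed
    also have "\<dots> = ennreal (\<beta> * \<zeta> / 4)" unfolding pairs ..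
    finally have "\<zeta> * g \<le> \<beta> * \<zeta> / 4" using \<zeta> \<beta> by (subst (asm) ennreal_le_iff) auto
    moreover have "\<zeta> * (3 / 4 * \<beta>) \<le> \<zeta> * g" using g34 \<zeta> by (intro mult_left_mono) auto
    moreover have "\<zeta> * \<beta> > 0" using \<zeta>0 \<beta> by simp
    moreover have "\<zeta> * (3 / 4 * \<beta>) = 3 / 4 * (\<zeta> * \<beta>)" "\<beta> * \<zeta> / 4 = (\<zeta> * \<beta>) / 4" by simp_all
    ultimately show False by linarith
  qed
  ultimately show ?thesis by blast
qed

section \<open>Maps that avoid the edges of a cubical grid\<close>

text \<open>\<open>h\<close> is deformed to \<open>g\<close>, and \<open>g\<close> to
  \<open>- \<theta>\<close>, along segments that avoid the origin.\<close>

lemma nullhomotopic_if_close_to_small_image: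
  fixes h g :: "'a::euclidean_space \<Rightarrow> 'b::euclidean_space"
  assumes h: "continuous_on F h" "h \<in> F \<rightarrow> sphere 0 1" and g: "continuous_on F g"
    and close: "\<And>x. x \<in> F \<Longrightarrow> norm (g x - h x) < 1"
    and theta: "\<theta> \<in> sphere 0 1" "\<And>x t. x \<in> F \<Longrightarrow> t > 0 \<Longrightarrow> g x \<noteq> t *\<^sub>R \<theta>"
  shows "\<exists>c. homotopic_with_canon (\<lambda>x. True) F (sphere 0 1) h (\<lambda>x. c)"
proof -
  let ?nz = "- {0::'b}"
  have h1: "norm (h x) = 1" if "x \<in> F" for x using h(2) that by auto
  have seg1: "closed_segment (h x) (g x) \<subseteq> ?nz" if x: "x \<in> F" for x
  proof -
    have "(1 - t) *\<^sub>R h x + t *\<^sub>R g x \<noteq> 0" if "0 \<le> t" "t \<le> 1" for t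
    proof
      assume "(1 - t) *\<^sub>R h x + t *\<^sub>R g x = 0"
      then have "h x = - (t *\<^sub>R (g x - h x))" by (simp add: algebra_simps eq_neg_iff_add_eq_0)
      then have "norm (h x) = norm (t *\<^sub>R (g x - h x))" by (metis norm_minus_cancel)
      also have "\<dots> = t * norm (g x - h x)" using that by simp
      also have "\<dots> \<le> 1 * norm (g x - h x)" using that by (intro mult_right_mono) auto
      finally show False using h1[OF x] close[OF x] by simp
    qed
    then show ?thesis by (auto simp: closed_segment_def)
  qed
  have g0: "g x \<noteq> 0" if "x \<in> F" for x using seg1[OF that] by auto
  have seg2: "closed_segment (g x) (- \<theta>) \<subseteq> ?nz" if x: "x \<in> F" for x
  proof -
    have "(1 - t) *\<^sub>R g x + t *\<^sub>R (- \<theta>) \<noteq> 0" if t: "0 \<le> t" "t \<le> 1" for t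
    proof
      assume "(1 - t) *\<^sub>R g x + t *\<^sub>R (- \<theta>) = 0"
      then have e: "(1 - t) *\<^sub>R g x = t *\<^sub>R \<theta>" by simp
      have "\<theta> \<noteq> 0" using theta(1) by auto
      then have "t < 1" using e t by (cases "t = 1") auto
      moreover from this e have "g x = (t / (1 - t)) *\<^sub>R \<theta>"
        by (metis (no_types, lifting) diff_gt_0_iff_gt divide_inverse_commute less_numeral_extra(3) real_vector_affinity_eq scaleR_scaleR vector_fraction_eq_iff)
      moreover have "t > 0" using g0[OF x] calculation t by (cases "t = 0") auto
      ultimately show False using theta(2)[OF x, of "t / (1 - t)"] by simp
    qed
    then show ?thesis by (auto simp: closed_segment_def)
  qed
  have "homotopic_with_canon (\<lambda>x. True) F ?nz h g"
    by (rule homotopic_with_linear[OF h(1) g seg1])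
  moreover have "homotopic_with_canon (\<lambda>x. True) F ?nz g (\<lambda>x. - \<theta>)"
    by (rule homotopic_with_linear[OF g continuous_on_const seg2])
  ultimately have "homotopic_with_canon (\<lambda>x. True) F ?nz h (\<lambda>x. - \<theta>)" by (rule homotopic_with_trans)
  then have "homotopic_with_canon (\<lambda>x. True) F (sphere 0 1) ((\<lambda>v. v /\<^sub>R norm v) \<circ> h) ((\<lambda>v. v /\<^sub>R norm v) \<circ> (\<lambda>x. - \<theta>))"
    by (rule homotopic_with_compose_continuous_left) (auto intro!: continuous_intros)
  then have "homotopic_with_canon (\<lambda>x. True) F (sphere 0 1) h (\<lambda>x. - \<theta>)"
    by (rule homotopic_with_eq) (use h1 theta(1) in auto)
  then show ?thesis by blast
qed

text \<open>Countably many proper subspaces form a null set.\<close>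

lemma small_span_union_misses_direction:
  fixes \<C> :: "'a::euclidean_space set set"
  assumes "countable \<C>" "\<And>C. C \<in> \<C> \<Longrightarrow> finite C \<and> card C < DIM('a)"
  shows "\<exists>\<theta>\<in>sphere 0 1. \<forall>t>0. t *\<^sub>R \<theta> \<notin> (\<Union>C\<in>\<C>. span C)"
proof -
  have "negligible (span C)" if "C \<in> \<C>" for C
  proof (rule negligible_lowdim)
    show "dim (span C) < DIM('a)" using assms(2)[OF that] dim_le_card'[of C] by simp
  qed
  then have neg: "negligible (\<Union>C\<in>\<C>. span C)"
    using assms(1) by (intro negligible_countable_Union) auto
  have "\<exists>v. v \<notin> (\<Union>C\<in>\<C>. span C) \<and> v \<noteq> 0"
  proof (rule ccontr)
    assume "\<not> ?thesis"
    then have "UNIV = insert 0 (\<Union>C\<in>\<C>. span C)" by auto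
    moreover have "negligible (insert 0 (\<Union>C\<in>\<C>. span C))" using neg by simp
    ultimately show False using non_negligible_UNIV by metis
  qed
  then obtain v where v: "v \<notin> (\<Union>C\<in>\<C>. span C)" "v \<noteq> 0" by blast
  show ?thesis
  proof (rule bexI[of _ "v /\<^sub>R norm v"], intro allI impI notI)
    fix t :: real assume t: "t > 0" "t *\<^sub>R (v /\<^sub>R norm v) \<in> (\<Union>C\<in>\<C>. span C)"
    then obtain C where C: "C \<in> \<C>" "t *\<^sub>R (v /\<^sub>R norm v) \<in> span C" by blast
    have "(norm v / t) *\<^sub>R (t *\<^sub>R (v /\<^sub>R norm v)) \<in> span C" by (rule span_scale) (rule C(2))
    moreover have "(norm v / t) *\<^sub>R (t *\<^sub>R (v /\<^sub>R norm v)) = v" using t v by simp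
    ultimately show False using v C by auto
  qed (use v in auto)
qed

text \<open>By the Lindelof property, countably many neighbourhoods on which \<open>c\<close> is constant
  cover \<open>G\<close>.\<close>

lemma countable_range_locally_constant:
  fixes c :: "'a::euclidean_space \<Rightarrow> 'b"
  assumes "\<And>x. x \<in> G \<Longrightarrow> \<exists>\<theta>>0. \<forall>x'\<in>G. dist x' x < \<theta> \<longrightarrow> c x' = c x"
  shows "countable (c ` G)"
proof -
  obtain \<theta> where \<theta>: "\<And>x. x \<in> G \<Longrightarrow> \<theta> x > (0::real)" "\<And>x x'. x \<in> G \<Longrightarrow> x' \<in> G \<Longrightarrow> dist x' x < \<theta> x \<Longrightarrow> c x' = c x"
    using assms by metis
  define \<F> where "\<F> = (\<lambda>x. ball x (\<theta> x)) ` G"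
  obtain \<F>' where \<F>': "\<F>' \<subseteq> \<F>" "countable \<F>'" "\<Union>\<F>' = \<Union>\<F>"
    using Lindelof[of \<F>] by (auto simp: \<F>_def)
  have "\<forall>U\<in>\<F>'. \<exists>x. x \<in> G \<and> U = ball x (\<theta> x)" using \<F>'(1) by (auto simp: \<F>_def)
  then obtain p where p: "\<And>U. U \<in> \<F>' \<Longrightarrow> p U \<in> G \<and> U = ball (p U) (\<theta> (p U))" by metis
  have "c ` G \<subseteq> (\<lambda>U. c (p U)) ` \<F>'"
  proof
    fix v assume "v \<in> c ` G"
    then obtain x where x: "x \<in> G" "v = c x" by blast
    have "ball x (\<theta> x) \<in> \<F>" "x \<in> ball x (\<theta> x)" using x \<theta>(1) by (auto simp: \<F>_def)
    then have "x \<in> \<Union>\<F>" by blast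
    then obtain U where U: "U \<in> \<F>'" "x \<in> U" using \<F>'(3) by blast
    have "x \<in> ball (p U) (\<theta> (p U))" using p[OF U(1)] U(2) by blast
    then have "dist x (p U) < \<theta> (p U)" by (simp add: dist_commute)
    then have "c x = c (p U)" using \<theta>(2)[of "p U" x] p[OF U(1)] x(1) by blast
    then show "v \<in> (\<lambda>U. c (p U)) ` \<F>'" using U x by blast
  qed
  then show ?thesis by (rule countable_subset) (rule countable_image[OF \<F>'(2)])
qed

text \<open>Two points are equivalent if a \<open>\<delta>\<close>-chain with constant key joins them.
  Classes are open in \<open>G\<close>, so one representative for each class is a locally constant
  choice.\<close>

lemma locally_constant_selection:
  fixes G :: "'a::metric_space set" and key :: "'a \<Rightarrow> 'k"
  assumes loc: "\<And>x. x \<in> G \<Longrightarrow> \<exists>\<theta>>0. \<forall>x'\<in>G. dist x' x < \<theta> \<longrightarrow> key x' = key x" and \<delta>: "\<delta> > 0"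
    and chains: "\<And>x (k::nat). (\<And>i. i \<le> k \<Longrightarrow> x i \<in> G \<and> key (x i) = key (x 0)) \<Longrightarrow>
      (\<And>i. i < k \<Longrightarrow> dist (x i) (x (Suc i)) < \<delta>) \<Longrightarrow> dist (x 0) (x k) < \<eta>"
  shows "\<exists>c. \<forall>x\<in>G. c x \<in> G \<and> dist (c x) x < \<eta> \<and> (\<exists>\<theta>>0. \<forall>x'\<in>G. dist x' x < \<theta> \<longrightarrow> c x' = c x)"
proof -
  define R where "R = {(x, x'). x \<in> G \<and> x' \<in> G \<and> dist x x' < \<delta> \<and> key x = key x'}"
  have symR: "sym (R\<^sup>*)" by (rule sym_rtrancl) (auto simp: sym_def R_def dist_commute)
  define c where "c = (\<lambda>x. SOME z. (x, z) \<in> R\<^sup>*)"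
  have cR: "(x, c x) \<in> R\<^sup>*" for x unfolding c_def by (rule someI[of _ x]) simp
  have same: "c x' = c x" if "(x', x) \<in> R" for x x'
  proof -
    have "(x', x) \<in> R\<^sup>*" "(x, x') \<in> R\<^sup>*" using that symD[OF symR] by auto
    then have "(x', z) \<in> R\<^sup>* \<longleftrightarrow> (x, z) \<in> R\<^sup>*" for z by (meson rtrancl_trans)
    then show ?thesis unfolding c_def by simp
  qed
  have near: "z \<in> G \<and> dist x z < \<eta>" if x: "x \<in> G" and z: "(x, z) \<in> R\<^sup>*" for x z
  proof -
    obtain k where "(x, z) \<in> R ^^ k" using z rtrancl_imp_relpow by blast
    then obtain g where g: "g 0 = x" "g k = z" "\<forall>i<k. (g i, g (Suc i)) \<in> R"
      unfolding relpow_fun_conv by blast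
    have all: "i \<le> k \<longrightarrow> g i \<in> G \<and> key (g i) = key (g 0)" for i
    proof (induction i)
      case (Suc i)
      show ?case
      proof
        assume "Suc i \<le> k"
        then have "(g i, g (Suc i)) \<in> R" "g i \<in> G \<and> key (g i) = key (g 0)" using g(3) Suc by auto
        then show "g (Suc i) \<in> G \<and> key (g (Suc i)) = key (g 0)" by (auto simp: R_def)
      qed
    qed (use x g in auto)
    have "dist (g 0) (g k) < \<eta>"
    proof (rule chains)
      show "g i \<in> G \<and> key (g i) = key (g 0)" if "i \<le> k" for i using all that by blast
      show "dist (g i) (g (Suc i)) < \<delta>" if "i < k" for i
      proof -
        have "(g i, g (Suc i)) \<in> R" using g(3) that by blast
        then show ?thesis by (simp add: R_def)
      qed
    qed
    then show ?thesis using all[of k] g by simp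
  qed
  show ?thesis
  proof (rule exI[of _ c], intro ballI conjI)
    fix x assume x: "x \<in> G"
    show "c x \<in> G" "dist (c x) x < \<eta>" using near[OF x cR] by (auto simp: dist_commute)
    obtain \<theta> where \<theta>: "\<theta> > 0" "\<forall>x'\<in>G. dist x' x < \<theta> \<longrightarrow> key x' = key x" using loc[OF x] by blast
    have "c x' = c x" if "x' \<in> G" "dist x' x < min \<theta> \<delta>" for x'
      using that x \<theta>(2) by (intro same) (auto simp: R_def)
    then show "\<exists>\<theta>>0. \<forall>x'\<in>G. dist x' x < \<theta> \<longrightarrow> c x' = c x"
      using \<theta>(1) \<delta> by (intro exI[of _ "min \<theta> \<delta>"]) auto
  qed
qed

lemma infdist_Ints_pos_iff: "infdist u \<int> > 0 \<longleftrightarrow> (u::real) \<notin> \<int>"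
proof -
  have "closed (\<int> :: real set)" by (rule closed_Ints)
  moreover have "(\<int> :: real set) \<noteq> {}" using Ints_0 by blast
  ultimately have "infdist u \<int> = 0 \<longleftrightarrow> u \<in> \<int>" using in_closed_iff_infdist_zero by blast
  then show ?thesis using infdist_nonneg[of u "\<int>"] by linarith
qed

lemma infdist_Ints_round: "infdist u \<int> = \<bar>(u::real) - of_int (round u)\<bar>"
proof (rule antisym)
  show "infdist u \<int> \<le> \<bar>u - of_int (round u)\<bar>"
    using infdist_le[of "of_int (round u)" "\<int>" u] by (simp add: dist_real_def)
  have "\<bar>u - of_int (round u)\<bar> \<le> dist u m" if "m \<in> \<int>" for m
    using that round_diff_minimal[of u] by (auto elim!: Ints_cases simp: dist_real_def)
  then show "\<bar>u - of_int (round u)\<bar> \<le> infdist u \<int>"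
    by (subst infdist_notempty) (auto intro!: cINF_greatest)
qed

text \<open>The grid has mesh \<open>l\<close> and a vertex at \<open>\<tau>\<close>; integer coordinates
  mark its hyperplanes.\<close>

definition grid_coord :: "real \<Rightarrow> 'a::euclidean_space \<Rightarrow> 'a \<Rightarrow> 'a \<Rightarrow> real" where
  "grid_coord l \<tau> i y = ((y - \<tau>) \<bullet> i) / l"

text \<open>The weight is positive where the coordinates in the directions \<open>I\<close> are no integers
  and all farther from the integers than the remaining ones, which is a neighbourhood of the open
  grid faces that are parallel to \<open>I\<close>.\<close>

definition face_weight :: "real \<Rightarrow> 'a::euclidean_space \<Rightarrow> 'a set \<Rightarrow> 'a \<Rightarrow> real" where
  "face_weight l \<tau> I y = (\<Prod>i\<in>I. infdist (grid_coord l \<tau> i y) \<int>) *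
     (\<Prod>i\<in>I. \<Prod>j\<in>Basis - I. max 0 (infdist (grid_coord l \<tau> i y) \<int> - infdist (grid_coord l \<tau> j y) \<int>))"

text \<open>The grid face parallel to \<open>I\<close> that is nearest to \<open>y\<close>: rounding down
  selects the interval of the face in its own directions.\<close>

definition face_key :: "real \<Rightarrow> 'a::euclidean_space \<Rightarrow> 'a set \<Rightarrow> 'a \<Rightarrow> 'a \<Rightarrow> int" where
  "face_key l \<tau> I y = (\<lambda>i. if i \<notin> Basis then 0 else if i \<in> I then \<lfloor>grid_coord l \<tau> i y\<rfloor> else round (grid_coord l \<tau> i y))"

lemma continuous_grid_coord[continuous_intros]: "continuous_on X (grid_coord l \<tau> i)"
  unfolding grid_coord_def divide_inverse by (intro continuous_intros)

lemma face_weight_nonneg: "face_weight l \<tau> I y \<ge> 0"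
  unfolding face_weight_def by (intro mult_nonneg_nonneg prod_nonneg) (auto simp: infdist_nonneg intro!: prod_nonneg)

lemma continuous_face_weight: "continuous_on X (face_weight l \<tau> I)"
  unfolding face_weight_def by (intro continuous_intros)

lemma face_weight_pos_iff:
  assumes I: "I \<subseteq> Basis"
  shows "face_weight l \<tau> I y > 0 \<longleftrightarrow> (\<forall>i\<in>I. infdist (grid_coord l \<tau> i y) \<int> > 0) \<and>
    (\<forall>i\<in>I. \<forall>j\<in>Basis - I. infdist (grid_coord l \<tau> j y) \<int> < infdist (grid_coord l \<tau> i y) \<int>)"
proof -
  have fI: "finite I" using I finite_Basis finite_subset by blast
  have "face_weight l \<tau> I y > 0 \<longleftrightarrow> face_weight l \<tau> I y \<noteq> 0" using face_weight_nonneg[of l \<tau> I y] by linarith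
  also have "\<dots> \<longleftrightarrow> (\<forall>i\<in>I. infdist (grid_coord l \<tau> i y) \<int> \<noteq> 0) \<and>
    (\<forall>i\<in>I. \<forall>j\<in>Basis - I. max 0 (infdist (grid_coord l \<tau> i y) \<int> - infdist (grid_coord l \<tau> j y) \<int>) \<noteq> 0)"
    unfolding face_weight_def using fI by simp
  also have "\<dots> \<longleftrightarrow> (\<forall>i\<in>I. infdist (grid_coord l \<tau> i y) \<int> > 0) \<and>
    (\<forall>i\<in>I. \<forall>j\<in>Basis - I. infdist (grid_coord l \<tau> j y) \<int> < infdist (grid_coord l \<tau> i y) \<int>)"
  proof -
    have "infdist u \<int> \<noteq> 0 \<longleftrightarrow> infdist u \<int> > 0" for u :: real using infdist_nonneg[of u "\<int>"] by linarith
    moreover have "max 0 (a - b) \<noteq> 0 \<longleftrightarrow> b < a" for a b :: real by (auto simp: max_def)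
    ultimately show ?thesis by simp
  qed
  finally show ?thesis .
qed

text \<open>If \<open>i \<in> I - J\<close> and \<open>j \<in> J - I\<close>, each of the two coordinates
  would be farther from the integers than the other.\<close>

lemma face_weight_nested:
  assumes "I \<subseteq> Basis" "J \<subseteq> Basis" "face_weight l \<tau> I y > 0" "face_weight l \<tau> J y > 0"
  shows "I \<subseteq> J \<or> J \<subseteq> I"
proof (rule ccontr)
  assume "\<not> ?thesis"
  then obtain i j where ij: "i \<in> I" "i \<notin> J" "j \<in> J" "j \<notin> I" by blast
  then have "infdist (grid_coord l \<tau> j y) \<int> < infdist (grid_coord l \<tau> i y) \<int>"
    using assms(2,3) unfolding face_weight_pos_iff[OF assms(1)] by blast
  moreover have "infdist (grid_coord l \<tau> i y) \<int> < infdist (grid_coord l \<tau> j y) \<int>"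
    using ij assms(1,4) unfolding face_weight_pos_iff[OF assms(2)] by blast
  ultimately show False by linarith
qed

lemma face_key_close:
  fixes y y' :: "'a::euclidean_space"
  assumes l: "l > 0" and k: "face_key l \<tau> I y = face_key l \<tau> I y'"
  shows "dist y y' \<le> real DIM('a) * l"
proof -
  have "\<bar>(y - y') \<bullet> i\<bar> \<le> l" if i: "i \<in> Basis" for i
  proof -
    have ki: "face_key l \<tau> I y i = face_key l \<tau> I y' i" using k by simp
    have "\<bar>grid_coord l \<tau> i y - grid_coord l \<tau> i y'\<bar> \<le> 1"
    proof (cases "i \<in> I")
      case True
      then have "\<lfloor>grid_coord l \<tau> i y\<rfloor> = \<lfloor>grid_coord l \<tau> i y'\<rfloor>" using ki i by (simp add: face_key_def)
      then show ?thesis by linarith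
    next
      case False
      then have "round (grid_coord l \<tau> i y) = round (grid_coord l \<tau> i y')" using ki i by (simp add: face_key_def)
      then show ?thesis using of_int_round_abs_le[of "grid_coord l \<tau> i y"] of_int_round_abs_le[of "grid_coord l \<tau> i y'"] by linarith
    qed
    moreover have "grid_coord l \<tau> i y - grid_coord l \<tau> i y' = ((y - y') \<bullet> i) / l"
      by (simp add: grid_coord_def diff_divide_distrib[symmetric] inner_diff_left)
    ultimately show ?thesis using l by (simp add: abs_divide)
  qed
  then have "(\<Sum>i\<in>Basis. \<bar>(y - y') \<bullet> i\<bar>) \<le> (\<Sum>i\<in>(Basis::'a set). l)" by (rule sum_mono)
  then show ?thesis using norm_le_l1[of "y - y'"] by (simp add: dist_norm)
qed

lemma face_key_locally_constant:
  fixes y :: "'a::euclidean_space"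
  assumes I: "I \<subseteq> Basis" "I \<noteq> {}" and w: "face_weight l \<tau> I y > 0"
  shows "eventually (\<lambda>y'. face_key l \<tau> I y' = face_key l \<tau> I y) (nhds y)"
proof -
  have lim: "((\<lambda>y'. grid_coord l \<tau> i y') \<longlongrightarrow> grid_coord l \<tau> i y) (nhds y)" for i
    using continuous_grid_coord[of UNIV l \<tau> i] by (simp add: continuous_on_eq_continuous_at isCont_def tendsto_at_iff_tendsto_nhds)
  have "eventually (\<lambda>y'. face_key l \<tau> I y' i = face_key l \<tau> I y i) (nhds y)" if i: "i \<in> Basis" for i
  proof (cases "i \<in> I")
    case True
    let ?u = "grid_coord l \<tau> i y"
    have "?u \<notin> \<int>" using w True unfolding face_weight_pos_iff[OF I(1)] infdist_Ints_pos_iff by blast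
    then have "of_int \<lfloor>?u\<rfloor> < ?u" by (metis Ints_of_int antisym_conv1 of_int_floor_le)
    then have "eventually (\<lambda>y'. of_int \<lfloor>?u\<rfloor> < grid_coord l \<tau> i y') (nhds y)" by (rule order_tendstoD(1)[OF lim])
    moreover have "eventually (\<lambda>y'. grid_coord l \<tau> i y' < of_int \<lfloor>?u\<rfloor> + 1) (nhds y)"
      by (rule order_tendstoD(2)[OF lim]) linarith
    ultimately show ?thesis
    proof eventually_elim
      case (elim y')
      then have "\<lfloor>grid_coord l \<tau> i y'\<rfloor> = \<lfloor>?u\<rfloor>" by linarith
      then show ?case using True i by (simp add: face_key_def)
    qed
  next
    case False
    let ?u = "grid_coord l \<tau> i y"
    obtain k where k: "k \<in> I" using I(2) by blast
    have "infdist ?u \<int> < infdist (grid_coord l \<tau> k y) \<int>"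
      using w False i k unfolding face_weight_pos_iff[OF I(1)] by blast
    also have "\<dots> \<le> 1/2" unfolding infdist_Ints_round using of_int_round_abs_le[of "grid_coord l \<tau> k y"] by linarith
    finally have "\<bar>?u - of_int (round ?u)\<bar> < 1/2" unfolding infdist_Ints_round .
    then have b: "of_int (round ?u) - 1/2 < ?u" "?u < of_int (round ?u) + 1/2" by linarith+
    have "eventually (\<lambda>y'. of_int (round ?u) - 1/2 < grid_coord l \<tau> i y') (nhds y)"
      by (rule order_tendstoD(1)[OF lim b(1)])
    moreover have "eventually (\<lambda>y'. grid_coord l \<tau> i y' < of_int (round ?u) + 1/2) (nhds y)"
      by (rule order_tendstoD(2)[OF lim b(2)])
    ultimately show ?thesis
    proof eventually_elim
      case (elim y')
      have "round (grid_coord l \<tau> i y') = round ?u"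
        by (rule round_unique) (use elim in linarith)+
      then show ?case using False i by (simp add: face_key_def)
    qed
  qed
  then have "eventually (\<lambda>y'. \<forall>i\<in>Basis. face_key l \<tau> I y' i = face_key l \<tau> I y i) (nhds y)"
    by (intro eventually_ball_finite) auto
  then show ?thesis
  proof eventually_elim
    case (elim y')
    show ?case
    proof
      fix i
      show "face_key l \<tau> I y' i = face_key l \<tau> I y i"
        using elim by (cases "i \<in> Basis") (auto simp: face_key_def)
    qed
  qed
qed

text \<open>The factor \<open>k\<close> jumps only where the weight vanishes, and is bounded.\<close>

lemma continuous_weighted_locally_constant:
  fixes w :: "'a::metric_space \<Rightarrow> real" and k :: "'a \<Rightarrow> 'b::real_normed_vector"
  assumes w: "continuous_on F w" "\<And>x. x \<in> F \<Longrightarrow> w x \<ge> 0"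
    and k: "\<And>x. x \<in> F \<Longrightarrow> w x > 0 \<Longrightarrow> norm (k x) \<le> 1"
    and loc: "\<And>x. x \<in> F \<Longrightarrow> w x > 0 \<Longrightarrow> \<exists>\<theta>>0. \<forall>x'\<in>F. w x' > 0 \<and> dist x' x < \<theta> \<longrightarrow> k x' = k x"
  shows "continuous_on F (\<lambda>x. w x *\<^sub>R k x)"
  unfolding continuous_on_def
proof
  fix x assume x: "x \<in> F"
  have lim: "(w \<longlongrightarrow> w x) (at x within F)" using w(1) x by (simp add: continuous_on_def)
  show "((\<lambda>x. w x *\<^sub>R k x) \<longlongrightarrow> w x *\<^sub>R k x) (at x within F)"
  proof (cases "w x > 0")
    case True
    obtain \<theta> where \<theta>: "\<theta> > 0" "\<forall>x'\<in>F. w x' > 0 \<and> dist x' x < \<theta> \<longrightarrow> k x' = k x" using loc[OF x True] by blast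
    have "eventually (\<lambda>x'. 0 < w x') (at x within F)" by (rule order_tendstoD(1)[OF lim True])
    moreover have "eventually (\<lambda>x'. x' \<in> F \<and> dist x' x < \<theta>) (at x within F)"
      unfolding eventually_at using \<theta>(1) by blast
    ultimately have "eventually (\<lambda>x'. w x' *\<^sub>R k x = w x' *\<^sub>R k x') (at x within F)"
      by eventually_elim (use \<theta>(2) in simp)
    moreover have "((\<lambda>x'. w x' *\<^sub>R k x) \<longlongrightarrow> w x *\<^sub>R k x) (at x within F)" by (intro tendsto_intros lim)
    ultimately show ?thesis by (rule Lim_transform_eventually[rotated])
  next
    case False
    then have w0: "w x = 0" using w(2)[OF x] by simp
    have "((\<lambda>x. w x *\<^sub>R k x) \<longlongrightarrow> 0) (at x within F)"
    proof (rule Lim_null_comparison)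
      have "eventually (\<lambda>x'. x' \<in> F) (at x within F)" unfolding eventually_at by (intro exI[of _ 1]) auto
      then show "eventually (\<lambda>x'. norm (w x' *\<^sub>R k x') \<le> w x') (at x within F)"
      proof eventually_elim
        case (elim x')
        show ?case
        proof (cases "w x' > 0")
          case True
          then show ?thesis using k[OF elim True] by (simp add: mult_left_le)
        next
          case False
          then have "w x' = 0" using w(2)[OF elim] by simp
          then show ?thesis by simp
        qed
      qed
      show "(w \<longlongrightarrow> 0) (at x within F)" using lim w0 by simp
    qed
    then show ?thesis using w0 by simp
  qed
qed

text \<open>A point whose image is on no grid edge has a positive \<open>face_weight\<close> for some face
  of dimension at least \<open>2\<close>. By \<open>face_weight_nested\<close> the directions of
  these faces form a chain, so there are at most \<open>n - 1\<close> of them at each point: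
  \<open>F\<close> looks like a space of dimension at most \<open>n - 2\<close>, and maps from
  such spaces to the \<open>(n-1)\<close>-sphere are inessential.

  Concretely, \<open>h\<close> is replaced by a partition of unity combination \<open>g\<close> of
  values of \<open>h\<close> at nearby points \<open>c I x\<close>, chosen locally constantly; on
  a fine grid they are close to \<open>x\<close> by \<open>small_chains\<close>. There are
  countably many values, and each value of \<open>g\<close> is a combination of at most
  \<open>n - 1\<close> of them, so \<open>g\<close> misses a whole ray.\<close>

lemma grid_avoiding_map_nullhomotopic:
  fixes f h :: "'a::euclidean_space \<Rightarrow> 'a"
  assumes K: "compact K" and f: "continuous_on K f" and fin: "\<And>y. finite {x\<in>K. f x = y}"
    and h: "continuous_on K h" "h \<in> K \<rightarrow> sphere 0 1"
  shows "\<exists>l0>0. \<forall>l \<tau> F. 0 < l \<and> l \<le> l0 \<and> F \<subseteq> K \<and>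
     (\<forall>x\<in>F. \<not> (\<exists>i\<in>Basis. \<forall>j\<in>Basis - {i}. grid_coord l \<tau> j (f x) \<in> \<int>)) \<longrightarrow>
     (\<exists>c. homotopic_with_canon (\<lambda>_. True) F (sphere 0 1) h (\<lambda>_. c))"
proof -
  let ?n = "DIM('a)"
  obtain \<eta> where \<eta>: "\<eta> > 0" "\<And>x x'. x \<in> K \<Longrightarrow> x' \<in> K \<Longrightarrow> dist x' x < \<eta> \<Longrightarrow> dist (h x') (h x) < 1/2"
    using compact_uniformly_continuous[OF h(1) K] unfolding uniformly_continuous_on_def
    by (metis zero_less_divide_1_iff zero_less_numeral)
  obtain \<delta> where \<delta>: "\<delta> > 0" "\<And>x (k::nat) y. (\<forall>i\<le>k. x i \<in> K \<and> dist (f (x i)) y < \<delta>) \<Longrightarrow>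
     (\<forall>i<k. dist (x i) (x (Suc i)) < \<delta>) \<Longrightarrow> dist (x 0) (x k) < \<eta>"
    using small_chains[OF K f fin \<eta>(1)] by blast
  \<comment> \<open>Points with the same face key differ by at most \<open>n * l\<close>, which has to be less
    than \<open>\<delta>\<close>.\<close>
  define l0 where "l0 = \<delta> / (2 * real ?n)"
  have l00: "l0 > 0" using \<delta> by (simp add: l0_def)
  have main: "\<exists>c. homotopic_with_canon (\<lambda>_. True) F (sphere 0 1) h (\<lambda>_. c)"
    if l: "0 < l" "l \<le> l0" and FK: "F \<subseteq> K"
      and av: "\<And>x. x \<in> F \<Longrightarrow> \<not> (\<exists>i\<in>Basis. \<forall>j\<in>Basis - {i}. grid_coord l \<tau> j (f x) \<in> \<int>)" for l \<tau> F
  proof -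
    have nl: "real ?n * l < \<delta>"
    proof -
      have "real ?n * l \<le> real ?n * l0" using l by (intro mult_left_mono) auto
      also have "\<dots> = \<delta> / 2" by (simp add: l0_def)
      finally show ?thesis using \<delta>(1) by linarith
    qed
    define \<I> where "\<I> = {I. I \<subseteq> (Basis::'a set) \<and> 2 \<le> card I}"
    have finI: "finite \<I>" unfolding \<I>_def by (rule finite_subset[of _ "Pow Basis"]) auto
    define \<psi> where "\<psi> = (\<lambda>I x. face_weight l \<tau> I (f x))"
    define G where "G = (\<lambda>I. {x\<in>F. \<psi> I x > 0})"
    have fF: "continuous_on F f" using f FK by (rule continuous_on_subset)
    have \<psi>0: "\<psi> I x \<ge> 0" for I x by (simp add: \<psi>_def face_weight_nonneg)
    have \<psi>c: "continuous_on F (\<psi> I)" for I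
      unfolding \<psi>_def by (rule continuous_on_compose2[OF continuous_face_weight[of UNIV] fF]) auto
    have sel: "\<exists>c. \<forall>x\<in>G I. c x \<in> G I \<and> dist (c x) x < \<eta> \<and> (\<exists>\<theta>>0. \<forall>x'\<in>G I. dist x' x < \<theta> \<longrightarrow> c x' = c x)"
      if I: "I \<in> \<I>" for I
    proof (rule locally_constant_selection[where key = "\<lambda>x. face_key l \<tau> I (f x)" and \<delta> = \<delta>])
      have I2: "I \<subseteq> Basis" "I \<noteq> {}" using I by (auto simp: \<I>_def)
      show "\<exists>\<theta>>0. \<forall>x'\<in>G I. dist x' x < \<theta> \<longrightarrow> face_key l \<tau> I (f x') = face_key l \<tau> I (f x)" if x: "x \<in> G I" for x
      proof -
        have "face_weight l \<tau> I (f x) > 0" using x by (simp add: G_def \<psi>_def)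
        from face_key_locally_constant[OF I2 this]
        obtain d where d: "d > 0" "\<And>y'. dist y' (f x) < d \<Longrightarrow> face_key l \<tau> I y' = face_key l \<tau> I (f x)"
          unfolding eventually_nhds_metric by blast
        obtain \<theta> where "\<theta> > 0" "\<forall>x'\<in>F. dist x' x < \<theta> \<longrightarrow> dist (f x') (f x) < d"
          using fF x d(1) unfolding continuous_on_iff G_def by blast
        then show ?thesis using d(2) by (intro exI[of _ \<theta>]) (auto simp: G_def)
      qed
      show "dist (x 0) (x k) < \<eta>"
        if c: "\<And>i. i \<le> k \<Longrightarrow> x i \<in> G I \<and> face_key l \<tau> I (f (x i)) = face_key l \<tau> I (f (x 0))"
          "\<And>i. i < k \<Longrightarrow> dist (x i) (x (Suc i)) < \<delta>" for x and k :: nat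
      proof (rule \<delta>(2)[of k x "f (x 0)"])
        show "\<forall>i\<le>k. x i \<in> K \<and> dist (f (x i)) (f (x 0)) < \<delta>"
        proof (intro allI impI conjI)
          fix i assume i: "i \<le> k"
          show "x i \<in> K" using c(1)[OF i] FK by (auto simp: G_def)
          have "dist (f (x i)) (f (x 0)) \<le> real ?n * l"
            using c(1)[OF i] l(1) by (intro face_key_close) auto
          then show "dist (f (x i)) (f (x 0)) < \<delta>" using nl by linarith
        qed
      qed (use c(2) in blast)
    qed (fact \<delta>(1))
    then obtain c where c: "\<And>I x. I \<in> \<I> \<Longrightarrow> x \<in> G I \<Longrightarrow> c I x \<in> G I \<and> dist (c I x) x < \<eta> \<and>
        (\<exists>\<theta>>0. \<forall>x'\<in>G I. dist x' x < \<theta> \<longrightarrow> c I x' = c I x)" by metis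
    define \<Psi> where "\<Psi> = (\<lambda>x. \<Sum>I\<in>\<I>. \<psi> I x)"
    have \<Psi>: "\<Psi> x > 0" if x: "x \<in> F" for x
    proof -
      \<comment> \<open>The coordinates of \<open>f x\<close> that are no integers: there are at least two of
        them, since \<open>f x\<close> is on no edge.\<close>
      define I0 where "I0 = {i\<in>Basis. infdist (grid_coord l \<tau> i (f x)) \<int> > 0}"
      have "2 \<le> card I0"
      proof (rule ccontr)
        assume "\<not> 2 \<le> card I0"
        then have "card I0 \<le> Suc 0" by simp
        moreover have "finite I0" by (simp add: I0_def)
        ultimately have e: "\<forall>i\<in>I0. \<forall>j\<in>I0. i = j" by (simp add: card_le_Suc0_iff_eq)
        obtain i where i: "i \<in> Basis" "I0 \<subseteq> {i}"
        proof (cases "I0 = {}")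
          case True
          then show ?thesis using that nonempty_Basis by blast
        next
          case False
          then show ?thesis using that e by (auto simp: I0_def)
        qed
        then have "\<forall>j\<in>Basis - {i}. grid_coord l \<tau> j (f x) \<in> \<int>"
          using infdist_Ints_pos_iff by (auto simp: I0_def)
        then show False using av[OF x] i(1) by blast
      qed
      then have I0: "I0 \<in> \<I>" by (auto simp: \<I>_def I0_def)
      have "\<psi> I0 x > 0"
      proof -
        have "infdist (grid_coord l \<tau> j (f x)) \<int> = 0" if "j \<in> Basis - I0" for j
          using that infdist_nonneg[of "grid_coord l \<tau> j (f x)" \<int>] by (auto simp: I0_def)
        then have "(\<forall>i\<in>I0. infdist (grid_coord l \<tau> i (f x)) \<int> > 0) \<and>
          (\<forall>i\<in>I0. \<forall>j\<in>Basis - I0. infdist (grid_coord l \<tau> j (f x)) \<int> < infdist (grid_coord l \<tau> i (f x)) \<int>)"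
          by (auto simp: I0_def)
        moreover have "I0 \<subseteq> Basis" by (auto simp: I0_def)
        ultimately show ?thesis unfolding \<psi>_def by (simp only: face_weight_pos_iff)
      qed
      also have "\<psi> I0 x \<le> \<Psi> x" unfolding \<Psi>_def using finI I0 \<psi>0 by (intro member_le_sum) auto
      finally show ?thesis .
    qed
    have \<Psi>c: "continuous_on F \<Psi>" unfolding \<Psi>_def by (intro continuous_on_sum \<psi>c)
    define g where "g = (\<lambda>x. \<Sum>I\<in>\<I>. (\<psi> I x / \<Psi> x) *\<^sub>R h (c I x))"
    have Gpos: "\<psi> I x / \<Psi> x > 0 \<longleftrightarrow> x \<in> G I" if "x \<in> F" for I x
      using \<Psi>[OF that] that by (simp add: G_def zero_less_divide_iff)
    have cK: "c I x \<in> K" if "I \<in> \<I>" "x \<in> G I" for I x using c[OF that] FK by (auto simp: G_def)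
    have gc: "continuous_on F g"
      unfolding g_def
    proof (rule continuous_on_sum)
      fix I assume I: "I \<in> \<I>"
      show "continuous_on F (\<lambda>x. (\<psi> I x / \<Psi> x) *\<^sub>R h (c I x))"
      proof (rule continuous_weighted_locally_constant)
        show "continuous_on F (\<lambda>x. \<psi> I x / \<Psi> x)"
        proof (intro continuous_on_divide \<psi>c \<Psi>c ballI)
          show "\<Psi> x \<noteq> 0" if "x \<in> F" for x using \<Psi>[OF that] by simp
        qed
        show "\<psi> I x / \<Psi> x \<ge> 0" if "x \<in> F" for x using \<Psi>[OF that] \<psi>0 by simp
        show "norm (h (c I x)) \<le> 1" if x: "x \<in> F" "\<psi> I x / \<Psi> x > 0" for x
        proof -
          have "h (c I x) \<in> sphere 0 1" using cK[OF I] Gpos[OF x(1)] x(2) h(2) by blast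
          then show ?thesis by simp
        qed
        show "\<exists>\<theta>>0. \<forall>x'\<in>F. \<psi> I x' / \<Psi> x' > 0 \<and> dist x' x < \<theta> \<longrightarrow> h (c I x') = h (c I x)"
          if x: "x \<in> F" "\<psi> I x / \<Psi> x > 0" for x
        proof -
          have "x \<in> G I" using Gpos[OF x(1)] x(2) by blast
          then obtain \<theta> where "\<theta> > 0" "\<forall>x'\<in>G I. dist x' x < \<theta> \<longrightarrow> c I x' = c I x" using c[OF I] by blast
          then show ?thesis using Gpos by (intro exI[of _ \<theta>]) metis
        qed
      qed
    qed
    have close: "norm (g x - h x) < 1" if x: "x \<in> F" for x
    proof -
      have s1: "(\<Sum>I\<in>\<I>. \<psi> I x / \<Psi> x) = 1"
        using \<Psi>[OF x] by (simp add: \<Psi>_def sum_divide_distrib[symmetric])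
      have "g x - h x = (\<Sum>I\<in>\<I>. (\<psi> I x / \<Psi> x) *\<^sub>R h (c I x)) - (\<Sum>I\<in>\<I>. \<psi> I x / \<Psi> x) *\<^sub>R h x"
        unfolding s1 by (simp add: g_def)
      also have "\<dots> = (\<Sum>I\<in>\<I>. (\<psi> I x / \<Psi> x) *\<^sub>R (h (c I x) - h x))"
        by (simp add: scaleR_sum_left scaleR_diff_right sum_subtractf)
      finally have "norm (g x - h x) \<le> (\<Sum>I\<in>\<I>. norm ((\<psi> I x / \<Psi> x) *\<^sub>R (h (c I x) - h x)))"
        by (simp only: norm_sum)
      also have "\<dots> \<le> (\<Sum>I\<in>\<I>. (\<psi> I x / \<Psi> x) * (1/2))"
      proof (rule sum_mono)
        fix I assume I: "I \<in> \<I>"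
        show "norm ((\<psi> I x / \<Psi> x) *\<^sub>R (h (c I x) - h x)) \<le> (\<psi> I x / \<Psi> x) * (1/2)"
        proof (cases "x \<in> G I")
          case True
          have "dist (h (c I x)) (h x) < 1/2"
            using \<eta>(2)[of x "c I x"] c[OF I True] cK[OF I True] x FK by blast
          then have "norm (h (c I x) - h x) \<le> 1/2" by (simp add: dist_norm)
          moreover have "\<psi> I x / \<Psi> x \<ge> 0" using \<Psi>[OF x] \<psi>0 by simp
          ultimately show ?thesis by (simp only: norm_scaleR abs_of_nonneg mult_left_mono)
        next
          case False
          then have "\<psi> I x = 0" using \<psi>0[of I x] x by (simp add: G_def)
          then show ?thesis by simp
        qed
      qed
      also have "\<dots> = (\<Sum>I\<in>\<I>. \<psi> I x / \<Psi> x) * (1/2)" by (rule sum_distrib_right[symmetric])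
      finally show ?thesis unfolding s1 by simp
    qed
    define P where "P = (\<Union>I\<in>\<I>. h ` (c I ` G I))"
    have "countable P"
    proof -
      have "countable (c I ` G I)" if "I \<in> \<I>" for I
        using c[OF that] by (intro countable_range_locally_constant) blast
      then show ?thesis unfolding P_def by (intro countable_UN[OF countable_finite[OF finI]] countable_image[of "c _ ` G _"]) auto
    qed
    define \<C> where "\<C> = {C. C \<subseteq> P \<and> finite C \<and> card C < ?n}"
    have "countable \<C>"
      by (rule countable_subset[OF _ countable_Collect_finite_subset[OF \<open>countable P\<close>]]) (auto simp: \<C>_def)
    moreover have "\<And>C. C \<in> \<C> \<Longrightarrow> finite C \<and> card C < ?n" by (simp add: \<C>_def)
    ultimately obtain \<theta> where \<theta>: "\<theta> \<in> sphere 0 1" "\<forall>t>0. t *\<^sub>R \<theta> \<notin> (\<Union>C\<in>\<C>. span C)"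
      using small_span_union_misses_direction[of \<C>] by blast
    have gC: "g x \<in> (\<Union>C\<in>\<C>. span C)" if x: "x \<in> F" for x
    proof -
      define \<J> where "\<J> = {I\<in>\<I>. x \<in> G I}"
      define C where "C = (\<lambda>I. h (c I x)) ` \<J>"
      have finJ: "finite \<J>" using finI by (simp add: \<J>_def)
      have nest: "I \<subseteq> J \<or> J \<subseteq> I" if "I \<in> \<J>" "J \<in> \<J>" for I J
        using that by (intro face_weight_nested[where l = l and \<tau> = \<tau> and y = "f x"]) (auto simp: \<J>_def \<I>_def G_def \<psi>_def)
      have finB: "finite I" if "I \<in> \<J>" for I
        using that finite_subset[OF _ finite_Basis] by (auto simp: \<J>_def \<I>_def)
      have "inj_on card \<J>"
        using nest finB by (intro inj_onI) (metis card_subset_eq)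
      then have "card \<J> = card (card ` \<J>)" by (simp add: card_image)
      also have "\<dots> \<le> card {2..?n}"
      proof (rule card_mono)
        show "card ` \<J> \<subseteq> {2..?n}"
          by (auto simp: \<J>_def \<I>_def intro: card_mono[OF finite_Basis])
      qed simp
      also have "\<dots> < ?n" by simp
      finally have "card C < ?n" unfolding C_def using card_image_le[OF finJ] le_less_trans by blast
      moreover have "C \<subseteq> P" by (auto simp: C_def P_def \<J>_def)
      ultimately have CC: "C \<in> \<C>" using finJ by (simp add: \<C>_def C_def)
      have "g x = (\<Sum>I\<in>\<J>. (\<psi> I x / \<Psi> x) *\<^sub>R h (c I x))"
        unfolding g_def
      proof (rule sum.mono_neutral_right[OF finI])
        show "\<forall>I\<in>\<I> - \<J>. (\<psi> I x / \<Psi> x) *\<^sub>R h (c I x) = 0"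
        proof
          fix I assume "I \<in> \<I> - \<J>"
          then have "\<psi> I x = 0" using \<psi>0[of I x] x by (auto simp: \<J>_def G_def)
          then show "(\<psi> I x / \<Psi> x) *\<^sub>R h (c I x) = 0" by simp
        qed
      qed (auto simp: \<J>_def)
      also have "\<dots> \<in> span C"
        by (intro span_sum span_scale span_base) (auto simp: C_def)
      finally show ?thesis using CC by blast
    qed
    show ?thesis
    proof (rule nullhomotopic_if_close_to_small_image[OF _ _ gc close \<theta>(1)])
      show "continuous_on F h" using h(1) FK by (rule continuous_on_subset)
      show "h \<in> F \<rightarrow> sphere 0 1" using h(2) FK by blast
      show "g x \<noteq> t *\<^sub>R \<theta>" if "x \<in> F" "t > 0" for x t
        using gC[OF that(1)] \<theta>(2) that(2) by metis
    qed
  qed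
  show ?thesis
  proof (rule exI[of _ l0], intro conjI allI impI)
    fix l \<tau> F
    assume a: "0 < l \<and> l \<le> l0 \<and> F \<subseteq> K \<and>
      (\<forall>x\<in>F. \<not> (\<exists>i\<in>Basis. \<forall>j\<in>Basis - {i}. grid_coord l \<tau> j (f x) \<in> \<int>))"
    show "\<exists>c. homotopic_with_canon (\<lambda>_. True) F (sphere 0 1) h (\<lambda>_. c)"
    proof (rule main[where l = l and \<tau> = \<tau> and F = F])
      show "\<not> (\<exists>i\<in>Basis. \<forall>j\<in>Basis - {i}. grid_coord l \<tau> j (f x) \<in> \<int>)" if "x \<in> F" for x
        using a that by (elim conjE bspec)
    qed (use a in simp_all)
  qed (fact l00)
qed

text \<open>This is \<open>small_chains\<close> for fine subdivisions of a curve.\<close>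

lemma small_image_curve:
  fixes f :: "'a::metric_space \<Rightarrow> 'b::metric_space"
  assumes K: "compact K" and f: "continuous_on K f" and fin: "\<And>y. finite {x\<in>K. f x = y}" and e: "\<epsilon> > 0"
  shows "\<exists>\<delta>>0. \<forall>\<gamma> c y. 0 \<le> c \<and> continuous_on {0..c::real} \<gamma> \<and> (\<forall>t\<in>{0..c}. \<gamma> t \<in> K \<and> dist (f (\<gamma> t)) y < \<delta>)
     \<longrightarrow> dist (\<gamma> 0) (\<gamma> c) < \<epsilon>"
proof -
  obtain \<delta> where \<delta>: "\<delta> > 0" "\<And>x (k::nat) y. (\<forall>i\<le>k. x i \<in> K \<and> dist (f (x i)) y < \<delta>) \<Longrightarrow>
     (\<forall>i<k. dist (x i) (x (Suc i)) < \<delta>) \<Longrightarrow> dist (x 0) (x k) < \<epsilon>"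
    using small_chains[OF K f fin e] by blast
  have "dist (\<gamma> 0) (\<gamma> c) < \<epsilon>" if c: "0 \<le> c" and \<gamma>: "continuous_on {0..c} \<gamma>"
    and near: "\<And>t. t\<in>{0..c} \<Longrightarrow> \<gamma> t \<in> K \<and> dist (f (\<gamma> t)) y < \<delta>" for \<gamma> :: "real \<Rightarrow> 'a" and c y
  proof -
    obtain d where d: "d > 0" "\<And>t t'. t \<in> {0..c} \<Longrightarrow> t' \<in> {0..c} \<Longrightarrow> dist t' t < d \<Longrightarrow> dist (\<gamma> t') (\<gamma> t) < \<delta>"
      using compact_uniformly_continuous[OF \<gamma>] \<delta>(1) unfolding uniformly_continuous_on_def by (metis compact_Icc)
    obtain N where N: "real N > c / d" using reals_Archimedean2 by blast
    have N0: "real N > 0" using N c d(1) by (metis divide_nonneg_pos le_less_trans)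
    have cN: "c / real N < d" using N N0 d(1) by (simp add: field_simps)
    define x where "x = (\<lambda>i. \<gamma> (c * (real i / real N)))"
    have t: "c * (real i / real N) \<in> {0..c}" if "i \<le> N" for i
    proof -
      have "c * (real i / real N) \<le> c * 1" using that N0 by (intro mult_left_mono c) auto
      then show ?thesis using c by simp
    qed
    have "dist (x 0) (x N) < \<epsilon>"
    proof (rule \<delta>(2)[of N x y])
      show "\<forall>i\<le>N. x i \<in> K \<and> dist (f (x i)) y < \<delta>" using near t by (simp add: x_def)
      show "\<forall>i<N. dist (x i) (x (Suc i)) < \<delta>"
      proof (intro allI impI)
        fix i assume i: "i < N"
        have "\<bar>c * (real i / real N) - c * (real (Suc i) / real N)\<bar> = c / real N"
          using c N0 by (simp add: right_diff_distrib[symmetric] diff_divide_distrib[symmetric] abs_mult)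
        then show "dist (x i) (x (Suc i)) < \<delta>"
          unfolding x_def using cN i by (intro d(2) t) (auto simp: dist_real_def)
      qed
    qed
    then show ?thesis using N0 by (simp add: x_def)
  qed
  then show ?thesis using \<delta>(1) by blast
qed

section \<open>Lifts of grid edges\<close>

text \<open>Let \<open>X\<close> be the preimage of the edges. Near a point of \<open>X\<close> the other
  points of \<open>X\<close> are joined to it by lifts of edge pieces. If none of these has its
  ends on different sides of \<open>A\<close>, both parts of \<open>X\<close> are closed, also
  together with the inner ball and with the outer region, respectively. The equidistant set
  \<open>F\<close> of the resulting disjoint closed sets is compact, separates \<open>b\<close>
  from infinity and does not meet \<open>X\<close>. By Borsuk's theorem the radial projection of
  \<open>F\<close> to the sphere is not homotopic to a constant, in contradiction to
  \<open>grid_avoiding_map_nullhomotopic\<close>.\<close>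

lemma lifted_grid_edge_crosses:
  fixes f :: "'a::euclidean_space \<Rightarrow> 'a"
  assumes rs: "0 < r" "r < \<rho>1" "\<rho>1 < \<rho>2" "\<rho>2 < s"
    and S: "{x. r \<le> dist x b \<and> dist x b \<le> s} \<subseteq> S"
    and f: "continuous_on S f" "open_mapping_on S f" "discrete_mapping_on S f"
  shows "\<exists>l0>0. \<forall>l \<tau> A. 0 < l \<and> l \<le> l0 \<and> (\<forall>x. dist x b \<le> \<rho>1 \<longrightarrow> x \<in> A) \<and> (\<forall>x. \<rho>2 \<le> dist x b \<longrightarrow> x \<notin> A) \<longrightarrow>
    (\<exists>\<gamma> i \<mu>. continuous_on {0..1} \<gamma> \<and> (\<forall>t\<in>{0..1}. r \<le> dist (\<gamma> t) b \<and> dist (\<gamma> t) b \<le> s \<and>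
        f (\<gamma> t) = f (\<gamma> 0) + t *\<^sub>R (\<mu> *\<^sub>R i)) \<and> i \<in> Basis \<and>
        (\<forall>j\<in>Basis - {i}. grid_coord l \<tau> j (f (\<gamma> 0)) \<in> \<int>) \<and> (\<gamma> 0 \<in> A \<longleftrightarrow> \<gamma> 1 \<notin> A))"
proof -
  let ?K = "{x. r \<le> dist x b \<and> dist x b \<le> s}"
  have "closed ?K" by (intro closed_Collect_conj closed_Collect_le continuous_intros)
  moreover have "bounded ?K" by (rule bounded_subset[OF bounded_cball[of b s]]) (auto simp: dist_commute)
  ultimately have K: "compact ?K" by (simp add: compact_eq_bounded_closed)
  note fK = continuous_on_subset[OF f(1) S]
  note fin = finite_fibre[OF f(3) f(1) K S]
  define h where "h = (\<lambda>x. inverse (norm (x - b)) *\<^sub>R (x - b))"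
  have hK: "continuous_on ?K h" unfolding h_def using rs by (intro continuous_intros) auto
  have hS: "h \<in> ?K \<rightarrow> sphere 0 1"
  proof
    fix x assume "x \<in> ?K"
    then have "x \<noteq> b" using rs by auto
    then show "h x \<in> sphere 0 1" by (simp add: h_def)
  qed
  from grid_avoiding_map_nullhomotopic[OF K fK fin hK hS]
  obtain l0 where l00: "l0 > 0" and l0: "\<forall>l \<tau> F. 0 < l \<and> l \<le> l0 \<and> F \<subseteq> ?K \<and>
     (\<forall>x\<in>F. \<not> (\<exists>i\<in>Basis. \<forall>j\<in>Basis - {i}. grid_coord l \<tau> j (f x) \<in> \<int>)) \<longrightarrow>
     (\<exists>c. homotopic_with_canon (\<lambda>_. True) F (sphere 0 1) h (\<lambda>_. c))"
    by (elim exE conjE)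
  have main: "\<exists>\<gamma> i \<mu>. continuous_on {0..1} \<gamma> \<and> (\<forall>t\<in>{0..1}. r \<le> dist (\<gamma> t) b \<and> dist (\<gamma> t) b \<le> s \<and>
        f (\<gamma> t) = f (\<gamma> 0) + t *\<^sub>R (\<mu> *\<^sub>R i)) \<and> i \<in> Basis \<and>
        (\<forall>j\<in>Basis - {i}. grid_coord l \<tau> j (f (\<gamma> 0)) \<in> \<int>) \<and> (\<gamma> 0 \<in> A \<longleftrightarrow> \<gamma> 1 \<notin> A)"
    if l: "0 < l" "l \<le> l0" and A: "\<And>x. dist x b \<le> \<rho>1 \<Longrightarrow> x \<in> A" "\<And>x. \<rho>2 \<le> dist x b \<Longrightarrow> x \<notin> A" for l \<tau> A
  proof (rule ccontr)
    assume neg: "\<not> ?thesis"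
    define u where "u = grid_coord l \<tau>"
    \<comment> \<open>The edges of the grid: points all of whose coordinates but one are integers.\<close>
    define Sk where "Sk = (\<Union>i\<in>Basis. \<Inter>j\<in>Basis - {i}. {y. u j y \<in> \<int>})"
    have Sk_iff: "y \<in> Sk \<longleftrightarrow> (\<exists>i\<in>Basis. \<forall>j\<in>Basis - {i}. u j y \<in> \<int>)" for y by (simp add: Sk_def)
    have "closed {y. u j y \<in> \<int>}" for j
      using continuous_closed_preimage[OF continuous_grid_coord[of UNIV l \<tau> j] closed_UNIV closed_Ints]
      by (simp add: u_def vimage_def)
    then have closedSk: "closed Sk" unfolding Sk_def by (intro closed_UN closed_INT ballI finite_Basis)
    define X where "X = {x \<in> ?K. f x \<in> Sk}"
    have "closed (?K \<inter> f -` Sk)" by (rule continuous_closed_preimage[OF fK \<open>closed ?K\<close> closedSk])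
    moreover have "?K \<inter> f -` Sk = X" by (auto simp: X_def)
    ultimately have closedX: "closed X" by simp
    \<comment> \<open>The images of nearby points of \<open>X\<close> lie on edges through \<open>f x\<close>, and
      a lift of the edge piece that ends at \<open>f x\<close> has to end at \<open>x\<close>
      itself.\<close>
    have local: "\<exists>\<theta>>0. \<forall>x'\<in>X. dist x' x < \<theta> \<longrightarrow> (x' \<in> A \<longleftrightarrow> x \<in> A)" if x: "x \<in> X" "r < dist x b" "dist x b < s" for x
    proof -
      have xK: "x \<in> ?K" using x by (simp add: X_def)
      obtain e1 where e1: "e1 > 0" "\<And>z. dist z x < e1 \<Longrightarrow> r < dist z b \<and> dist z b < s"
      proof (rule that[of "min (dist x b - r) (s - dist x b)"])
        show "0 < min (dist x b - r) (s - dist x b)" using x by simp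
        show "r < dist z b \<and> dist z b < s" if "dist z x < min (dist x b - r) (s - dist x b)" for z
          using that dist_triangle[of z b x] dist_triangle[of x b z] by (simp add: dist_commute)
      qed
      obtain e2 where e2: "e2 > 0" "\<And>z. z \<in> ?K \<Longrightarrow> f z = f x \<Longrightarrow> dist z x < e2 \<Longrightarrow> z = x"
      proof -
        obtain d where "d > 0" "\<forall>z\<in>{z\<in>?K. f z = f x}. z \<noteq> x \<longrightarrow> d \<le> dist x z"
          using finite_set_avoid[OF fin[of "f x"], of x] by blast
        then show ?thesis by (intro that[of d]) (force simp: dist_commute)+
      qed
      define e where "e = min e1 e2 / 2"
      have e: "e > 0" "2 * e \<le> e1" "2 * e \<le> e2" using e1 e2 by (auto simp: e_def)
      obtain \<delta> where \<delta>: "\<delta> > 0" "\<And>\<gamma> c y. 0 \<le> c \<Longrightarrow> continuous_on {0..c::real} \<gamma> \<Longrightarrow>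
          (\<forall>t\<in>{0..c}. \<gamma> t \<in> ?K \<and> dist (f (\<gamma> t)) y < \<delta>) \<Longrightarrow> dist (\<gamma> 0) (\<gamma> c) < e"
        using small_image_curve[OF K fK fin e(1)] by blast
      define m where "m = (\<lambda>j. if u j (f x) \<in> \<int> then 1 else infdist (u j (f x)) \<int>)"
      have m: "m j > 0" for j using infdist_Ints_pos_iff by (simp add: m_def)
      \<comment> \<open>Within this distance of \<open>f x\<close>, a coordinate can be an integer only if it has
        the same value as at \<open>f x\<close>.\<close>
      define \<kappa> where "\<kappa> = l * Min (m ` Basis)"
      have \<kappa>: "\<kappa> > 0" unfolding \<kappa>_def using l m by (intro mult_pos_pos) auto
      have same: "u j y = u j (f x)" if j: "j \<in> Basis" and y: "dist y (f x) < \<kappa>" "u j y \<in> \<int>" for j y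
      proof -
        have "u j y - u j (f x) = ((y - f x) \<bullet> j) / l"
          by (simp add: u_def grid_coord_def diff_divide_distrib[symmetric] inner_diff_left)
        then have "\<bar>u j y - u j (f x)\<bar> = \<bar>(y - f x) \<bullet> j\<bar> / l" using l by (simp add: abs_divide)
        also have "\<dots> \<le> dist y (f x) / l"
          using l j Basis_le_norm[of j "y - f x"] by (intro divide_right_mono) (auto simp: dist_norm)
        also have "\<dots> < Min (m ` Basis)" unfolding pos_divide_less_eq[OF l(1)] using y(1) by (simp only: \<kappa>_def mult.commute)
        also have "\<dots> \<le> m j" using j by (intro Min_le) auto
        finally have d: "\<bar>u j y - u j (f x)\<bar> < m j" .
        show ?thesis
        proof (cases "u j (f x) \<in> \<int>")
          case True
          then obtain p q where "u j y = of_int p" "u j (f x) = of_int q" using y(2) by (auto elim!: Ints_cases)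
          moreover have "m j = 1" using True by (simp add: m_def)
          ultimately show ?thesis using d by simp
        next
          case False
          have "infdist (u j (f x)) \<int> \<le> dist (u j (f x)) (u j y)" using y(2) by (rule infdist_le)
          then show ?thesis using d False by (simp add: m_def dist_real_def abs_minus_commute)
        qed
      qed
      obtain \<theta>0 where \<theta>0: "\<theta>0 > 0" "\<And>x'. x' \<in> ?K \<Longrightarrow> dist x' x < \<theta>0 \<Longrightarrow> dist (f x') (f x) < min \<delta> \<kappa>"
      proof -
        have "min \<delta> \<kappa> > 0" using \<delta>(1) \<kappa> by simp
        from fK[unfolded continuous_on_iff, rule_format, OF xK this]
        obtain d where "d > 0" "\<forall>x'\<in>?K. dist x' x < d \<longrightarrow> dist (f x') (f x) < min \<delta> \<kappa>" by blast
        then show ?thesis by (intro that[of d]) auto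
      qed
      have "x' \<in> A \<longleftrightarrow> x \<in> A" if x': "x' \<in> X" "dist x' x < min \<theta>0 e" for x'
      proof (rule ccontr)
        assume ne: "\<not> (x' \<in> A \<longleftrightarrow> x \<in> A)"
        have x'K: "x' \<in> ?K" using x' by (simp add: X_def)
        have fd: "dist (f x') (f x) < \<delta>" "dist (f x') (f x) < \<kappa>" using \<theta>0(2)[OF x'K] x' by auto
        obtain i where i: "i \<in> Basis" "\<forall>j\<in>Basis - {i}. u j (f x') \<in> \<int>" using x'(1) Sk_iff by (auto simp: X_def)
        define \<mu> where "\<mu> = (f x - f x') \<bullet> i"
        have line: "f x - f x' = \<mu> *\<^sub>R i"
        proof (rule euclidean_eqI)
          fix j :: 'a assume j: "j \<in> Basis"
          show "(f x - f x') \<bullet> j = (\<mu> *\<^sub>R i) \<bullet> j"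
          proof (cases "j = i")
            case True
            then show ?thesis using j by (simp add: \<mu>_def)
          next
            case False
            then have "u j (f x') = u j (f x)" using i(2) j fd by (intro same) auto
            then have "(f x - f x') \<bullet> j = 0" using l by (simp add: u_def grid_coord_def inner_diff_left)
            then show ?thesis using False j i(1) by (simp add: inner_Basis)
          qed
        qed
        have x'in: "r < dist x' b" "dist x' b < s" using e1(2)[of x'] x' e by auto
        obtain c \<gamma> where c: "0 \<le> c" "c \<le> 1" "continuous_on {0..c} \<gamma>" "\<gamma> 0 = x'"
          "\<And>t. t \<in> {0..c} \<Longrightarrow> f (\<gamma> t) = f x' + t *\<^sub>R (\<mu> *\<^sub>R i)"
          "\<And>t. t \<in> {0..c} \<Longrightarrow> r \<le> dist (\<gamma> t) b \<and> dist (\<gamma> t) b \<le> s"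
          "c = 1 \<and> r < dist (\<gamma> c) b \<and> dist (\<gamma> c) b < s \<or> dist (\<gamma> c) b = r \<or> dist (\<gamma> c) b = s"
          by (rule ring_lift[OF S f x'in, where v = "\<mu> *\<^sub>R i"], rule that, assumption+)
        have "dist (\<gamma> 0) (\<gamma> c) < e"
        proof (rule \<delta>(2)[OF c(1,3), of "f x"], intro ballI conjI)
          fix t assume t: "t \<in> {0..c}"
          show "\<gamma> t \<in> ?K" using c(6)[OF t] by simp
          have "f (\<gamma> t) - f x = - ((1 - t) *\<^sub>R (f x - f x'))"
            unfolding c(5)[OF t] line[symmetric] by (simp add: algebra_simps)
          then have "dist (f (\<gamma> t)) (f x) = norm ((1 - t) *\<^sub>R (f x - f x'))" by (simp only: dist_norm norm_minus_cancel)
          also have "\<dots> \<le> 1 * dist (f x') (f x)"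
            using t c(2) unfolding norm_scaleR by (intro mult_mono) (auto simp: dist_norm norm_minus_commute)
          finally show "dist (f (\<gamma> t)) (f x) < \<delta>" using fd by simp
        qed
        then have near: "dist (\<gamma> c) x < 2 * e"
          using c(4) x'(2) dist_triangle[of "\<gamma> c" x x'] by (simp add: dist_commute)
        then have "r < dist (\<gamma> c) b" "dist (\<gamma> c) b < s" using e1(2)[of "\<gamma> c"] e by auto
        then have c1: "c = 1" using c(7) by linarith
        have "f (\<gamma> 1) = f x' + 1 *\<^sub>R (\<mu> *\<^sub>R i)" using c(5)[of 1] c1 by simp
        then have "f (\<gamma> 1) = f x" unfolding line[symmetric] by simp
        moreover have "\<gamma> 1 \<in> ?K" using c(6)[of 1] c1 by simp
        ultimately have "\<gamma> 1 = x" using e2(2)[of "\<gamma> 1"] near c1 e by simp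
        then show False
          using neg ne c c1 i unfolding u_def by blast
      qed
      then show ?thesis using \<theta>0(1) e(1) by (intro exI[of _ "min \<theta>0 e"]) auto
    qed
    define P where "P = {x. dist x b \<le> \<rho>1} \<union> (X \<inter> A)"
    define N where "N = {x. \<rho>2 \<le> dist x b} \<union> (X - A)"
    have frontier_case: "z \<in> X \<and> (z \<in> A \<longleftrightarrow> a)"
      if z: "\<forall>n. y n \<in> X \<and> (y n \<in> A \<longleftrightarrow> a)" "(y \<longlonglongrightarrow> z)" and zr: "r < dist z b" "dist z b < s" for y :: "nat \<Rightarrow> 'a" and z a
    proof -
      have zX: "z \<in> X" using closed_sequentially[OF closedX, of y z] z by blast
      obtain \<theta> where \<theta>: "\<theta> > 0" "\<forall>x'\<in>X. dist x' z < \<theta> \<longrightarrow> (x' \<in> A \<longleftrightarrow> z \<in> A)" using local[OF zX zr] by blast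
      have "eventually (\<lambda>n. dist (y n) z < \<theta>) sequentially" using tendstoD[OF z(2) \<theta>(1)] .
      then obtain n where "dist (y n) z < \<theta>" by (auto simp: eventually_sequentially)
      then show ?thesis using \<theta>(2) z(1) zX by blast
    qed
    have XA: "dist x b < \<rho>2" if "x \<in> X \<inter> A" for x using A(2)[of x] that by force
    have XnA: "\<rho>1 < dist x b" if "x \<in> X - A" for x using A(1)[of x] that by force
    have "closed P"
      unfolding closed_sequential_limits
    proof (intro allI impI, elim conjE)
      fix y z assume y: "\<forall>n. y n \<in> P" and lim: "y \<longlonglongrightarrow> z"
      show "z \<in> P"
      proof (cases "dist z b \<le> \<rho>1")
        case True
        then show ?thesis by (simp add: P_def)
      next
        case False
        have dl: "(\<lambda>n. dist (y n) b) \<longlonglongrightarrow> dist z b" by (intro tendsto_intros lim)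
        have "eventually (\<lambda>n. \<rho>1 < dist (y n) b) sequentially" using order_tendstoD(1)[OF dl, of \<rho>1] False by simp
        then obtain n0 where n0: "\<And>n. n \<ge> n0 \<Longrightarrow> \<rho>1 < dist (y n) b" by (auto simp: eventually_sequentially)
        have yX: "y (n + n0) \<in> X \<inter> A" for n using y n0[of "n + n0"] unfolding P_def by force
        have "(\<lambda>n. y (n + n0)) \<longlonglongrightarrow> z" using lim by (rule LIMSEQ_ignore_initial_segment)
        moreover have "dist z b \<le> \<rho>2"
          by (rule LIMSEQ_le_const2[OF LIMSEQ_ignore_initial_segment[OF dl, of n0]]) (use XA yX in \<open>auto intro: less_imp_le\<close>)
        ultimately have "z \<in> X \<and> (z \<in> A \<longleftrightarrow> True)"
          using frontier_case[of "\<lambda>n. y (n + n0)" True z] yX False rs by simp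
        then show ?thesis by (simp add: P_def)
      qed
    qed
    have "closed N"
      unfolding closed_sequential_limits
    proof (intro allI impI, elim conjE)
      fix y z assume y: "\<forall>n. y n \<in> N" and lim: "y \<longlonglongrightarrow> z"
      show "z \<in> N"
      proof (cases "\<rho>2 \<le> dist z b")
        case True
        then show ?thesis by (simp add: N_def)
      next
        case False
        have dl: "(\<lambda>n. dist (y n) b) \<longlonglongrightarrow> dist z b" by (intro tendsto_intros lim)
        have "eventually (\<lambda>n. dist (y n) b < \<rho>2) sequentially" using order_tendstoD(2)[OF dl, of \<rho>2] False by simp
        then obtain n0 where n0: "\<And>n. n \<ge> n0 \<Longrightarrow> dist (y n) b < \<rho>2" by (auto simp: eventually_sequentially)
        have yX: "y (n + n0) \<in> X - A" for n using y n0[of "n + n0"] unfolding N_def by force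
        have "(\<lambda>n. y (n + n0)) \<longlonglongrightarrow> z" using lim by (rule LIMSEQ_ignore_initial_segment)
        moreover have "\<rho>1 \<le> dist z b"
          by (rule LIMSEQ_le_const[OF LIMSEQ_ignore_initial_segment[OF dl, of n0]]) (use XnA yX in \<open>auto intro: less_imp_le\<close>)
        ultimately have "z \<in> X \<and> (z \<in> A \<longleftrightarrow> False)"
          using frontier_case[of "\<lambda>n. y (n + n0)" False z] yX False rs by simp
        then show ?thesis by (simp add: N_def)
      qed
    qed
    have bP: "b \<in> P" using rs by (simp add: P_def)
    obtain q0 :: 'a where q0: "norm q0 = \<rho>2" using vector_choose_size[of \<rho>2] rs by auto
    have Nne: "b + q0 \<in> N" using q0 by (simp add: N_def dist_norm)
    have disj: "P \<inter> N = {}" using A rs XA XnA by (force simp: P_def N_def)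
    \<comment> \<open>Negative on \<open>P\<close> and positive on \<open>N\<close>; its zeros form the separating
      set.\<close>
    define H where "H = (\<lambda>x. infdist x P - infdist x N)"
    have Hc: "continuous_on Y H" for Y unfolding H_def by (intro continuous_intros)
    have HP: "H x < 0" if "x \<in> P" for x
    proof -
      have "infdist x P = 0" using that by simp
      moreover have "infdist x N \<noteq> 0" using in_closed_iff_infdist_zero[OF \<open>closed N\<close>] Nne that disj by blast
      ultimately show ?thesis using infdist_nonneg[of x N] by (simp add: H_def)
    qed
    have HN: "H x > 0" if "x \<in> N" for x
    proof -
      have "infdist x N = 0" using that by simp
      moreover have "infdist x P \<noteq> 0" using in_closed_iff_infdist_zero[OF \<open>closed P\<close>] bP that disj by blast
      ultimately show ?thesis using infdist_nonneg[of x P] by (simp add: H_def)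
    qed
    define F where "F = {x. H x = 0}"
    have FPN: "x \<notin> P \<and> x \<notin> N" if "x \<in> F" for x using HP[of x] HN[of x] that by (auto simp: F_def)
    have FK: "F \<subseteq> ?K" using FPN rs by (force simp: P_def N_def)
    have "closed F" unfolding F_def using Hc[of UNIV] by (intro closed_Collect_eq) auto
    then have cF: "compact F" using FK K by (metis closed_Int_compact inf.absorb_iff1)
    have bF: "b \<notin> F" using FPN bP by blast
    have "\<forall>x\<in>F. \<not> (\<exists>i\<in>Basis. \<forall>j\<in>Basis - {i}. grid_coord l \<tau> j (f x) \<in> \<int>)"
    proof
      fix x assume x: "x \<in> F"
      have "x \<notin> X" using FPN[OF x] by (auto simp: P_def N_def)
      then have "f x \<notin> Sk" using x FK by (auto simp: X_def)
      then show "\<not> (\<exists>i\<in>Basis. \<forall>j\<in>Basis - {i}. grid_coord l \<tau> j (f x) \<in> \<int>)"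
        unfolding Sk_iff u_def .
    qed
    then have "\<exists>c. homotopic_with_canon (\<lambda>_. True) F (sphere 0 1) h (\<lambda>_. c)"
      using l0[rule_format, OF conjI[OF l(1) conjI[OF l(2) conjI[OF FK]]]] by (rule meta_mp[rotated])
    then have "\<not> bounded (connected_component_set (- F) b)"
      using Borsuk_map_essential_bounded_component[OF cF bF] unfolding h_def by blast
    then have "\<not> (\<forall>q\<in>connected_component_set (- F) b. dist b q \<le> \<rho>2)"
      unfolding bounded_def by blast
    then obtain q where q0: "q \<in> connected_component_set (- F) b" "\<not> dist b q \<le> \<rho>2" by blast
    then have q: "q \<in> connected_component_set (- F) b" "\<rho>2 \<le> dist q b" by (simp_all add: dist_commute)
    have "connected (H ` connected_component_set (- F) b)"
      by (intro connected_continuous_image Hc connected_connected_component)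
    moreover have "H b \<in> H ` connected_component_set (- F) b" using bF by (intro imageI) (simp add: connected_component_refl_eq)
    moreover have "H q \<in> H ` connected_component_set (- F) b" using q by blast
    moreover have "H b < 0" using HP[OF bP] .
    moreover have "H q > 0" using HN[of q] q by (simp add: N_def)
    ultimately have "0 \<in> H ` connected_component_set (- F) b"
      using connectedD_interval[of "H ` connected_component_set (- F) b" "H b" "H q" 0] by simp
    then obtain z where "z \<in> connected_component_set (- F) b" "H z = 0" by force
    then show False using connected_component_subset[of "- F" b] by (auto simp: F_def)
  qed
  show ?thesis
  proof (rule exI[of _ l0], intro conjI allI impI)
    fix l \<tau> A
    assume a: "0 < l \<and> l \<le> l0 \<and> (\<forall>x. dist x b \<le> \<rho>1 \<longrightarrow> x \<in> A) \<and> (\<forall>x. \<rho>2 \<le> dist x b \<longrightarrow> x \<notin> A)"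
    show "\<exists>\<gamma> i \<mu>. continuous_on {0..1} \<gamma> \<and> (\<forall>t\<in>{0..1}. r \<le> dist (\<gamma> t) b \<and> dist (\<gamma> t) b \<le> s \<and>
        f (\<gamma> t) = f (\<gamma> 0) + t *\<^sub>R (\<mu> *\<^sub>R i)) \<and> i \<in> Basis \<and>
        (\<forall>j\<in>Basis - {i}. grid_coord l \<tau> j (f (\<gamma> 0)) \<in> \<int>) \<and> (\<gamma> 0 \<in> A \<longleftrightarrow> \<gamma> 1 \<notin> A)"
      by (rule main) (use a in auto)
  qed (fact l00)
qed

section \<open>Grids with small line integrals\<close>

lemma segment_integral_along_axis:
  fixes \<rho> :: "'a::euclidean_space \<Rightarrow> ennreal"
  assumes [measurable]: "\<rho> \<in> borel_measurable borel" and i: "norm i = 1"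
    and L: "\<bar>\<xi>\<bar> \<le> L" "\<bar>\<xi> + \<mu>\<bar> \<le> L"
  shows "segment_integral \<rho> (p + \<xi> *\<^sub>R i) (\<mu> *\<^sub>R i) \<le> (\<integral>\<^sup>+t\<in>{-L..L}. \<rho> (p + t *\<^sub>R i) \<partial>lborel)"
proof (cases "\<mu> = 0")
  case True
  then show ?thesis by (simp add: segment_integral_def)
next
  case False
  have "(\<integral>\<^sup>+t\<in>{-L..L}. \<rho> (p + t *\<^sub>R i) \<partial>lborel) =
     ennreal \<bar>\<mu>\<bar> * (\<integral>\<^sup>+t. \<rho> (p + (\<xi> + \<mu> * t) *\<^sub>R i) * indicator {-L..L} (\<xi> + \<mu> * t) \<partial>lborel)"
    using False by (intro nn_integral_real_affine) auto
  moreover have "(\<integral>\<^sup>+t\<in>{0..1}. \<rho> (p + \<xi> *\<^sub>R i + t *\<^sub>R (\<mu> *\<^sub>R i)) \<partial>lborel) \<le>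
     (\<integral>\<^sup>+t. \<rho> (p + (\<xi> + \<mu> * t) *\<^sub>R i) * indicator {-L..L} (\<xi> + \<mu> * t) \<partial>lborel)"
  proof (rule nn_integral_mono)
    fix t :: real
    have e: "p + \<xi> *\<^sub>R i + t *\<^sub>R (\<mu> *\<^sub>R i) = p + (\<xi> + \<mu> * t) *\<^sub>R i" by (simp add: algebra_simps)
    have "\<xi> + \<mu> * t \<in> {-L..L}" if "t \<in> {0..1}"
    proof -
      have "\<xi> + \<mu> * t = (1 - t) * \<xi> + t * (\<xi> + \<mu>)" by (simp add: algebra_simps)
      then have "\<bar>\<xi> + \<mu> * t\<bar> \<le> (1 - t) * \<bar>\<xi>\<bar> + t * \<bar>\<xi> + \<mu>\<bar>"
        using that abs_triangle_ineq[of "(1 - t) * \<xi>" "t * (\<xi> + \<mu>)"] by (simp add: abs_mult)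
      also have "\<dots> \<le> (1 - t) * L + t * L" using L that by (intro add_mono mult_left_mono) auto
      finally show ?thesis by (simp add: algebra_simps abs_le_iff)
    qed
    then show "\<rho> (p + \<xi> *\<^sub>R i + t *\<^sub>R (\<mu> *\<^sub>R i)) * indicator {0..1} t \<le>
      \<rho> (p + (\<xi> + \<mu> * t) *\<^sub>R i) * indicator {-L..L} (\<xi> + \<mu> * t)"
      unfolding e by (simp add: indicator_def)
  qed
  ultimately show ?thesis unfolding segment_integral_def using i by (simp add: mult_left_mono)
qed

lemma mean_axis_integral:
  fixes \<rho> :: "'a::euclidean_space \<Rightarrow> ennreal"
  assumes [measurable]: "\<rho> \<in> borel_measurable borel" and i: "norm i = 1" and L: "L > 0"
    and T: "\<And>\<tau> t. norm \<tau> < l \<Longrightarrow> \<bar>t\<bar> \<le> L \<Longrightarrow> norm (\<tau> + w + t *\<^sub>R i) < T"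
  shows "(\<integral>\<^sup>+\<tau>\<in>ball 0 l. (\<integral>\<^sup>+t\<in>{-L..L}. \<rho> (\<tau> + w + t *\<^sub>R i) \<partial>lborel) \<partial>lborel) \<le>
    ennreal (2 * L) * (\<integral>\<^sup>+x\<in>ball 0 T. \<rho> x \<partial>lborel)"
proof -
  have [measurable]: "ball (0::'a) l \<in> sets borel" "ball (0::'a) T \<in> sets borel" by auto
  have "(\<integral>\<^sup>+\<tau>\<in>ball 0 l. (\<integral>\<^sup>+t\<in>{-L..L}. \<rho> (\<tau> + w + t *\<^sub>R i) \<partial>lborel) \<partial>lborel) =
    (\<integral>\<^sup>+\<tau>. (\<integral>\<^sup>+t. \<rho> (\<tau> + w + t *\<^sub>R i) * indicator {-L..L} t * indicator (ball 0 l) \<tau> \<partial>lborel) \<partial>lborel)"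
    by (rule nn_integral_cong, rule nn_integral_multc[symmetric]) measurable
  also have "\<dots> = (\<integral>\<^sup>+t. (\<integral>\<^sup>+\<tau>. \<rho> (\<tau> + w + t *\<^sub>R i) * indicator {-L..L} t * indicator (ball 0 l) \<tau> \<partial>lborel) \<partial>lborel)"
    by (rule lborel_pair.Fubini'[symmetric]) measurable
  also have "\<dots> \<le> (\<integral>\<^sup>+t. (\<integral>\<^sup>+x\<in>ball 0 T. \<rho> x \<partial>lborel) * indicator {-L..L} t \<partial>lborel)"
  proof (rule nn_integral_mono)
    fix t :: real
    show "(\<integral>\<^sup>+\<tau>. \<rho> (\<tau> + w + t *\<^sub>R i) * indicator {-L..L} t * indicator (ball 0 l) \<tau> \<partial>lborel) \<le>
      (\<integral>\<^sup>+x\<in>ball 0 T. \<rho> x \<partial>lborel) * indicator {-L..L} t"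
    proof (cases "t \<in> {-L..L}")
      case False
      then show ?thesis by simp
    next
      case True
      have "(\<integral>\<^sup>+x\<in>ball 0 T. \<rho> x \<partial>lborel) = ennreal (\<bar>1\<bar> ^ DIM('a)) *
        (\<integral>\<^sup>+\<tau>. \<rho> ((w + t *\<^sub>R i) + 1 *\<^sub>R \<tau>) * indicator (ball 0 T) ((w + t *\<^sub>R i) + 1 *\<^sub>R \<tau>) \<partial>lborel)"
        by (intro nn_integral_affine) auto
      also have "\<dots> = (\<integral>\<^sup>+\<tau>. \<rho> ((w + t *\<^sub>R i) + 1 *\<^sub>R \<tau>) * indicator (ball 0 T) ((w + t *\<^sub>R i) + 1 *\<^sub>R \<tau>) \<partial>lborel)"
        by simp
      also have "\<dots> \<ge> (\<integral>\<^sup>+\<tau>. \<rho> (\<tau> + w + t *\<^sub>R i) * indicator {-L..L} t * indicator (ball 0 l) \<tau> \<partial>lborel)"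
      proof (rule nn_integral_mono)
        fix \<tau> :: 'a
        have e: "(w + t *\<^sub>R i) + 1 *\<^sub>R \<tau> = \<tau> + w + t *\<^sub>R i" by simp
        have "\<tau> + w + t *\<^sub>R i \<in> ball 0 T" if "\<tau> \<in> ball 0 l" using T[of \<tau> t] that True by auto
        then show "\<rho> (\<tau> + w + t *\<^sub>R i) * indicator {-L..L} t * indicator (ball 0 l) \<tau> \<le>
          \<rho> ((w + t *\<^sub>R i) + 1 *\<^sub>R \<tau>) * indicator (ball 0 T) ((w + t *\<^sub>R i) + 1 *\<^sub>R \<tau>)"
          unfolding e using True by (simp add: indicator_def)
      qed
      finally show ?thesis using True by simp
    qed
  qed
  also have "\<dots> = ennreal (2 * L) * (\<integral>\<^sup>+x\<in>ball 0 T. \<rho> x \<partial>lborel)"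
    by (subst nn_integral_cmult_indicator) (use L in \<open>auto simp: mult.commute\<close>)
  finally show ?thesis .
qed

lemma finite_grid_vectors:
  assumes l: "l \<noteq> 0"
  shows "finite {w::'a::euclidean_space. \<forall>j\<in>Basis. \<exists>k::int. \<bar>k\<bar> \<le> N \<and> w \<bullet> j = l * of_int k}"
proof -
  have "{w::'a. \<forall>j\<in>Basis. \<exists>k::int. \<bar>k\<bar> \<le> N \<and> w \<bullet> j = l * of_int k} \<subseteq>
    (\<lambda>g. \<Sum>j\<in>Basis. (l * of_int (g j)) *\<^sub>R j) ` (Basis \<rightarrow>\<^sub>E {-N..N})"
  proof
    fix w :: 'a assume "w \<in> {w::'a. \<forall>j\<in>Basis. \<exists>k::int. \<bar>k\<bar> \<le> N \<and> w \<bullet> j = l * of_int k}"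
    then obtain g where g: "\<And>j. j \<in> Basis \<Longrightarrow> \<bar>g j\<bar> \<le> N \<and> w \<bullet> j = l * of_int (g j)" by (auto dest!: bchoice)
    have "w = (\<Sum>j\<in>Basis. (w \<bullet> j) *\<^sub>R j)" by (rule euclidean_representation[symmetric])
    also have "\<dots> = (\<Sum>j\<in>Basis. (l * of_int (restrict g Basis j)) *\<^sub>R j)"
      using g by (intro sum.cong) auto
    finally have e: "w = (\<Sum>j\<in>Basis. (l * of_int (restrict g Basis j)) *\<^sub>R j)" .
    have "restrict g Basis \<in> Basis \<rightarrow>\<^sub>E {-N..N}" using g by (force simp: abs_le_iff)
    then show "w \<in> (\<lambda>g. \<Sum>j\<in>Basis. (l * of_int (g j)) *\<^sub>R j) ` (Basis \<rightarrow>\<^sub>E {-N..N})"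
      unfolding image_iff using e by (intro bexI)
  qed
  then show ?thesis by (rule finite_subset) (intro finite_imageI finite_PiE, auto)
qed

text \<open>Only finitely many lines of a grid are relevant for a bounded set. By Fubini's theorem the
  integrals along them are small on average over the translations \<open>\<tau>\<close> of the
  grid, if the integral of \<open>\<rho>\<close> is small.\<close>

lemma good_grid:
  fixes l L :: real
  assumes l: "l > 0" and L: "L > 0"
  shows "\<exists>T>0. \<exists>\<epsilon>>0. \<forall>\<rho>. \<rho> \<in> borel_measurable borel \<and> (\<integral>\<^sup>+x\<in>ball 0 T. \<rho> x \<partial>lborel) < ennreal \<epsilon> \<longrightarrow>
    (\<exists>\<tau>::'a::euclidean_space. \<forall>u i \<mu>. i \<in> Basis \<and> norm u \<le> L \<and> norm (u + \<mu> *\<^sub>R i) \<le> L \<and>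
       (\<forall>j\<in>Basis - {i}. grid_coord l \<tau> j u \<in> \<int>) \<longrightarrow> segment_integral \<rho> u (\<mu> *\<^sub>R i) < 1)"
proof -
  define M where "M = L + l"
  have M: "M > 0" using l L by (simp add: M_def)
  define N :: int where "N = \<lceil>M / l\<rceil>"
  \<comment> \<open>Base points, relative to \<open>\<tau>\<close>, of the grid lines that can meet the ball of
    radius \<open>L\<close>.\<close>
  define W where "W = {w::'a. \<forall>j\<in>Basis. \<exists>k::int. \<bar>k\<bar> \<le> N \<and> w \<bullet> j = l * of_int k}"
  have finW: "finite W" unfolding W_def using l by (intro finite_grid_vectors) auto
  define T where "T = l + (\<Sum>w\<in>W. norm w) + M + 1"
  have T0: "T > 0" using l M by (simp add: T_def add_pos_nonneg sum_nonneg add.assoc)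
  have T: "norm (\<tau> + w + t *\<^sub>R i) < T" if "norm \<tau> < l" "\<bar>t\<bar> \<le> M" "w \<in> W" "i \<in> Basis" for \<tau> w i :: 'a and t
  proof -
    have "norm (\<tau> + w + t *\<^sub>R i) \<le> norm \<tau> + norm w + norm (t *\<^sub>R i)"
      by (intro norm_triangle_le add_right_mono norm_triangle_ineq)
    moreover have "norm (t *\<^sub>R i) = \<bar>t\<bar>" using that by simp
    moreover have "norm w \<le> (\<Sum>w\<in>W. norm w)" using finW that by (intro member_le_sum) auto
    ultimately show ?thesis using that by (simp add: T_def)
  qed
  define c where "c = real (card (W \<times> (Basis::'a set))) * (2 * M)"
  have "0 < M / l" using M l by simp
  then have N0: "0 \<le> N" unfolding N_def by linarith
  have "0 \<in> W" using N0 by (auto simp: W_def intro!: exI[of _ 0])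
  then have "card (W \<times> (Basis::'a set)) > 0" using finW by (auto simp: card_gt_0_iff)
  then have c: "c > 0" using M by (simp add: c_def)
  define V where "V = unit_ball_vol (real DIM('a)) * l ^ DIM('a)"
  have V: "V > 0" using l by (simp add: V_def)
  have eV: "emeasure lborel (ball (0::'a) l) = ennreal V" unfolding V_def using l by (intro emeasure_ball) simp
  define \<epsilon> where "\<epsilon> = V / c"
  have \<epsilon>: "\<epsilon> > 0" using V c by (simp add: \<epsilon>_def)
  have main: "\<exists>\<tau>. \<forall>u i \<mu>. i \<in> Basis \<and> norm u \<le> L \<and> norm (u + \<mu> *\<^sub>R i) \<le> L \<and>
       (\<forall>j\<in>Basis - {i}. grid_coord l \<tau> j u \<in> \<int>) \<longrightarrow> segment_integral \<rho> u (\<mu> *\<^sub>R i) < 1"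
    if \<rho>[measurable]: "\<rho> \<in> borel_measurable borel" and small: "(\<integral>\<^sup>+x\<in>ball 0 T. \<rho> x \<partial>lborel) < ennreal \<epsilon>"
    for \<rho> :: "'a \<Rightarrow> ennreal"
  proof -
    have [measurable]: "ball (0::'a) l \<in> sets borel" by simp
    define G where "G = (\<lambda>p \<tau>. \<integral>\<^sup>+t\<in>{-M..M}. \<rho> (\<tau> + fst p + t *\<^sub>R snd p) \<partial>lborel)"
    have [measurable]: "G p \<in> borel_measurable borel" for p unfolding G_def by measurable
    have int: "(\<integral>\<^sup>+\<tau>\<in>ball 0 l. (\<Sum>p\<in>W \<times> Basis. G p \<tau>) \<partial>lborel) < ennreal V"
    proof -
      have "(\<integral>\<^sup>+\<tau>\<in>ball 0 l. (\<Sum>p\<in>W \<times> Basis. G p \<tau>) \<partial>lborel) = (\<Sum>p\<in>W \<times> Basis. (\<integral>\<^sup>+\<tau>\<in>ball 0 l. G p \<tau> \<partial>lborel))"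
        unfolding sum_distrib_right by (rule nn_integral_sum) measurable
      also have "\<dots> \<le> (\<Sum>p\<in>W \<times> (Basis::'a set). ennreal (2 * M) * (\<integral>\<^sup>+x\<in>ball 0 T. \<rho> x \<partial>lborel))"
      proof (rule sum_mono)
        fix p :: "'a \<times> 'a" assume p: "p \<in> W \<times> Basis"
        show "(\<integral>\<^sup>+\<tau>\<in>ball 0 l. G p \<tau> \<partial>lborel) \<le> ennreal (2 * M) * (\<integral>\<^sup>+x\<in>ball 0 T. \<rho> x \<partial>lborel)"
          unfolding G_def by (rule mean_axis_integral[OF \<rho> _ M]) (use p T in auto)
      qed
      also have "\<dots> = ennreal c * (\<integral>\<^sup>+x\<in>ball 0 T. \<rho> x \<partial>lborel)"
        using M by (simp add: c_def ennreal_mult ennreal_of_nat_eq_real_of_nat mult.assoc)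
      also have "\<dots> < ennreal c * ennreal \<epsilon>"
        using small c by (intro ennreal_mult_strict_left_mono) auto
      also have "\<dots> = ennreal V" using c \<epsilon> by (simp add: ennreal_mult[symmetric] \<epsilon>_def)
      finally show ?thesis .
    qed
    have "\<exists>\<tau>\<in>ball 0 l. (\<Sum>p\<in>W \<times> Basis. G p \<tau>) < 1"
    proof (rule ccontr)
      assume "\<not> ?thesis"
      then have ge: "1 \<le> (\<Sum>p\<in>W \<times> Basis. G p \<tau>)" if "\<tau> \<in> ball 0 l" for \<tau> using that by (auto simp: not_less)
      have "ennreal V = (\<integral>\<^sup>+\<tau>. indicator (ball (0::'a) l) \<tau> \<partial>lborel)" using eV by simp
      also have "\<dots> \<le> (\<integral>\<^sup>+\<tau>\<in>ball 0 l. (\<Sum>p\<in>W \<times> Basis. G p \<tau>) \<partial>lborel)"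
        by (rule nn_integral_mono) (use ge in \<open>auto simp: indicator_def\<close>)
      finally show False using int by simp
    qed
    then obtain \<tau> where \<tau>: "norm \<tau> < l" "(\<Sum>p\<in>W \<times> Basis. G p \<tau>) < 1" by auto
    have "segment_integral \<rho> u (\<mu> *\<^sub>R i) < 1"
      if i: "i \<in> Basis" and u: "norm u \<le> L" "norm (u + \<mu> *\<^sub>R i) \<le> L" and g: "\<forall>j\<in>Basis - {i}. grid_coord l \<tau> j u \<in> \<int>" for u i \<mu>
    proof -
      define w where "w = (u - \<tau>) - ((u - \<tau>) \<bullet> i) *\<^sub>R i"
      define \<xi> where "\<xi> = (u - \<tau>) \<bullet> i"
      have wi: "w \<bullet> i = 0" using i by (simp add: w_def inner_diff_left)
      have wj: "w \<bullet> j = (u - \<tau>) \<bullet> j" if "j \<in> Basis" "j \<noteq> i" for j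
        using that i by (simp add: w_def inner_diff_left inner_Basis)
      have bd: "\<bar>(u - \<tau>) \<bullet> j\<bar> \<le> M" if "j \<in> Basis" for j
        using Basis_le_norm[OF that, of "u - \<tau>"] norm_triangle_ineq4[of u \<tau>] u \<tau> by (simp add: M_def)
      have "\<exists>k::int. \<bar>k\<bar> \<le> N \<and> w \<bullet> j = l * of_int k" if j: "j \<in> Basis" for j
      proof (cases "j = i")
        case True
        then show ?thesis using N0 wi by (intro exI[of _ 0]) auto
      next
        case False
        then obtain k where k: "grid_coord l \<tau> j u = of_int k" using g j by (auto elim!: Ints_cases)
        then have e: "(u - \<tau>) \<bullet> j = l * of_int k" using l by (simp add: grid_coord_def field_simps)
        have "l * \<bar>of_int k\<bar> \<le> M" using bd[OF j] l unfolding e by (simp add: abs_mult)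
        then have "\<bar>of_int k\<bar> \<le> M / l" using l by (simp add: field_simps)
        then have "\<bar>k\<bar> \<le> N" unfolding N_def by (simp add: le_ceiling_iff)
        then show ?thesis using e wj[OF j False] by auto
      qed
      then have wW: "w \<in> W" by (simp add: W_def)
      have ue: "u = (\<tau> + w) + \<xi> *\<^sub>R i" by (simp add: w_def \<xi>_def)
      have l1: "\<bar>\<xi>\<bar> \<le> M" using bd[OF i] by (simp add: \<xi>_def)
      have "\<xi> + \<mu> = ((u + \<mu> *\<^sub>R i) - \<tau>) \<bullet> i" using i by (simp add: \<xi>_def inner_diff_left inner_add_left)
      then have l2: "\<bar>\<xi> + \<mu>\<bar> \<le> M"
        using Basis_le_norm[OF i, of "u + \<mu> *\<^sub>R i - \<tau>"] norm_triangle_ineq4[of "u + \<mu> *\<^sub>R i" \<tau>] u \<tau> by (simp add: M_def)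
      have "segment_integral \<rho> ((\<tau> + w) + \<xi> *\<^sub>R i) (\<mu> *\<^sub>R i) \<le> (\<integral>\<^sup>+t\<in>{-M..M}. \<rho> ((\<tau> + w) + t *\<^sub>R i) \<partial>lborel)"
        by (rule segment_integral_along_axis[OF \<rho> _ l1 l2]) (use i in simp)
      also have "\<dots> = G (w, i) \<tau>" by (simp add: G_def)
      also have "\<dots> \<le> (\<Sum>p\<in>W \<times> Basis. G p \<tau>)" using finW wW i by (intro member_le_sum) auto
      also have "\<dots> < 1" by (rule \<tau>(2))
      finally show ?thesis using ue by simp
    qed
    then show ?thesis by blast
  qed
  show ?thesis
  proof (rule exI[of _ T], intro conjI T0, rule exI[of _ \<epsilon>], intro conjI \<epsilon>, intro allI impI, elim conjE)
    fix \<rho> :: "'a \<Rightarrow> ennreal"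
    assume "\<rho> \<in> borel_measurable borel" "(\<integral>\<^sup>+x\<in>ball 0 T. \<rho> x \<partial>lborel) < ennreal \<epsilon>"
    then show "\<exists>\<tau>. \<forall>u i \<mu>. i \<in> Basis \<and> norm u \<le> L \<and> norm (u + \<mu> *\<^sub>R i) \<le> L \<and>
       (\<forall>j\<in>Basis - {i}. grid_coord l \<tau> j u \<in> \<int>) \<longrightarrow> segment_integral \<rho> u (\<mu> *\<^sub>R i) < 1"
      by (rule main)
  qed
qed

section \<open>The radial integral of a ring map\<close>

text \<open>The radius \<open>R'\<close> leaves room for barriers that surround the closed ball of radius
  \<open>R\<close>.\<close>

locale ring_map =
  fixes D :: "'a::euclidean_space set" and Q :: "'a \<Rightarrow> ennreal" and b :: 'a and f :: "'a \<Rightarrow> 'a" and R R' :: real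
  assumes dim: "DIM('a) \<ge> 2" and openD: "open D" and Qm: "Q \<in> borel_measurable (lebesgue_on D)"
    and Qpos: "\<And>x. x \<in> D \<Longrightarrow> Q x > 0"
    and openf: "open_mapping_on (D - {b}) f" and discf: "discrete_mapping_on (D - {b}) f"
    and ringf: "ring_Q_mapping D Q b f"
    and R: "0 < R" "R < R'" "ereal R < boundary_dist b D" and ballD: "cball b R' \<subseteq> D"
    and mean_finite: "AE t in lebesgue. t \<in> {0<..<R} \<longrightarrow> spherical_mean Q b t < \<infinity>"
begin

lemma contf: "continuous_on (D - {b}) f" using ringf by (simp add: ring_Q_mapping_def)

lemma ring_subset: "0 < r \<Longrightarrow> s \<le> R' \<Longrightarrow> {x. r \<le> dist x b \<and> dist x b \<le> s} \<subseteq> D - {b}"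
  using ballD by (auto simp: subset_iff dist_commute)

lemma cball_R: "cball b R \<subseteq> D"
  using ballD R(2) by (meson less_imp_le order_trans subset_cball)

text \<open>Additivity and monotone convergence need a measurable integrand, and the spherical mean agrees
  almost everywhere with a Borel function of the radius.\<close>

lemma radial_integral_borel:
  obtains \<psi> where "\<psi> \<in> borel_measurable borel"
    "\<And>r s. 0 \<le> r \<Longrightarrow> s \<le> R \<Longrightarrow> radial_integral Q b r s = (\<integral>\<^sup>+t\<in>{r<..<s}. \<psi> t \<partial>lborel)"
proof -
  obtain Q' where Q': "Q' \<in> borel_measurable borel"
    and mean: "AE t in lborel. 0 < t \<and> t < R \<longrightarrow> spherical_mean Q b t = direction_integral Q' b t / ennreal (unit_ball_vol (real DIM('a)))"
    by (rule AE_spherical_mean[OF openD Qm Qpos cball_R], assumption, rule that, assumption+)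
  define q where "q = (\<lambda>t. direction_integral Q' b t / ennreal (unit_ball_vol (real DIM('a))))"
  have [measurable]: "q \<in> borel_measurable borel" unfolding q_def using Q' by measurable
  have "radial_density DIM('a) q \<in> borel_measurable borel" by measurable
  moreover have "radial_integral Q b r s = (\<integral>\<^sup>+t\<in>{r<..<s}. radial_density DIM('a) q t \<partial>lborel)" if "0 \<le> r" "s \<le> R" for r s
    unfolding radial_integral_def nn_integral_completion
  proof (rule nn_integral_cong_AE)
    show "AE t in lborel. 1 / (ennreal t * ennreal_powr (spherical_mean Q b t) (1 / real (DIM('a) - 1))) * indicator {r<..<s} t
      = radial_density DIM('a) q t * indicator {r<..<s} t"
      using mean
    proof eventually_elim
      case (elim t)
      show ?case
      proof (cases "t \<in> {r<..<s}")
        case True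
        then have "spherical_mean Q b t = q t" using elim that by (simp add: q_def)
        then show ?thesis by (simp add: radial_density_def)
      qed simp
    qed
  qed
  ultimately show ?thesis by (rule that)
qed

lemma radial_integral_add:
  assumes "0 \<le> r" "r \<le> t" "t \<le> s" "s \<le> R"
  shows "radial_integral Q b r s = radial_integral Q b r t + radial_integral Q b t s"
proof -
  obtain \<psi> where [measurable]: "\<psi> \<in> borel_measurable borel"
    and \<psi>: "\<And>r s. 0 \<le> r \<Longrightarrow> s \<le> R \<Longrightarrow> radial_integral Q b r s = (\<integral>\<^sup>+t\<in>{r<..<s}. \<psi> t \<partial>lborel)"
    by (rule radial_integral_borel, rule that, assumption+)
  have "(\<integral>\<^sup>+x\<in>{r<..<s}. \<psi> x \<partial>lborel) = (\<integral>\<^sup>+x. \<psi> x * indicator {r<..<t} x + \<psi> x * indicator {t<..<s} x \<partial>lborel)"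
  proof (rule nn_integral_cong_AE)
    have "AE x in lborel. x \<noteq> t" by (rule AE_lborel_singleton)
    then show "AE x in lborel. \<psi> x * indicator {r<..<s} x = \<psi> x * indicator {r<..<t} x + \<psi> x * indicator {t<..<s} x"
      by eventually_elim (use assms in \<open>auto simp: indicator_def\<close>)
  qed
  also have "\<dots> = (\<integral>\<^sup>+x\<in>{r<..<t}. \<psi> x \<partial>lborel) + (\<integral>\<^sup>+x\<in>{t<..<s}. \<psi> x \<partial>lborel)"
    by (rule nn_integral_add) measurable
  finally show ?thesis using assms by (simp add: \<psi>)
qed

lemma radial_integral_limit:
  assumes inf: "radial_integral Q b 0 s = top" and s: "0 < s" "s \<le> R"
  shows "\<exists>r0. 0 < r0 \<and> r0 < s \<and> (\<forall>r. 0 < r \<and> r \<le> r0 \<longrightarrow> ennreal T < radial_integral Q b r s)"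
proof -
  obtain \<psi> where [measurable]: "\<psi> \<in> borel_measurable borel"
    and \<psi>: "\<And>r s. 0 \<le> r \<Longrightarrow> s \<le> R \<Longrightarrow> radial_integral Q b r s = (\<integral>\<^sup>+t\<in>{r<..<s}. \<psi> t \<partial>lborel)"
    by (rule radial_integral_borel, rule that, assumption+)
  define a where "a = (\<lambda>k::nat. s / real (k + 2))"
  have a: "0 < a k" "a k < s" for k
  proof -
    show "0 < a k" using s by (simp add: a_def)
    have "s * 1 < s * real (k + 2)" using s by (intro mult_strict_left_mono) auto
    then show "a k < s" by (simp add: a_def divide_less_eq)
  qed
  have inc: "incseq (\<lambda>k t. \<psi> t * indicator {a k<..<s} t)"
  proof (rule incseq_SucI, rule le_funI)
    fix k t
    have "a (Suc k) \<le> a k" using s by (simp add: a_def field_simps)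
    then show "\<psi> t * indicator {a k<..<s} t \<le> \<psi> t * indicator {a (Suc k)<..<s} t"
      by (auto simp: indicator_def)
  qed
  have "(\<integral>\<^sup>+t\<in>{0<..<s}. \<psi> t \<partial>lborel) = (\<integral>\<^sup>+t. (SUP k. \<psi> t * indicator {a k<..<s} t) \<partial>lborel)"
  proof (rule nn_integral_cong)
    fix t :: real
    show "\<psi> t * indicator {0<..<s} t = (SUP k. \<psi> t * indicator {a k<..<s} t)"
    proof (rule antisym)
      show "\<psi> t * indicator {0<..<s} t \<le> (SUP k. \<psi> t * indicator {a k<..<s} t)"
      proof (cases "t \<in> {0<..<s}")
        case True
        obtain k :: nat where "s / t < real k" using reals_Archimedean2 by blast
        then have "a k < t" using True s by (simp add: a_def field_simps)
        then have "\<psi> t * indicator {0<..<s} t = \<psi> t * indicator {a k<..<s} t" using True by simp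
        also have "\<dots> \<le> (SUP k. \<psi> t * indicator {a k<..<s} t)" by (rule SUP_upper) simp
        finally show ?thesis .
      qed simp
      show "(SUP k. \<psi> t * indicator {a k<..<s} t) \<le> \<psi> t * indicator {0<..<s} t"
      proof (rule SUP_least)
        fix k
        show "\<psi> t * indicator {a k<..<s} t \<le> \<psi> t * indicator {0<..<s} t"
          using a(1)[of k] by (auto simp: indicator_def)
      qed
    qed
  qed
  also have "\<dots> = (SUP k. \<integral>\<^sup>+t\<in>{a k<..<s}. \<psi> t \<partial>lborel)"
    by (rule nn_integral_monotone_convergence_SUP[OF inc]) measurable
  also have "\<dots> = (SUP k. radial_integral Q b (a k) s)"
    using a s by (intro SUP_cong refl \<psi>[symmetric]) (auto intro: less_imp_le)
  finally have "(SUP k. radial_integral Q b (a k) s) = top" using inf \<psi>[of 0 s] s by simp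
  then have "ennreal T < (SUP k. radial_integral Q b (a k) s)" by (simp only: ennreal_less_top)
  then obtain k where k: "ennreal T < radial_integral Q b (a k) s" by (auto simp: less_SUP_iff)
  have "ennreal T < radial_integral Q b r s" if "0 < r" "r \<le> a k" for r
  proof -
    have "radial_integral Q b r s = radial_integral Q b r (a k) + radial_integral Q b (a k) s"
      using that a[of k] s by (intro radial_integral_add) auto
    then have "radial_integral Q b (a k) s \<le> radial_integral Q b r s" by simp
    then show ?thesis using k by (rule less_le_trans[rotated])
  qed
  then show ?thesis using a[of k] by (intro exI[of _ "a k"]) auto
qed

lemma modulus_bound:
  assumes "0 < r" "r < s" "s \<le> R" "j > 0" "radial_integral Q b r s = ennreal j"
  shows "modulus (ring_image_family f b r s) \<le> ennreal (real DIM('a) * unit_ball_vol (real DIM('a)) / j ^ (DIM('a) - 1))"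
  by (rule modulus_ring_bounds(1)[OF dim ringf openD Qm Qpos cball_R R(3) mean_finite assms(1-3) assms(4,5)])

lemma modulus_zero:
  assumes "0 < r" "r < s" "s \<le> R" "radial_integral Q b r s = top"
  shows "modulus (ring_image_family f b r s) = 0"
  by (rule modulus_ring_bounds(2)[OF dim ringf openD Qm Qpos cball_R R(3) mean_finite assms(1-3) assms(4)])

lemma admissible_below:
  assumes "modulus \<Gamma> < ennreal e"
  obtains \<rho> :: "'a \<Rightarrow> ennreal" where "\<rho> \<in> adm \<Gamma>" "\<rho> \<in> borel_measurable borel" "(\<integral>\<^sup>+x. \<rho> x ^ DIM('a) \<partial>lborel) < ennreal e"
proof -
  obtain \<rho> where "\<rho> \<in> adm \<Gamma>" "(\<integral>\<^sup>+x. \<rho> x ^ DIM('a) \<partial>lborel) < ennreal e"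
    using assms unfolding modulus_def by (auto simp: INF_less_iff)
  then show ?thesis by (intro that[of \<rho>]) (auto simp: adm_def)
qed

end

section \<open>Finiteness of the radial integral\<close>

text \<open>Young's inequality with the parameter \<open>e / (2 * V)\<close>, which lets both terms
  contribute \<open>e / 2\<close>.\<close>

lemma nn_integral_le_of_small_energy:
  fixes \<rho> :: "'a::euclidean_space \<Rightarrow> ennreal"
  assumes \<rho>[measurable]: "\<rho> \<in> borel_measurable borel" and B: "B \<in> sets borel" "emeasure lborel B = ennreal V" "V > 0"
    and e: "e > 0" and small: "(\<integral>\<^sup>+x. \<rho> x ^ DIM('a) \<partial>lborel) \<le> ennreal (e / 2 * (e / (2 * V)) ^ (DIM('a) - 1))"
  shows "(\<integral>\<^sup>+x\<in>B. \<rho> x \<partial>lborel) \<le> ennreal e"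
proof -
  let ?n = "DIM('a)"
  define d where "d = e / (2 * V)"
  have d: "d > 0" using e B(3) by (simp add: d_def)
  note B(1)[measurable]
  have "(\<integral>\<^sup>+x\<in>B. \<rho> x \<partial>lborel) \<le> ennreal d * emeasure lborel B + ennreal (1 / d ^ (?n - 1)) * (\<integral>\<^sup>+x\<in>B. \<rho> x ^ ?n \<partial>lborel)"
    by (rule nn_integral_young[OF \<rho> B(1) d])
  also have "\<dots> \<le> ennreal d * ennreal V + ennreal (1 / d ^ (?n - 1)) * ennreal (e / 2 * d ^ (?n - 1))"
  proof (rule add_mono)
    have "(\<integral>\<^sup>+x\<in>B. \<rho> x ^ ?n \<partial>lborel) \<le> (\<integral>\<^sup>+x. \<rho> x ^ ?n \<partial>lborel)"
      by (rule nn_integral_mono) (auto simp: indicator_def)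
    then show "ennreal (1 / d ^ (?n - 1)) * (\<integral>\<^sup>+x\<in>B. \<rho> x ^ ?n \<partial>lborel) \<le> ennreal (1 / d ^ (?n - 1)) * ennreal (e / 2 * d ^ (?n - 1))"
      using small unfolding d_def by (intro mult_left_mono) (auto intro: order_trans)
  qed (simp add: B(2))
  also have "\<dots> = ennreal (e / 2) + ennreal (e / 2)"
  proof -
    have "d * V = e / 2" using B(3) by (simp add: d_def)
    then have m1: "ennreal d * ennreal V = ennreal (e / 2)"
      by (subst ennreal_mult[symmetric]) (use d B(3) in auto)
    have m2: "ennreal (1 / d ^ (?n - 1)) * ennreal (e / 2 * d ^ (?n - 1)) = ennreal (e / 2)"
      by (subst ennreal_mult[symmetric]) (use d e in auto)
    show ?thesis by (simp only: m1 m2)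
  qed
  also have "\<dots> = ennreal e" using e by (simp add: ennreal_plus[symmetric] del: ennreal_plus)
  finally show ?thesis .
qed

context ring_map
begin

text \<open>Admissible densities for the countably many rings can be chosen with arbitrarily small integrals
  over a large ball. Their sum has integral less than \<open>1\<close> along all relevant lines of
  a suitable grid. However, some lift of a grid edge leads from \<open>A\<close> to its
  complement, hence across one of the rings.\<close>

lemma no_zero_modulus_barrier:
  fixes p q :: "nat \<Rightarrow> real"
  assumes t0: "0 < t0" "t0 < R'" and A: "\<And>x. dist x b < t0 \<Longrightarrow> x \<in> A" "\<And>x. t0 < dist x b \<Longrightarrow> x \<notin> A"
    and pq: "\<And>k. p k < q k" "\<And>k. modulus (ring_image_family f b (p k) (q k)) = 0"
    and sep: "\<And>x y. x \<in> A \<Longrightarrow> y \<notin> A \<Longrightarrow> \<exists>k. dist x b \<le> p k \<and> q k \<le> dist y b"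
  shows False
proof -
  define r where "r = t0 / 4"
  define \<rho>1 where "\<rho>1 = t0 / 2"
  define s where "s = R'"
  define \<rho>2 where "\<rho>2 = (t0 + R') / 2"
  have ord: "0 < r" "r < \<rho>1" "\<rho>1 < \<rho>2" "\<rho>2 < s" using t0 by (auto simp: r_def \<rho>1_def \<rho>2_def s_def)
  have S: "{x. r \<le> dist x b \<and> dist x b \<le> s} \<subseteq> D - {b}" using ord by (intro ring_subset) (auto simp: s_def)
  let ?K = "{x. r \<le> dist x b \<and> dist x b \<le> s}"
  have "closed ?K" by (intro closed_Collect_conj closed_Collect_le continuous_intros)
  moreover have "bounded ?K" by (rule bounded_subset[OF bounded_cball[of b s]]) (auto simp: dist_commute)
  ultimately have K: "compact ?K" by (simp add: compact_eq_bounded_closed)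
  have "compact (f ` ?K)" by (rule compact_continuous_image[OF continuous_on_subset[OF contf S] K])
  then have "bounded (f ` ?K)" by (rule compact_imp_bounded)
  then obtain L0 where L0: "\<forall>y\<in>f ` ?K. norm y \<le> L0" unfolding bounded_iff by (elim exE)
  define L where "L = max 1 L0"
  have L: "L > 0" "\<And>x. x \<in> ?K \<Longrightarrow> norm (f x) \<le> L" using L0 by (auto simp: L_def le_max_iff_disj)
  define cross where "cross = (\<lambda>l \<tau> \<gamma> i \<mu>. continuous_on {0..1} \<gamma> \<and> (\<forall>t\<in>{0..1}. r \<le> dist (\<gamma> t) b \<and> dist (\<gamma> t) b \<le> s \<and>
        f (\<gamma> t) = f (\<gamma> 0) + t *\<^sub>R (\<mu> *\<^sub>R i)) \<and> i \<in> Basis \<and>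
        (\<forall>j\<in>Basis - {i}. grid_coord l \<tau> j (f (\<gamma> 0)) \<in> \<int>) \<and> (\<gamma> 0 \<in> A \<longleftrightarrow> \<gamma> 1 \<notin> A))"
  from lifted_grid_edge_crosses[OF ord S contf openf discf]
  obtain l where l: "l > 0" and bar: "\<forall>l' \<tau> A. 0 < l' \<and> l' \<le> l \<and> (\<forall>x. dist x b \<le> \<rho>1 \<longrightarrow> x \<in> A) \<and> (\<forall>x. \<rho>2 \<le> dist x b \<longrightarrow> x \<notin> A) \<longrightarrow>
    (\<exists>\<gamma> i \<mu>. continuous_on {0..1} \<gamma> \<and> (\<forall>t\<in>{0..1}. r \<le> dist (\<gamma> t) b \<and> dist (\<gamma> t) b \<le> s \<and>
        f (\<gamma> t) = f (\<gamma> 0) + t *\<^sub>R (\<mu> *\<^sub>R i)) \<and> i \<in> Basis \<and>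
        (\<forall>j\<in>Basis - {i}. grid_coord l' \<tau> j (f (\<gamma> 0)) \<in> \<int>) \<and> (\<gamma> 0 \<in> A \<longleftrightarrow> \<gamma> 1 \<notin> A))"
    by (elim exE conjE)
  have A1: "\<forall>x. dist x b \<le> \<rho>1 \<longrightarrow> x \<in> A" "\<forall>x. \<rho>2 \<le> dist x b \<longrightarrow> x \<notin> A"
    using A t0 by (auto simp: \<rho>1_def \<rho>2_def)
  have crossing: "\<exists>\<gamma> i \<mu>. cross l \<tau> \<gamma> i \<mu>" for \<tau>
    unfolding cross_def by (rule bar[rule_format, OF conjI[OF l conjI[OF order_refl conjI[OF A1]]]])
  obtain T \<epsilon> where T: "T > 0" and \<epsilon>: "\<epsilon> > 0" and grid: "\<forall>\<rho>. \<rho> \<in> borel_measurable borel \<and> (\<integral>\<^sup>+x\<in>ball 0 T. \<rho> x \<partial>lborel) < ennreal \<epsilon> \<longrightarrow>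
    (\<exists>\<tau>::'a. \<forall>u i \<mu>. i \<in> Basis \<and> norm u \<le> L \<and> norm (u + \<mu> *\<^sub>R i) \<le> L \<and>
       (\<forall>j\<in>Basis - {i}. grid_coord l \<tau> j u \<in> \<int>) \<longrightarrow> segment_integral \<rho> u (\<mu> *\<^sub>R i) < 1)"
    using good_grid[OF l L(1)] by (elim exE conjE)
  define V where "V = unit_ball_vol (real DIM('a)) * T ^ DIM('a)"
  have V: "V > 0" "emeasure lborel (ball (0::'a) T) = ennreal V"
    using T unfolding V_def by (auto intro!: emeasure_ball)
  define e where "e = (\<lambda>k::nat. \<epsilon> / 2 * (1 / 2) ^ Suc k)"
  have e: "e k > 0" for k using \<epsilon> by (simp add: e_def)
  have ex: "\<exists>\<rho>. \<rho> \<in> adm (ring_image_family f b (p k) (q k)) \<and> \<rho> \<in> borel_measurable borel \<and> (\<integral>\<^sup>+x\<in>ball 0 T. \<rho> x \<partial>lborel) \<le> ennreal (e k)" for k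
  proof -
    have "0 < e k / 2 * (e k / (2 * V)) ^ (DIM('a) - 1)" using e[of k] V by simp
    then have "modulus (ring_image_family f b (p k) (q k)) < ennreal (e k / 2 * (e k / (2 * V)) ^ (DIM('a) - 1))"
      unfolding pq(2) by (simp del: times_divide_eq_left)
    then obtain \<rho> where \<rho>: "\<rho> \<in> adm (ring_image_family f b (p k) (q k))" "\<rho> \<in> borel_measurable borel"
      "(\<integral>\<^sup>+x. \<rho> x ^ DIM('a) \<partial>lborel) < ennreal (e k / 2 * (e k / (2 * V)) ^ (DIM('a) - 1))"
      by (rule admissible_below)
    have "(\<integral>\<^sup>+x\<in>ball 0 T. \<rho> x \<partial>lborel) \<le> ennreal (e k)"
      by (rule nn_integral_le_of_small_energy[OF \<rho>(2) _ V(2,1) e less_imp_le[OF \<rho>(3)]]) simp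
    then show ?thesis using \<rho> by blast
  qed
  then obtain \<rho> where adm: "\<And>k. \<rho> k \<in> adm (ring_image_family f b (p k) (q k))" and meas[measurable]: "\<And>k. \<rho> k \<in> borel_measurable borel"
    and small: "\<And>k. (\<integral>\<^sup>+x\<in>ball 0 T. \<rho> k x \<partial>lborel) \<le> ennreal (e k)" by metis
  define P where "P = (\<lambda>x. \<Sum>k. \<rho> k x)"
  have [measurable]: "ball (0::'a) T \<in> sets borel" by simp
  have Pm[measurable]: "P \<in> borel_measurable borel" unfolding P_def by measurable
  have le: "\<rho> k x \<le> P x" for k x unfolding P_def
    using sum_le_suminf[of "\<lambda>k. \<rho> k x" "{k}"] by (simp add: summableI)
  have "(\<integral>\<^sup>+x\<in>ball 0 T. P x \<partial>lborel) = (\<integral>\<^sup>+x. (\<Sum>k. \<rho> k x * indicator (ball 0 T) x) \<partial>lborel)"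
    unfolding P_def by (simp add: ennreal_suminf_multc)
  also have "\<dots> = (\<Sum>k. \<integral>\<^sup>+x\<in>ball 0 T. \<rho> k x \<partial>lborel)"
    by (rule nn_integral_suminf) measurable
  also have "\<dots> \<le> (\<Sum>k. ennreal (e k))" by (rule suminf_le) (auto intro: summableI small)
  also have "\<dots> = ennreal (\<epsilon> / 2)"
  proof -
    have "e sums (\<epsilon> / 2 * 1)" unfolding e_def by (intro sums_mult power_half_series)
    then show ?thesis using e by (intro sums_ennreal[THEN iffD2, THEN sums_unique, symmetric]) (auto intro: less_imp_le simp: \<epsilon> less_imp_le)
  qed
  also have "\<dots> < ennreal \<epsilon>" using \<epsilon> by (simp add: ennreal_less_iff)
  finally have PT: "(\<integral>\<^sup>+x\<in>ball 0 T. P x \<partial>lborel) < ennreal \<epsilon>" .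
  obtain \<tau> where \<tau>: "\<forall>u i \<mu>. i \<in> Basis \<and> norm u \<le> L \<and> norm (u + \<mu> *\<^sub>R i) \<le> L \<and>
       (\<forall>j\<in>Basis - {i}. grid_coord l \<tau> j u \<in> \<int>) \<longrightarrow> segment_integral P u (\<mu> *\<^sub>R i) < 1"
    using grid[rule_format, OF conjI[OF Pm PT]] by (elim exE)
  obtain \<gamma> i \<mu> where "cross l \<tau> \<gamma> i \<mu>" using crossing[of \<tau>] by (elim exE)
  note cr' = this[unfolded cross_def]
  have cr: "continuous_on {0..1} \<gamma>" "\<And>t. t \<in> {0..1} \<Longrightarrow> \<gamma> t \<in> ?K" "\<And>t. t \<in> {0..1} \<Longrightarrow> f (\<gamma> t) = f (\<gamma> 0) + t *\<^sub>R (\<mu> *\<^sub>R i)"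
    "i \<in> Basis" "\<forall>j\<in>Basis - {i}. grid_coord l \<tau> j (f (\<gamma> 0)) \<in> \<int>" "\<gamma> 0 \<in> A \<longleftrightarrow> \<gamma> 1 \<notin> A"
    using cr' by (blast, blast, blast, blast, blast, blast)
  have n0: "norm (f (\<gamma> 0)) \<le> L" using L(2)[OF cr(2)[of 0]] by simp
  have "f (\<gamma> 1) = f (\<gamma> 0) + \<mu> *\<^sub>R i" using cr(3)[of 1] by simp
  then have n1: "norm (f (\<gamma> 0) + \<mu> *\<^sub>R i) \<le> L" using L(2)[OF cr(2)[of 1]] by simp
  have lt: "segment_integral P (f (\<gamma> 0)) (\<mu> *\<^sub>R i) < 1"
    by (rule \<tau>[rule_format, OF conjI[OF cr(4) conjI[OF n0 conjI[OF n1 cr(5)]]]])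
  obtain k where k: "dist (\<gamma> 0) b \<le> p k \<and> q k \<le> dist (\<gamma> 1) b \<or> dist (\<gamma> 1) b \<le> p k \<and> q k \<le> dist (\<gamma> 0) b"
    using sep cr(6) by (cases "\<gamma> 0 \<in> A") blast+
  have "1 \<le> segment_integral (\<rho> k) (f (\<gamma> 0)) (\<mu> *\<^sub>R i)"
    by (rule segment_crossing[OF adm pq(1) zero_le_one order_refl cr(1) cr(3) k])
  also have "\<dots> \<le> segment_integral P (f (\<gamma> 0)) (\<mu> *\<^sub>R i)"
    unfolding segment_integral_def by (intro mult_left_mono nn_integral_mono mult_right_mono le) auto
  finally show False using lt by simp
qed

text \<open>Let \<open>t0\<close> be the first radius at which the integral from \<open>r\<close> becomes
  infinite. Either it is infinite already on every interval to the left of \<open>t0\<close>, or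
  on every interval to the right of \<open>t0\<close>. All rings adjacent to the sphere of radius
  \<open>t0\<close> from that side have modulus zero, and every path that crosses the sphere
  crosses one of them.\<close>

lemma radial_integral_finite:
  assumes rs: "0 < r" "r \<le> s" "s \<le> R"
  shows "radial_integral Q b r s < top"
proof (rule ccontr)
  assume "\<not> ?thesis"
  then have inf: "radial_integral Q b r s = top" by (simp add: less_top[symmetric])
  define E where "E = {t. r \<le> t \<and> t \<le> s \<and> radial_integral Q b r t = top}"
  have sE: "s \<in> E" using rs inf by (simp add: E_def)
  have bE: "bdd_below E" by (rule bdd_belowI[of _ r]) (simp add: E_def)
  define t0 where "t0 = Inf E"
  have t0: "r \<le> t0" "t0 \<le> s"
    unfolding t0_def using sE bE by (auto intro!: cInf_greatest cInf_lower simp: E_def)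
  have below: "radial_integral Q b r t < top" if "r \<le> t" "t < t0" for t
  proof (rule ccontr)
    assume "\<not> ?thesis"
    then have "t \<in> E" using that t0 by (simp add: E_def less_top[symmetric])
    then have "t0 \<le> t" unfolding t0_def using bE by (rule cInf_lower)
    then show False using that by simp
  qed
  have t0R: "0 < t0" "t0 < R'" using t0 rs R by auto
  show False
  proof (cases "radial_integral Q b r t0 = top")
    case True
    have "r \<noteq> t0"
    proof
      assume "r = t0"
      then have "radial_integral Q b r t0 = 0" by (simp add: radial_integral_def)
      then show False using True by simp
    qed
    then have rt: "r < t0" using t0 by simp
    define p where "p = (\<lambda>k::nat. t0 - (t0 - r) / real (k + 2))"
    have p: "r \<le> p k" "p k < t0" for k
    proof -
      have "(t0 - r) / real (k + 2) \<le> (t0 - r) / 1" using rt by (intro divide_left_mono) auto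
      then show "r \<le> p k" by (simp add: p_def)
      show "p k < t0" using rt by (simp add: p_def)
    qed
    show False
    proof (rule no_zero_modulus_barrier[where A = "{x. dist x b < t0}" and p = p and q = "\<lambda>_. t0", OF t0R])
      show "modulus (ring_image_family f b (p k) t0) = 0" for k
      proof (rule modulus_zero)
        have "radial_integral Q b r t0 = radial_integral Q b r (p k) + radial_integral Q b (p k) t0"
          using p[of k] rs t0 by (intro radial_integral_add) auto
        then show "radial_integral Q b (p k) t0 = top"
          using True below[OF p[of k]] by (metis ennreal_add_eq_top less_irrefl)
      qed (use p[of k] rs t0 in auto)
      show "\<exists>k. dist x b \<le> p k \<and> t0 \<le> dist y b" if "x \<in> {x. dist x b < t0}" "y \<notin> {x. dist x b < t0}" for x y
      proof -
        obtain k :: nat where k: "(t0 - r) / (t0 - dist x b) < real k" using reals_Archimedean2 by blast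
        have "(t0 - r) / real (k + 2) \<le> t0 - dist x b"
        proof -
          have "t0 - r < real k * (t0 - dist x b)" using k that by (simp add: divide_less_eq)
          also have "\<dots> \<le> real (k + 2) * (t0 - dist x b)" using that by (intro mult_right_mono) auto
          finally show ?thesis by (simp add: divide_le_eq mult.commute)
        qed
        then show ?thesis using that by (intro exI[of _ k]) (auto simp: p_def)
      qed
    qed (use p in auto)
  next
    case False
    then have ts: "t0 < s" using inf t0 by (cases "t0 = s") auto
    define q where "q = (\<lambda>k::nat. t0 + (s - t0) / real (k + 2))"
    have q: "t0 < q k" "q k \<le> s" for k
    proof -
      have "(s - t0) / real (k + 2) \<le> (s - t0) / 1" using ts by (intro divide_left_mono) auto
      then show "q k \<le> s" by (simp add: q_def)
      show "t0 < q k" using ts by (simp add: q_def)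
    qed
    show False
    proof (rule no_zero_modulus_barrier[where A = "{x. dist x b \<le> t0}" and p = "\<lambda>_. t0" and q = q, OF t0R])
      show "modulus (ring_image_family f b t0 (q k)) = 0" for k
      proof (rule modulus_zero)
        have "\<exists>t\<in>E. t < q k" using cInf_lessD[of E "q k"] sE q(1)[of k] unfolding t0_def by blast
        then obtain t where t: "t \<in> E" "t < q k" by blast
        have "radial_integral Q b r (q k) = radial_integral Q b r t + radial_integral Q b t (q k)"
          using t q[of k] rs by (intro radial_integral_add) (auto simp: E_def)
        then have top: "radial_integral Q b r (q k) = top" using t by (simp add: E_def)
        have "radial_integral Q b r (q k) = radial_integral Q b r t0 + radial_integral Q b t0 (q k)"
          using q[of k] rs t0 by (intro radial_integral_add) auto
        then show "radial_integral Q b t0 (q k) = top" using top False by (metis ennreal_add_eq_top)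
      qed (use q[of k] t0R rs in auto)
      show "\<exists>k. dist x b \<le> t0 \<and> q k \<le> dist y b" if "x \<in> {x. dist x b \<le> t0}" "y \<notin> {x. dist x b \<le> t0}" for x y
      proof -
        obtain k :: nat where k: "(s - t0) / (dist y b - t0) < real k" using reals_Archimedean2 by blast
        have "(s - t0) / real (k + 2) \<le> dist y b - t0"
        proof -
          have "s - t0 < real k * (dist y b - t0)" using k that by (simp add: divide_less_eq)
          also have "\<dots> \<le> real (k + 2) * (dist y b - t0)" using that by (intro mult_right_mono) auto
          finally show ?thesis by (simp add: divide_le_eq mult.commute)
        qed
        then show ?thesis using that by (intro exI[of _ k]) (auto simp: q_def)
      qed
    qed (use q in auto)
  qed
qed

text \<open>The integral from \<open>s\<close> to \<open>R\<close> is finite, so the divergence at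
  \<open>0\<close> persists when the outer radius is lowered to \<open>s\<close>.\<close>

lemma small_modulus:
  assumes inf: "radial_integral Q b 0 R = top" and s: "0 < s" "s \<le> R" and e: "\<epsilon> > 0"
  shows "\<exists>r0. 0 < r0 \<and> r0 < s \<and> (\<forall>r. 0 < r \<and> r \<le> r0 \<longrightarrow> modulus (ring_image_family f b r s) < ennreal \<epsilon>)"
proof -
  define \<omega> where "\<omega> = real DIM('a) * unit_ball_vol (real DIM('a))"
  have \<omega>: "\<omega> > 0" by (simp add: \<omega>_def)
  have "radial_integral Q b 0 R = radial_integral Q b 0 s + radial_integral Q b s R"
    using s by (intro radial_integral_add) auto
  moreover have "radial_integral Q b s R < top" using s by (intro radial_integral_finite) auto
  ultimately have "radial_integral Q b 0 s = top" using inf by (metis ennreal_add_eq_top less_irrefl)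
  then obtain r0 where r0: "0 < r0" "r0 < s" "\<And>r. 0 < r \<Longrightarrow> r \<le> r0 \<Longrightarrow> ennreal (max 1 (2 * \<omega> / \<epsilon>)) < radial_integral Q b r s"
    using radial_integral_limit[OF _ s, of "max 1 (2 * \<omega> / \<epsilon>)"] by blast
  have "modulus (ring_image_family f b r s) < ennreal \<epsilon>" if r: "0 < r" "r \<le> r0" for r
  proof -
    have "radial_integral Q b r s < top" using r r0 s by (intro radial_integral_finite) auto
    then obtain j where j: "j \<ge> 0" "radial_integral Q b r s = ennreal j" by (cases "radial_integral Q b r s") auto
    have jm: "max 1 (2 * \<omega> / \<epsilon>) < j" using r0(3)[OF r] j by (simp add: ennreal_less_iff del: max_less_iff_conj)
    then have j1: "1 < j" "2 * \<omega> / \<epsilon> < j" by auto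
    have "modulus (ring_image_family f b r s) \<le> ennreal (\<omega> / j ^ (DIM('a) - 1))"
      unfolding \<omega>_def using r r0 s j1 j by (intro modulus_bound) auto
    also have "\<dots> < ennreal \<epsilon>"
    proof -
      have "j ^ 1 \<le> j ^ (DIM('a) - 1)" using j1 dim by (intro power_increasing) auto
      then have "\<omega> / j ^ (DIM('a) - 1) \<le> \<omega> / j" using \<omega> j1 by (intro divide_left_mono) auto
      also have "\<dots> < \<epsilon>" using j1 e \<omega> by (simp add: field_simps)
      finally show ?thesis using \<omega> j1 by (simp add: ennreal_less_iff)
    qed
    finally show ?thesis .
  qed
  then show ?thesis using r0(1,2) by blast
qed

end

section \<open>Images of small spheres\<close>

text \<open>The sum of the unit vectors of \<open>p\<close> and \<open>q\<close> works; if it vanishes, any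
  vector orthogonal to \<open>p\<close> does.\<close>

lemma escaping_direction:
  fixes p q :: "'a::euclidean_space"
  assumes dim: "DIM('a) \<ge> 2" and p: "p \<noteq> 0" and q: "q \<noteq> 0"
  shows "\<exists>v. norm v = 1 \<and> p \<bullet> v \<ge> 0 \<and> q \<bullet> v \<ge> 0"
proof -
  define w where "w = p /\<^sub>R norm p + q /\<^sub>R norm q"
  show ?thesis
  proof (cases "w = 0")
    case True
    then have "p /\<^sub>R norm p = - (q /\<^sub>R norm q)" by (simp add: w_def eq_neg_iff_add_eq_0)
    then have "q = - (norm q *\<^sub>R (p /\<^sub>R norm p))" using q by simp
    then have qp: "q = (- norm q / norm p) *\<^sub>R p" by (simp add: divide_inverse)
    obtain v where v: "v \<noteq> 0" "orthogonal p v" using orthogonal_to_vector_exists[OF dim, of p] by blast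
    have "p \<bullet> v = 0" using v by (simp add: orthogonal_def)
    then have pv: "p \<bullet> (v /\<^sub>R norm v) = 0" by simp
    moreover have "q \<bullet> (v /\<^sub>R norm v) = (- norm q / norm p) * (p \<bullet> (v /\<^sub>R norm v))"
      using arg_cong[OF qp, of "\<lambda>z. z \<bullet> (v /\<^sub>R norm v)"] unfolding inner_scaleR_left .
    ultimately have "p \<bullet> (v /\<^sub>R norm v) = 0" "q \<bullet> (v /\<^sub>R norm v) = 0" by simp_all
    then show ?thesis using v by (intro exI[of _ "v /\<^sub>R norm v"]) auto
  next
    case False
    have c: "\<bar>p \<bullet> q\<bar> \<le> norm p * norm q" by (rule Cauchy_Schwarz_ineq2)
    have "p \<bullet> w = norm p + (p \<bullet> q) / norm q"
      using p by (simp add: w_def inner_add_right dot_square_norm power2_eq_square divide_inverse mult.commute)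
    moreover have "- norm p \<le> (p \<bullet> q) / norm q" using c q by (simp add: field_simps abs_le_iff)
    moreover have "q \<bullet> w = norm q + (p \<bullet> q) / norm p"
      using q by (simp add: w_def inner_add_right dot_square_norm power2_eq_square divide_inverse mult.commute inner_commute)
    moreover have "- norm q \<le> (p \<bullet> q) / norm p" using c p by (simp add: field_simps abs_le_iff)
    ultimately have "p \<bullet> w \<ge> 0" "q \<bullet> w \<ge> 0" by linarith+
    then show ?thesis using False by (intro exI[of _ "w /\<^sub>R norm w"]) auto
  qed
qed

lemma norm_add_along:
  fixes p v :: "'a::euclidean_space"
  assumes "p \<bullet> v \<ge> 0" "t \<ge> 0"
  shows "norm p \<le> norm (p + t *\<^sub>R v)"
proof (rule norm_le[THEN iffD2])
  have "(p + t *\<^sub>R v) \<bullet> (p + t *\<^sub>R v) = p \<bullet> p + 2 * t * (p \<bullet> v) + t\<^sup>2 * (v \<bullet> v)"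
    by (simp add: inner_add_left inner_add_right inner_commute power2_eq_square algebra_simps)
  moreover have "2 * t * (p \<bullet> v) \<ge> 0" "t\<^sup>2 * (v \<bullet> v) \<ge> 0" using assms by auto
  ultimately show "p \<bullet> p \<le> (p + t *\<^sub>R v) \<bullet> (p + t *\<^sub>R v)" by linarith
qed

text \<open>If \<open>f x\<close> is outside both balls, it starts a ray that avoids both balls. The last
  point of the ray in the compact image of the closed ring comes from an interior point of the
  ring, which contradicts openness.\<close>

lemma two_balls:
  fixes f :: "'a::euclidean_space \<Rightarrow> 'a"
  assumes dim: "DIM('a) \<ge> 2" and S: "{x. \<alpha> \<le> dist x b \<and> dist x b \<le> \<beta>} \<subseteq> S"
    and f: "continuous_on S f" "open_mapping_on S f" and \<delta>: "\<delta> \<ge> 0"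
    and y: "\<And>x. dist x b = \<alpha> \<Longrightarrow> f x \<in> cball y1 \<delta>" "\<And>x. dist x b = \<beta> \<Longrightarrow> f x \<in> cball y2 \<delta>"
    and x: "\<alpha> \<le> dist x b" "dist x b \<le> \<beta>"
  shows "f x \<in> cball y1 \<delta> \<union> cball y2 \<delta>"
proof (rule ccontr)
  let ?K = "{x. \<alpha> \<le> dist x b \<and> dist x b \<le> \<beta>}"
  let ?U = "{x. \<alpha> < dist x b \<and> dist x b < \<beta>}"
  assume out: "f x \<notin> cball y1 \<delta> \<union> cball y2 \<delta>"
  have "closed ?K" by (intro closed_Collect_conj closed_Collect_le continuous_intros)
  moreover have "bounded ?K" by (rule bounded_subset[OF bounded_cball[of b \<beta>]]) (auto simp: dist_commute)
  ultimately have K: "compact ?K" by (simp add: compact_eq_bounded_closed)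
  have "open ?U" by (intro open_Collect_conj open_Collect_less continuous_intros)
  moreover have "?U \<subseteq> S" using S by force
  ultimately have V: "open (f ` ?U)" using f(2) unfolding open_mapping_on_def by blast
  have cK: "compact (f ` ?K)" by (rule compact_continuous_image[OF continuous_on_subset[OF f(1) S] K])
  have ne: "f x - y1 \<noteq> 0" "f x - y2 \<noteq> 0" using out \<delta> by auto
  obtain v where v: "norm v = 1" "(f x - y1) \<bullet> v \<ge> 0" "(f x - y2) \<bullet> v \<ge> 0"
    using escaping_direction[OF dim ne] by blast
  define g where "g = (\<lambda>t::real. f x + t *\<^sub>R v)"
  have outg: "g t \<notin> cball y1 \<delta> \<union> cball y2 \<delta>" if "t \<ge> 0" for t
  proof -
    have "norm (f x - y1) \<le> norm (f x - y1 + t *\<^sub>R v)" "norm (f x - y2) \<le> norm (f x - y2 + t *\<^sub>R v)"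
      using v that by (auto intro: norm_add_along)
    moreover have "f x - y1 + t *\<^sub>R v = g t - y1" "f x - y2 + t *\<^sub>R v = g t - y2" by (auto simp: g_def)
    moreover have "norm (f x - y1) > \<delta>" "norm (f x - y2) > \<delta>" using out by (auto simp: dist_norm norm_minus_commute)
    ultimately have "norm (g t - y1) > \<delta>" "norm (g t - y2) > \<delta>" by (simp_all only: less_le_trans)
    then show ?thesis by (simp add: dist_norm norm_minus_commute)
  qed
  define T where "T = {t. 0 \<le> t \<and> g t \<in> f ` ?K}"
  obtain B where B: "\<And>z. z \<in> f ` ?K \<Longrightarrow> norm z \<le> B" using compact_imp_bounded[OF cK] unfolding bounded_iff by blast
  have "closed (g -` (f ` ?K))"
    unfolding g_def by (rule continuous_closed_vimage[OF compact_imp_closed[OF cK]]) (intro continuous_intros)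
  moreover have "T = {0..} \<inter> g -` (f ` ?K)" by (auto simp: T_def)
  ultimately have "closed T" by (simp add: closed_Int)
  moreover have "bounded T"
    unfolding bounded_iff
  proof (intro exI ballI)
    fix t assume t: "t \<in> T"
    have "norm (t *\<^sub>R v) \<le> norm (g t) + norm (f x)" using norm_triangle_ineq4[of "g t" "f x"] by (simp add: g_def)
    also have "\<dots> \<le> B + norm (f x)" using B t by (intro add_right_mono) (auto simp: T_def)
    finally show "norm t \<le> B + norm (f x)" using v by simp
  qed
  ultimately have "compact T" by (simp add: compact_eq_bounded_closed)
  moreover have "0 \<in> T" using x by (auto simp: T_def g_def)
  ultimately obtain t where t: "t \<in> T" "\<forall>t'\<in>T. t' \<le> t" using compact_attains_sup[of T] by blast
  then obtain z where z: "z \<in> ?K" "g t = f z" by (auto simp: T_def)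
  have t0: "t \<ge> 0" using t by (simp add: T_def)
  have "dist z b \<noteq> \<alpha>" "dist z b \<noteq> \<beta>" using outg[OF t0] y[of z] z(2) by auto
  then have "z \<in> ?U" using z by auto
  then have "g t \<in> f ` ?U" using z by blast
  then obtain e where e: "e > 0" "ball (g t) e \<subseteq> f ` ?U" using V by (meson openE)
  have "dist (g t) (g (t + e/2)) = e/2" using v e by (simp add: g_def dist_norm algebra_simps)
  then have "g (t + e/2) \<in> f ` ?U" using e by auto
  then have "t + e/2 \<in> T" using t0 e by (auto simp: T_def)
  then show False using t e by force
qed

text \<open>Suppose that all small spheres whose images meet a given ball have small images. If
  \<open>f\<close> does not tend to infinity, the images of all small spheres meet a fixed ball:
  otherwise a point with a small image lies between two spheres with small images farther out,
  which \<open>two_balls\<close> excludes. Then \<open>two_balls\<close> shows that the image of a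
  ring between small spheres lies in two small balls; they intersect since the image of a radial
  segment is connected, and \<open>f\<close> has the Cauchy property at \<open>b\<close>.\<close>

lemma spread_spheres:
  fixes f :: "'a::euclidean_space \<Rightarrow> 'a"
  assumes dim: "DIM('a) \<ge> 2" and R: "R > 0" and S: "{x. 0 < dist x b \<and> dist x b \<le> R} \<subseteq> S"
    and f: "continuous_on S f" "open_mapping_on S f"
    and nolim: "\<not> (\<exists>l. (f \<longlongrightarrow> l) (at b))" and nopole: "\<not> filterlim f at_infinity (at b)"
  shows "\<exists>\<delta>>0. \<exists>T>0. \<forall>r0>0. \<exists>r. 0 < r \<and> r < r0 \<and> (\<exists>x y. dist x b = r \<and> dist y b = r \<and> norm (f x) \<le> T \<and> \<delta> \<le> dist (f x) (f y))"
proof (rule ccontr)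
  assume neg: "\<not> ?thesis"
  define Pd where "Pd = (\<lambda>\<delta> T r0. \<exists>r. 0 < r \<and> r < r0 \<and> (\<exists>x y. dist x b = r \<and> dist y b = r \<and> norm (f x) \<le> T \<and> \<delta> \<le> dist (f x) (f y)))"
  have neg': "\<not> (\<exists>\<delta>>0. \<exists>T>0. \<forall>r0>0. Pd \<delta> T r0)" using neg unfolding Pd_def .
  have tight: "\<exists>r0>0. r0 \<le> R \<and> (\<forall>x y. 0 < dist x b \<and> dist x b < r0 \<and> dist y b = dist x b \<and> norm (f x) \<le> T \<longrightarrow> dist (f x) (f y) < \<delta>)"
    if \<delta>T: "\<delta> > 0" "T > 0" for \<delta> T
  proof -
    obtain r0 where r0: "r0 > 0" "\<not> Pd \<delta> T r0" using neg' \<delta>T by blast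
    have "dist (f x) (f y) < \<delta>" if "0 < dist x b" "dist x b < r0" "dist y b = dist x b" "norm (f x) \<le> T" for x y
    proof (rule ccontr)
      assume "\<not> dist (f x) (f y) < \<delta>"
      then have "Pd \<delta> T r0" unfolding Pd_def using that
        by (intro exI[of _ "dist x b"] conjI exI[of _ x] exI[of _ y]) auto
      then show False using r0(2) by blast
    qed
    then show ?thesis using r0(1) R by (intro exI[of _ "min r0 R"]) auto
  qed
  have sub: "{x. \<alpha> \<le> dist x b \<and> dist x b \<le> \<beta>} \<subseteq> S" if "0 < \<alpha>" "\<beta> \<le> R" for \<alpha> \<beta>
    using S that by force
  have "\<not> (\<forall>T>0. eventually (\<lambda>x. T \<le> norm (f x)) (at b))"
    using nopole unfolding filterlim_at_infinity[OF order_refl] by auto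
  then obtain T1 where T1: "T1 > 0" "\<not> eventually (\<lambda>x. T1 \<le> norm (f x)) (at b)" by blast
  \<comment> \<open>\<open>f\<close> does not tend to infinity, so some points arbitrarily close to
    \<open>b\<close> have small images.\<close>
  have often: "\<exists>x. 0 < dist x b \<and> dist x b < r0 \<and> norm (f x) < T1" if "r0 > 0" for r0
    using T1(2) that unfolding eventually_at by (metis UNIV_I not_le zero_less_dist_iff)
  \<comment> \<open>The norm of \<open>f\<close> attains intermediate values along radial segments.\<close>
  have ray: "\<exists>z. min (dist x0 b) e \<le> dist z b \<and> dist z b \<le> max (dist x0 b) e \<and> norm (f z) = T"
    if x0: "0 < dist x0 b" "dist x0 b \<le> R" and e: "0 < e" "e \<le> R" and T: "norm (f x0) \<le> T" "\<And>z. dist z b = e \<Longrightarrow> T \<le> norm (f z)" for x0 e T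
  proof -
    define d where "d = dist x0 b"
    define m where "m = (\<lambda>t. d + t * (e - d))"
    define c where "c = (\<lambda>t. b + (m t / d) *\<^sub>R (x0 - b))"
    have d: "d > 0" "d \<le> R" using x0 by (auto simp: d_def)
    have m: "min d e \<le> m t \<and> m t \<le> max d e" if "0 \<le> t" "t \<le> 1" for t
    proof -
      have "m t = (1 - t) * d + t * e" by (simp add: m_def algebra_simps)
      moreover have "(1 - t) * d + t * e \<le> (1 - t) * max d e + t * max d e" using that by (intro add_mono mult_left_mono) auto
      moreover have "(1 - t) * min d e + t * min d e \<le> (1 - t) * d + t * e" using that by (intro add_mono mult_left_mono) auto
      ultimately show ?thesis by (simp add: algebra_simps)
    qed
    have dc: "dist (c t) b = m t" if "0 \<le> t" "t \<le> 1" for t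
    proof -
      have "m t > 0" using m[OF that] d e by (auto simp: min_def split: if_splits)
      moreover have "norm (x0 - b) = d" by (simp add: d_def dist_norm)
      ultimately show ?thesis using d by (simp add: c_def dist_norm)
    qed
    have "continuous_on {0..1} (\<lambda>t. norm (f (c t)))"
    proof (intro continuous_on_norm continuous_on_compose2[OF f(1)])
      show "continuous_on {0..1} c" unfolding c_def m_def using d by (intro continuous_intros) auto
      show "c ` {0..1} \<subseteq> S"
      proof
        fix z assume "z \<in> c ` {0..1}"
        then obtain t where t: "0 \<le> t" "t \<le> 1" "z = c t" by auto
        have "0 < m t" "m t \<le> R" using m[OF t(1,2)] d e by (auto simp: min_def max_def split: if_splits)
        then show "z \<in> S" using S dc[OF t(1,2)] t(3) by auto
      qed
    qed
    moreover have "norm (f (c 0)) \<le> T" using T(1) d by (simp add: c_def m_def)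
    moreover have "T \<le> norm (f (c 1))" using dc[of 1] by (intro T(2)) (simp add: m_def)
    ultimately obtain t where t: "0 \<le> t" "t \<le> 1" "norm (f (c t)) = T"
      using IVT'[of "\<lambda>t. norm (f (c t))" 0 T 1] by auto
    then show ?thesis using dc[OF t(1,2)] m[OF t(1,2)] by (intro exI[of _ "c t"]) (simp add: d_def)
  qed
  have "\<exists>r1>0. r1 \<le> R \<and> (\<forall>r. 0 < r \<and> r < r1 \<longrightarrow> (\<exists>z. dist z b = r \<and> norm (f z) \<le> T1 + 2))"
  proof (rule ccontr)
    assume "\<not> ?thesis"
    then have missing: "\<exists>r. 0 < r \<and> r < r1 \<and> (\<forall>z. dist z b = r \<longrightarrow> T1 + 2 < norm (f z))" if "0 < r1" "r1 \<le> R" for r1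
      using that by (meson not_le)
    obtain r0 where r0: "r0 > 0" "r0 \<le> R"
      "\<And>x y. 0 < dist x b \<Longrightarrow> dist x b < r0 \<Longrightarrow> dist y b = dist x b \<Longrightarrow> norm (f x) \<le> T1 + 2 \<Longrightarrow> dist (f x) (f y) < 1/4"
      using tight[of "1/4" "T1 + 2"] T1 by auto
    obtain r2 where r2: "0 < r2" "r2 < r0" "\<And>z. dist z b = r2 \<Longrightarrow> T1 + 2 < norm (f z)" using missing[OF r0(1,2)] by blast
    obtain x0 where x0: "0 < dist x0 b" "dist x0 b < r2" "norm (f x0) < T1" using often[OF r2(1)] by blast
    obtain r1 where r1: "0 < r1" "r1 < dist x0 b" "\<And>z. dist z b = r1 \<Longrightarrow> T1 + 2 < norm (f z)"
      using missing[of "dist x0 b"] x0 r2 r0 by auto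
    have "\<exists>z. min (dist x0 b) r1 \<le> dist z b \<and> dist z b \<le> max (dist x0 b) r1 \<and> norm (f z) = T1 + 1"
    proof (rule ray)
      show "T1 + 1 \<le> norm (f z)" if "dist z b = r1" for z using r1(3)[OF that] by simp
    qed (use x0 r1(1,2) r2(1,2) r0(1,2) in linarith)+
    then obtain z1 where z1: "min (dist x0 b) r1 \<le> dist z1 b" "dist z1 b \<le> max (dist x0 b) r1" "norm (f z1) = T1 + 1"
      by blast
    have "\<exists>z. min (dist x0 b) r2 \<le> dist z b \<and> dist z b \<le> max (dist x0 b) r2 \<and> norm (f z) = T1 + 1"
    proof (rule ray)
      show "T1 + 1 \<le> norm (f z)" if "dist z b = r2" for z using r2(3)[OF that] by simp
    qed (use x0 r1(1,2) r2(1,2) r0(1,2) in linarith)+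
    then obtain z2 where z2: "min (dist x0 b) r2 \<le> dist z2 b" "dist z2 b \<le> max (dist x0 b) r2" "norm (f z2) = T1 + 1"
      by blast
    have b1: "r1 \<le> dist z1 b" "dist z1 b \<le> dist x0 b" and b2: "dist x0 b \<le> dist z2 b" "dist z2 b \<le> r2"
      using z1 z2 x0 r1 by auto
    have "f x0 \<in> cball (f z1) (1/4) \<union> cball (f z2) (1/4)"
    proof (rule two_balls[OF dim sub[of "dist z1 b" "dist z2 b"] f])
      show "f x \<in> cball (f z1) (1/4)" if "dist x b = dist z1 b" for x
      proof -
        have "dist (f z1) (f x) < 1/4"
          by (rule r0(3)) (use that b1 b2 r1(1,2) x0 r2(1,2) z1(3) in linarith)+
        then show ?thesis by simp
      qed
      show "f x \<in> cball (f z2) (1/4)" if "dist x b = dist z2 b" for x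
      proof -
        have "dist (f z2) (f x) < 1/4"
          by (rule r0(3)) (use that b1 b2 r1(1,2) x0 r2(1,2) z2(3) in linarith)+
        then show ?thesis by simp
      qed
    qed (use b1 b2 r1 r2 r0 in auto)
    then have "norm (f x0) \<ge> T1 + 1 - 1/4"
      using z1(3) z2(3) norm_triangle_ineq2[of "f z1" "f x0"] norm_triangle_ineq2[of "f z2" "f x0"] by (auto simp: dist_norm)
    then show False using x0 by simp
  qed
  then obtain r1 where r1: "r1 > 0" "r1 \<le> R" "\<And>r. 0 < r \<Longrightarrow> r < r1 \<Longrightarrow> \<exists>z. dist z b = r \<and> norm (f z) \<le> T1 + 2"
    by blast
  have cauchy: "\<exists>r>0. \<forall>x y. 0 < dist x b \<and> dist x b < r \<and> 0 < dist y b \<and> dist y b < r \<longrightarrow> dist (f x) (f y) < \<epsilon>"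
    if \<epsilon>: "\<epsilon> > 0" for \<epsilon>
  proof -
    define \<delta> where "\<delta> = \<epsilon> / 5"
    have \<delta>: "\<delta> > 0" using \<epsilon> by (simp add: \<delta>_def)
    obtain r0 where r0: "r0 > 0" "r0 \<le> R"
      "\<And>x y. 0 < dist x b \<Longrightarrow> dist x b < r0 \<Longrightarrow> dist y b = dist x b \<Longrightarrow> norm (f x) \<le> T1 + 2 \<Longrightarrow> dist (f x) (f y) < \<delta>"
      using tight[of \<delta> "T1 + 2"] T1 \<delta> by auto
    define r where "r = min r0 r1"
    have r: "r > 0" "r \<le> r0" "r \<le> r1" using r0 r1 by (auto simp: r_def)
    have ordered: "dist (f x) (f y) < \<epsilon>" if x: "0 < dist x b" and y: "dist y b < r" and xy: "dist x b \<le> dist y b" for x y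
    proof -
      obtain zx where zx: "dist zx b = dist x b" "norm (f zx) \<le> T1 + 2" proof -
        have "\<exists>z. dist z b = dist x b \<and> norm (f z) \<le> T1 + 2" by (rule r1(3)) (use x y xy r in linarith)+
        then show ?thesis using that by blast
      qed
      obtain zy where zy: "dist zy b = dist y b" "norm (f zy) \<le> T1 + 2" proof -
        have "\<exists>z. dist z b = dist y b \<and> norm (f z) \<le> T1 + 2" by (rule r1(3)) (use x y xy r in linarith)+
        then show ?thesis using that by blast
      qed
      have nx: "dist (f zx) (f w) < \<delta>" if "dist w b = dist x b" for w by (rule r0(3)) (use zx that x y xy r in linarith)+
      have ny: "dist (f zy) (f w) < \<delta>" if "dist w b = dist y b" for w by (rule r0(3)) (use zy that x y xy r in linarith)+
      have in2: "f w \<in> cball (f zx) \<delta> \<union> cball (f zy) \<delta>" if "dist x b \<le> dist w b" "dist w b \<le> dist y b" for w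
      proof (rule two_balls[OF dim sub[of "dist x b" "dist y b"] f])
        show "f u \<in> cball (f zx) \<delta>" if "dist u b = dist x b" for u using nx[OF that] by simp
        show "f u \<in> cball (f zy) \<delta>" if "dist u b = dist y b" for u using ny[OF that] by simp
      qed (use that x y r r0(1,2) \<delta> in linarith)+
      define c where "c = (\<lambda>t. b + (t / dist x b) *\<^sub>R (zx - b))"
      have dc: "dist (c t) b = t" if "t \<ge> dist x b" for t
      proof -
        have "t > 0" using that x by linarith
        then show ?thesis using x zx(1) by (simp add: c_def dist_norm)
      qed
      have cS: "c ` {dist x b..dist y b} \<subseteq> S"
      proof
        fix w assume "w \<in> c ` {dist x b..dist y b}"
        then obtain t where t: "dist x b \<le> t" "t \<le> dist y b" "w = c t" by auto
        then show "w \<in> S" using S dc[of t] x y r r0 by auto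
      qed
      have "continuous_on {dist x b..dist y b} c" unfolding c_def using x by (intro continuous_intros) auto
      then have "continuous_on {dist x b..dist y b} (\<lambda>t. f (c t))" using f(1) cS by (intro continuous_on_compose2[OF f(1)]) auto
      then have conn: "connected ((\<lambda>t. f (c t)) ` {dist x b..dist y b})" by (rule connected_continuous_image) simp
      have "\<exists>w. w \<in> cball (f zx) \<delta> \<inter> cball (f zy) \<delta>"
      proof (rule ccontr)
        assume none: "\<not> ?thesis"
        let ?C = "(\<lambda>t. f (c t)) ` {dist x b..dist y b}"
        have "f (c t) \<in> cball (f zx) \<delta> \<union> cball (f zy) \<delta>" if "t \<in> {dist x b..dist y b}" for t
          by (rule in2) (use dc[of t] that in auto)
        then have "?C \<subseteq> cball (f zx) \<delta> \<union> cball (f zy) \<delta>" by blast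
        moreover have "cball (f zx) \<delta> \<inter> cball (f zy) \<delta> \<inter> ?C = {}" using none by blast
        moreover have "f (c (dist x b)) \<in> cball (f zx) \<delta> \<inter> ?C" using nx[of "c (dist x b)"] dc[of "dist x b"] xy by auto
        moreover have "f (c (dist y b)) \<in> cball (f zy) \<delta> \<inter> ?C" using ny[of "c (dist y b)"] dc[of "dist y b"] xy by auto
        ultimately show False using conn unfolding connected_closed by (metis closed_cball empty_iff)
      qed
      then have "dist (f zx) (f zy) \<le> 2 * \<delta>" using dist_triangle2 by (metis IntE add_mono dist_commute mem_cball mult_2 order_trans)
      then have "dist (f x) (f y) < 4 * \<delta>"
        using nx[of x] ny[of y] dist_triangle_4[of "f x" "f y" "f zx" "f zy"] by (simp add: dist_commute)
      then show ?thesis using \<epsilon> by (simp add: \<delta>_def)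
    qed
    have "dist (f x) (f y) < \<epsilon>" if "0 < dist x b" "dist x b < r" "0 < dist y b" "dist y b < r" for x y
      using ordered[of x y] ordered[of y x] that by (cases "dist x b \<le> dist y b") (auto simp: dist_commute)
    then show ?thesis using r(1) by blast
  qed
  obtain e0 :: 'a where e0: "norm e0 = 1" using vector_choose_size[of 1] by auto
  define X where "X = (\<lambda>k::nat. b + inverse (real (Suc k)) *\<^sub>R e0)"
  have dX: "dist (X k) b = inverse (real (Suc k))" for k using e0 by (simp add: X_def dist_norm)
  have small: "\<exists>k0. \<forall>k\<ge>k0. dist (X k) b < r" if "r > 0" for r
    using order_tendstoD(2)[OF LIMSEQ_inverse_real_of_nat that] unfolding dX eventually_sequentially .
  have pX: "0 < dist (X k) b" for k unfolding dX by simp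
  have "Cauchy (\<lambda>k. f (X k))"
  proof (rule metric_CauchyI)
    fix \<epsilon> :: real assume "\<epsilon> > 0"
    then obtain r where r: "r > 0" "\<forall>x y. 0 < dist x b \<and> dist x b < r \<and> 0 < dist y b \<and> dist y b < r \<longrightarrow> dist (f x) (f y) < \<epsilon>"
      using cauchy by blast
    obtain k0 where "\<forall>k\<ge>k0. dist (X k) b < r" using small[OF r(1)] by blast
    then show "\<exists>M. \<forall>m\<ge>M. \<forall>n\<ge>M. dist (f (X m)) (f (X n)) < \<epsilon>" using r(2) pX by (intro exI[of _ k0]) simp
  qed
  then obtain l where l: "(\<lambda>k. f (X k)) \<longlonglongrightarrow> l" using Cauchy_convergent convergent_def by blast
  have "(f \<longlongrightarrow> l) (at b)"
  proof (rule tendstoI)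
    fix \<epsilon> :: real assume \<epsilon>: "\<epsilon> > 0"
    then obtain r where r: "r > 0" "\<forall>x y. 0 < dist x b \<and> dist x b < r \<and> 0 < dist y b \<and> dist y b < r \<longrightarrow> dist (f x) (f y) < \<epsilon>/2"
      using cauchy[of "\<epsilon>/2"] by auto
    obtain k0 where k0: "\<forall>k\<ge>k0. dist (X k) b < r" using small[OF r(1)] by blast
    have "dist (f x) l < \<epsilon>" if x: "x \<noteq> b" "dist x b < r" for x
    proof -
      have "(\<lambda>k. dist (f x) (f (X k))) \<longlonglongrightarrow> dist (f x) l" by (intro tendsto_intros l)
      then have "dist (f x) l \<le> \<epsilon>/2"
      proof (rule LIMSEQ_le_const2, intro exI allI impI)
        fix k assume "k0 \<le> k"
        then have "dist (f x) (f (X k)) < \<epsilon>/2" using r(2) k0 pX x by simp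
        then show "dist (f x) (f (X k)) \<le> \<epsilon>/2" by simp
      qed
      then show ?thesis using \<epsilon> by simp
    qed
    then show "\<forall>\<^sub>F x in at b. dist (f x) l < \<epsilon>" unfolding eventually_at using r(1) by blast
  qed
  then show False using nolim by blast
qed

section \<open>Growth and covered spheres\<close>

text \<open>Young's inequality, by Bernoulli's inequality for the \<open>n\<close>-th power of
  \<open>g * t\<close>. Unlike in \<open>young_split\<close>, the constants have to be sharp.\<close>

lemma bernoulli_split:
  fixes g :: ennreal
  assumes t: "t > 0" and n: "n > 0"
  shows "g \<le> ennreal (t ^ (n - 1) / real n) * g ^ n + ennreal (real (n - 1) / (real n * t))"
proof (cases g)
  case (real x)
  have "1 + real n * (x * t - 1) \<le> (1 + (x * t - 1)) ^ n"
    using real t by (intro Bernoulli_inequality) auto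
  then have le: "real n * (x * t) \<le> x ^ n * t ^ n + (real n - 1)" by (simp add: power_mult_distrib algebra_simps)
  have tn: "t ^ n = t * t ^ (n - 1)" using n by (metis power_minus_mult mult.commute)
  have "x = real n * (x * t) / (real n * t)" using t n by simp
  also have "\<dots> \<le> (x ^ n * t ^ n + (real n - 1)) / (real n * t)"
    using le t n by (intro divide_right_mono) auto
  also have "\<dots> = t ^ (n - 1) / real n * x ^ n + real (n - 1) / (real n * t)"
    using t n by (simp add: add_divide_distrib tn of_nat_diff)
  finally have "ennreal x \<le> ennreal (t ^ (n - 1) / real n * x ^ n + real (n - 1) / (real n * t))" by (rule ennreal_leI)
  also have "\<dots> = ennreal (t ^ (n - 1) / real n * x ^ n) + ennreal (real (n - 1) / (real n * t))"
    using t real by (intro ennreal_plus) auto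
  also have "ennreal (t ^ (n - 1) / real n * x ^ n) = ennreal (t ^ (n - 1) / real n) * ennreal x ^ n"
    by (subst ennreal_mult) (use t real in \<open>auto simp: ennreal_power\<close>)
  finally show ?thesis using real by simp
next
  case top
  have "t ^ (n - 1) / real n > 0" using t n by simp
  then show ?thesis using top n t by (simp add: ennreal_mult_top power_eq_top_ennreal)
qed

text \<open>Hoelder's inequality for \<open>g\<close> against the weight \<open>s^(n-1)\<close>, from
  \<open>bernoulli_split\<close> with the optimal parameter \<open>t = s * ln (c / a)\<close>.\<close>

lemma log_hoelder:
  fixes g :: "real \<Rightarrow> ennreal"
  assumes [measurable]: "g \<in> borel_measurable borel" and ac: "0 < a" "a < c" and n: "n > 0"
    and one: "1 \<le> (\<integral>\<^sup>+s\<in>{a..c}. g s \<partial>lborel)"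
  shows "1 \<le> ennreal (ln (c / a) ^ (n - 1)) * (\<integral>\<^sup>+s\<in>{a..c}. g s ^ n * ennreal (s ^ (n - 1)) \<partial>lborel)"
proof (rule ccontr)
  define \<Lambda> where "\<Lambda> = ln (c / a)"
  have \<Lambda>: "\<Lambda> > 0" using ac by (simp add: \<Lambda>_def)
  define X where "X = (\<integral>\<^sup>+s\<in>{a..c}. g s ^ n * ennreal (s ^ (n - 1)) \<partial>lborel)"
  assume "\<not> ?thesis"
  then have lt: "ennreal (\<Lambda> ^ (n - 1)) * X < 1" by (simp add: \<Lambda>_def X_def)
  then obtain y where y: "y \<ge> 0" "ennreal (\<Lambda> ^ (n - 1)) * X = ennreal y"
    by (cases "ennreal (\<Lambda> ^ (n - 1)) * X") auto
  have y1: "y < 1" using lt y by (simp add: ennreal_less_one_iff)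
  have inv: "(\<integral>\<^sup>+s\<in>{a..c}. ennreal (1 / s) \<partial>lborel) = ennreal \<Lambda>"
  proof -
    have "(\<integral>\<^sup>+s. ennreal (1 / s) * indicator {a..c} s \<partial>lborel) = ln c - ln a"
      by (rule nn_integral_FTC_Icc) (use ac in \<open>auto intro!: derivative_eq_intros\<close>)
    then show ?thesis using ac by (simp add: \<Lambda>_def ln_div)
  qed
  have "1 \<le> (\<integral>\<^sup>+s\<in>{a..c}. g s \<partial>lborel)" by (rule one)
  also have "\<dots> \<le> (\<integral>\<^sup>+s. ennreal (1 / real n * \<Lambda> ^ (n - 1)) * (g s ^ n * ennreal (s ^ (n - 1)) * indicator {a..c} s) +
      ennreal (real (n - 1) / (real n * \<Lambda>)) * (ennreal (1 / s) * indicator {a..c} s) \<partial>lborel)"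
  proof (rule nn_integral_mono)
    fix s :: real
    show "g s * indicator {a..c} s \<le> ennreal (1 / real n * \<Lambda> ^ (n - 1)) * (g s ^ n * ennreal (s ^ (n - 1)) * indicator {a..c} s) +
      ennreal (real (n - 1) / (real n * \<Lambda>)) * (ennreal (1 / s) * indicator {a..c} s)"
    proof (cases "s \<in> {a..c}")
      case True
      then have s: "s > 0" using ac by simp
      have m1: "ennreal ((s * \<Lambda>) ^ (n - 1) / real n) = ennreal (1 / real n * \<Lambda> ^ (n - 1)) * ennreal (s ^ (n - 1))"
        by (subst ennreal_mult[symmetric]) (use s \<Lambda> in \<open>auto simp: power_mult_distrib mult_ac\<close>)
      have m2: "ennreal (real (n - 1) / (real n * (s * \<Lambda>))) = ennreal (real (n - 1) / (real n * \<Lambda>)) * ennreal (1 / s)"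
        by (subst ennreal_mult[symmetric]) (use s \<Lambda> in \<open>auto simp: mult_ac\<close>)
      have "g s \<le> ennreal ((s * \<Lambda>) ^ (n - 1) / real n) * g s ^ n + ennreal (real (n - 1) / (real n * (s * \<Lambda>)))"
        using s \<Lambda> n by (intro bernoulli_split) auto
      then show ?thesis unfolding m1 m2 using True by (simp add: mult_ac)
    qed simp
  qed
  also have "\<dots> = ennreal (1 / real n * \<Lambda> ^ (n - 1)) * X + ennreal (real (n - 1) / (real n * \<Lambda>)) * ennreal \<Lambda>"
    unfolding X_def inv[symmetric] by (subst nn_integral_add, measurable) (simp add: nn_integral_cmult)
  also have "\<dots> = ennreal (1 / real n * y) + ennreal (real (n - 1) / real n)"
  proof -
    have "ennreal (1 / real n * \<Lambda> ^ (n - 1)) * X = ennreal (1 / real n) * (ennreal (\<Lambda> ^ (n - 1)) * X)"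
      using \<Lambda> by (subst ennreal_mult) (auto simp: mult.assoc)
    also have "\<dots> = ennreal (1 / real n * y)" unfolding y(2) by (subst ennreal_mult[symmetric]) (use y in auto)
    finally have e1: "ennreal (1 / real n * \<Lambda> ^ (n - 1)) * X = ennreal (1 / real n * y)" .
    have e2: "ennreal (real (n - 1) / (real n * \<Lambda>)) * ennreal \<Lambda> = ennreal (real (n - 1) / real n)"
      by (subst ennreal_mult[symmetric]) (use \<Lambda> in auto)
    show ?thesis by (simp only: e1 e2)
  qed
  also have "\<dots> = ennreal (1 / real n * y + real (n - 1) / real n)" using y by (intro ennreal_plus[symmetric]) auto
  finally have "1 \<le> 1 / real n * y + real (n - 1) / real n" by (simp only: ennreal_ge_1)
  moreover have "1 / real n * y + real (n - 1) / real n < 1"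
    using y1 n by (simp add: add_divide_distrib[symmetric] of_nat_diff)
  ultimately show False by simp
qed

lemma segment_integral_ray:
  fixes \<rho> :: "'a::euclidean_space \<Rightarrow> ennreal"
  assumes [measurable]: "\<rho> \<in> borel_measurable borel" and \<theta>: "norm \<theta> = 1" and ac: "a < c"
  shows "segment_integral \<rho> (a *\<^sub>R \<theta>) ((c - a) *\<^sub>R \<theta>) = (\<integral>\<^sup>+s\<in>{a..c}. \<rho> (s *\<^sub>R \<theta>) \<partial>lborel)"
proof -
  have "(\<integral>\<^sup>+s\<in>{a..c}. \<rho> (s *\<^sub>R \<theta>) \<partial>lborel) =
    ennreal \<bar>c - a\<bar> * (\<integral>\<^sup>+t. \<rho> ((a + (c - a) * t) *\<^sub>R \<theta>) * indicator {a..c} (a + (c - a) * t) \<partial>lborel)"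
    using ac by (intro nn_integral_real_affine) auto
  also have "(\<integral>\<^sup>+t. \<rho> ((a + (c - a) * t) *\<^sub>R \<theta>) * indicator {a..c} (a + (c - a) * t) \<partial>lborel) =
    (\<integral>\<^sup>+t\<in>{0..1}. \<rho> (a *\<^sub>R \<theta> + t *\<^sub>R ((c - a) *\<^sub>R \<theta>)) \<partial>lborel)"
  proof (rule nn_integral_cong)
    fix t :: real
    have "a + (c - a) * t \<le> c \<longleftrightarrow> (c - a) * t \<le> (c - a) * 1" by auto
    also have "\<dots> \<longleftrightarrow> t \<le> 1" using ac by (subst mult_le_cancel_left_pos) auto
    finally have "(indicator {a..c} (a + (c - a) * t) :: ennreal) = indicator {0..1} t"
      using ac by (simp add: indicator_def zero_le_mult_iff)
    moreover have "(a + (c - a) * t) *\<^sub>R \<theta> = a *\<^sub>R \<theta> + t *\<^sub>R ((c - a) *\<^sub>R \<theta>)" by (simp add: algebra_simps)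
    ultimately show "\<rho> ((a + (c - a) * t) *\<^sub>R \<theta>) * indicator {a..c} (a + (c - a) * t) =
      \<rho> (a *\<^sub>R \<theta> + t *\<^sub>R ((c - a) *\<^sub>R \<theta>)) * indicator {0..1} t" by simp
  qed
  finally show ?thesis unfolding segment_integral_def using \<theta> ac by simp
qed

context ring_map
begin

text \<open>The lift of a radial segment from norm \<open>Rs\<close> to norm \<open>T\<close> cannot end on
  the outer sphere, where the norm of \<open>f\<close> is less than \<open>Rs\<close>, nor exist
  in full, since the norm of \<open>f\<close> is less than \<open>T\<close>. So it ends on the
  inner sphere and crosses the ring from \<open>r\<close> to \<open>a\<close>. Hoelder's
  inequality on each ray and polar coordinates give the sharp constant, which matters because only
  the gap between \<open>p\<close> and \<open>1\<close> is to spare in the comparison with the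
  upper bound.\<close>

lemma modulus_ge_lifted_rays:
  assumes r: "0 < r" "r < a" "a < r2" "r2 \<le> R" and Rs: "0 < Rs" "Rs < T"
    and outer: "\<And>x. dist x b = r2 \<Longrightarrow> norm (f x) < Rs"
    and bound: "\<And>x. r \<le> dist x b \<Longrightarrow> dist x b \<le> r2 \<Longrightarrow> norm (f x) < T"
    and U: "U \<in> sets borel" "U \<subseteq> ball 0 1" "0 \<notin> U"
    and cov: "\<And>u. u \<in> U \<Longrightarrow> \<exists>x. a < dist x b \<and> dist x b < r2 \<and> f x = (Rs / norm u) *\<^sub>R u"
    and m: "ennreal m \<le> emeasure lborel U" "m \<ge> 0"
  shows "ennreal (real DIM('a) * m / ln (T / Rs) ^ (DIM('a) - 1)) \<le> modulus (ring_image_family f b r a)"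
  unfolding modulus_def
proof (rule INF_greatest)
  let ?n = "DIM('a)"
  fix \<rho> :: "'a \<Rightarrow> ennreal" assume adm: "\<rho> \<in> adm (ring_image_family f b r a)"
  have \<rho>[measurable]: "\<rho> \<in> borel_measurable borel" using adm by (simp add: adm_def)
  note U(1)[measurable]
  have [measurable]: "ball (0::'a) 1 \<in> sets borel" by simp
  define \<Lambda> where "\<Lambda> = ln (T / Rs) ^ (?n - 1)"
  have \<Lambda>: "\<Lambda> > 0" using Rs by (simp add: \<Lambda>_def)
  have S: "{x. r \<le> dist x b \<and> dist x b \<le> r2} \<subseteq> D - {b}" using r R by (intro ring_subset) auto
  have ray: "1 \<le> ennreal \<Lambda> * (\<integral>\<^sup>+s\<in>{Rs..T}. \<rho> ((s / norm u) *\<^sub>R u) ^ ?n * ennreal (s ^ (?n - 1)) \<partial>lborel)" if u: "u \<in> U" for u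
  proof -
    define \<theta> where "\<theta> = u /\<^sub>R norm u"
    have u0: "u \<noteq> 0" using u U(3) by auto
    have \<theta>: "norm \<theta> = 1" using u0 by (simp add: \<theta>_def)
    have su: "(s / norm u) *\<^sub>R u = s *\<^sub>R \<theta>" for s by (simp add: \<theta>_def divide_inverse)
    obtain x where x: "a < dist x b" "dist x b < r2" "f x = Rs *\<^sub>R \<theta>" using cov[OF u] su by metis
    have xr: "r < dist x b" using x r by simp
    obtain c \<gamma> where c: "0 \<le> c" "c \<le> 1" "continuous_on {0..c} \<gamma>" "\<gamma> 0 = x"
      "\<And>t. t \<in> {0..c} \<Longrightarrow> f (\<gamma> t) = f x + t *\<^sub>R ((T - Rs) *\<^sub>R \<theta>)"
      "\<And>t. t \<in> {0..c} \<Longrightarrow> r \<le> dist (\<gamma> t) b \<and> dist (\<gamma> t) b \<le> r2"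
      "c = 1 \<and> r < dist (\<gamma> c) b \<and> dist (\<gamma> c) b < r2 \<or> dist (\<gamma> c) b = r \<or> dist (\<gamma> c) b = r2"
      by (rule ring_lift[OF S contf openf discf xr x(2), where v = "(T - Rs) *\<^sub>R \<theta>"], rule that, assumption+)
    have cc: "c \<in> {0..c}" using c by simp
    have "f (\<gamma> c) = (Rs + c * (T - Rs)) *\<^sub>R \<theta>" unfolding c(5)[OF cc] x(3) by (simp add: algebra_simps)
    moreover have pos: "0 \<le> c * (T - Rs)" using c Rs by simp
    ultimately have nf: "norm (f (\<gamma> c)) = Rs + c * (T - Rs)" using \<theta> Rs by simp
    have "dist (\<gamma> c) b \<noteq> r2" using outer[of "\<gamma> c"] nf pos by auto
    moreover have "c \<noteq> 1" using bound[of "\<gamma> c"] c(6)[OF cc] nf by auto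
    ultimately have ends: "dist (\<gamma> c) b = r" using c(7) by blast
    have "1 \<le> segment_integral \<rho> (f x) ((T - Rs) *\<^sub>R \<theta>)"
      by (rule segment_crossing[OF adm r(2) c(1,2,3) c(5)]) (use ends c(4) x in auto)
    also have "\<dots> = (\<integral>\<^sup>+s\<in>{Rs..T}. \<rho> (s *\<^sub>R \<theta>) \<partial>lborel)"
      unfolding x(3) by (rule segment_integral_ray[OF \<rho> \<theta> Rs(2)])
    finally have "1 \<le> (\<integral>\<^sup>+s\<in>{Rs..T}. \<rho> (s *\<^sub>R \<theta>) \<partial>lborel)" .
    from log_hoelder[OF _ Rs _ this, of ?n]
    show ?thesis unfolding \<Lambda>_def su by simp
  qed
  have "ennreal (real ?n * m / \<Lambda>) = of_nat ?n * (ennreal (1 / \<Lambda>) * ennreal m)"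
    using m(2) \<Lambda> by (simp add: ennreal_of_nat_eq_real_of_nat ennreal_mult[symmetric])
  also have "\<dots> \<le> of_nat ?n * (ennreal (1 / \<Lambda>) * emeasure lborel U)"
    by (intro mult_left_mono m(1)) auto
  also have "ennreal (1 / \<Lambda>) * emeasure lborel U = (\<integral>\<^sup>+u. ennreal (1 / \<Lambda>) * indicator U u \<partial>lborel)"
    by (simp add: nn_integral_cmult_indicator)
  also have "of_nat ?n * (\<integral>\<^sup>+u. ennreal (1 / \<Lambda>) * indicator U u \<partial>lborel) \<le> of_nat ?n *
    (\<integral>\<^sup>+u\<in>ball 0 1. (\<integral>\<^sup>+s\<in>{0<..}. \<rho> (0 + (s / norm u) *\<^sub>R u) ^ ?n * ennreal (s ^ (?n - 1)) \<partial>lborel) \<partial>lborel)"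
  proof (rule mult_left_mono, rule nn_integral_mono)
    fix u :: 'a
    show "ennreal (1 / \<Lambda>) * indicator U u \<le>
      (\<integral>\<^sup>+s\<in>{0<..}. \<rho> (0 + (s / norm u) *\<^sub>R u) ^ ?n * ennreal (s ^ (?n - 1)) \<partial>lborel) * indicator (ball 0 1) u"
    proof (cases "u \<in> U")
      case True
      have "ennreal (1 / \<Lambda>) * 1 \<le> ennreal (1 / \<Lambda>) * (ennreal \<Lambda> * (\<integral>\<^sup>+s\<in>{Rs..T}. \<rho> ((s / norm u) *\<^sub>R u) ^ ?n * ennreal (s ^ (?n - 1)) \<partial>lborel))"
        by (rule mult_left_mono[OF ray[OF True]]) simp
      also have "\<dots> = (\<integral>\<^sup>+s\<in>{Rs..T}. \<rho> ((s / norm u) *\<^sub>R u) ^ ?n * ennreal (s ^ (?n - 1)) \<partial>lborel)"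
        using \<Lambda> by (simp add: mult.assoc[symmetric] ennreal_mult[symmetric])
      also have "\<dots> \<le> (\<integral>\<^sup>+s\<in>{0<..}. \<rho> (0 + (s / norm u) *\<^sub>R u) ^ ?n * ennreal (s ^ (?n - 1)) \<partial>lborel)"
        using Rs by (intro nn_integral_mono) (auto simp: indicator_def)
      finally have "ennreal (1 / \<Lambda>) \<le> (\<integral>\<^sup>+s\<in>{0<..}. \<rho> (0 + (s / norm u) *\<^sub>R u) ^ ?n * ennreal (s ^ (?n - 1)) \<partial>lborel)" by simp
      moreover have "u \<in> ball 0 1" using True U(2) by blast
      ultimately show ?thesis using True by (simp del: mem_ball)
    qed simp
  qed simp
  also have "\<dots> = (\<integral>\<^sup>+x. \<rho> x ^ ?n \<partial>lborel)" by (rule nn_integral_polar[symmetric]) measurable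
  finally show "ennreal (real ?n * m / ln (T / Rs) ^ (?n - 1)) \<le> (\<integral>\<^sup>+x. \<rho> x ^ ?n \<partial>lborel)"
    by (simp add: \<Lambda>_def)
qed

lemma open_image_ring: "0 \<le> r \<Longrightarrow> s \<le> R' \<Longrightarrow> open (f ` {x. r < dist x b \<and> dist x b < s})"
proof -
  assume rs: "0 \<le> r" "s \<le> R'"
  have "open {x. r < dist x b \<and> dist x b < s}" by (intro open_Collect_conj open_Collect_less continuous_intros)
  moreover have "{x. r < dist x b \<and> dist x b < s} \<subseteq> D - {b}" using ballD rs by (auto simp: subset_iff dist_commute)
  ultimately show ?thesis using openf unfolding open_mapping_on_def by blast
qed

text \<open>Let \<open>I\<close> be the radial integral from \<open>r\<close> to \<open>R\<close>. Comparing
  the bounds for the modulus of the ring from \<open>r\<close> to a fixed radius gives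
  \<open>q * (I - const) \<le> const + p * I\<close> for a share \<open>q^(n-1)\<close> of the
  sphere that is covered from outside the fixed radius. As \<open>q > p\<close> is possible and
  \<open>I\<close> tends to infinity for \<open>r\<close> to \<open>0\<close>, this is absurd.\<close>

lemma sphere_not_covered:
  assumes inf: "radial_integral Q b 0 R = top" and r2: "0 < r2" "r2 \<le> R" and C: "0 < C" and p: "0 < p" "p < 1"
    and growth: "\<And>x. 0 < dist x b \<Longrightarrow> dist x b \<le> r2 \<Longrightarrow>
      norm (f x) \<le> C * exp (p * enn2real (radial_integral Q b (dist x b) R))"
    and Rs: "0 < Rs" and outer: "\<And>x. dist x b = r2 \<Longrightarrow> norm (f x) < Rs"
    and cov: "AE u in lborel. u \<in> ball 0 1 \<longrightarrow> (Rs / norm u) *\<^sub>R u \<in> f ` {x. 0 < dist x b \<and> dist x b < r2}"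
  shows False
proof -
  let ?n = "DIM('a)"
  define \<Omega> where "\<Omega> = unit_ball_vol (real ?n)"
  have \<Omega>: "\<Omega> > 0" by (simp add: \<Omega>_def)
  \<comment> \<open>The gap between \<open>p\<close> and \<open>q\<close> pays for covering only a part of the
    sphere from outside radius \<open>a k\<close>.\<close>
  define q where "q = (1 + p) / 2"
  have q: "0 < q" "q < 1" "p < q" using p by (auto simp: q_def)
  define a where "a = (\<lambda>k::nat. r2 / real (k + 2))"
  have a: "0 < a k" "a k < r2" for k
  proof -
    show "0 < a k" using r2 by (simp add: a_def)
    have "r2 * 1 < r2 * real (k + 2)" using r2 by (intro mult_strict_left_mono) auto
    then show "a k < r2" by (simp add: a_def divide_less_eq)
  qed
  define W where "W = (\<lambda>k. f ` {x. a k < dist x b \<and> dist x b < r2})"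
  have [measurable]: "W k \<in> sets borel" for k
    unfolding W_def by (intro borel_open open_image_ring less_imp_le[OF a(1)]) (use r2 R in auto)
  define U where "U = (\<lambda>k. {u \<in> ball (0::'a) 1. u \<noteq> 0 \<and> (Rs / norm u) *\<^sub>R u \<in> W k})"
  have [measurable]: "ball (0::'a) 1 \<in> sets borel" by simp
  have Um[measurable]: "U k \<in> sets borel" for k unfolding U_def by measurable
  have inc: "incseq U"
  proof (rule incseq_SucI)
    fix k
    have "a (Suc k) \<le> a k" using r2 by (simp add: a_def field_simps)
    then have "W k \<subseteq> W (Suc k)" unfolding W_def by (intro image_mono) auto
    then show "U k \<subseteq> U (Suc k)" by (auto simp: U_def)
  qed
  have WU: "(\<Union>k. W k) = f ` {x. 0 < dist x b \<and> dist x b < r2}"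
  proof (rule antisym)
    show "(\<Union>k. W k) \<subseteq> f ` {x. 0 < dist x b \<and> dist x b < r2}"
      unfolding W_def by (intro UN_least image_mono) (use less_trans[OF a(1)] in blast)
    show "f ` {x. 0 < dist x b \<and> dist x b < r2} \<subseteq> (\<Union>k. W k)"
    proof
      fix y assume "y \<in> f ` {x. 0 < dist x b \<and> dist x b < r2}"
      then obtain x where x: "0 < dist x b" "dist x b < r2" "y = f x" by blast
      obtain k :: nat where "r2 / dist x b < real k" using reals_Archimedean2 by blast
      then have "r2 < real k * dist x b" using x by (simp add: divide_less_eq)
      also have "\<dots> \<le> real (k + 2) * dist x b" by (intro mult_right_mono) auto
      finally have "a k < dist x b" by (simp add: a_def divide_less_eq mult.commute)
      then show "y \<in> (\<Union>k. W k)" using x unfolding W_def by blast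
    qed
  qed
  have "emeasure lborel (\<Union>k. U k) = emeasure lborel (ball (0::'a) 1)"
  proof (rule emeasure_eq_AE)
    have "AE u in lborel. u \<noteq> (0::'a)" by (rule AE_lborel_singleton)
    then show "AE u in lborel. u \<in> (\<Union>k. U k) \<longleftrightarrow> u \<in> ball 0 1" using cov
    proof eventually_elim
      case (elim u)
      show ?case
      proof
        assume u: "u \<in> ball 0 1"
        then have "(Rs / norm u) *\<^sub>R u \<in> (\<Union>k. W k)" unfolding WU using elim by blast
        then show "u \<in> (\<Union>k. U k)" using u elim by (auto simp: U_def)
      qed (auto simp: U_def)
    qed
  qed auto
  also have "\<dots> = ennreal \<Omega>" unfolding \<Omega>_def using emeasure_ball[of 1 "0::'a"] by simp
  finally have "(SUP k. emeasure lborel (U k)) = ennreal \<Omega>"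
  proof -
    assume e: "emeasure lborel (\<Union>k. U k) = ennreal \<Omega>"
    have "range U \<subseteq> sets lborel" using Um by auto
    then show ?thesis using SUP_emeasure_incseq[of U lborel] inc e by simp
  qed
  moreover have "q ^ (?n - 1) * \<Omega> < \<Omega>"
  proof -
    have "q ^ (?n - 1) < 1" using q dim by (intro power_less_one_iff[THEN iffD2]) auto
    then show ?thesis using \<Omega> by simp
  qed
  ultimately have "ennreal (q ^ (?n - 1) * \<Omega>) < (SUP k. emeasure lborel (U k))"
    using q \<Omega> by (simp add: ennreal_less_iff)
  then obtain k where k: "ennreal (q ^ (?n - 1) * \<Omega>) < emeasure lborel (U k)" by (auto simp: less_SUP_iff)
  define c0 where "c0 = enn2real (radial_integral Q b (a k) R)"
  have c0: "radial_integral Q b (a k) R = ennreal c0" "c0 \<ge> 0"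
    using radial_integral_finite[of "a k" R] a[of k] r2 by (auto simp: c0_def)
  define C1 where "C1 = (Rs + 1 + C) / Rs"
  have C1: "C1 > 1" using Rs C by (simp add: C1_def)
  \<comment> \<open>The final inequality bounds the radial integral by \<open>Tb\<close>, whereas \<open>r\<close>
    is chosen such that it is larger.\<close>
  define Tb where "Tb = c0 + 2 * (ln C1 + q * c0) / (1 - p)"
  have Tb: "Tb \<ge> c0" using C1 q p c0 by (simp add: Tb_def)
  obtain r0 where r0: "0 < r0" "\<And>r. 0 < r \<Longrightarrow> r \<le> r0 \<Longrightarrow> ennreal Tb < radial_integral Q b r R"
    using radial_integral_limit[OF inf R(1), of Tb] by auto
  define r where "r = min r0 (a k / 2)"
  have r: "0 < r" "r < a k" "r \<le> r0" using r0 a(1)[of k] by (auto simp: r_def min_def)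
  define y where "y = enn2real (radial_integral Q b r R)"
  have y: "radial_integral Q b r R = ennreal y" "y \<ge> 0"
    using radial_integral_finite[of r R] r a[of k] r2 by (auto simp: y_def)
  have yT: "Tb < y" using r0(2)[OF r(1,3)] Tb c0 unfolding y(1) by (simp add: ennreal_less_iff)
  have "radial_integral Q b r R = radial_integral Q b r (a k) + radial_integral Q b (a k) R"
    using r a[of k] r2 by (intro radial_integral_add) auto
  moreover have "radial_integral Q b r (a k) < top"
    using r a[of k] r2 by (intro radial_integral_finite) auto
  then obtain j where j: "j \<ge> 0" "radial_integral Q b r (a k) = ennreal j" by (cases "radial_integral Q b r (a k)") auto
  ultimately have "ennreal y = ennreal (j + c0)" unfolding y(1) c0(1) j(2) using j c0 by simp
  then have yj: "y = j + c0" using y j c0 by (subst (asm) ennreal_inj) auto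
  have j0: "j > 0" using yj yT Tb by linarith
  define T where "T = Rs + 1 + C * exp (p * y)"
  have T: "Rs < T" using C by (simp add: T_def add_pos_nonneg)
  have bound: "norm (f x) < T" if x: "r \<le> dist x b" "dist x b \<le> r2" for x
  proof -
    have "radial_integral Q b r R = radial_integral Q b r (dist x b) + radial_integral Q b (dist x b) R"
      using x r r2 by (intro radial_integral_add) auto
    then have "radial_integral Q b (dist x b) R \<le> ennreal y" unfolding y(1)[symmetric] by simp
    then have "enn2real (radial_integral Q b (dist x b) R) \<le> y" using y(2) by (intro enn2real_leI) auto
    then have "C * exp (p * enn2real (radial_integral Q b (dist x b) R)) \<le> C * exp (p * y)"
      using C p by simp
    moreover have "norm (f x) \<le> C * exp (p * enn2real (radial_integral Q b (dist x b) R))"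
      using x r by (intro growth) auto
    ultimately show ?thesis using Rs by (simp add: T_def)
  qed
  have "ennreal (real ?n * (q ^ (?n - 1) * \<Omega>) / ln (T / Rs) ^ (?n - 1)) \<le> modulus (ring_image_family f b r (a k))"
  proof (rule modulus_ge_lifted_rays[OF r(1,2) a(2) r2(2) Rs T outer bound Um])
    show "\<exists>x. a k < dist x b \<and> dist x b < r2 \<and> f x = (Rs / norm u) *\<^sub>R u" if "u \<in> U k" for u
      using that by (force simp: U_def W_def)
  qed (use k q \<Omega> in \<open>auto simp: U_def less_imp_le\<close>)
  also have "\<dots> \<le> ennreal (real ?n * \<Omega> / j ^ (?n - 1))"
    unfolding \<Omega>_def using r a[of k] r2 j0 j by (intro modulus_bound) auto
  finally have "real ?n * (q ^ (?n - 1) * \<Omega>) / ln (T / Rs) ^ (?n - 1) \<le> real ?n * \<Omega> / j ^ (?n - 1)"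
    using \<Omega> j0 by (subst (asm) ennreal_le_iff) auto
  moreover have L: "ln (T / Rs) > 0" using T Rs by simp
  ultimately have "(real ?n * \<Omega>) * (q * j) ^ (?n - 1) \<le> (real ?n * \<Omega>) * ln (T / Rs) ^ (?n - 1)"
    using j0 by (simp add: power_mult_distrib divide_simps mult_ac)
  then have "(q * j) ^ (?n - 1) \<le> ln (T / Rs) ^ (?n - 1)"
    using \<Omega> by (subst (asm) mult_le_cancel_left_pos) auto
  moreover have "?n - 1 = Suc (?n - 2)" using dim by simp
  ultimately have "(q * j) ^ Suc (?n - 2) \<le> ln (T / Rs) ^ Suc (?n - 2)" by (simp only:)
  then have "q * j \<le> ln (T / Rs)" by (rule power_le_imp_le_base) (use L in simp)
  also have "\<dots> \<le> ln (C1 * exp (p * y))"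
  proof (rule ln_mono)
    show "0 < T / Rs" using T Rs by simp
    have "1 \<le> exp (p * y)" using p y by simp
    then have "Rs + 1 \<le> (Rs + 1) * exp (p * y)" using Rs by simp
    then have "T \<le> (Rs + 1 + C) * exp (p * y)" by (simp add: T_def distrib_right)
    then show "T / Rs \<le> C1 * exp (p * y)" using Rs by (simp add: C1_def divide_right_mono)
  qed
  also have "\<dots> = ln C1 + p * y" using C1 by (simp add: ln_mult)
  finally have "q * (y - c0) \<le> ln C1 + p * y" using yj by simp
  then have "(q - p) * y \<le> ln C1 + q * c0" by (simp add: algebra_simps)
  moreover have "q - p = (1 - p) / 2" by (simp add: q_def field_simps)
  ultimately have "y \<le> 2 * (ln C1 + q * c0) / (1 - p)" using p by (simp add: field_simps)
  then show False using yT c0 by (simp add: Tb_def)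
qed

end

section \<open>Behaviour at the isolated point\<close>

context ring_map
begin

text \<open>By polar coordinates a null set is negligible on almost every sphere about the origin, so
  \<open>f\<close> would cover almost all of some sphere.\<close>

lemma omitted_set_not_null:
  assumes inf: "radial_integral Q b 0 R = top" and r2: "0 < r2" "r2 \<le> R" and C: "0 < C" and p: "0 < p" "p < 1"
    and growth: "\<And>x. 0 < dist x b \<Longrightarrow> dist x b \<le> r2 \<Longrightarrow>
      norm (f x) \<le> C * exp (p * enn2real (radial_integral Q b (dist x b) R))"
    and R0: "0 < R0" and outer: "\<And>x. dist x b = r2 \<Longrightarrow> norm (f x) \<le> R0"
  shows "{y. R0 < norm y \<and> y \<notin> f ` {x. 0 < dist x b \<and> dist x b < r2}} \<notin> null_sets lborel"
proof
  define N where "N = {y. R0 < norm y \<and> y \<notin> f ` {x. 0 < dist x b \<and> dist x b < r2}}"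
  assume "{y. R0 < norm y \<and> y \<notin> f ` {x. 0 < dist x b \<and> dist x b < r2}} \<in> null_sets lborel"
  then have N: "N \<in> null_sets lborel" by (simp add: N_def)
  then have [measurable]: "N \<in> sets borel" by auto
  have [measurable]: "ball (0::'a) 1 \<in> sets borel" by simp
  have ae: "AE s in lborel. 0 < s \<longrightarrow> direction_integral (indicator N) 0 s = 0"
    by (rule null_set_direction_integral[OF N])
  have "\<exists>s. s > R0 \<and> direction_integral (indicator N) 0 s = 0"
  proof (rule ccontr)
    assume no: "\<not> ?thesis"
    have "AE s in lborel. s \<notin> {R0<..<R0 + 1}" using ae
      by eventually_elim (use no R0 in auto)
    then have "emeasure lborel {R0<..<R0 + 1} = 0"
      by (subst (asm) AE_iff_measurable[of "{R0<..<R0 + 1}"]) auto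
    then show False by simp
  qed
  then obtain s where s: "s > R0" "direction_integral (indicator N) 0 s = 0" by blast
  have "AE u in lborel. indicator N (0 + (s / norm u) *\<^sub>R u) * indicator (ball 0 1) u = (0::ennreal)"
    using s(2) unfolding direction_integral_def by (subst (asm) nn_integral_0_iff_AE) auto
  moreover have "AE u in lborel. u \<noteq> (0::'a)" by (rule AE_lborel_singleton)
  ultimately have cov: "AE u in lborel. u \<in> ball 0 1 \<longrightarrow> (s / norm u) *\<^sub>R u \<in> f ` {x. 0 < dist x b \<and> dist x b < r2}"
  proof eventually_elim
    case (elim u)
    show ?case
    proof
      assume u: "u \<in> ball 0 1"
      then have "(s / norm u) *\<^sub>R u \<notin> N" using elim(1) by (auto simp: indicator_def split: if_splits)
      moreover have "norm ((s / norm u) *\<^sub>R u) = s" using elim(2) s R0 by simp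
      ultimately show "(s / norm u) *\<^sub>R u \<in> f ` {x. 0 < dist x b \<and> dist x b < r2}"
        using s(1) unfolding N_def by (metis (mono_tags, lifting) mem_Collect_eq)
    qed
  qed
  show False
  proof (rule sphere_not_covered[OF inf r2 C p growth _ _ cov])
    show "norm (f x) < s" if "dist x b = r2" for x using outer[OF that] s by simp
  qed (use s R0 in auto)
qed

lemma compact_image_ring:
  assumes "0 < r" "s \<le> R'"
  shows "compact (f ` {x. r \<le> dist x b \<and> dist x b \<le> s})"
proof (rule compact_continuous_image)
  show "continuous_on {x. r \<le> dist x b \<and> dist x b \<le> s} f"
    using contf ring_subset[OF assms] by (rule continuous_on_subset)
  have "closed {x. r \<le> dist x b \<and> dist x b \<le> s}" by (intro closed_Collect_conj closed_Collect_le continuous_intros)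
  moreover have "bounded {x. r \<le> dist x b \<and> dist x b \<le> s}"
    by (rule bounded_subset[OF bounded_cball[of b s]]) (auto simp: dist_commute)
  ultimately show "compact {x. r \<le> dist x b \<and> dist x b \<le> s}" by (simp add: compact_eq_bounded_closed)
qed

lemma bounded_on_sphere:
  assumes "0 < r" "r \<le> R'"
  obtains R0 where "0 < R0" "\<And>x. dist x b = r \<Longrightarrow> norm (f x) \<le> R0"
proof -
  have "bounded (f ` {x. r \<le> dist x b \<and> dist x b \<le> r})" using compact_image_ring[OF assms] by (rule compact_imp_bounded)
  then obtain B where B: "\<forall>y\<in>f ` {x. r \<le> dist x b \<and> dist x b \<le> r}. norm y \<le> B" unfolding bounded_iff by (elim exE)
  show ?thesis
  proof (rule that[of "max 1 B"])
    show "norm (f x) \<le> max 1 B" if "dist x b = r" for x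
      using B that by (auto simp: le_max_iff_disj)
  qed simp
qed

text \<open>If \<open>f\<close> tends to infinity, then only a compact part of the punctured ball matters
  near a given value. So the set of omitted values outside the ball of radius \<open>R0\<close> is
  open as well as the set of values; the outside being connected, nothing is omitted.\<close>

lemma not_pole:
  assumes inf: "radial_integral Q b 0 R = top" and r2: "0 < r2" "r2 \<le> R" and C: "0 < C" and p: "0 < p" "p < 1"
    and growth: "\<And>x. 0 < dist x b \<Longrightarrow> dist x b \<le> r2 \<Longrightarrow>
      norm (f x) \<le> C * exp (p * enn2real (radial_integral Q b (dist x b) R))"
  shows "\<not> filterlim f at_infinity (at b)"
proof
  assume pole: "filterlim f at_infinity (at b)"
  obtain R0 where R0: "0 < R0" "\<And>x. dist x b = r2 \<Longrightarrow> norm (f x) \<le> R0"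
  proof -
    have "r2 \<le> R'" using r2 R by simp
    then show ?thesis using bounded_on_sphere[OF r2(1)] that by blast
  qed
  define W where "W = f ` {x. 0 < dist x b \<and> dist x b < r2}"
  have openW: "open W" unfolding W_def using r2 R by (intro open_image_ring) auto
  have large: "\<exists>d>0. \<forall>x. 0 < dist x b \<and> dist x b < d \<longrightarrow> B \<le> norm (f x)" for B
  proof -
    have "eventually (\<lambda>x. max 1 B \<le> norm (f x)) (at b)"
    proof -
      have "max 1 B > 0" by simp
      from pole[unfolded filterlim_at_infinity[OF order_refl], rule_format, OF this] show ?thesis .
    qed
    then obtain d where d: "d > 0" "\<forall>x. x \<noteq> b \<and> dist x b < d \<longrightarrow> max 1 B \<le> norm (f x)"
      unfolding eventually_at by auto
    then show ?thesis by (intro exI[of _ d]) auto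
  qed
  define V where "V = - cball (0::'a) R0"
  have "connected V" unfolding V_def using dim by (intro connected_complement_bounded_convex) auto
  have openVW: "open (V - W)"
  proof (subst open_subopen, intro ballI)
    fix y assume y: "y \<in> V - W"
    obtain d where d: "d > 0" "\<forall>x. 0 < dist x b \<and> dist x b < d \<longrightarrow> norm y + 1 \<le> norm (f x)" using large by blast
    define d' where "d' = min d r2"
    have d': "d' > 0" "d' \<le> r2" "d' \<le> d" using d r2 by (auto simp: d'_def)
    define K where "K = f ` {x. d' \<le> dist x b \<and> dist x b \<le> r2}"
    have "closed K" unfolding K_def using d' r2 R by (intro compact_imp_closed compact_image_ring) auto
    have "y \<notin> K"
    proof
      assume "y \<in> K"
      then obtain x where x: "d' \<le> dist x b" "dist x b \<le> r2" "y = f x" by (auto simp: K_def)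
      show False
      proof (cases "dist x b = r2")
        case True
        then show False using R0(2)[OF True] y x by (simp add: V_def)
      next
        case False
        then show False using x d' y by (auto simp: W_def)
      qed
    qed
    have "V \<inter> ball 0 (norm y + 1) \<inter> - K \<subseteq> V - W"
    proof
      fix z assume z: "z \<in> V \<inter> ball 0 (norm y + 1) \<inter> - K"
      have "z \<notin> W"
      proof
        assume "z \<in> W"
        then obtain x where x: "0 < dist x b" "dist x b < r2" "z = f x" unfolding W_def by blast
        have "\<not> d' \<le> dist x b" using z x unfolding K_def by auto
        then have "norm y + 1 \<le> norm (f x)" using d x d' by simp
        then show False using z x by simp
      qed
      then show "z \<in> V - W" using z by blast
    qed
    moreover have "open (V \<inter> ball 0 (norm y + 1) \<inter> - K)" using \<open>closed K\<close> by (intro open_Int) (auto simp: V_def)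
    moreover have "y \<in> V \<inter> ball 0 (norm y + 1) \<inter> - K" using y \<open>y \<notin> K\<close> by simp
    ultimately show "\<exists>T. open T \<and> y \<in> T \<and> T \<subseteq> V - W" by blast
  qed
  have "V \<inter> W \<noteq> {}"
  proof -
    obtain d where d: "d > 0" "\<forall>x. 0 < dist x b \<and> dist x b < d \<longrightarrow> R0 + 1 \<le> norm (f x)" using large by blast
    obtain e0 :: 'a where e0: "norm e0 = min d r2 / 2" using vector_choose_size[of "min d r2 / 2"] d r2 by auto
    have "0 < dist (b + e0) b" "dist (b + e0) b < d" "dist (b + e0) b < r2" using e0 d r2 by (auto simp: dist_norm)
    then have "R0 + 1 \<le> norm (f (b + e0))" and "f (b + e0) \<in> W" using d(2) unfolding W_def by blast+
    then have "f (b + e0) \<in> V \<inter> W" by (simp add: V_def)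
    then show ?thesis by blast
  qed
  then have "V \<subseteq> W"
    using connectedD[OF \<open>connected V\<close> openVW openW] by blast
  then have empty: "{y. R0 < norm y \<and> y \<notin> W} = {}" by (auto simp: V_def)
  have "{y. R0 < norm y \<and> y \<notin> W} \<notin> null_sets lborel"
    unfolding W_def by (rule omitted_set_not_null[OF inf r2 C p growth R0])
  then show False unfolding empty by simp
qed

text \<open>Choose radii \<open>rj < rl < rk < rm < r2\<close> such that the four successive rings have
  small modulus and the image of the sphere of radius \<open>rk\<close> is spread, and a density
  of small energy that is admissible for all four rings. It admits two segments with integrals
  less than \<open>1\<close> from a value on that sphere via a point \<open>w\<close> to an
  omitted value \<open>z\<close>. The lift of the first segment crosses neither ring adjacent to
  the sphere, so it stays between the radii \<open>rl\<close> and \<open>rm\<close>. The lift of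
  the second one then stays between \<open>rj\<close> and \<open>r2\<close>. Hence both lifts
  exist in full, and \<open>z\<close> is a value.\<close>

lemma limit_or_pole:
  assumes inf: "radial_integral Q b 0 R = top" and r2: "0 < r2" "r2 \<le> R" and C: "0 < C" and p: "0 < p" "p < 1"
    and growth: "\<And>x. 0 < dist x b \<Longrightarrow> dist x b \<le> r2 \<Longrightarrow>
      norm (f x) \<le> C * exp (p * enn2real (radial_integral Q b (dist x b) R))"
  shows "(\<exists>l. (f \<longlongrightarrow> l) (at b)) \<or> filterlim f at_infinity (at b)"
proof (rule ccontr)
  let ?n = "DIM('a)"
  assume neg: "\<not> ?thesis"
  have punct: "{x. 0 < dist x b \<and> dist x b \<le> R} \<subseteq> D - {b}" using cball_R by (auto simp: subset_iff dist_commute)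
  from spread_spheres[OF dim R(1) punct contf openf] neg
  obtain \<delta> T0 where \<delta>: "\<delta> > 0" and T0: "T0 > 0" and spread: "\<forall>r0>0. \<exists>r. 0 < r \<and> r < r0 \<and>
     (\<exists>x y. dist x b = r \<and> dist y b = r \<and> norm (f x) \<le> T0 \<and> \<delta> \<le> dist (f x) (f y))" by blast
  obtain R0 where R0: "0 < R0" "\<And>x. dist x b = r2 \<Longrightarrow> norm (f x) \<le> R0"
  proof -
    have "r2 \<le> R'" using r2 R by simp
    then show ?thesis using bounded_on_sphere[OF r2(1)] that by blast
  qed
  define W where "W = f ` {x. 0 < dist x b \<and> dist x b < r2}"
  have openW: "open W" unfolding W_def using r2 R by (intro open_image_ring) auto
  define Z where "Z = (\<lambda>k::nat. {y. R0 < norm y \<and> y \<notin> W} \<inter> ball 0 (T0 + \<delta> + 1 + real k))"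
  have "{y::'a. R0 < norm y} \<in> sets borel" by measurable
  moreover have "{y. R0 < norm y \<and> y \<notin> W} = {y. R0 < norm y} - W" by auto
  ultimately have NW: "{y. R0 < norm y \<and> y \<notin> W} \<in> sets borel" using openW by auto
  have Zm: "Z k \<in> sets borel" for k unfolding Z_def using NW by auto
  have "\<exists>k. emeasure lborel (Z k) > 0"
  proof (rule ccontr)
    assume "\<not> ?thesis"
    then have "Z k \<in> null_sets lborel" for k using Zm by (intro null_setsI) (auto simp: zero_less_iff_neq_zero)
    then have "(\<Union>k. Z k) \<in> null_sets lborel" by (rule null_sets_UN)
    moreover have "(\<Union>k. Z k) = {y. R0 < norm y \<and> y \<notin> W}"
    proof
      show "{y. R0 < norm y \<and> y \<notin> W} \<subseteq> (\<Union>k. Z k)"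
      proof
        fix y assume y: "y \<in> {y. R0 < norm y \<and> y \<notin> W}"
        obtain k :: nat where "norm y < real k" using reals_Archimedean2 by blast
        then have "y \<in> Z k" using y \<delta> T0 by (simp add: Z_def)
        then show "y \<in> (\<Union>k. Z k)" by blast
      qed
    qed (auto simp: Z_def)
    ultimately show False using omitted_set_not_null[OF inf r2 C p growth R0] unfolding W_def by simp
  qed
  then obtain k where k: "emeasure lborel (Z k) > 0" by blast
  define T where "T = T0 + \<delta> + 1 + real k"
  have T: "T > 0" using T0 \<delta> by (simp add: T_def)
  have ZT: "Z k \<subseteq> ball 0 T" by (auto simp: Z_def T_def)
  from short_segments_from_continuum[OF T \<delta> Zm ZT k]
  obtain \<epsilon> where \<epsilon>: "\<epsilon> > 0" and KL: "\<forall>\<rho> K p q. \<rho> \<in> borel_measurable borel \<and> (\<integral>\<^sup>+x. \<rho> x ^ ?n \<partial>lborel) < ennreal \<epsilon> \<and>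
     compact K \<and> connected K \<and> p \<in> K \<and> q \<in> K \<and> \<delta> \<le> dist p q \<and> cball p \<delta> \<subseteq> ball 0 T \<longrightarrow>
     (\<exists>y\<in>K. \<exists>w. \<exists>z\<in>Z k. segment_integral \<rho> y (w - y) < 1 \<and> segment_integral \<rho> w (z - w) < 1)"
    by (elim exE conjE)
  have e4: "\<epsilon> / 4 > 0" using \<epsilon> by simp
  have step: "\<exists>r0. 0 < r0 \<and> r0 < s \<and> (\<forall>r. 0 < r \<and> r \<le> r0 \<longrightarrow> modulus (ring_image_family f b r s) < ennreal (\<epsilon> / 4))"
    if "0 < s" "s \<le> R" for s by (rule small_modulus[OF inf that e4])
  obtain rm where rm: "0 < rm" "rm < r2" "modulus (ring_image_family f b rm r2) < ennreal (\<epsilon> / 4)"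
    using step[OF r2] by blast
  obtain rk0 where rk0: "0 < rk0" "rk0 < rm" "\<forall>r. 0 < r \<and> r \<le> rk0 \<longrightarrow> modulus (ring_image_family f b r rm) < ennreal (\<epsilon> / 4)"
    using step[of rm] rm r2 by auto
  obtain rk xa xb where rk: "0 < rk" "rk < rk0" and xab: "dist xa b = rk" "dist xb b = rk" "norm (f xa) \<le> T0" "\<delta> \<le> dist (f xa) (f xb)"
    using spread rk0(1) by blast
  have rkm: "rk < rm" "modulus (ring_image_family f b rk rm) < ennreal (\<epsilon> / 4)" using rk rk0 by auto
  obtain rl where rl: "0 < rl" "rl < rk" "modulus (ring_image_family f b rl rk) < ennreal (\<epsilon> / 4)"
    using step[of rk] rk rkm rm r2 by auto
  obtain rj where rj: "0 < rj" "rj < rl" "modulus (ring_image_family f b rj rl) < ennreal (\<epsilon> / 4)"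
    using step[of rl] rl rkm rm r2 by auto
  obtain \<rho>1 where \<rho>1: "\<rho>1 \<in> adm (ring_image_family f b rm r2)" and m1[measurable]: "\<rho>1 \<in> borel_measurable borel" and i1: "(\<integral>\<^sup>+x. \<rho>1 x ^ ?n \<partial>lborel) < ennreal (\<epsilon> / 4)"
    using rm(3) by (rule admissible_below)
  obtain \<rho>2 where \<rho>2: "\<rho>2 \<in> adm (ring_image_family f b rk rm)" and m2[measurable]: "\<rho>2 \<in> borel_measurable borel" and i2: "(\<integral>\<^sup>+x. \<rho>2 x ^ ?n \<partial>lborel) < ennreal (\<epsilon> / 4)"
    using rkm(2) by (rule admissible_below)
  obtain \<rho>3 where \<rho>3: "\<rho>3 \<in> adm (ring_image_family f b rl rk)" and m3[measurable]: "\<rho>3 \<in> borel_measurable borel" and i3: "(\<integral>\<^sup>+x. \<rho>3 x ^ ?n \<partial>lborel) < ennreal (\<epsilon> / 4)"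
    using rl(3) by (rule admissible_below)
  obtain \<rho>4 where \<rho>4: "\<rho>4 \<in> adm (ring_image_family f b rj rl)" and m4[measurable]: "\<rho>4 \<in> borel_measurable borel" and i4: "(\<integral>\<^sup>+x. \<rho>4 x ^ ?n \<partial>lborel) < ennreal (\<epsilon> / 4)"
    using rj(3) by (rule admissible_below)
  define \<rho> where "\<rho> = (\<lambda>x. max (max (\<rho>1 x) (\<rho>2 x)) (max (\<rho>3 x) (\<rho>4 x)))"
  have \<rho>m[measurable]: "\<rho> \<in> borel_measurable borel" unfolding \<rho>_def by measurable
  have "(\<integral>\<^sup>+x. \<rho> x ^ ?n \<partial>lborel) \<le> (\<integral>\<^sup>+x. (\<rho>1 x ^ ?n + \<rho>2 x ^ ?n) + (\<rho>3 x ^ ?n + \<rho>4 x ^ ?n) \<partial>lborel)"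
  proof (rule nn_integral_mono)
    fix x
    have mx: "max u v ^ ?n \<le> u ^ ?n + v ^ ?n" for u v :: ennreal by (simp add: max_def)
    have "\<rho> x ^ ?n \<le> max (\<rho>1 x) (\<rho>2 x) ^ ?n + max (\<rho>3 x) (\<rho>4 x) ^ ?n" unfolding \<rho>_def by (rule mx)
    also have "\<dots> \<le> (\<rho>1 x ^ ?n + \<rho>2 x ^ ?n) + (\<rho>3 x ^ ?n + \<rho>4 x ^ ?n)" by (intro add_mono mx)
    finally show "\<rho> x ^ ?n \<le> (\<rho>1 x ^ ?n + \<rho>2 x ^ ?n) + (\<rho>3 x ^ ?n + \<rho>4 x ^ ?n)" .
  qed
  also have "\<dots> = ((\<integral>\<^sup>+x. \<rho>1 x ^ ?n \<partial>lborel) + (\<integral>\<^sup>+x. \<rho>2 x ^ ?n \<partial>lborel)) + ((\<integral>\<^sup>+x. \<rho>3 x ^ ?n \<partial>lborel) + (\<integral>\<^sup>+x. \<rho>4 x ^ ?n \<partial>lborel))"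
    by (simp add: nn_integral_add)
  also have "\<dots> < (ennreal (\<epsilon> / 4) + ennreal (\<epsilon> / 4)) + (ennreal (\<epsilon> / 4) + ennreal (\<epsilon> / 4))"
    by (intro add_strict_mono i1 i2 i3 i4)
  also have "\<dots> = ennreal \<epsilon>" using \<epsilon> by (simp add: ennreal_plus[symmetric] del: ennreal_plus)
  finally have small: "(\<integral>\<^sup>+x. \<rho> x ^ ?n \<partial>lborel) < ennreal \<epsilon>" .
  have le: "segment_integral \<rho>1 u v \<le> segment_integral \<rho> u v" "segment_integral \<rho>2 u v \<le> segment_integral \<rho> u v"
    "segment_integral \<rho>3 u v \<le> segment_integral \<rho> u v" "segment_integral \<rho>4 u v \<le> segment_integral \<rho> u v" for u v
    unfolding segment_integral_def \<rho>_def by (intro mult_left_mono nn_integral_mono mult_right_mono; simp add: le_max_iff_disj)+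
  define K where "K = f ` sphere b rk"
  have sub: "sphere b rk \<subseteq> D - {b}" using punct rk rkm rm r2 by (auto simp: dist_commute subset_iff)
  have cS: "continuous_on (sphere b rk) f" using contf sub by (rule continuous_on_subset)
  have "compact K" unfolding K_def by (rule compact_continuous_image[OF cS compact_sphere])
  moreover have "connected K" unfolding K_def by (rule connected_continuous_image[OF cS connected_sphere[OF dim]])
  moreover have "f xa \<in> K" "f xb \<in> K" using xab by (auto simp: K_def dist_commute)
  moreover have "cball (f xa) \<delta> \<subseteq> ball 0 T"
  proof
    fix z assume "z \<in> cball (f xa) \<delta>"
    then have "norm z \<le> norm (f xa) + \<delta>" using norm_triangle_ineq2[of z "f xa"] by (simp add: dist_norm norm_minus_commute)
    then show "z \<in> ball 0 T" using xab(3) by (simp add: T_def)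
  qed
  ultimately have "\<exists>y\<in>K. \<exists>w. \<exists>z\<in>Z k. segment_integral \<rho> y (w - y) < 1 \<and> segment_integral \<rho> w (z - w) < 1"
    using KL[rule_format, of \<rho> K "f xa" "f xb"] \<rho>m small xab(4) by simp
  then obtain y w z where y: "y \<in> K" and z: "z \<in> Z k" and s1: "segment_integral \<rho> y (w - y) < 1" and s2: "segment_integral \<rho> w (z - w) < 1"
    by blast
  from y obtain x1 where "x1 \<in> sphere b rk" "y = f x1" unfolding K_def by blast
  then have x1: "dist x1 b = rk" "f x1 = y" by (simp_all add: dist_commute)
  have S: "{x. rj \<le> dist x b \<and> dist x b \<le> r2} \<subseteq> D - {b}" using rj r2 R by (intro ring_subset) auto
  have lower1: "segment_integral \<rho>1 u v < 1" "segment_integral \<rho>2 u v < 1" "segment_integral \<rho>3 u v < 1" "segment_integral \<rho>4 u v < 1"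
    if "segment_integral \<rho> u v < 1" for u v using le that by (meson le_less_trans)+
  have x1r: "rj < dist x1 b" "dist x1 b < r2" using x1 rj rl rkm rm by auto
  obtain c \<gamma> where c: "0 \<le> c" "c \<le> 1" "continuous_on {0..c} \<gamma>" "\<gamma> 0 = x1"
      "\<And>t. t \<in> {0..c} \<Longrightarrow> f (\<gamma> t) = f x1 + t *\<^sub>R (w - y)"
      "\<And>t. t \<in> {0..c} \<Longrightarrow> rj \<le> dist (\<gamma> t) b \<and> dist (\<gamma> t) b \<le> r2"
      "c = 1 \<and> rj < dist (\<gamma> c) b \<and> dist (\<gamma> c) b < r2 \<or> dist (\<gamma> c) b = rj \<or> dist (\<gamma> c) b = r2"
    by (rule ring_lift[OF S contf openf discf x1r, where v = "w - y"], rule that, assumption+)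
  have up1: "dist (\<gamma> c) b < rm"
  proof (rule ccontr)
    assume "\<not> dist (\<gamma> c) b < rm"
    then have "1 \<le> segment_integral \<rho>2 (f x1) (w - y)"
      by (intro segment_crossing[OF \<rho>2 rkm(1) c(1,2,3,5)]) (use c(4) x1 in auto)
    then show False using lower1(2)[OF s1] x1(2) by simp
  qed
  have lo1: "rl < dist (\<gamma> c) b"
  proof (rule ccontr)
    assume "\<not> rl < dist (\<gamma> c) b"
    then have "1 \<le> segment_integral \<rho>3 (f x1) (w - y)"
      by (intro segment_crossing[OF \<rho>3 rl(2) c(1,2,3,5)]) (use c(4) x1 in auto)
    then show False using lower1(3)[OF s1] x1(2) by simp
  qed
  have c1: "c = 1" using c(7) up1 lo1 rj rm by auto
  define x2 where "x2 = \<gamma> c"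
  have x2: "rl < dist x2 b" "dist x2 b < rm" using up1 lo1 by (auto simp: x2_def)
  have fx2: "f x2 = w" using c(5)[of 1] c1 x1(2) by (simp add: x2_def)
  have x2r: "rj < dist x2 b" "dist x2 b < r2" using x2 rj rm by auto
  obtain c' \<gamma>' where c': "0 \<le> c'" "c' \<le> 1" "continuous_on {0..c'} \<gamma>'" "\<gamma>' 0 = x2"
      "\<And>t. t \<in> {0..c'} \<Longrightarrow> f (\<gamma>' t) = f x2 + t *\<^sub>R (z - w)"
      "\<And>t. t \<in> {0..c'} \<Longrightarrow> rj \<le> dist (\<gamma>' t) b \<and> dist (\<gamma>' t) b \<le> r2"
      "c' = 1 \<and> rj < dist (\<gamma>' c') b \<and> dist (\<gamma>' c') b < r2 \<or> dist (\<gamma>' c') b = rj \<or> dist (\<gamma>' c') b = r2"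
    by (rule ring_lift[OF S contf openf discf x2r, where v = "z - w"], rule that, assumption+)
  have up2: "dist (\<gamma>' c') b \<noteq> r2"
  proof
    assume "dist (\<gamma>' c') b = r2"
    then have "1 \<le> segment_integral \<rho>1 (f x2) (z - w)"
      by (intro segment_crossing[OF \<rho>1 rm(2) c'(1,2,3,5)]) (use c'(4) x2 in auto)
    then show False using lower1(1)[OF s2] fx2 by simp
  qed
  have lo2: "dist (\<gamma>' c') b \<noteq> rj"
  proof
    assume "dist (\<gamma>' c') b = rj"
    then have "1 \<le> segment_integral \<rho>4 (f x2) (z - w)"
      by (intro segment_crossing[OF \<rho>4 rj(2) c'(1,2,3,5)]) (use c'(4) x2 in auto)
    then show False using lower1(4)[OF s2] fx2 by simp
  qed
  have fin: "c' = 1" "rj < dist (\<gamma>' 1) b" "dist (\<gamma>' 1) b < r2" using c'(7) up2 lo2 by auto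
  have "f (\<gamma>' 1) = z" using c'(5)[of 1] fin(1) fx2 by simp
  moreover have "\<gamma>' 1 \<in> {x. 0 < dist x b \<and> dist x b < r2}" using fin rj less_trans by blast
  ultimately have "z \<in> W" unfolding W_def by blast
  then show False using z by (auto simp: Z_def)
qed

end

lemma cball_subset_of_boundary_dist:
  fixes b :: "'a::euclidean_space"
  assumes b: "b \<in> D" and R: "ereal R < boundary_dist b D"
  shows "cball b R \<subseteq> D"
proof (cases "R \<ge> 0")
  case True
  show ?thesis
  proof (rule ccontr)
    assume "\<not> cball b R \<subseteq> D"
    then have "cball b R - D \<noteq> {}" by blast
    moreover have "b \<in> cball b R \<inter> D" using b True by simp
    then have "cball b R \<inter> D \<noteq> {}" by blast
    moreover have "connected (cball b R)" by simp
    ultimately have "cball b R \<inter> frontier D \<noteq> {}" using connected_Int_frontier by blast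
    then obtain y where y: "y \<in> frontier D" "dist b y \<le> R" by auto
    have "boundary_dist b D \<le> ereal (dist b y)" unfolding boundary_dist_def using y(1) by (rule INF_lower)
    also have "\<dots> \<le> ereal R" using y(2) by simp
    finally show False using R by simp
  qed
qed auto

theorem mainTheorem1:
  fixes D :: "(real ^ 'n) set" and Q :: "real ^ 'n \<Rightarrow> ennreal"
    and f :: "real ^ 'n \<Rightarrow> real ^ 'n" and b :: "real ^ 'n" and \<epsilon>\<^sub>0 :: real
  assumes "CARD('n) \<ge> 2"
    and "open D" and "connected D" and "b \<in> D"
    and "Q \<in> borel_measurable (lebesgue_on D)" and "\<And>x. x \<in> D \<Longrightarrow> Q x > 0"
    and "open_mapping_on (D - {b}) f" and "discrete_mapping_on (D - {b}) f"
    and "ring_Q_mapping D Q b f"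
    and "0 < \<epsilon>\<^sub>0" and "ereal \<epsilon>\<^sub>0 < boundary_dist b D"
    and "radial_integral Q b 0 \<epsilon>\<^sub>0 = \<infinity>"
    and "AE t in lebesgue. t \<in> {0<..<\<epsilon>\<^sub>0} \<longrightarrow> spherical_mean Q b t < \<infinity>"
  shows
    "(\<forall>p C. 0 < p \<and> p < (1 / 4) powr (1 / real (CARD('n) - 1)) \<and> 0 < C \<and>
        (\<forall>x \<in> ball b \<epsilon>\<^sub>0 - {b}.
           ereal (norm (f x)) \<le>
             ereal C * exp_ereal (ereal p * enn2ereal (radial_integral Q b (dist x b) \<epsilon>\<^sub>0)))
      \<longrightarrow> (\<exists>l. (f \<longlongrightarrow> l) (at b)) \<or> filterlim f at_infinity (at b))
   \<and> (\<forall>p. 0 < p \<and> p < (1 / 4) powr (1 / real (CARD('n) - 1)) \<and>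
        ((\<lambda>x. ereal (norm (f x)) *
            exp_ereal (- (ereal p * enn2ereal (radial_integral Q b (dist x b) \<epsilon>\<^sub>0))))
          \<longlongrightarrow> 0) (at b)
      \<longrightarrow> removable_at f b \<and> \<not> pole_at f b)"
proof -
  obtain R' where R': "ereal \<epsilon>\<^sub>0 < ereal R'" "ereal R' < boundary_dist b D"
    using ereal_dense2[OF assms(11)] by blast
  interpret ring_map D Q b f \<epsilon>\<^sub>0 R'
  proof
    show "DIM(real ^ 'n) \<ge> 2" using assms(1) by simp
    show "cball b R' \<subseteq> D" using assms(4) R'(2) by (rule cball_subset_of_boundary_dist)
  qed (use assms R' in auto)
  have inf: "radial_integral Q b 0 \<epsilon>\<^sub>0 = top" using assms(12) by simp
  have "real (CARD('n) - 1) > 0" using assms(1) by simp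
  then have "(1 / 4 :: real) powr (1 / real (CARD('n) - 1)) < 1"
    by (simp add: powr_def ln_div)
  then have p1: "p < 1" if "p < (1 / 4) powr (1 / real (CARD('n) - 1))" for p :: real using that by linarith
  define I where "I = (\<lambda>x. enn2real (radial_integral Q b (dist x b) \<epsilon>\<^sub>0))"
  have I: "enn2ereal (radial_integral Q b (dist x b) \<epsilon>\<^sub>0) = ereal (I x)" if "0 < dist x b" "dist x b \<le> \<epsilon>\<^sub>0" for x
  proof -
    have "radial_integral Q b (dist x b) \<epsilon>\<^sub>0 < top" using that by (intro radial_integral_finite) auto
    then show ?thesis unfolding I_def by (cases "radial_integral Q b (dist x b) \<epsilon>\<^sub>0") auto
  qed
  have half: "0 < \<epsilon>\<^sub>0 / 2" "\<epsilon>\<^sub>0 / 2 \<le> \<epsilon>\<^sub>0" using assms(10) by auto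
  show ?thesis
  proof (intro conjI allI impI)
    fix p C
    assume a: "0 < p \<and> p < (1 / 4) powr (1 / real (CARD('n) - 1)) \<and> 0 < C \<and>
        (\<forall>x \<in> ball b \<epsilon>\<^sub>0 - {b}.
           ereal (norm (f x)) \<le>
             ereal C * exp_ereal (ereal p * enn2ereal (radial_integral Q b (dist x b) \<epsilon>\<^sub>0)))"
    show "(\<exists>l. (f \<longlongrightarrow> l) (at b)) \<or> filterlim f at_infinity (at b)"
    proof (rule limit_or_pole[OF inf half, of C p])
      show "norm (f x) \<le> C * exp (p * enn2real (radial_integral Q b (dist x b) \<epsilon>\<^sub>0))"
        if x: "0 < dist x b" "dist x b \<le> \<epsilon>\<^sub>0 / 2" for x
      proof -
        have "x \<in> ball b \<epsilon>\<^sub>0 - {b}" using x assms(10) by (auto simp: dist_commute)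
        then have "ereal (norm (f x)) \<le> ereal C * exp_ereal (ereal p * enn2ereal (radial_integral Q b (dist x b) \<epsilon>\<^sub>0))"
          using a by blast
        then have "ereal (norm (f x)) \<le> ereal C * exp_ereal (ereal p * ereal (I x))"
          using I[of x] x half by simp
        then show ?thesis by (simp add: exp_ereal_def I_def)
      qed
    qed (use a p1 in auto)
  next
    fix p
    assume a: "0 < p \<and> p < (1 / 4) powr (1 / real (CARD('n) - 1)) \<and>
        ((\<lambda>x. ereal (norm (f x)) *
            exp_ereal (- (ereal p * enn2ereal (radial_integral Q b (dist x b) \<epsilon>\<^sub>0))))
          \<longlongrightarrow> 0) (at b)"
    have "eventually (\<lambda>x. ereal (norm (f x)) *
            exp_ereal (- (ereal p * enn2ereal (radial_integral Q b (dist x b) \<epsilon>\<^sub>0))) < 1) (at b)"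
      using a by (intro order_tendstoD(2)[where y = 0]) auto
    then obtain d where d: "d > 0" "\<And>x. x \<noteq> b \<Longrightarrow> dist x b < d \<Longrightarrow> ereal (norm (f x)) *
            exp_ereal (- (ereal p * enn2ereal (radial_integral Q b (dist x b) \<epsilon>\<^sub>0))) < 1"
      unfolding eventually_at by auto
    \<comment> \<open>Near \<open>b\<close> the product is less than \<open>1\<close>, which is the growth bound
      with constant \<open>1\<close>.\<close>
    define r2 where "r2 = min (\<epsilon>\<^sub>0 / 2) (d / 2)"
    have r2: "0 < r2" "r2 \<le> \<epsilon>\<^sub>0" "r2 < d" using half d(1) by (auto simp: r2_def min_def)
    have growth: "norm (f x) \<le> 1 * exp (p * enn2real (radial_integral Q b (dist x b) \<epsilon>\<^sub>0))"
      if x: "0 < dist x b" "dist x b \<le> r2" for x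
    proof -
      have "ereal (norm (f x)) * exp_ereal (- (ereal p * enn2ereal (radial_integral Q b (dist x b) \<epsilon>\<^sub>0))) < 1"
        using x r2 by (intro d(2)) auto
      then have "ereal (norm (f x)) * exp_ereal (- (ereal p * ereal (I x))) < 1"
        using I[of x] x r2 by simp
      then have "norm (f x) * exp (- (p * I x)) < 1" by (simp add: exp_ereal_def one_ereal_def)
      then show ?thesis by (simp add: I_def exp_minus field_simps)
    qed
    have np: "\<not> filterlim f at_infinity (at b)"
      by (rule not_pole[OF inf r2(1,2) zero_less_one _ _ growth]) (use a p1 in auto)
    moreover have "(\<exists>l. (f \<longlongrightarrow> l) (at b)) \<or> filterlim f at_infinity (at b)"
      by (rule limit_or_pole[OF inf r2(1,2) zero_less_one _ _ growth]) (use a p1 in auto)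
    ultimately show "removable_at f b" by (auto simp: removable_at_def)
    show "\<not> pole_at f b" using np by (simp add: pole_at_def)
  qed
qed

end
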